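(* Let $s>2$, let $\psi_0\in H^s(\mathbb R)$ be real-valued, and let $0<T<+\infty$. Let $\psi\in C([0,T);H^s(\mathbb R))$ be a solution, with $\psi(\cdot,0)=\psi_0$, of $$\partial_\tau\psi+\partial_\theta a(\psi,\psi)=0,$$ where $$\widehat{a(\psi,\phi)}(k,\tau)=\int_{-\infty}^{+\infty}S(k-\ell,\ell)\,\hat\psi(k-\ell,\tau)\,\hat\phi(\ell,\tau)\,d\ell,\qquad S(k,\ell)=\frac{2\,|k\,\ell\,(k+\ell)|^{1/2}}{|k+\ell|+|k|+|\ell|}\ \ (S(k,\ell)=0\text{ if }k\ell=0).$$ If $$\int_0^T\|\psi(\cdot,\tau)\|_{s'}^{2/s'}\,d\tau<+\infty$$ for some $s'>2$, then $\psi$ is continuable to a solution $\psi\in C([0,T');H^s(\mathbb R))$ with some $T'>T$.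
   Context: Functions $\psi(\theta,\tau)$ are real-valued, $\theta\in\mathbb R$. Fourier transform in $\theta$: $\hat\psi(k,\tau)=\frac1{2\pi}\int_{-\infty}^{+\infty}\psi(\theta,\tau)e^{-ik\theta}\,d\theta$. The homogeneous Sobolev norm is $\|\psi\|_{r}=\left(\int_{-\infty}^{+\infty}|k|^{2r}|\hat\psi(k)|^2dk\right)^{1/2}$, and $\|\psi\|_{H^s(\mathbb R)}=\left(\int_{-\infty}^{+\infty}(1+|k|^{2s})|\hat\psi(k)|^2dk\right)^{1/2}$. *)

theory Defs
  imports "HOL-Analysis.Analysis"
begin

text \<open>
  Elements of \<open>L\<^sup>2(\<real>)\<close> and of the Sobolev spaces are represented by Borel functions. Equality
  of such elements is equality almost everywhere, and all notions below respect it.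
\<close>

definition L2 :: "(real \<Rightarrow> 'a::{banach, second_countable_topology}) set" where
  "L2 = {f. f \<in> borel_measurable lborel \<and> integrable lborel (\<lambda>x. (norm (f x))\<^sup>2)}"

text \<open>
  The Fourier transform on \<open>L\<^sup>2(\<real>)\<close>: the limit in \<open>L\<^sup>2\<close> of the truncated integrals
  \<open>1/(2\<pi>) \<integral> f(\<theta>) exp(-ik\<theta>) d\<theta>\<close> over \<open>[-R, R]\<close>. The limit is determined up to null sets.
\<close>

definition truncated_fourier :: "real \<Rightarrow> (real \<Rightarrow> real) \<Rightarrow> real \<Rightarrow> complex" where
  "truncated_fourier R f k =
     1 / (2 * pi) * (LINT \<theta>:{-R..R}|lborel. complex_of_real (f \<theta>) * exp (- \<i> * k * \<theta>))"

definition has_fourier_transform :: "(real \<Rightarrow> real) \<Rightarrow> (real \<Rightarrow> complex) \<Rightarrow> bool" where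
  "has_fourier_transform f g \<longleftrightarrow> f \<in> L2 \<and> g \<in> L2 \<and>
     ((\<lambda>R. \<integral>\<^sup>+k. ennreal ((cmod (truncated_fourier R f k - g k))\<^sup>2) \<partial>lborel) \<longlongrightarrow> 0) at_top"

definition fourier :: "(real \<Rightarrow> real) \<Rightarrow> real \<Rightarrow> complex" where
  "fourier f = (SOME g. has_fourier_transform f g)"

text \<open>Real powers of extended nonnegative numbers; only positive exponents \<open>p\<close> are used.\<close>

definition ennpow :: "ennreal \<Rightarrow> real \<Rightarrow> ennreal" where
  "ennpow x p = (if x = top then top else ennreal (enn2real x powr p))"

text \<open>Both norms take the value \<open>top\<close> when the defining integral diverges.\<close>

definition hom_norm :: "real \<Rightarrow> (real \<Rightarrow> real) \<Rightarrow> ennreal" where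
  "hom_norm r f =
     ennpow (\<integral>\<^sup>+k. ennreal (\<bar>k\<bar> powr (2 * r) * (cmod (fourier f k))\<^sup>2) \<partial>lborel) (1 / 2)"

definition Hs_norm :: "real \<Rightarrow> (real \<Rightarrow> real) \<Rightarrow> ennreal" where
  "Hs_norm s f =
     ennpow (\<integral>\<^sup>+k. ennreal ((1 + \<bar>k\<bar> powr (2 * s)) * (cmod (fourier f k))\<^sup>2) \<partial>lborel) (1 / 2)"

definition Hs :: "real \<Rightarrow> (real \<Rightarrow> real) set" where
  "Hs s = {f. f \<in> L2 \<and> Hs_norm s f < top}"

text \<open>
  The kernel vanishes if \<open>k * l = 0\<close>; at the origin this is the convention \<open>0 / 0 = 0\<close>.
\<close>

definition S_kernel :: "real \<Rightarrow> real \<Rightarrow> real" where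
  "S_kernel k l = 2 * sqrt \<bar>k * l * (k + l)\<bar> / (\<bar>k + l\<bar> + \<bar>k\<bar> + \<bar>l\<bar>)"

definition a_hat :: "(real \<Rightarrow> real) \<Rightarrow> (real \<Rightarrow> real) \<Rightarrow> real \<Rightarrow> complex" where
  "a_hat \<psi> \<phi> k =
     (LINT l|lborel. complex_of_real (S_kernel (k - l) l) * fourier \<psi> (k - l) * fourier \<phi> l)"

text \<open>
  For real-valued arguments \<open>a_hat\<close> is Hermitian (as \<open>S_kernel\<close> is even), so \<open>a\<close> is real-valued.
\<close>

definition a_form :: "(real \<Rightarrow> real) \<Rightarrow> (real \<Rightarrow> real) \<Rightarrow> real \<Rightarrow> real" where
  "a_form \<psi> \<phi> = (SOME u. has_fourier_transform u (a_hat \<psi> \<phi>))"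

text \<open>
  The distributional derivative of \<open>u \<in> L\<^sup>2\<close>, where it is again in \<open>L\<^sup>2\<close>, as the Fourier multiplier \<open>ik\<close>.
\<close>

definition has_L2_deriv :: "(real \<Rightarrow> real) \<Rightarrow> (real \<Rightarrow> real) \<Rightarrow> bool" where
  "has_L2_deriv u v \<longleftrightarrow> u \<in> L2 \<and> has_fourier_transform v (\<lambda>k. \<i> * k * fourier u k)"

definition continuous_into_Hs :: "real \<Rightarrow> real set \<Rightarrow> (real \<Rightarrow> real \<Rightarrow> real) \<Rightarrow> bool" where
  "continuous_into_Hs s I \<psi> \<longleftrightarrow>
     (\<forall>\<tau>\<in>I. \<psi> \<tau> \<in> Hs s) \<and>
     (\<forall>\<tau>\<in>I. ((\<lambda>\<sigma>. Hs_norm s (\<lambda>\<theta>. \<psi> \<sigma> \<theta> - \<psi> \<tau> \<theta>)) \<longlongrightarrow> 0) (at \<tau> within I))"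

text \<open>\<open>w\<close> is the derivative in \<open>H\<^sup>s\<close> of the curve \<open>\<psi>\<close> at time \<open>\<tau>\<close> (one-sided at end points of \<open>I\<close>).\<close>

definition has_time_deriv_in_Hs ::
  "real \<Rightarrow> real set \<Rightarrow> (real \<Rightarrow> real \<Rightarrow> real) \<Rightarrow> real \<Rightarrow> (real \<Rightarrow> real) \<Rightarrow> bool" where
  "has_time_deriv_in_Hs s I \<psi> \<tau> w \<longleftrightarrow> w \<in> Hs s \<and>
     ((\<lambda>\<sigma>. Hs_norm s (\<lambda>\<theta>. (\<psi> \<sigma> \<theta> - \<psi> \<tau> \<theta>) / (\<sigma> - \<tau>) - w \<theta>)) \<longlongrightarrow> 0) (at \<tau> within I)"

text \<open>
  Solutions in \<open>C([0,T); H\<^sup>s)\<close> of \<open>\<partial>\<^sub>\<tau>\<psi> + \<partial>\<^sub>\<theta> a(\<psi>,\<psi>) = 0\<close> with initial datum \<open>\<psi>0\<close>. For \<open>s > 2\<close> the form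
  \<open>a\<close> maps \<open>H\<^sup>s \<times> H\<^sup>s\<close> to \<open>H\<^sup>s\<close>, so the equation is an identity in \<open>H\<^bsup>s-1\<^esup>\<close>.
\<close>

definition is_solution ::
  "real \<Rightarrow> real \<Rightarrow> (real \<Rightarrow> real) \<Rightarrow> (real \<Rightarrow> real \<Rightarrow> real) \<Rightarrow> bool" where
  "is_solution s T \<psi>0 \<psi> \<longleftrightarrow>
     continuous_into_Hs s {0..<T} \<psi> \<and>
     (AE \<theta> in lborel. \<psi> 0 \<theta> = \<psi>0 \<theta>) \<and>
     (\<forall>\<tau>\<in>{0..<T}. \<exists>w v.
        has_time_deriv_in_Hs (s - 1) {0..<T} \<psi> \<tau> w \<and>
        has_L2_deriv (a_form (\<psi> \<tau>) (\<psi> \<tau>)) v \<and>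
        (AE \<theta> in lborel. w \<theta> + v \<theta> = 0))"

end

theory Submission
  imports Defs "HOL-Probability.Probability"
begin

text \<open>
  On the Fourier side the equation is an ordinary differential equation \<open>u' = B u u\<close> for Hermitian
  square integrable functions, where \<open>B u v (k) = - i k \<integral> S(k - l, l) u(k - l) v(l) dl\<close>. This form
  loses one derivative: it maps \<open>H\<^sup>s\<close> to \<open>H\<^bsup>s-1\<^esup>\<close>. The loss disappears in energy estimates. For an even
  weight \<open>W\<close> the energy \<open>\<langle>W u, u\<rangle>\<close> has derivative \<open>2 \<langle>W u, B u u\<rangle>\<close>, an integral over triples of
  frequencies \<open>k = l + (k - l)\<close>. Its integrand is, up to the factor \<open>k W(k)\<close>, symmetric in the triple,
  so that symmetrisation replaces this factor by \<open>k W(k) - l W(l) - (k - l) W(k - l)\<close>. If \<open>W\<close> grows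
  like a power, this difference is bounded by the frequency of smallest modulus times the geometric
  mean of the weights at the other two frequencies. The kernel is bounded by the square root of the
  smallest modulus, whence \<open>|2 \<langle>W u, B u u\<rangle>| \<le> C A(u) \<langle>W u, u\<rangle>\<close> with \<open>A(u) = \<integral> |k|\<^bsup>3/2\<^esup> |u(k)| dk\<close>
  (lemma \<open>inner_B_energy\<close>). For \<open>W = 1\<close> the symmetrised factor vanishes, and the norm of \<open>L\<^sup>2\<close> is
  conserved (\<open>inner_B_conserved\<close>).

  By Gronwall's lemma the norm of \<open>H\<^sup>s\<close> stays bounded as long as \<open>\<integral> A(u(t)) dt\<close> is finite. The
  interpolation inequality \<open>A(u) \<le> C \<parallel>u\<parallel>\<^bsub>s'\<^esub>\<^bsup>2/s'\<^esup> \<parallel>u\<parallel>\<^bsub>0\<^esub>\<^bsup>1 - 2/s'\<^esup>\<close> (\<open>mom_interpolation\<close>) and the conservation law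
  show that the hypothesis of the theorem controls precisely this integral.

  Boundedness alone does not give a limit in \<open>H\<^sup>s\<close> at time \<open>T\<close>. The energy estimate is therefore
  applied with the weights \<open>(1 + |k|\<^bsup>2s\<^esup>) min(1, |k|/R)\<close>, whose constant is independent of \<open>R\<close>: the part
  of \<open>u(t)\<close> at high frequencies is small uniformly in \<open>t\<close>, while the low frequencies converge because
  \<open>u\<close> is Lipschitz continuous in \<open>L\<^sup>2\<close>. So \<open>u(t)\<close> converges in \<open>H\<^sup>s\<close> (\<open>fsol_limit\<close>). A solution that starts
  from the limit exists on a short time interval (\<open>local_existence\<close>; spectral truncations are
  ordinary differential equations with a locally Lipschitz right-hand side, and the same uniform
  control of high frequencies makes them converge in \<open>H\<^sup>s\<close>). Both pieces are glued at \<open>T\<close>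
  (\<open>fsol_glue\<close>).

  The link with functions of \<open>\<theta>\<close> is Plancherel's theorem. It is proved with Gaussian regularisation
  and turns the truncated Fourier integrals into an operator on \<open>L\<^sup>2\<close> that is a multiple of an isometry and
  maps the real functions onto the Hermitian ones. Solutions then correspond to curves of
  transforms (\<open>is_solution_iff\<close>).
\<close>

section \<open>The real Hilbert space of complex-valued square integrable functions\<close>

lemma L2_measurable: "f \<in> L2 \<Longrightarrow> f \<in> borel_measurable borel"
  by (simp add: L2_def)

lemma L2_integrable: "f \<in> L2 \<Longrightarrow> integrable lborel (\<lambda>x. (norm (f x))\<^sup>2)"
  by (simp add: L2_def)

lemma L2_iff_nn_integral:
  "f \<in> L2 \<longleftrightarrow> f \<in> borel_measurable borel \<and> (\<integral>\<^sup>+x. ennreal ((norm (f x))\<^sup>2) \<partial>lborel) < \<infinity>"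
  by (auto simp: L2_def integrable_iff_bounded)

lemma L2_mono:
  assumes "f \<in> L2" "g \<in> borel_measurable borel" "AE x in lborel. norm (g x) \<le> C * norm (f x)"
  shows "g \<in> L2"
proof -
  note [measurable] = assms(2) L2_measurable[OF assms(1)]
  have "integrable lborel (\<lambda>x. C\<^sup>2 * (norm (f x))\<^sup>2)"
    using L2_integrable[OF assms(1)] by simp
  then have "integrable lborel (\<lambda>x. (norm (g x))\<^sup>2)"
  proof (rule Bochner_Integration.integrable_bound)
    show "AE x in lborel. norm ((norm (g x))\<^sup>2) \<le> norm (C\<^sup>2 * (norm (f x))\<^sup>2)"
      using assms(3)
    proof eventually_elim
      case (elim x)
      then have "(norm (g x))\<^sup>2 \<le> (C * norm (f x))\<^sup>2" by (intro power_mono) auto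
      then show ?case by (simp add: power_mult_distrib)
    qed
  qed simp
  then show ?thesis using assms(2) by (simp add: L2_def)
qed

lemma L2_cong_AE:
  assumes "f \<in> L2" "g \<in> borel_measurable borel" "AE x in lborel. f x = g x"
  shows "g \<in> L2"
  by (rule L2_mono[OF assms(1,2), of 1]) (use assms(3) in auto)

lemma L2_zero: "(\<lambda>x. 0) \<in> L2"
  by (simp add: L2_def)

lemma L2_add:
  assumes "f \<in> L2" "g \<in> L2" shows "(\<lambda>x. f x + g x) \<in> L2"
proof -
  note [measurable] = L2_measurable[OF assms(1)] L2_measurable[OF assms(2)]
  have "integrable lborel (\<lambda>x. 2 * (norm (f x))\<^sup>2 + 2 * (norm (g x))\<^sup>2)"
    using L2_integrable[OF assms(1)] L2_integrable[OF assms(2)] by simp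
  then have "integrable lborel (\<lambda>x. (norm (f x + g x))\<^sup>2)"
  proof (rule Bochner_Integration.integrable_bound)
    have "(norm (f x + g x))\<^sup>2 \<le> 2 * (norm (f x))\<^sup>2 + 2 * (norm (g x))\<^sup>2" for x
    proof -
      have "(norm (f x + g x))\<^sup>2 \<le> (norm (f x) + norm (g x))\<^sup>2"
        by (intro power_mono norm_triangle_ineq) auto
      also have "\<dots> \<le> 2 * (norm (f x))\<^sup>2 + 2 * (norm (g x))\<^sup>2"
        using sum_squares_bound[of "norm (f x)" "norm (g x)"] by (simp add: power2_sum)
      finally show ?thesis .
    qed
    then show "AE x in lborel. norm ((norm (f x + g x))\<^sup>2) \<le> norm (2 * (norm (f x))\<^sup>2 + 2 * (norm (g x))\<^sup>2)"
      by (auto intro!: AE_I2 order_trans[OF _ abs_ge_self])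
  qed simp
  then show ?thesis by (simp add: L2_def)
qed

lemma L2_scaleR: "f \<in> L2 \<Longrightarrow> (\<lambda>x. c *\<^sub>R f x) \<in> L2"
  by (rule L2_mono[where C = "\<bar>c\<bar>"]) (auto simp: L2_def)

lemma L2_minus: "f \<in> L2 \<Longrightarrow> (\<lambda>x. - f x) \<in> L2"
  using L2_scaleR[of f "-1"] by simp

lemma L2_diff: "f \<in> L2 \<Longrightarrow> g \<in> L2 \<Longrightarrow> (\<lambda>x. f x - g x) \<in> L2"
  using L2_add[OF _ L2_minus, of f g] by simp

lemma integrable_L2_mult_norm:
  assumes "f \<in> L2" "g \<in> L2" shows "integrable lborel (\<lambda>x. norm (f x) * norm (g x))"
proof -
  note [measurable] = L2_measurable[OF assms(1)] L2_measurable[OF assms(2)]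
  have "integrable lborel (\<lambda>x. (norm (f x))\<^sup>2 + (norm (g x))\<^sup>2)"
    using L2_integrable[OF assms(1)] L2_integrable[OF assms(2)] by simp
  then show ?thesis
  proof (rule Bochner_Integration.integrable_bound)
    have "norm (f x) * norm (g x) \<le> (norm (f x))\<^sup>2 + (norm (g x))\<^sup>2" for x
    proof -
      have "0 \<le> norm (f x) * norm (g x)" by simp
      then show ?thesis
        using sum_squares_bound[of "norm (f x)" "norm (g x)"] unfolding mult.assoc by linarith
    qed
    then show "AE x in lborel. norm (norm (f x) * norm (g x)) \<le> norm ((norm (f x))\<^sup>2 + (norm (g x))\<^sup>2)"
      by (auto intro!: AE_I2)
  qed simp
qed

text \<open>
  Square integrable functions up to null sets form a type, so that the theory of derivatives of
  curves in Banach spaces applies to them.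
\<close>

definition l2rel :: "(real \<Rightarrow> complex) \<Rightarrow> (real \<Rightarrow> complex) \<Rightarrow> bool" where
  "l2rel f g \<longleftrightarrow> f \<in> L2 \<and> g \<in> L2 \<and> (AE x in lborel. f x = g x)"

quotient_type l2 = "real \<Rightarrow> complex" / partial: l2rel
  morphisms rep cls
proof (rule part_equivpI)
  show "\<exists>x. l2rel x x" using L2_zero by (auto simp: l2rel_def)
  show "symp l2rel" by (auto simp: symp_def l2rel_def)
  show "transp l2rel" by (auto simp: transp_def l2rel_def)
qed

lemma rep_L2 [simp, intro]: "rep u \<in> L2"
  using Quotient3_rep_reflp[OF Quotient3_l2, of u] by (simp add: l2rel_def)

lemma rep_measurable [measurable]: "rep u \<in> borel_measurable borel"
  by (rule L2_measurable) simp

lemma cls_rep [simp]: "cls (rep u) = u"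
  by (rule Quotient3_abs_rep[OF Quotient3_l2])

lemma cls_eq_iff: "f \<in> L2 \<Longrightarrow> g \<in> L2 \<Longrightarrow> cls f = cls g \<longleftrightarrow> (AE x in lborel. f x = g x)"
  using Quotient3_rel[OF Quotient3_l2, of f g] by (auto simp: l2rel_def)

lemma rep_cls: "f \<in> L2 \<Longrightarrow> AE x in lborel. rep (cls f) x = f x"
  by (subst cls_eq_iff[symmetric]) auto

lemma l2_eqI: "AE x in lborel. rep u x = rep v x \<Longrightarrow> u = v"
  using cls_eq_iff[of "rep u" "rep v"] by simp

lemma l2_eq_iff: "u = v \<longleftrightarrow> (AE x in lborel. rep u x = rep v x)"
  using l2_eqI by auto

instantiation l2 :: real_inner
begin

definition "0 = cls (\<lambda>x. 0)"
definition "u + v = cls (\<lambda>x. rep u x + rep v x)"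
definition "u - v = cls (\<lambda>x. rep u x - rep v x)"
definition "- u = cls (\<lambda>x. - rep u x)"
definition "c *\<^sub>R u = cls (\<lambda>x. c *\<^sub>R rep u x)"
definition "inner u v = (LINT x|lborel. rep u x \<bullet> rep v x)"
definition "norm (u::l2) = sqrt (inner u u)"
definition "dist (u::l2) v = norm (u - v)"
definition "sgn (u::l2) = inverse (norm u) *\<^sub>R u"
definition "uniformity = (INF e\<in>{0 <..}. principal {(x::l2, y). dist x y < e})"
definition "open U = (\<forall>x\<in>U. eventually (\<lambda>(x'::l2, y). x' = x \<longrightarrow> y \<in> U) uniformity)"

lemma rep_zero: "AE x in lborel. rep 0 x = 0"
  unfolding zero_l2_def by (rule rep_cls) (rule L2_zero)
lemma rep_add: "AE x in lborel. rep (u + v) x = rep u x + rep v x"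
  unfolding plus_l2_def by (rule rep_cls) (intro L2_add; simp)
lemma rep_diff: "AE x in lborel. rep (u - v) x = rep u x - rep v x"
  unfolding minus_l2_def by (rule rep_cls) (intro L2_diff; simp)
lemma rep_minus: "AE x in lborel. rep (- u) x = - rep u x"
  unfolding uminus_l2_def by (rule rep_cls) (intro L2_minus; simp)
lemma rep_scaleR: "AE x in lborel. rep (c *\<^sub>R u) x = c *\<^sub>R rep u x"
  unfolding scaleR_l2_def by (rule rep_cls) (intro L2_scaleR; simp)

lemma integrable_inner_L2:
  fixes f g :: "real \<Rightarrow> complex"
  assumes "f \<in> L2" "g \<in> L2" shows "integrable lborel (\<lambda>x. f x \<bullet> g x)"
  apply (rule Bochner_Integration.integrable_bound[OF integrable_L2_mult_norm[OF assms]])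
  using L2_measurable[OF assms(1)] L2_measurable[OF assms(2)]
  by (auto intro!: AE_I2 Cauchy_Schwarz_ineq2)

instance
proof
  fix u v w :: l2 and a b :: real
  show "u + v + w = u + (v + w)"
    apply (rule l2_eqI) using rep_add[of "u+v" w] rep_add[of u v] rep_add[of u "v+w"] rep_add[of v w]
    by eventually_elim simp
  show "u + v = v + u"
    apply (rule l2_eqI) using rep_add[of u v] rep_add[of v u] by eventually_elim simp
  show "0 + u = u"
    apply (rule l2_eqI) using rep_add[of 0 u] rep_zero by eventually_elim simp
  show "- u + u = 0"
    apply (rule l2_eqI) using rep_add[of "-u" u] rep_zero rep_minus[of u] by eventually_elim simp
  show "u - v = u + - v"
    apply (rule l2_eqI) using rep_diff[of u v] rep_add[of u "-v"] rep_minus[of v] by eventually_elim simp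
  show "a *\<^sub>R (u + v) = a *\<^sub>R u + a *\<^sub>R v"
    apply (rule l2_eqI) using rep_scaleR[of a "u+v"] rep_add[of u v] rep_add[of "a *\<^sub>R u" "a *\<^sub>R v"]
      rep_scaleR[of a u] rep_scaleR[of a v] by eventually_elim (simp add: algebra_simps)
  show "(a + b) *\<^sub>R u = a *\<^sub>R u + b *\<^sub>R u"
    apply (rule l2_eqI) using rep_scaleR[of "a+b" u] rep_add[of "a *\<^sub>R u" "b *\<^sub>R u"]
      rep_scaleR[of a u] rep_scaleR[of b u] by eventually_elim (simp add: algebra_simps)
  show "a *\<^sub>R b *\<^sub>R u = (a * b) *\<^sub>R u"
    apply (rule l2_eqI) using rep_scaleR[of a "b *\<^sub>R u"] rep_scaleR[of b u] rep_scaleR[of "a*b" u]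
    by eventually_elim simp
  show "1 *\<^sub>R u = u"
    apply (rule l2_eqI) using rep_scaleR[of 1 u] by eventually_elim simp
  show "dist u v = norm (u - v)" by (rule dist_l2_def)
  show "sgn u = inverse (norm u) *\<^sub>R u" by (rule sgn_l2_def)
  show "uniformity = (INF e\<in>{0 <..}. principal {(x::l2, y). dist x y < e})"
    by (rule uniformity_l2_def)
  show "open U = (\<forall>x\<in>U. eventually (\<lambda>(x', y). x' = x \<longrightarrow> y \<in> U) uniformity)" for U :: "l2 set"
    by (rule open_l2_def)
  show "inner u v = inner v u" unfolding inner_l2_def by (simp add: inner_commute)
  have "(LINT x|lborel. rep (u + v) x \<bullet> rep w x) = (LINT x|lborel. rep u x \<bullet> rep w x + rep v x \<bullet> rep w x)"
    apply (rule integral_cong_AE) using rep_add[of u v] by (auto simp: inner_add_left)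
  then show "inner (u + v) w = inner u w + inner v w"
    unfolding inner_l2_def by (simp add: integrable_inner_L2)
  have "(LINT x|lborel. rep (a *\<^sub>R u) x \<bullet> rep v x) = (LINT x|lborel. a * (rep u x \<bullet> rep v x))"
    apply (rule integral_cong_AE) using rep_scaleR[of a u] by auto
  then show "inner (a *\<^sub>R u) v = a * inner u v"
    unfolding inner_l2_def by simp
  show "0 \<le> inner u u" unfolding inner_l2_def by (intro integral_nonneg_AE) auto
  have "inner u u = 0 \<longleftrightarrow> (AE x in lborel. rep u x \<bullet> rep u x = 0)"
    unfolding inner_l2_def by (intro integral_nonneg_eq_0_iff_AE integrable_inner_L2) auto
  also have "\<dots> \<longleftrightarrow> (AE x in lborel. rep u x = rep 0 x)"
  proof
    assume "AE x in lborel. rep u x \<bullet> rep u x = 0"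
    then show "AE x in lborel. rep u x = rep 0 x" using rep_zero by eventually_elim simp
  next
    assume "AE x in lborel. rep u x = rep 0 x"
    then show "AE x in lborel. rep u x \<bullet> rep u x = 0" using rep_zero by eventually_elim simp
  qed
  finally show "inner u u = 0 \<longleftrightarrow> u = 0" by (simp add: l2_eq_iff)
  show "norm u = sqrt (inner u u)" by (rule norm_l2_def)
qed

end

lemma norm_l2_sq: "(norm u)\<^sup>2 = (LINT x|lborel. (cmod (rep u x))\<^sup>2)"
  by (simp add: power2_norm_eq_inner inner_l2_def)

lemma nn_integral_rep: "(\<integral>\<^sup>+x. ennreal ((cmod (rep u x))\<^sup>2) \<partial>lborel) = ennreal ((norm u)\<^sup>2)"
  unfolding norm_l2_sq by (intro nn_integral_eq_integral L2_integrable) auto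

lemma rep_sum: "finite A \<Longrightarrow> AE x in lborel. rep (\<Sum>i\<in>A. u i) x = (\<Sum>i\<in>A. rep (u i) x)"
proof (induction A rule: finite_induct)
  case empty
  then show ?case using rep_zero by simp
next
  case (insert a A)
  show ?case unfolding sum.insert[OF insert.hyps]
    using insert.IH rep_add[of "u a" "\<Sum>i\<in>A. u i"] by eventually_elim simp
qed

lemma nn_integral_cls:
  assumes "f \<in> L2" shows "(\<integral>\<^sup>+x. ennreal ((cmod (f x))\<^sup>2) \<partial>lborel) = ennreal ((norm (cls f))\<^sup>2)"
  unfolding nn_integral_rep[symmetric]
  by (rule nn_integral_cong_AE) (use rep_cls[OF assms] in \<open>eventually_elim, simp\<close>)

lemma cls_diff: "f \<in> L2 \<Longrightarrow> g \<in> L2 \<Longrightarrow> cls (\<lambda>x. f x - g x) = cls f - cls g"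
  apply (rule l2_eqI)
  using rep_cls[OF L2_diff[of f g]] rep_diff[of "cls f" "cls g"] rep_cls[of f] rep_cls[of g]
  by (auto elim: eventually_elim2)

lemma cls_scaleR: "f \<in> L2 \<Longrightarrow> cls (\<lambda>x. c *\<^sub>R f x) = c *\<^sub>R cls f"
  apply (rule l2_eqI)
  using rep_cls[OF L2_scaleR[of f c]] rep_scaleR[of c "cls f"] rep_cls[of f]
  by (auto elim: eventually_elim2)

lemma inner_cls:
  assumes "f \<in> L2" "g \<in> L2" shows "inner (cls f) (cls g) = (LINT x|lborel. f x \<bullet> g x)"
proof -
  note [measurable] = L2_measurable[OF assms(1)] L2_measurable[OF assms(2)]
  show ?thesis unfolding inner_l2_def
    apply (rule integral_cong_AE)
    using rep_cls[OF assms(1)] rep_cls[OF assms(2)] by (auto elim: eventually_elim2)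
qed

lemma norm_cls_le:
  assumes "f \<in> L2" "g \<in> L2" "AE x in lborel. cmod (f x) \<le> cmod (g x)"
  shows "norm (cls f) \<le> norm (cls g)"
proof -
  have "ennreal ((norm (cls f))\<^sup>2) \<le> ennreal ((norm (cls g))\<^sup>2)"
    unfolding nn_integral_cls[OF assms(1), symmetric] nn_integral_cls[OF assms(2), symmetric]
    by (rule nn_integral_mono_AE) (use assms(3) in \<open>eventually_elim, simp add: power_mono\<close>)
  then have "(norm (cls f))\<^sup>2 \<le> (norm (cls g))\<^sup>2" by simp
  then show ?thesis by (rule power2_le_imp_le) simp
qed

text \<open>
  Riesz--Fischer: along a subsequence whose increments are summable in norm, the series of the
  moduli of the increments is square integrable, so that the subsequence converges almost
  everywhere; Fatou's lemma identifies the pointwise limit with the limit in norm.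
\<close>

lemma l2_subseq_AE:
  fixes X :: "nat \<Rightarrow> l2"
  assumes "\<And>n. norm (X (Suc n) - X n) \<le> (1/2)^n"
  shows "AE x in lborel. convergent (\<lambda>n. rep (X n) x)"
proof -
  define d where "d n x = cmod (rep (X (Suc n) - X n) x)" for n x
  have [measurable]: "d n \<in> borel_measurable borel" for n unfolding d_def by measurable
  have dL2: "(\<lambda>x. complex_of_real (d n x)) \<in> L2" for n
    by (rule L2_mono[of "rep (X (Suc n) - X n)" _ 1]) (auto simp: d_def)
  define D where "D n = cls (\<lambda>x. complex_of_real (d n x))" for n
  have nD: "norm (D n) \<le> (1/2)^n" for n
  proof -
    have "norm (D n) \<le> norm (cls (rep (X (Suc n) - X n)))"
      unfolding D_def by (rule norm_cls_le[OF dL2 rep_L2]) (auto simp: d_def)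
    then show ?thesis using assms[of n] by simp
  qed
  have bd: "norm (\<Sum>i<n. D i) \<le> 2" for n
  proof -
    have "norm (\<Sum>i<n. D i) \<le> (\<Sum>i<n. (1/2)^i)" by (rule sum_norm_le) (use nD in auto)
    also have "\<dots> \<le> 2" by (simp add: sum_gp_strict)
    finally show ?thesis .
  qed
  have le4: "(\<integral>\<^sup>+x. ennreal ((\<Sum>i<n. d i x)\<^sup>2) \<partial>lborel) \<le> 4" for n
  proof -
    have "(\<integral>\<^sup>+x. ennreal ((\<Sum>i<n. d i x)\<^sup>2) \<partial>lborel) = (\<integral>\<^sup>+x. ennreal ((cmod (rep (\<Sum>i<n. D i) x))\<^sup>2) \<partial>lborel)"
    proof (rule nn_integral_cong_AE)
      have "AE x in lborel. \<forall>i. rep (D i) x = complex_of_real (d i x)"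
        unfolding AE_all_countable D_def using rep_cls[OF dL2] by auto
      then show "AE x in lborel. ennreal ((\<Sum>i<n. d i x)\<^sup>2) = ennreal ((cmod (rep (\<Sum>i<n. D i) x))\<^sup>2)"
        using rep_sum[of "{..<n}" D]
        by (auto elim!: eventually_elim2 simp flip: of_real_sum)
    qed
    also have "\<dots> = ennreal ((norm (\<Sum>i<n. D i))\<^sup>2)" by (rule nn_integral_rep)
    also have "\<dots> \<le> ennreal (2\<^sup>2)" using bd[of n] by (intro ennreal_leI power_mono) auto
    finally show ?thesis by simp
  qed
  have inc: "incseq (\<lambda>n x. ennreal ((\<Sum>i<n. d i x)\<^sup>2))"
    by (auto simp: incseq_def le_fun_def d_def intro!: ennreal_leI power_mono sum_mono2 sum_nonneg)
  have "(\<integral>\<^sup>+x. (SUP n. ennreal ((\<Sum>i<n. d i x)\<^sup>2)) \<partial>lborel) = (SUP n. \<integral>\<^sup>+x. ennreal ((\<Sum>i<n. d i x)\<^sup>2) \<partial>lborel)"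
    by (rule nn_integral_monotone_convergence_SUP[OF inc]) measurable
  also have "\<dots> \<le> 4" using le4 by (rule SUP_least)
  finally have "(\<integral>\<^sup>+x. (SUP n. ennreal ((\<Sum>i<n. d i x)\<^sup>2)) \<partial>lborel) \<noteq> \<infinity>"
    by (auto simp: top_unique)
  then have fin: "AE x in lborel. (SUP n. ennreal ((\<Sum>i<n. d i x)\<^sup>2)) \<noteq> \<infinity>"
    by (intro nn_integral_PInf_AE) auto
  have inc_eq: "AE x in lborel. \<forall>n. rep (X (Suc n) - X n) x = rep (X (Suc n)) x - rep (X n) x"
    unfolding AE_all_countable using rep_diff by auto
  show ?thesis using fin inc_eq
  proof eventually_elim
    case (elim x)
    obtain r where r: "(SUP n. ennreal ((\<Sum>i<n. d i x)\<^sup>2)) = ennreal r" "r \<ge> 0"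
      using elim(1) by (cases "(SUP n. ennreal ((\<Sum>i<n. d i x)\<^sup>2))") auto
    have "(\<Sum>i<n. d i x) \<le> sqrt r" for n
    proof -
      have "ennreal ((\<Sum>i<n. d i x)\<^sup>2) \<le> ennreal r" unfolding r(1)[symmetric] by (rule SUP_upper) simp
      then show ?thesis using r(2) by (intro real_le_rsqrt) simp
    qed
    then have "summable (\<lambda>n. d n x)"
      by (intro summableI_nonneg_bounded[of _ "sqrt r"]) (auto simp: d_def)
    then have "summable (\<lambda>n. norm (rep (X (Suc n)) x - rep (X n) x))"
      using elim(2) by (simp add: d_def)
    then have "summable (\<lambda>n. rep (X (Suc n)) x - rep (X n) x)"
      by (rule summable_norm_cancel)
    then have "convergent (\<lambda>n. \<Sum>i<n. rep (X (Suc i)) x - rep (X i) x)"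
      by (simp add: summable_iff_convergent)
    then have "convergent (\<lambda>n. rep (X n) x - rep (X 0) x)"
      by (simp add: sum_lessThan_telescope[of "\<lambda>n. rep (X n) x"])
    then show ?case
      using convergent_add[OF _ convergent_const, of "\<lambda>n. rep (X n) x - rep (X 0) x" "rep (X 0) x"] by simp
  qed
qed

text \<open>
  Pointwise limits inherit norm bounds by Fatou's lemma; applied to differences this identifies
  the pointwise limit of a Cauchy sequence with its limit in norm.
\<close>

lemma Fatou_l2:
  fixes X :: "nat \<Rightarrow> l2"
  assumes [measurable]: "f \<in> borel_measurable borel"
    and lim: "AE x in lborel. (\<lambda>n. rep (X n) x) \<longlonglongrightarrow> f x"
    and bd: "\<And>n. n \<ge> k \<Longrightarrow> norm (X n) \<le> C"
  shows "f \<in> L2" "norm (cls f) \<le> C"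
proof -
  have C: "C \<ge> 0" using bd[of k] norm_ge_zero[of "X k"] by linarith
  have "(\<integral>\<^sup>+x. ennreal ((cmod (f x))\<^sup>2) \<partial>lborel)
     = (\<integral>\<^sup>+x. liminf (\<lambda>n. ennreal ((cmod (rep (X n) x))\<^sup>2)) \<partial>lborel)"
  proof (rule nn_integral_cong_AE)
    show "AE x in lborel. ennreal ((cmod (f x))\<^sup>2) = liminf (\<lambda>n. ennreal ((cmod (rep (X n) x))\<^sup>2))"
      using lim
    proof eventually_elim
      case (elim x)
      have "(\<lambda>n. ennreal ((cmod (rep (X n) x))\<^sup>2)) \<longlonglongrightarrow> ennreal ((cmod (f x))\<^sup>2)"
        by (intro tendsto_intros elim)
      then show ?case using lim_imp_Liminf[OF sequentially_bot] by metis
    qed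
  qed
  also have "\<dots> \<le> liminf (\<lambda>n. \<integral>\<^sup>+x. ennreal ((cmod (rep (X n) x))\<^sup>2) \<partial>lborel)"
    by (rule nn_integral_liminf) measurable
  also have "\<dots> = liminf (\<lambda>n. ennreal ((norm (X n))\<^sup>2))" by (simp add: nn_integral_rep)
  also have "\<dots> \<le> liminf (\<lambda>n. ennreal (C\<^sup>2))"
  proof (rule Liminf_mono)
    show "\<forall>\<^sub>F n in sequentially. ennreal ((norm (X n))\<^sup>2) \<le> ennreal (C\<^sup>2)"
      using eventually_ge_at_top[of k]
      by eventually_elim (use bd in \<open>auto intro!: ennreal_leI power_mono\<close>)
  qed
  also have "\<dots> = ennreal (C\<^sup>2)" by (simp add: Liminf_const)
  finally have le: "(\<integral>\<^sup>+x. ennreal ((cmod (f x))\<^sup>2) \<partial>lborel) \<le> ennreal (C\<^sup>2)" .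
  then show f: "f \<in> L2" by (auto simp: L2_iff_nn_integral intro: le_less_trans)
  have "ennreal ((norm (cls f))\<^sup>2) \<le> ennreal (C\<^sup>2)" using le nn_integral_cls[OF f] by simp
  then have "(norm (cls f))\<^sup>2 \<le> C\<^sup>2" by simp
  then show "norm (cls f) \<le> C" using C by (rule power2_le_imp_le)
qed

instance l2 :: complete_space
proof
  fix X :: "nat \<Rightarrow> l2" assume C: "Cauchy X"
  have "\<exists>r. strict_mono (r :: nat \<Rightarrow> nat) \<and> (\<forall>n. \<forall>m\<ge>r n. norm (X m - X (r n)) \<le> (1/2)^n)"
  proof -
    have ex: "\<exists>M. \<forall>m\<ge>M. \<forall>n\<ge>M. norm (X m - X n) < (1/2)^k" for k
      using C[unfolded Cauchy_iff, rule_format, of "(1/2)^k"] by auto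
    obtain M where M: "\<And>k m n. m \<ge> M k \<Longrightarrow> n \<ge> M k \<Longrightarrow> norm (X m - X n) < (1/2)^k"
      using ex by metis
    define r where "r = rec_nat (M 0) (\<lambda>n a. max (Suc a) (M (Suc n)))"
    have rS: "r (Suc n) = max (Suc (r n)) (M (Suc n))" and r0: "r 0 = M 0" for n
      by (simp_all add: r_def)
    have sm: "strict_mono r" unfolding strict_mono_Suc_iff rS by (simp add: less_max_iff_disj)
    have ge: "r n \<ge> M n" for n by (cases n) (auto simp: r0 rS)
    have "norm (X m - X (r n)) \<le> (1/2)^n" if "m \<ge> r n" for m n
      by (rule less_imp_le[OF M]) (use that ge[of n] in linarith)+
    then show ?thesis using sm by blast
  qed
  then obtain r where sm: "strict_mono r" and r: "\<And>n m. m \<ge> r n \<Longrightarrow> norm (X m - X (r n)) \<le> (1/2)^n"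
    by auto
  define Y where "Y n = X (r n)" for n
  have "norm (Y (Suc n) - Y n) \<le> (1/2)^n" for n
    unfolding Y_def using sm by (intro r) (simp add: strict_mono_leD)
  then have ae: "AE x in lborel. convergent (\<lambda>n. rep (Y n) x)" by (rule l2_subseq_AE)
  define f where "f x = lim (\<lambda>n. rep (Y n) x)" for x
  have [measurable]: "f \<in> borel_measurable borel" unfolding f_def by measurable
  have lim: "AE x in lborel. (\<lambda>n. rep (Y n) x) \<longlonglongrightarrow> f x"
    using ae by eventually_elim (simp add: convergent_LIMSEQ_iff f_def)
  have *: "(\<lambda>x. f x - rep (Y m) x) \<in> L2 \<and> norm (cls (\<lambda>x. f x - rep (Y m) x)) \<le> (1/2)^m" for m
  proof -
    have dl: "AE x in lborel. (\<lambda>n. rep (Y n - Y m) x) \<longlonglongrightarrow> f x - rep (Y m) x"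
    proof -
      have "AE x in lborel. \<forall>n. rep (Y n - Y m) x = rep (Y n) x - rep (Y m) x"
        unfolding AE_all_countable using rep_diff by auto
      then show ?thesis using lim
        by eventually_elim (auto intro!: tendsto_intros)
    qed
    have bd: "norm (Y n - Y m) \<le> (1/2)^m" if "n \<ge> m" for n
      unfolding Y_def using sm that by (intro r) (simp add: strict_mono_leD)
    show ?thesis
      by (intro conjI; rule Fatou_l2[where k = m and X = "\<lambda>n. Y n - Y m"]) (use dl bd in auto)
  qed
  have fL2: "f \<in> L2" using L2_add[OF conjunct1[OF *[of 0]] rep_L2[of "Y 0"]] by simp
  have Y: "norm (Y m - cls f) \<le> (1/2)^m" for m
    using *[of m] cls_diff[OF fL2 rep_L2[of "Y m"]] by (simp add: norm_minus_commute)
  have "Y \<longlonglongrightarrow> cls f"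
  proof (rule LIM_zero_cancel, rule Lim_null_comparison)
    show "\<forall>\<^sub>F m in sequentially. norm (Y m - cls f) \<le> (1/2)^m" using Y by simp
    show "(\<lambda>m. (1/2::real)^m) \<longlonglongrightarrow> 0" by (intro LIMSEQ_power_zero) simp
  qed
  then have "X \<longlonglongrightarrow> cls f"
    using Cauchy_converges_subseq[OF C sm] unfolding Y_def o_def by simp
  then show "convergent X" by (auto simp: convergent_def)
qed

section \<open>Multiplication operators\<close>

definition mul :: "(real \<Rightarrow> real) \<Rightarrow> l2 \<Rightarrow> l2" where
  "mul m u = cls (\<lambda>x. m x *\<^sub>R rep u x)"

definition bmeas :: "(real \<Rightarrow> real) \<Rightarrow> bool" where
  "bmeas m \<longleftrightarrow> m \<in> borel_measurable borel \<and> (\<exists>K. \<forall>x. \<bar>m x\<bar> \<le> K)"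

lemma bmeasI: "m \<in> borel_measurable borel \<Longrightarrow> (\<And>x. \<bar>m x\<bar> \<le> K) \<Longrightarrow> bmeas m"
  by (auto simp: bmeas_def)

lemma bmeas_measurable: "bmeas m \<Longrightarrow> m \<in> borel_measurable borel"
  by (auto simp: bmeas_def)

lemma L2_mul: "bmeas m \<Longrightarrow> f \<in> L2 \<Longrightarrow> (\<lambda>x. m x *\<^sub>R f x) \<in> L2"
proof -
  assume m: "bmeas m" and f: "f \<in> L2"
  obtain K where K: "\<And>x. \<bar>m x\<bar> \<le> K" using m by (auto simp: bmeas_def)
  note [measurable] = bmeas_measurable[OF m] L2_measurable[OF f]
  show ?thesis by (rule L2_mono[OF f, of _ K]) (use K in \<open>auto intro!: mult_right_mono\<close>)
qed

lemma rep_mul: "bmeas m \<Longrightarrow> AE x in lborel. rep (mul m u) x = m x *\<^sub>R rep u x"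
  unfolding mul_def by (rule rep_cls) (simp add: L2_mul)

lemma norm_mul_le:
  assumes "m \<in> borel_measurable borel" "\<And>x. \<bar>m x\<bar> \<le> K"
  shows "norm (mul m u) \<le> K * norm u"
proof -
  have m: "bmeas m" using assms by (auto simp: bmeas_def)
  have K: "K \<ge> 0" using assms(2)[of 0] by linarith
  have "norm (mul m u) \<le> norm (cls (\<lambda>x. K *\<^sub>R rep u x))"
    unfolding mul_def
    by (rule norm_cls_le) (use assms(2) K in \<open>auto intro!: L2_mul[OF m] L2_scaleR mult_right_mono\<close>)
  also have "\<dots> = K * norm u" using K by (simp add: cls_scaleR)
  finally show ?thesis .
qed

lemma mul_add: assumes m: "bmeas m" shows "mul m (u + v) = mul m u + mul m v"
proof (rule l2_eqI)
  show "AE x in lborel. rep (mul m (u + v)) x = rep (mul m u + mul m v) x"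
    using rep_mul[OF m, of "u+v"] rep_mul[OF m, of u] rep_mul[OF m, of v] rep_add[of u v]
      rep_add[of "mul m u" "mul m v"]
    by eventually_elim (simp add: algebra_simps)
qed

lemma mul_scaleR: assumes m: "bmeas m" shows "mul m (c *\<^sub>R u) = c *\<^sub>R mul m u"
proof (rule l2_eqI)
  show "AE x in lborel. rep (mul m (c *\<^sub>R u)) x = rep (c *\<^sub>R mul m u) x"
    using rep_mul[OF m, of "c *\<^sub>R u"] rep_mul[OF m, of u] rep_scaleR[of c u] rep_scaleR[of c "mul m u"]
    by eventually_elim (simp add: algebra_simps)
qed

lemma bounded_linear_mul: "bmeas m \<Longrightarrow> bounded_linear (mul m)"
proof -
  assume m: "bmeas m"
  then obtain K where "\<And>x. \<bar>m x\<bar> \<le> K" by (auto simp: bmeas_def)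
  then show ?thesis using norm_mul_le[OF bmeas_measurable[OF m]] mul_add[OF m] mul_scaleR[OF m]
    by (intro bounded_linear_intro[where K = K]) (auto simp: mult.commute)
qed

lemma mul_mul: "bmeas m \<Longrightarrow> bmeas n \<Longrightarrow> mul m (mul n u) = mul (\<lambda>x. m x * n x) u"
proof (rule l2_eqI)
  assume m: "bmeas m" and n: "bmeas n"
  obtain K L where "\<And>x. \<bar>m x\<bar> \<le> K" "\<And>x. \<bar>n x\<bar> \<le> L" using m n by (auto simp: bmeas_def)
  then have mn: "bmeas (\<lambda>x. m x * n x)" using bmeas_measurable[OF m] bmeas_measurable[OF n]
    by (intro bmeasI[of _ "K * L"]) (auto simp: abs_mult intro!: mult_mono order_trans[OF abs_ge_zero])
  show "AE x in lborel. rep (mul m (mul n u)) x = rep (mul (\<lambda>x. m x * n x) u) x"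
    using rep_mul[OF m, of "mul n u"] rep_mul[OF n, of u] rep_mul[OF mn, of u]
    by eventually_elim simp
qed

lemma inner_mul: "bmeas m \<Longrightarrow> inner (mul m u) v = (LINT x|lborel. m x * (rep u x \<bullet> rep v x))"
  using bmeas_measurable[of m] unfolding inner_l2_def
  by (intro integral_cong_AE) (use rep_mul[of m u] in auto)

lemma inner_mul_commute:
  assumes m: "bmeas m" shows "inner (mul m u) v = inner u (mul m v)"
proof -
  have "inner u (mul m v) = inner (mul m v) u" by (rule inner_commute)
  also have "\<dots> = (LINT x|lborel. m x * (rep v x \<bullet> rep u x))" by (rule inner_mul[OF m])
  also have "\<dots> = (LINT x|lborel. m x * (rep u x \<bullet> rep v x))"
    by (intro Bochner_Integration.integral_cong refl arg_cong2[where f = "(*)"] inner_commute)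
  finally show ?thesis using inner_mul[OF m, of u v] by simp
qed

lemma inner_mul_self:
  assumes m: "bmeas m" and "\<And>x. m x \<ge> 0"
  shows "ennreal (inner (mul m u) u) = (\<integral>\<^sup>+x. ennreal (m x * (cmod (rep u x))\<^sup>2) \<partial>lborel)"
proof -
  have "inner (mul m u) u = (LINT x|lborel. m x * (cmod (rep u x))\<^sup>2)"
    by (simp add: inner_mul[OF m] power2_norm_eq_inner)
  moreover have "integrable lborel (\<lambda>x. m x * (cmod (rep u x))\<^sup>2)"
  proof -
    have "integrable lborel (\<lambda>x. (m x *\<^sub>R rep u x) \<bullet> rep u x)"
      by (intro integrable_inner_L2 L2_mul m) auto
    then show ?thesis by (simp add: power2_norm_eq_inner)
  qed
  ultimately show ?thesis using assms(2) by (subst nn_integral_eq_integral) auto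
qed

section \<open>The kernel and convolution estimates\<close>

lemma S_kernel_nonneg: "S_kernel k l \<ge> 0"
  by (simp add: S_kernel_def)

lemma S_kernel_commute: "S_kernel k l = S_kernel l k"
  by (simp add: S_kernel_def ac_simps)

lemma S_kernel_minus: "S_kernel (- k) (- l) = S_kernel k l"
proof -
  have 1: "\<bar>- k + - l\<bar> = \<bar>k + l\<bar>" by arith
  have "- k * - l * (- k + - l) = - (k * l * (k + l))" by (simp add: algebra_simps)
  then have "\<bar>- k * - l * (- k + - l)\<bar> = \<bar>k * l * (k + l)\<bar>" by (simp only: abs_minus_cancel)
  then show ?thesis unfolding S_kernel_def 1 by simp
qed

lemma S_kernel_rotate: "S_kernel (l - k) k = S_kernel (k - l) l"
  by (simp add: S_kernel_def abs_mult abs_minus_commute ac_simps)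

lemma S_kernel_measurable [measurable (raw)]:
  assumes [measurable]: "f \<in> borel_measurable M" "g \<in> borel_measurable M"
  shows "(\<lambda>x. S_kernel (f x) (g x)) \<in> borel_measurable M"
  unfolding S_kernel_def by measurable

lemma S_kernel_le1: "S_kernel k l \<le> sqrt \<bar>k\<bar>"
proof (cases "k = 0 \<and> l = 0")
  case True
  then show ?thesis by (simp add: S_kernel_def)
next
  case False
  then have D: "\<bar>k + l\<bar> + \<bar>k\<bar> + \<bar>l\<bar> > 0" by auto
  have "sqrt (\<bar>l\<bar> * \<bar>k + l\<bar>) \<le> (\<bar>l\<bar> + \<bar>k + l\<bar>) / 2" by (rule arith_geo_mean_sqrt) auto
  then have *: "2 * sqrt (\<bar>l\<bar> * \<bar>k + l\<bar>) \<le> \<bar>k + l\<bar> + \<bar>k\<bar> + \<bar>l\<bar>" by simp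
  have "2 * sqrt \<bar>k * l * (k + l)\<bar> = sqrt \<bar>k\<bar> * (2 * sqrt (\<bar>l\<bar> * \<bar>k + l\<bar>))"
    by (simp add: abs_mult real_sqrt_mult)
  also have "\<dots> \<le> sqrt \<bar>k\<bar> * (\<bar>k + l\<bar> + \<bar>k\<bar> + \<bar>l\<bar>)" by (intro mult_left_mono *) auto
  finally show ?thesis using D by (simp add: S_kernel_def field_simps)
qed

lemma S_kernel_le2: "S_kernel k l \<le> sqrt \<bar>l\<bar>"
  using S_kernel_le1[of l k] by (simp add: S_kernel_commute)

lemma S_kernel_le3: "S_kernel (k - l) l \<le> sqrt \<bar>k\<bar>"
  using S_kernel_le2[of "l - k" k] by (simp add: S_kernel_rotate)

lemma nn_integral_reflect:
  fixes f :: "real \<Rightarrow> ennreal"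
  assumes "f \<in> borel_measurable borel"
  shows "(\<integral>\<^sup>+x. f (k - x) \<partial>lborel) = (\<integral>\<^sup>+x. f x \<partial>lborel)"
  using nn_integral_real_affine[OF assms, of "-1" k] by simp

lemma nn_integral_shift:
  fixes f :: "real \<Rightarrow> ennreal"
  assumes "f \<in> borel_measurable borel"
  shows "(\<integral>\<^sup>+x. f (x + k) \<partial>lborel) = (\<integral>\<^sup>+x. f x \<partial>lborel)"
  using nn_integral_real_affine[OF assms, of 1 k] by (simp add: add.commute)

lemma integral_reflect:
  fixes f :: "real \<Rightarrow> complex"
  shows "(LINT x|lborel. f (k - x)) = (LINT x|lborel. f x)"
  using lborel_integral_real_affine[of "-1" f k] by simp

lemma AE_reflect:
  fixes k :: real
  assumes "AE x in lborel. P x" shows "AE x in lborel. P (k - x)"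
proof -
  from assms obtain N where N: "{x. \<not> P x} \<subseteq> N" "N \<in> sets borel" "emeasure lborel N = 0"
    by (auto elim!: AE_E)
  define M where "M = (\<lambda>x. k - x) -` N"
  have M: "M \<in> sets borel" unfolding M_def using N(2) by (intro measurable_sets_borel[of _ borel]) auto
  have "emeasure lborel M = (\<integral>\<^sup>+x. indicator M x \<partial>lborel)" using M by simp
  also have "\<dots> = (\<integral>\<^sup>+x. indicator N (k - x) \<partial>lborel)"
    by (intro nn_integral_cong) (simp add: M_def indicator_def)
  also have "\<dots> = emeasure lborel N"
    using N(2) nn_integral_reflect[of "indicator N" k] by simp
  finally have "emeasure lborel M = 0" using N(3) by simp
  then show ?thesis by (intro AE_I[of _ _ M]) (use N M in \<open>auto simp: M_def\<close>)
qed

lemma ennreal_le_of_sq: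
  assumes "a\<^sup>2 \<le> (ennreal c)\<^sup>2" "c \<ge> 0" shows "a \<le> ennreal c"
proof (cases a)
  case (real r)
  then have "ennreal (r\<^sup>2) \<le> ennreal (c\<^sup>2)" using assms by (simp add: ennreal_power)
  then have "r\<^sup>2 \<le> c\<^sup>2" by simp
  then show ?thesis using real assms(2) by (auto intro: ennreal_leI power2_le_imp_le)
next
  case top
  then show ?thesis using assms by (auto simp: power2_eq_square top_unique ennreal_mult_eq_top_iff)
qed

lemma Cauchy_Schwarz_nn:
  fixes f g :: "real \<Rightarrow> real"
  assumes [measurable]: "f \<in> borel_measurable borel" "g \<in> borel_measurable borel"
    and f: "(\<integral>\<^sup>+x. ennreal ((f x)\<^sup>2) \<partial>lborel) \<le> ennreal (X\<^sup>2)"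
    and g: "(\<integral>\<^sup>+x. ennreal ((g x)\<^sup>2) \<partial>lborel) \<le> ennreal (Y\<^sup>2)"
    and nn: "\<And>x. f x \<ge> 0" "\<And>x. g x \<ge> 0" "X \<ge> 0" "Y \<ge> 0"
  shows "(\<integral>\<^sup>+x. ennreal (f x) * ennreal (g x) \<partial>lborel) \<le> ennreal (X * Y)"
proof (rule ennreal_le_of_sq)
  have "(\<integral>\<^sup>+x. ennreal (f x) * ennreal (g x) \<partial>lborel)\<^sup>2
     \<le> (\<integral>\<^sup>+x. (ennreal (f x))\<^sup>2 \<partial>lborel) * (\<integral>\<^sup>+x. (ennreal (g x))\<^sup>2 \<partial>lborel)"
    by (rule Cauchy_Schwarz_nn_integral) measurable
  also have "\<dots> \<le> ennreal (X\<^sup>2) * ennreal (Y\<^sup>2)"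
    using f g nn by (intro mult_mono) (auto simp: ennreal_power)
  also have "\<dots> = (ennreal (X * Y))\<^sup>2"
    using nn by (simp add: ennreal_power power_mult_distrib ennreal_mult)
  finally show "(\<integral>\<^sup>+x. ennreal (f x) * ennreal (g x) \<partial>lborel)\<^sup>2 \<le> (ennreal (X * Y))\<^sup>2" .
qed (use nn in auto)

text \<open>
  Young's inequality in dual form: for a fixed difference \<open>m = k - l\<close> the integral over \<open>l\<close> is
  bounded by the Cauchy-Schwarz inequality, independently of \<open>m\<close>.
\<close>

lemma trilinear_bound:
  fixes f h :: "real \<Rightarrow> real" and g :: "real \<Rightarrow> ennreal"
  assumes [measurable]: "f \<in> borel_measurable borel" "h \<in> borel_measurable borel" "g \<in> borel_measurable borel"
    and f: "(\<integral>\<^sup>+x. ennreal ((f x)\<^sup>2) \<partial>lborel) \<le> ennreal (X\<^sup>2)"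
    and h: "(\<integral>\<^sup>+x. ennreal ((h x)\<^sup>2) \<partial>lborel) \<le> ennreal (Y\<^sup>2)"
    and nn: "\<And>x. f x \<ge> 0" "\<And>x. h x \<ge> 0" "X \<ge> 0" "Y \<ge> 0"
  shows "(\<integral>\<^sup>+k. \<integral>\<^sup>+l. ennreal (f k) * g (k - l) * ennreal (h l) \<partial>lborel \<partial>lborel)
      \<le> (\<integral>\<^sup>+x. g x \<partial>lborel) * ennreal (X * Y)"
proof -
  have "(\<integral>\<^sup>+k. \<integral>\<^sup>+l. ennreal (f k) * g (k - l) * ennreal (h l) \<partial>lborel \<partial>lborel)
      = (\<integral>\<^sup>+l. \<integral>\<^sup>+k. ennreal (f k) * g (k - l) * ennreal (h l) \<partial>lborel \<partial>lborel)"
    by (rule lborel_pair.Fubini') measurable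
  also have "\<dots> = (\<integral>\<^sup>+l. \<integral>\<^sup>+m. ennreal (f (m + l)) * g m * ennreal (h l) \<partial>lborel \<partial>lborel)"
  proof (rule nn_integral_cong)
    fix l
    show "(\<integral>\<^sup>+k. ennreal (f k) * g (k - l) * ennreal (h l) \<partial>lborel)
        = (\<integral>\<^sup>+m. ennreal (f (m + l)) * g m * ennreal (h l) \<partial>lborel)"
      using nn_integral_shift[of "\<lambda>k. ennreal (f k) * g (k - l) * ennreal (h l)" l] by simp
  qed
  also have "\<dots> = (\<integral>\<^sup>+m. \<integral>\<^sup>+l. ennreal (f (m + l)) * g m * ennreal (h l) \<partial>lborel \<partial>lborel)"
    by (rule lborel_pair.Fubini') measurable
  also have "\<dots> = (\<integral>\<^sup>+m. g m * (\<integral>\<^sup>+l. ennreal (f (m + l)) * ennreal (h l) \<partial>lborel) \<partial>lborel)"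
    by (intro nn_integral_cong, subst nn_integral_cmult[symmetric]) (auto simp: ac_simps intro!: nn_integral_cong)
  also have "\<dots> \<le> (\<integral>\<^sup>+m. g m * ennreal (X * Y) \<partial>lborel)"
  proof (intro nn_integral_mono mult_left_mono Cauchy_Schwarz_nn)
    show "(\<integral>\<^sup>+l. ennreal ((f (m + l))\<^sup>2) \<partial>lborel) \<le> ennreal (X\<^sup>2)" for m
      using f nn_integral_shift[of "\<lambda>x. ennreal ((f x)\<^sup>2)" m] by (simp add: add.commute)
  qed (use h nn in auto)
  also have "\<dots> = (\<integral>\<^sup>+x. g x \<partial>lborel) * ennreal (X * Y)" by (rule nn_integral_multc) measurable
  finally show ?thesis .
qed

text \<open>
  The convolution with an integrable \<open>g\<close> is estimated by Cauchy-Schwarz with respect to the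
  density \<open>g (k - l)\<close>.
\<close>

lemma Young_L1_L2:
  fixes g h :: "real \<Rightarrow> real"
  assumes [measurable]: "g \<in> borel_measurable borel" "h \<in> borel_measurable borel"
    and nn: "\<And>x. g x \<ge> 0" "\<And>x. h x \<ge> 0"
  shows "(\<integral>\<^sup>+k. (\<integral>\<^sup>+l. ennreal (g (k - l) * h l) \<partial>lborel)\<^sup>2 \<partial>lborel)
     \<le> (\<integral>\<^sup>+x. ennreal (g x) \<partial>lborel)\<^sup>2 * (\<integral>\<^sup>+x. ennreal ((h x)\<^sup>2) \<partial>lborel)"
proof -
  define G where "G = (\<integral>\<^sup>+x. ennreal (g x) \<partial>lborel)"
  have "(\<integral>\<^sup>+l. ennreal (g (k - l) * h l) \<partial>lborel)\<^sup>2 \<le> G * (\<integral>\<^sup>+l. ennreal (g (k - l) * (h l)\<^sup>2) \<partial>lborel)" for k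
  proof -
    have m: "(\<integral>\<^sup>+l. ennreal (g (k - l) * h l) \<partial>lborel)
       = (\<integral>\<^sup>+l. ennreal (sqrt (g (k - l))) * ennreal (sqrt (g (k - l)) * h l) \<partial>lborel)"
      using nn by (intro nn_integral_cong) (simp add: ennreal_mult[symmetric] mult.assoc[symmetric])
    have "(\<integral>\<^sup>+l. ennreal (g (k - l) * h l) \<partial>lborel)\<^sup>2 \<le> (\<integral>\<^sup>+l. (ennreal (sqrt (g (k - l))))\<^sup>2 \<partial>lborel)
        * (\<integral>\<^sup>+l. (ennreal (sqrt (g (k - l)) * h l))\<^sup>2 \<partial>lborel)"
      unfolding m
      by (rule Cauchy_Schwarz_nn_integral) measurable
    also have "(\<integral>\<^sup>+l. (ennreal (sqrt (g (k - l))))\<^sup>2 \<partial>lborel) = G"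
      using nn nn_integral_reflect[of "\<lambda>x. ennreal (g x)" k] by (simp add: ennreal_power G_def)
    also have "(\<integral>\<^sup>+l. (ennreal (sqrt (g (k - l)) * h l))\<^sup>2 \<partial>lborel) = (\<integral>\<^sup>+l. ennreal (g (k - l) * (h l)\<^sup>2) \<partial>lborel)"
      using nn by (simp add: ennreal_power power_mult_distrib)
    finally show ?thesis .
  qed
  then have "(\<integral>\<^sup>+k. (\<integral>\<^sup>+l. ennreal (g (k - l) * h l) \<partial>lborel)\<^sup>2 \<partial>lborel)
      \<le> (\<integral>\<^sup>+k. G * (\<integral>\<^sup>+l. ennreal (g (k - l) * (h l)\<^sup>2) \<partial>lborel) \<partial>lborel)"
    by (intro nn_integral_mono) auto
  also have "\<dots> = G * (\<integral>\<^sup>+k. \<integral>\<^sup>+l. ennreal (g (k - l) * (h l)\<^sup>2) \<partial>lborel \<partial>lborel)"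
    by (rule nn_integral_cmult) measurable
  also have "(\<integral>\<^sup>+k. \<integral>\<^sup>+l. ennreal (g (k - l) * (h l)\<^sup>2) \<partial>lborel \<partial>lborel)
      = (\<integral>\<^sup>+l. \<integral>\<^sup>+k. ennreal (g (k - l) * (h l)\<^sup>2) \<partial>lborel \<partial>lborel)"
    by (rule lborel_pair.Fubini') measurable
  also have "\<dots> = (\<integral>\<^sup>+l. G * ennreal ((h l)\<^sup>2) \<partial>lborel)"
  proof (rule nn_integral_cong)
    fix l
    have "(\<integral>\<^sup>+k. ennreal (g (k - l) * (h l)\<^sup>2) \<partial>lborel) = (\<integral>\<^sup>+k. ennreal (g (k - l)) * ennreal ((h l)\<^sup>2) \<partial>lborel)"
      using nn by (simp add: ennreal_mult)
    also have "\<dots> = (\<integral>\<^sup>+k. ennreal (g (k - l)) \<partial>lborel) * ennreal ((h l)\<^sup>2)"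
      by (rule nn_integral_multc) measurable
    also have "(\<integral>\<^sup>+k. ennreal (g (k - l)) \<partial>lborel) = G"
      using nn_integral_shift[of "\<lambda>x. ennreal (g x)" "-l"] by (simp add: G_def)
    finally show "(\<integral>\<^sup>+k. ennreal (g (k - l) * (h l)\<^sup>2) \<partial>lborel) = G * ennreal ((h l)\<^sup>2)" .
  qed
  also have "\<dots> = G * (\<integral>\<^sup>+l. ennreal ((h l)\<^sup>2) \<partial>lborel)" by (rule nn_integral_cmult) measurable
  finally show ?thesis by (simp add: G_def power2_eq_square mult.assoc)
qed

section \<open>Sobolev norms and moments\<close>

text \<open>
  The square of the norm of \<open>H\<^sup>s\<close>, with value \<open>\<infinity>\<close> outside of this space.
\<close>

definition hsq :: "real \<Rightarrow> l2 \<Rightarrow> ennreal" where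
  "hsq s u = (\<integral>\<^sup>+k. ennreal ((1 + \<bar>k\<bar> powr (2 * s)) * (cmod (rep u k))\<^sup>2) \<partial>lborel)"

text \<open>
  The moment of order \<open>3/2\<close> is the quantity that governs the growth of all energies; the one of
  order \<open>1/2\<close> measures one factor in the estimates of the nonlinearity.
\<close>

definition mom :: "real \<Rightarrow> l2 \<Rightarrow> ennreal" where
  "mom p u = (\<integral>\<^sup>+k. ennreal (\<bar>k\<bar> powr p * cmod (rep u k)) \<partial>lborel)"

text \<open>
  The constant in the Cauchy-Schwarz estimate of moments by Sobolev norms.
\<close>

definition kap :: "real \<Rightarrow> real \<Rightarrow> ennreal" where
  "kap p s = (\<integral>\<^sup>+k. ennreal (\<bar>k\<bar> powr (2 * p) / (1 + \<bar>k\<bar> powr (2 * s))) \<partial>lborel)"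

lemma norm_le_hsq: "ennreal ((norm u)\<^sup>2) \<le> hsq s u"
  unfolding nn_integral_rep[symmetric] hsq_def
  by (intro nn_integral_mono ennreal_leI) (simp add: mult_le_cancel_right1)

lemma nn_integral_powr_tail:
  assumes "q > 1"
  shows "(\<integral>\<^sup>+x\<in>{1..}. ennreal (x powr (- q)) \<partial>lborel) < \<infinity>"
proof -
  have "(\<integral>\<^sup>+x. ennreal (x powr (- q)) * indicator {1..} x \<partial>lborel) = ennreal (0 - (- (1 powr (1 - q) / (q - 1))))"
  proof (rule nn_integral_FTC_atLeast[where F = "\<lambda>x. - (x powr (1 - q) / (q - 1))"])
    show "((\<lambda>x. - (x powr (1 - q) / (q - 1))) \<longlongrightarrow> 0) at_top"
    proof -
      have "((\<lambda>x::real. x powr (1 - q)) \<longlongrightarrow> 0) at_top"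
        by (rule tendsto_neg_powr) (use assms in \<open>auto simp: filterlim_ident\<close>)
      from tendsto_minus[OF tendsto_divide_zero[OF this]] show ?thesis by simp
    qed
  next
    fix x :: real assume "1 \<le> x"
    then have "DERIV (\<lambda>x. x powr (1 - q)) x :> (1 - q) * x powr (1 - q - 1)"
      by (intro has_real_derivative_powr) simp
    from DERIV_minus[OF DERIV_cdivide[OF this, of "q - 1"]]
    show "DERIV (\<lambda>x. - (x powr (1 - q) / (q - 1))) x :> x powr - q"
    proof (rule DERIV_cong)
      have "q - 1 \<noteq> 0" using assms by simp
      then show "- ((1 - q) * x powr (1 - q - 1) / (q - 1)) = x powr - q"
        by (simp add: minus_divide_left[symmetric] divide_eq_eq flip: minus_divide_left) (simp add: field_simps)
    qed
  qed auto
  then show ?thesis by simp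
qed

lemma kap_finite:
  assumes "p \<ge> 0" "2 * s - 2 * p > 1" shows "kap p s < \<infinity>"
proof -
  define q where "q = 2 * s - 2 * p"
  define T where "T = (\<integral>\<^sup>+x\<in>{1..}. ennreal (x powr (- q)) \<partial>lborel)"
  have T: "T < \<infinity>" unfolding T_def by (rule nn_integral_powr_tail) (use assms q_def in simp)
  have pt: "ennreal (\<bar>k\<bar> powr (2 * p) / (1 + \<bar>k\<bar> powr (2 * s)))
     \<le> indicator {-1..1} k + ennreal (k powr (- q)) * indicator {1..} k
        + ennreal ((0 - k) powr (- q)) * indicator {1..} (0 - k)" for k
  proof (cases "\<bar>k\<bar> \<le> 1")
    case True
    have "\<bar>k\<bar> powr (2 * p) \<le> 1" using True assms(1) by (intro powr_le1) auto
    then have "\<bar>k\<bar> powr (2 * p) / (1 + \<bar>k\<bar> powr (2 * s)) \<le> 1"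
      by (simp add: divide_le_eq add_pos_nonneg) (meson order_trans powr_ge_zero add_increasing2 order_refl)
    then have "ennreal (\<bar>k\<bar> powr (2 * p) / (1 + \<bar>k\<bar> powr (2 * s))) \<le> indicator {-1..1} k"
      using True by (auto simp: indicator_def abs_le_iff intro: order_trans[OF ennreal_leI])
    then show ?thesis by (simp add: add.assoc add_increasing2)
  next
    case False
    have "\<bar>k\<bar> powr (2 * p) / (1 + \<bar>k\<bar> powr (2 * s)) \<le> \<bar>k\<bar> powr (2 * p) / \<bar>k\<bar> powr (2 * s)"
      using False by (intro divide_left_mono) (auto simp: add_pos_nonneg)
    also have "\<dots> = \<bar>k\<bar> powr (- q)" by (simp add: q_def powr_diff[symmetric])
    finally have *: "ennreal (\<bar>k\<bar> powr (2 * p) / (1 + \<bar>k\<bar> powr (2 * s))) \<le> ennreal (\<bar>k\<bar> powr (- q))"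
      by (rule ennreal_leI)
    from False consider "k > 1" | "k < -1" by linarith
    then show ?thesis
      by cases (use * in \<open>auto simp: indicator_def\<close>)
  qed
  have "kap p s \<le> (\<integral>\<^sup>+k. indicator {-1..1} k + ennreal (k powr (- q)) * indicator {1..} k
        + ennreal ((0 - k) powr (- q)) * indicator {1..} (0 - k) \<partial>lborel)"
    unfolding kap_def by (intro nn_integral_mono pt)
  also have "\<dots> = emeasure lborel {-1..1::real} + T + (\<integral>\<^sup>+k. ennreal ((0 - k) powr (- q)) * indicator {1..} (0 - k) \<partial>lborel)"
    by (subst nn_integral_add; (subst nn_integral_add)?) (auto simp: T_def)
  also have "(\<integral>\<^sup>+k. ennreal ((0 - k) powr (- q)) * indicator {1..} (0 - k) \<partial>lborel) = T"
    unfolding T_def by (rule nn_integral_reflect) measurable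
  also have "emeasure lborel {-1..1::real} + T + T < \<infinity>" using T by simp
  finally show ?thesis .
qed

lemma powr_sq: "((x::real) powr p)\<^sup>2 = x powr (2 * p)"
  by (simp add: power2_eq_square powr_add[symmetric])

text \<open>
  Cauchy-Schwarz after multiplying and dividing by the square root of \<open>w\<close>.
\<close>

lemma mom_sq_le_weighted:
  assumes [measurable]: "w \<in> borel_measurable borel" and w: "\<And>k. w k > 0"
  shows "(mom p u)\<^sup>2 \<le> (\<integral>\<^sup>+k. ennreal (\<bar>k\<bar> powr (2 * p) / w k) \<partial>lborel) * (\<integral>\<^sup>+k. ennreal (w k * (cmod (rep u k))\<^sup>2) \<partial>lborel)"
proof -
  have w0: "w k \<ge> 0" for k using w[of k] by simp
  have m: "mom p u = (\<integral>\<^sup>+k. ennreal (\<bar>k\<bar> powr p / sqrt (w k)) * ennreal (sqrt (w k) * cmod (rep u k)) \<partial>lborel)"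
    unfolding mom_def
  proof (intro nn_integral_cong)
    fix k
    have "sqrt (w k) > 0" using w[of k] by simp
    then have "\<bar>k\<bar> powr p / sqrt (w k) * (sqrt (w k) * cmod (rep u k)) = \<bar>k\<bar> powr p * cmod (rep u k)"
      by simp
    then show "ennreal (\<bar>k\<bar> powr p * cmod (rep u k))
        = ennreal (\<bar>k\<bar> powr p / sqrt (w k)) * ennreal (sqrt (w k) * cmod (rep u k))"
      using w0[of k] by (subst ennreal_mult[symmetric]) auto
  qed
  have "(mom p u)\<^sup>2 \<le> (\<integral>\<^sup>+k. (ennreal (\<bar>k\<bar> powr p / sqrt (w k)))\<^sup>2 \<partial>lborel)
      * (\<integral>\<^sup>+k. (ennreal (sqrt (w k) * cmod (rep u k)))\<^sup>2 \<partial>lborel)"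
    unfolding m by (rule Cauchy_Schwarz_nn_integral) measurable
  moreover have "(\<bar>k\<bar> powr p / sqrt (w k))\<^sup>2 = \<bar>k\<bar> powr (2 * p) / w k" for k
    using w0[of k] by (simp only: power_divide powr_sq real_sqrt_pow2)
  moreover have "(sqrt (w k) * cmod (rep u k))\<^sup>2 = w k * (cmod (rep u k))\<^sup>2" for k
    using w0[of k] by (simp only: power_mult_distrib real_sqrt_pow2)
  ultimately show ?thesis using w0 by (simp add: ennreal_power)
qed

lemma mom_le: "(mom p u)\<^sup>2 \<le> kap p s * hsq s u"
  unfolding kap_def hsq_def by (rule mom_sq_le_weighted) (auto simp: add_pos_nonneg)

lemma mom_finite:
  assumes "p \<ge> 0" "2 * s - 2 * p > 1" "hsq s u < \<infinity>" shows "mom p u < \<infinity>"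
proof -
  have "(mom p u)\<^sup>2 < \<infinity>"
    using mom_le[of p u s] kap_finite[OF assms(1,2)] assms(3)
    by (auto simp: ennreal_mult_less_top intro: le_less_trans)
  then show ?thesis by (cases "mom p u") (auto simp: power2_eq_square)
qed

lemma hsq_add_le: "hsq s (u + v) \<le> 2 * hsq s u + 2 * hsq s v"
proof -
  have "hsq s (u + v) \<le> (\<integral>\<^sup>+k. 2 * ennreal ((1 + \<bar>k\<bar> powr (2 * s)) * (cmod (rep u k))\<^sup>2)
      + 2 * ennreal ((1 + \<bar>k\<bar> powr (2 * s)) * (cmod (rep v k))\<^sup>2) \<partial>lborel)"
    unfolding hsq_def
  proof (rule nn_integral_mono_AE)
    show "AE k in lborel. ennreal ((1 + \<bar>k\<bar> powr (2 * s)) * (cmod (rep (u + v) k))\<^sup>2)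
      \<le> 2 * ennreal ((1 + \<bar>k\<bar> powr (2 * s)) * (cmod (rep u k))\<^sup>2)
        + 2 * ennreal ((1 + \<bar>k\<bar> powr (2 * s)) * (cmod (rep v k))\<^sup>2)"
      using rep_add[of u v]
    proof eventually_elim
      case (elim k)
      let ?w = "1 + \<bar>k\<bar> powr (2 * s)"
      have "(cmod (rep u k + rep v k))\<^sup>2 \<le> (cmod (rep u k) + cmod (rep v k))\<^sup>2"
        by (intro power_mono norm_triangle_ineq) auto
      also have "\<dots> \<le> 2 * (cmod (rep u k))\<^sup>2 + 2 * (cmod (rep v k))\<^sup>2"
        using sum_squares_bound[of "cmod (rep u k)" "cmod (rep v k)"] by (simp add: power2_sum)
      finally have "?w * (cmod (rep u k + rep v k))\<^sup>2 \<le> ?w * (2 * (cmod (rep u k))\<^sup>2 + 2 * (cmod (rep v k))\<^sup>2)"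
        by (rule mult_left_mono) simp
      also have "\<dots> = 2 * (?w * (cmod (rep u k))\<^sup>2) + 2 * (?w * (cmod (rep v k))\<^sup>2)"
        by (simp add: algebra_simps)
      finally have "ennreal (?w * (cmod (rep (u + v) k))\<^sup>2)
          \<le> ennreal (2 * (?w * (cmod (rep u k))\<^sup>2) + 2 * (?w * (cmod (rep v k))\<^sup>2))"
        unfolding elim by (rule ennreal_leI)
      also have "\<dots> = 2 * ennreal (?w * (cmod (rep u k))\<^sup>2) + 2 * ennreal (?w * (cmod (rep v k))\<^sup>2)"
        by (subst ennreal_plus) (simp_all add: ennreal_mult)
      finally show ?case .
    qed
  qed
  also have "\<dots> = 2 * hsq s u + 2 * hsq s v"
    unfolding hsq_def by (subst nn_integral_add) (auto simp: nn_integral_cmult)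
  finally show ?thesis .
qed

lemma hsq_scaleR: "hsq s (c *\<^sub>R u) = ennreal (c\<^sup>2) * hsq s u"
proof -
  have "hsq s (c *\<^sub>R u) = (\<integral>\<^sup>+k. ennreal (c\<^sup>2) * ennreal ((1 + \<bar>k\<bar> powr (2 * s)) * (cmod (rep u k))\<^sup>2) \<partial>lborel)"
    unfolding hsq_def
  proof (rule nn_integral_cong_AE)
    show "AE k in lborel. ennreal ((1 + \<bar>k\<bar> powr (2 * s)) * (cmod (rep (c *\<^sub>R u) k))\<^sup>2)
      = ennreal (c\<^sup>2) * ennreal ((1 + \<bar>k\<bar> powr (2 * s)) * (cmod (rep u k))\<^sup>2)"
      using rep_scaleR[of c u]
      by eventually_elim (simp add: ennreal_mult[symmetric] power_mult_distrib ac_simps)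
  qed
  also have "\<dots> = ennreal (c\<^sup>2) * hsq s u" unfolding hsq_def by (rule nn_integral_cmult) measurable
  finally show ?thesis .
qed

lemma hsq_minus: "hsq s (- u) = hsq s u"
  using hsq_scaleR[of s "-1" u] by simp

lemma hsq_diff_le: "hsq s (u - v) \<le> 2 * hsq s u + 2 * hsq s v"
  using hsq_add_le[of s u "-v"] by (simp add: hsq_minus)

lemma hsq_0 [simp]: "hsq s 0 = 0"
  using hsq_scaleR[of s 0 0] by simp

lemma hsq_add_finite: "hsq s u < \<infinity> \<Longrightarrow> hsq s v < \<infinity> \<Longrightarrow> hsq s (u + v) < \<infinity>"
  by (rule le_less_trans[OF hsq_add_le]) (simp add: ennreal_mult_less_top)

lemma hsq_diff_finite: "hsq s u < \<infinity> \<Longrightarrow> hsq s v < \<infinity> \<Longrightarrow> hsq s (u - v) < \<infinity>"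
  by (rule le_less_trans[OF hsq_diff_le]) (simp add: ennreal_mult_less_top)

section \<open>The quadratic form on the Fourier side\<close>

text \<open>
  The transform of \<open>a(f, g)\<close> in terms of the transforms of \<open>f\<close> and \<open>g\<close>.
\<close>

definition conv :: "(real \<Rightarrow> complex) \<Rightarrow> (real \<Rightarrow> complex) \<Rightarrow> real \<Rightarrow> complex" where
  "conv f g k = (LINT l|lborel. complex_of_real (S_kernel (k - l) l) * f (k - l) * g l)"

definition bfun :: "(real \<Rightarrow> complex) \<Rightarrow> (real \<Rightarrow> complex) \<Rightarrow> real \<Rightarrow> complex" where
  "bfun f g k = - (\<i> * complex_of_real k * conv f g k)"

text \<open>
  Minus the transform of the derivative of \<open>a\<close>; the equation is \<open>u' = B u u\<close>.
\<close>

definition B :: "l2 \<Rightarrow> l2 \<Rightarrow> l2" where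
  "B u v = cls (bfun (rep u) (rep v))"

lemma conv_measurable [measurable]:
  assumes [measurable]: "f \<in> borel_measurable borel" "g \<in> borel_measurable borel"
  shows "conv f g \<in> borel_measurable borel"
  unfolding conv_def by measurable

lemma bfun_measurable [measurable]:
  assumes [measurable]: "f \<in> borel_measurable borel" "g \<in> borel_measurable borel"
  shows "bfun f g \<in> borel_measurable borel"
  unfolding bfun_def by measurable

lemma conv_cong:
  assumes "AE x in lborel. f x = f' x" "AE x in lborel. g x = g' x"
  and [measurable]: "f \<in> borel_measurable borel" "g \<in> borel_measurable borel"
     "f' \<in> borel_measurable borel" "g' \<in> borel_measurable borel"
  shows "conv f g k = conv f' g' k"
  unfolding conv_def
proof (rule integral_cong_AE)
  show "AE l in lborel. complex_of_real (S_kernel (k - l) l) * f (k - l) * g l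
      = complex_of_real (S_kernel (k - l) l) * f' (k - l) * g' l"
    using AE_reflect[OF assms(1), of k] assms(2) by eventually_elim simp
qed measurable

lemma conv_commute: "conv f g k = conv g f k"
  unfolding conv_def
  using integral_reflect[of "\<lambda>l. complex_of_real (S_kernel (k - l) l) * f (k - l) * g l" k]
  by (simp add: S_kernel_commute ac_simps)

lemma conv_reflect:
  assumes "\<And>x. f (- x) = cnj (f x)" "\<And>x. g (- x) = cnj (g x)"
  shows "conv f g (- k) = cnj (conv f g k)"
proof -
  have "conv f g (- k) = (LINT l|lborel. complex_of_real (S_kernel (- k - (0 - l)) (0 - l)) * f (- k - (0 - l)) * g (0 - l))"
    unfolding conv_def
    using integral_reflect[of "\<lambda>l. complex_of_real (S_kernel (- k - l) l) * f (- k - l) * g l" 0] by simp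
  also have "\<dots> = (LINT l|lborel. cnj (complex_of_real (S_kernel (k - l) l) * f (k - l) * g l))"
  proof (rule Bochner_Integration.integral_cong[OF refl])
    fix l
    have "S_kernel (- k - (0 - l)) (0 - l) = S_kernel (k - l) l"
      using S_kernel_minus[of "k - l" l] by simp
    moreover have "f (- k - (0 - l)) = cnj (f (k - l))" using assms(1)[of "k - l"] by simp
    ultimately show "complex_of_real (S_kernel (- k - (0 - l)) (0 - l)) * f (- k - (0 - l)) * g (0 - l)
        = cnj (complex_of_real (S_kernel (k - l) l) * f (k - l) * g l)"
      using assms(2)[of l] by simp
  qed
  also have "\<dots> = cnj (conv f g k)" unfolding conv_def by (rule Bochner_Integration.integral_cnj)
  finally show ?thesis .
qed

text \<open>
  The transforms of real functions.
\<close>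

definition herm :: "l2 \<Rightarrow> bool" where
  "herm u \<longleftrightarrow> (AE k in lborel. rep u (- k) = cnj (rep u k))"

text \<open>
  A Hermitian class has a representative that is Hermitian everywhere; the symmetries of the
  trilinear form can then be used pointwise.
\<close>

definition hrep :: "l2 \<Rightarrow> real \<Rightarrow> complex" where
  "hrep u k = (rep u k + cnj (rep u (- k))) / 2"

lemma hrep_herm: "hrep u (- k) = cnj (hrep u k)"
  by (simp add: hrep_def)

lemma cnj_measurable [measurable (raw)]: "f \<in> borel_measurable M \<Longrightarrow> (\<lambda>x. cnj (f x)) \<in> borel_measurable M"
  by (rule borel_measurable_continuous_on[OF _]) (auto intro: continuous_intros)

lemma hrep_measurable [measurable]: "hrep u \<in> borel_measurable borel"
  unfolding hrep_def by measurable

lemma hrep_AE: "herm u \<Longrightarrow> AE k in lborel. rep u k = hrep u k"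
  unfolding herm_def hrep_def by (erule eventually_mono) simp

text \<open>
  A majorant of \<open>conv\<close> that does not presuppose convergence of the integral.
\<close>

definition abs_conv :: "(real \<Rightarrow> complex) \<Rightarrow> (real \<Rightarrow> complex) \<Rightarrow> real \<Rightarrow> ennreal" where
  "abs_conv f g k = (\<integral>\<^sup>+l. ennreal (S_kernel (k - l) l * cmod (f (k - l)) * cmod (g l)) \<partial>lborel)"

lemma abs_conv_measurable [measurable]:
  assumes [measurable]: "f \<in> borel_measurable borel" "g \<in> borel_measurable borel"
  shows "abs_conv f g \<in> borel_measurable borel"
  unfolding abs_conv_def by measurable

lemma abs_conv_cong:
  assumes "AE x in lborel. f x = f' x" "AE x in lborel. g x = g' x"
  shows "abs_conv f g k = abs_conv f' g' k"
  unfolding abs_conv_def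
  by (rule nn_integral_cong_AE) (use AE_reflect[OF assms(1), of k] assms(2) in \<open>eventually_elim, simp\<close>)

lemma cmod_conv_le_abs_conv: "ennreal (cmod (conv f g k)) \<le> abs_conv f g k"
proof (cases "integrable lborel (\<lambda>l. complex_of_real (S_kernel (k - l) l) * f (k - l) * g l)")
  case True
  from integral_norm_bound_ennreal[OF this] show ?thesis
    unfolding conv_def abs_conv_def by (simp add: norm_mult S_kernel_nonneg)
next
  case False
  then show ?thesis unfolding conv_def by (simp add: not_integrable_integral_eq)
qed

text \<open>
  Of the two frequencies \<open>k - l\<close> and \<open>l\<close> one has modulus at least \<open>\<bar>k\<bar> / 2\<close> and takes over the
  whole weight; the kernel is at most the square root of the other one.
\<close>

lemma kernel_weight_bound:
  assumes "s \<ge> 1"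
  shows "sqrt (1 + \<bar>k\<bar> powr (2 * (s - 1))) * \<bar>k\<bar> * S_kernel (k - l) l
    \<le> (sqrt 2 * 2 powr s) * (sqrt (1 + \<bar>k - l\<bar> powr (2 * s)) * sqrt \<bar>l\<bar>
        + sqrt \<bar>k - l\<bar> * sqrt (1 + \<bar>l\<bar> powr (2 * s)))"
proof -
  have main: "sqrt (1 + \<bar>k\<bar> powr (2 * (s - 1))) * \<bar>k\<bar> \<le> sqrt 2 * 2 powr s * sqrt (1 + x powr (2 * s))"
    if x: "\<bar>k\<bar> \<le> 2 * x" for x
  proof -
    have x0: "x \<ge> 0" using x by linarith
    have "\<bar>k\<bar> powr (2 * s) \<le> (2 * x) powr (2 * s)" using x assms by (intro powr_mono2) auto
    also have "\<dots> = 2 powr (2 * s) * x powr (2 * s)" using x0 by (simp add: powr_mult)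
    finally have 1: "\<bar>k\<bar> powr (2 * s) \<le> 2 powr (2 * s) * x powr (2 * s)" .
    have one: "1 \<le> (2::real) powr (2 * s)" using assms by (intro ge_one_powr_ge_zero) auto
    have "\<bar>k\<bar>\<^sup>2 \<le> 1 + \<bar>k\<bar> powr (2 * s)"
    proof (cases "\<bar>k\<bar> \<le> 1")
      case True
      then have "\<bar>k\<bar>\<^sup>2 \<le> 1" by (simp add: abs_square_le_1)
      then show ?thesis by (simp add: add_increasing2)
    next
      case False
      then have "\<bar>k\<bar> powr 2 \<le> \<bar>k\<bar> powr (2 * s)" using assms by (intro powr_mono) auto
      then show ?thesis using False by simp
    qed
    moreover have "\<bar>k\<bar> powr (2 * (s - 1)) * \<bar>k\<bar>\<^sup>2 = \<bar>k\<bar> powr (2 * s)"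
    proof (cases "k = 0")
      case False
      then have "\<bar>k\<bar>\<^sup>2 = \<bar>k\<bar> powr 2" by simp
      then have "\<bar>k\<bar> powr (2 * (s - 1)) * \<bar>k\<bar>\<^sup>2 = \<bar>k\<bar> powr (2 * (s - 1) + 2)" by (simp only: powr_add)
      then show ?thesis by simp
    qed simp
    ultimately have "(1 + \<bar>k\<bar> powr (2 * (s - 1))) * \<bar>k\<bar>\<^sup>2 \<le> 2 * (1 + \<bar>k\<bar> powr (2 * s))"
      by (simp add: distrib_right)
    also have "\<dots> \<le> 2 * (2 powr (2 * s) * (1 + x powr (2 * s)))" using 1 one by (simp add: algebra_simps)
    finally have "sqrt ((1 + \<bar>k\<bar> powr (2 * (s - 1))) * \<bar>k\<bar>\<^sup>2) \<le> sqrt (2 * ((2 powr s)\<^sup>2 * (1 + x powr (2 * s))))"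
      by (simp add: powr_sq)
    then show ?thesis by (simp add: real_sqrt_mult)
  qed
  have S: "S_kernel (k - l) l \<le> sqrt \<bar>k - l\<bar>" "S_kernel (k - l) l \<le> sqrt \<bar>l\<bar>" "S_kernel (k - l) l \<ge> 0"
    by (rule S_kernel_le1 S_kernel_le2 S_kernel_nonneg)+
  have c: "sqrt 2 * 2 powr s \<ge> 0" by simp
  show ?thesis
  proof (cases "\<bar>l\<bar> \<le> \<bar>k - l\<bar>")
    case True
    then have "\<bar>k\<bar> \<le> 2 * \<bar>k - l\<bar>" using abs_triangle_ineq[of "k - l" l] by simp
    from mult_mono[OF main[OF this] S(2)]
    have "sqrt (1 + \<bar>k\<bar> powr (2 * (s - 1))) * \<bar>k\<bar> * S_kernel (k - l) l
      \<le> sqrt 2 * 2 powr s * sqrt (1 + \<bar>k - l\<bar> powr (2 * s)) * sqrt \<bar>l\<bar>" using S(3) by simp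
    also have "\<dots> \<le> (sqrt 2 * 2 powr s) * (sqrt (1 + \<bar>k - l\<bar> powr (2 * s)) * sqrt \<bar>l\<bar>
        + sqrt \<bar>k - l\<bar> * sqrt (1 + \<bar>l\<bar> powr (2 * s)))"
      unfolding mult.assoc[of "sqrt 2 * 2 powr s"] by (intro mult_left_mono c) simp
    finally show ?thesis .
  next
    case False
    then have "\<bar>k\<bar> \<le> 2 * \<bar>l\<bar>" using abs_triangle_ineq[of "k - l" l] by simp
    from mult_mono[OF main[OF this] S(1)]
    have "sqrt (1 + \<bar>k\<bar> powr (2 * (s - 1))) * \<bar>k\<bar> * S_kernel (k - l) l
      \<le> sqrt 2 * 2 powr s * sqrt (1 + \<bar>l\<bar> powr (2 * s)) * sqrt \<bar>k - l\<bar>" using S(3) by simp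
    also have "\<dots> \<le> (sqrt 2 * 2 powr s) * (sqrt (1 + \<bar>k - l\<bar> powr (2 * s)) * sqrt \<bar>l\<bar>
        + sqrt \<bar>k - l\<bar> * sqrt (1 + \<bar>l\<bar> powr (2 * s)))"
      unfolding mult.assoc[of "sqrt 2 * 2 powr s"] by (intro mult_left_mono c) (simp add: mult.commute)
    finally show ?thesis .
  qed
qed

lemma ennreal_sq_add_le: "((a::ennreal) + b)\<^sup>2 \<le> 2 * a\<^sup>2 + 2 * b\<^sup>2"
proof (cases "a = top \<or> b = top")
  case True
  then show ?thesis by (auto simp: power2_eq_square ennreal_mult_eq_top_iff)
next
  case False
  then obtain x y where xy: "a = ennreal x" "b = ennreal y" "x \<ge> 0" "y \<ge> 0"
    by (metis ennreal_cases)
  have "(x + y)\<^sup>2 \<le> 2 * x\<^sup>2 + 2 * y\<^sup>2" using sum_squares_bound[of x y] by (simp add: power2_sum)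
  then have "ennreal ((x + y)\<^sup>2) \<le> ennreal (2 * x\<^sup>2 + 2 * y\<^sup>2)" by (rule ennreal_leI)
  moreover have "ennreal ((x + y)\<^sup>2) = (a + b)\<^sup>2"
    using xy by (simp add: ennreal_power[symmetric])
  moreover have "ennreal (2 * x\<^sup>2 + 2 * y\<^sup>2) = 2 * a\<^sup>2 + 2 * b\<^sup>2"
    using xy by (simp add: ennreal_power ennreal_plus ennreal_mult)
  ultimately show ?thesis by simp
qed

lemma abs_conv_weighted_bound:
  assumes s: "s \<ge> 1"
  shows "(\<integral>\<^sup>+k. (ennreal (sqrt (1 + \<bar>k\<bar> powr (2 * (s - 1))) * \<bar>k\<bar>) * abs_conv (rep u) (rep v) k)\<^sup>2 \<partial>lborel)
    \<le> ennreal (2 * (sqrt 2 * 2 powr s)\<^sup>2) * ((mom (1/2) v)\<^sup>2 * hsq s u + (mom (1/2) u)\<^sup>2 * hsq s v)"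
proof -
  define c where "c = sqrt 2 * 2 powr s"
  have c0: "c \<ge> 0" by (simp add: c_def)
  define U V where "U k = cmod (rep u k)" and "V k = cmod (rep v k)" for k
  have [measurable]: "U \<in> borel_measurable borel" "V \<in> borel_measurable borel"
    unfolding U_def V_def by measurable
  have UV: "U k \<ge> 0" "V k \<ge> 0" for k by (auto simp: U_def V_def)
  define L where "L k = sqrt (1 + \<bar>k\<bar> powr (2 * s))" for k :: real
  have [measurable]: "L \<in> borel_measurable borel" unfolding L_def by measurable
  have L0: "L k \<ge> 0" "(L k)\<^sup>2 = 1 + \<bar>k\<bar> powr (2 * s)" for k by (auto simp: L_def)
  define P where "P k = (\<integral>\<^sup>+l. ennreal ((sqrt \<bar>k - l\<bar> * V (k - l)) * (L l * U l)) \<partial>lborel)" for k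
  define Q where "Q k = (\<integral>\<^sup>+l. ennreal ((sqrt \<bar>k - l\<bar> * U (k - l)) * (L l * V l)) \<partial>lborel)" for k
  have [measurable]: "P \<in> borel_measurable borel" "Q \<in> borel_measurable borel"
    unfolding P_def Q_def by measurable
  have pt: "ennreal (sqrt (1 + \<bar>k\<bar> powr (2 * (s - 1))) * \<bar>k\<bar>) * abs_conv (rep u) (rep v) k \<le> ennreal c * (P k + Q k)" for k
  proof -
    let ?w = "sqrt (1 + \<bar>k\<bar> powr (2 * (s - 1)))"
    have "ennreal (?w * \<bar>k\<bar>) * abs_conv (rep u) (rep v) k
        = ennreal (?w * \<bar>k\<bar>) * (\<integral>\<^sup>+l. ennreal (S_kernel (k - l) l * U (k - l) * V l) \<partial>lborel)"
      by (simp add: U_def V_def abs_conv_def)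
    also have "\<dots> = (\<integral>\<^sup>+l. ennreal (?w * \<bar>k\<bar>) * ennreal (S_kernel (k - l) l * U (k - l) * V l) \<partial>lborel)"
      by (rule nn_integral_cmult[symmetric]) measurable
    also have "\<dots> \<le> (\<integral>\<^sup>+l. ennreal c * (ennreal ((sqrt \<bar>k - (k - l)\<bar> * V (k - (k - l))) * (L (k - l) * U (k - l)))
          + ennreal ((sqrt \<bar>k - l\<bar> * U (k - l)) * (L l * V l))) \<partial>lborel)"
    proof (rule nn_integral_mono)
      fix l
      have "(?w * \<bar>k\<bar>) * (S_kernel (k - l) l * U (k - l) * V l) = (?w * \<bar>k\<bar> * S_kernel (k - l) l) * (U (k - l) * V l)"
        by (simp only: ac_simps)
      also have "\<dots> \<le> (c * (L (k - l) * sqrt \<bar>l\<bar> + sqrt \<bar>k - l\<bar> * L l)) * (U (k - l) * V l)"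
        unfolding c_def L_def by (intro mult_right_mono kernel_weight_bound s mult_nonneg_nonneg UV)
      also have "\<dots> = c * ((sqrt \<bar>l\<bar> * V l) * (L (k - l) * U (k - l)) + (sqrt \<bar>k - l\<bar> * U (k - l)) * (L l * V l))"
        by (simp only: algebra_simps)
      finally have "ennreal ((?w * \<bar>k\<bar>) * (S_kernel (k - l) l * U (k - l) * V l))
        \<le> ennreal (c * ((sqrt \<bar>l\<bar> * V l) * (L (k - l) * U (k - l)) + (sqrt \<bar>k - l\<bar> * U (k - l)) * (L l * V l)))"
        by (rule ennreal_leI)
      then show "ennreal (?w * \<bar>k\<bar>) * ennreal (S_kernel (k - l) l * U (k - l) * V l)
        \<le> ennreal c * (ennreal ((sqrt \<bar>k - (k - l)\<bar> * V (k - (k - l))) * (L (k - l) * U (k - l)))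
          + ennreal ((sqrt \<bar>k - l\<bar> * U (k - l)) * (L l * V l)))"
        using UV L0(1) c0 S_kernel_nonneg
        by (subst ennreal_mult[symmetric], simp, simp, subst ennreal_plus[symmetric], simp, simp,
            subst ennreal_mult[symmetric], simp, simp, simp)
    qed
    also have "\<dots> = ennreal c * ((\<integral>\<^sup>+l. ennreal ((sqrt \<bar>k - (k - l)\<bar> * V (k - (k - l))) * (L (k - l) * U (k - l))) \<partial>lborel)
          + Q k)"
      unfolding Q_def by (subst nn_integral_cmult, measurable, subst nn_integral_add) auto
    also have "(\<integral>\<^sup>+l. ennreal ((sqrt \<bar>k - (k - l)\<bar> * V (k - (k - l))) * (L (k - l) * U (k - l))) \<partial>lborel) = P k"
      unfolding P_def by (rule nn_integral_reflect[of "\<lambda>l. ennreal ((sqrt \<bar>k - l\<bar> * V (k - l)) * (L l * U l))" k]) measurable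
    finally show ?thesis .
  qed
  have "(\<integral>\<^sup>+k. (ennreal (sqrt (1 + \<bar>k\<bar> powr (2 * (s - 1))) * \<bar>k\<bar>) * abs_conv (rep u) (rep v) k)\<^sup>2 \<partial>lborel)
    \<le> (\<integral>\<^sup>+k. ennreal (2 * c\<^sup>2) * ((P k)\<^sup>2 + (Q k)\<^sup>2) \<partial>lborel)"
  proof (rule nn_integral_mono)
    fix k
    have "(ennreal (sqrt (1 + \<bar>k\<bar> powr (2 * (s - 1))) * \<bar>k\<bar>) * abs_conv (rep u) (rep v) k)\<^sup>2 \<le> (ennreal c * (P k + Q k))\<^sup>2"
      by (intro power_mono pt) simp
    also have "\<dots> = ennreal (c\<^sup>2) * (P k + Q k)\<^sup>2" using c0 by (simp add: power_mult_distrib ennreal_power)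
    also have "\<dots> \<le> ennreal (c\<^sup>2) * (2 * (P k)\<^sup>2 + 2 * (Q k)\<^sup>2)" by (intro mult_left_mono ennreal_sq_add_le) simp
    also have "\<dots> = ennreal (2 * c\<^sup>2) * ((P k)\<^sup>2 + (Q k)\<^sup>2)"
      by (simp add: ennreal_mult algebra_simps)
    finally show "(ennreal (sqrt (1 + \<bar>k\<bar> powr (2 * (s - 1))) * \<bar>k\<bar>) * abs_conv (rep u) (rep v) k)\<^sup>2 
      \<le> ennreal (2 * c\<^sup>2) * ((P k)\<^sup>2 + (Q k)\<^sup>2)" .
  qed
  also have "\<dots> = ennreal (2 * c\<^sup>2) * ((\<integral>\<^sup>+k. (P k)\<^sup>2 \<partial>lborel) + (\<integral>\<^sup>+k. (Q k)\<^sup>2 \<partial>lborel))"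
    by (subst nn_integral_cmult, measurable, subst nn_integral_add) auto
  also have "\<dots> \<le> ennreal (2 * c\<^sup>2) * ((mom (1/2) v)\<^sup>2 * hsq s u + (mom (1/2) u)\<^sup>2 * hsq s v)"
  proof (intro mult_left_mono add_mono)
    have h: "(\<integral>\<^sup>+x. ennreal ((L x * U x)\<^sup>2) \<partial>lborel) = hsq s u" "(\<integral>\<^sup>+x. ennreal ((L x * V x)\<^sup>2) \<partial>lborel) = hsq s v"
      by (simp_all add: hsq_def L0 power_mult_distrib U_def V_def)
    have m: "(\<integral>\<^sup>+x. ennreal (sqrt \<bar>x\<bar> * U x) \<partial>lborel) = mom (1/2) u" "(\<integral>\<^sup>+x. ennreal (sqrt \<bar>x\<bar> * V x) \<partial>lborel) = mom (1/2) v"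
      by (simp_all add: mom_def U_def V_def powr_half_sqrt)
    show "(\<integral>\<^sup>+k. (P k)\<^sup>2 \<partial>lborel) \<le> (mom (1/2) v)\<^sup>2 * hsq s u"
      unfolding P_def h[symmetric] m[symmetric]
      by (rule Young_L1_L2[of "\<lambda>x. sqrt \<bar>x\<bar> * V x" "\<lambda>l. L l * U l"]) (auto simp: UV L0)
    show "(\<integral>\<^sup>+k. (Q k)\<^sup>2 \<partial>lborel) \<le> (mom (1/2) u)\<^sup>2 * hsq s v"
      unfolding Q_def h[symmetric] m[symmetric]
      by (rule Young_L1_L2[of "\<lambda>x. sqrt \<bar>x\<bar> * U x" "\<lambda>l. L l * V l"]) (auto simp: UV L0)
  qed auto
  finally show ?thesis unfolding c_def .
qed

lemma bfun_weighted_bound: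
  assumes s: "s \<ge> 1"
  shows "(\<integral>\<^sup>+k. ennreal ((1 + \<bar>k\<bar> powr (2 * (s - 1))) * (cmod (bfun (rep u) (rep v) k))\<^sup>2) \<partial>lborel)
    \<le> ennreal (2 * (sqrt 2 * 2 powr s)\<^sup>2) * ((mom (1/2) v)\<^sup>2 * hsq s u + (mom (1/2) u)\<^sup>2 * hsq s v)"
proof (rule order_trans[OF nn_integral_mono abs_conv_weighted_bound[OF s]])
  fix k
  let ?w = "sqrt (1 + \<bar>k\<bar> powr (2 * (s - 1)))"
  have "ennreal ((1 + \<bar>k\<bar> powr (2 * (s - 1))) * (cmod (bfun (rep u) (rep v) k))\<^sup>2)
     = (ennreal (?w * \<bar>k\<bar>) * ennreal (cmod (conv (rep u) (rep v) k)))\<^sup>2"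
    by (simp add: bfun_def norm_mult ennreal_mult[symmetric] ennreal_power power_mult_distrib mult.assoc)
  also have "\<dots> \<le> (ennreal (?w * \<bar>k\<bar>) * abs_conv (rep u) (rep v) k)\<^sup>2"
    by (intro power_mono mult_left_mono cmod_conv_le_abs_conv) auto
  finally show "ennreal ((1 + \<bar>k\<bar> powr (2 * (s - 1))) * (cmod (bfun (rep u) (rep v) k))\<^sup>2)
     \<le> (ennreal (?w * \<bar>k\<bar>) * abs_conv (rep u) (rep v) k)\<^sup>2" .
qed

definition KB :: "real \<Rightarrow> ennreal" where
  "KB s = ennreal (4 * (sqrt 2 * 2 powr s)\<^sup>2) * kap (1/2) s"

lemma KB_finite: "s > 1 \<Longrightarrow> KB s < \<infinity>"
  unfolding KB_def using kap_finite[of "1/2" s] by (simp add: ennreal_mult_less_top)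

lemma bfun_Hs_bound:
  assumes s: "s > 1"
  shows "(\<integral>\<^sup>+k. ennreal ((1 + \<bar>k\<bar> powr (2 * (s - 1))) * (cmod (bfun (rep u) (rep v) k))\<^sup>2) \<partial>lborel)
    \<le> KB s * hsq s u * hsq s v"
proof -
  let ?c = "ennreal (2 * (sqrt 2 * 2 powr s)\<^sup>2)"
  have "(\<integral>\<^sup>+k. ennreal ((1 + \<bar>k\<bar> powr (2 * (s - 1))) * (cmod (bfun (rep u) (rep v) k))\<^sup>2) \<partial>lborel)
    \<le> ?c * ((mom (1/2) v)\<^sup>2 * hsq s u + (mom (1/2) u)\<^sup>2 * hsq s v)"
    by (rule bfun_weighted_bound) (use s in simp)
  also have "\<dots> \<le> ?c * ((kap (1/2) s * hsq s v) * hsq s u + (kap (1/2) s * hsq s u) * hsq s v)"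
    by (intro mult_left_mono add_mono mult_right_mono mom_le) auto
  also have "\<dots> = ?c * (2 * (kap (1/2) s * hsq s u * hsq s v))"
    by (simp only: mult_2 mult.assoc mult.commute[of "hsq s u" "hsq s v"])
  also have "\<dots> = KB s * hsq s u * hsq s v"
  proof -
    have "ennreal (4 * (sqrt 2 * 2 powr s)\<^sup>2) = ?c * 2"
      by (simp add: ennreal_mult[symmetric] flip: ennreal_numeral)
    then show ?thesis by (simp add: KB_def ac_simps)
  qed
  finally show ?thesis .
qed

lemma bfun_L2:
  assumes s: "s > 1" and u: "hsq s u < \<infinity>" and v: "hsq s v < \<infinity>"
  shows "bfun (rep u) (rep v) \<in> L2"
  unfolding L2_iff_nn_integral
proof
  have "(\<integral>\<^sup>+k. ennreal ((cmod (bfun (rep u) (rep v) k))\<^sup>2) \<partial>lborel)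
     \<le> (\<integral>\<^sup>+k. ennreal ((1 + \<bar>k\<bar> powr (2 * (s - 1))) * (cmod (bfun (rep u) (rep v) k))\<^sup>2) \<partial>lborel)"
    by (intro nn_integral_mono ennreal_leI) (simp add: mult_le_cancel_right1)
  also have "\<dots> \<le> KB s * hsq s u * hsq s v" by (rule bfun_Hs_bound[OF s])
  also have "\<dots> < \<infinity>" using KB_finite[OF s] u v by (simp add: ennreal_mult_less_top)
  finally show "(\<integral>\<^sup>+k. ennreal ((cmod (bfun (rep u) (rep v) k))\<^sup>2) \<partial>lborel) < \<infinity>" .
qed measurable

lemma rep_B:
  assumes "s > 1" "hsq s u < \<infinity>" "hsq s v < \<infinity>"
  shows "AE k in lborel. rep (B u v) k = bfun (rep u) (rep v) k"
  unfolding B_def by (rule rep_cls[OF bfun_L2[OF assms]])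

lemma hsq_B:
  assumes s: "s > 1" and u: "hsq s u < \<infinity>" and v: "hsq s v < \<infinity>"
  shows "hsq (s - 1) (B u v) \<le> KB s * hsq s u * hsq s v"
proof -
  have "hsq (s - 1) (B u v) = (\<integral>\<^sup>+k. ennreal ((1 + \<bar>k\<bar> powr (2 * (s - 1))) * (cmod (bfun (rep u) (rep v) k))\<^sup>2) \<partial>lborel)"
    unfolding hsq_def by (rule nn_integral_cong_AE) (use rep_B[OF assms] in \<open>eventually_elim, simp\<close>)
  then show ?thesis using bfun_Hs_bound[OF s, of u v] by simp
qed

lemma B_commute: "B u v = B v u"
proof -
  have "bfun (rep u) (rep v) = bfun (rep v) (rep u)" by (rule ext) (simp add: bfun_def conv_commute)
  then show ?thesis by (simp add: B_def)
qed

text \<open>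
  The kernel is bounded by the square root of \<open>\<bar>k - l\<bar>\<close>, so that the integrand is a product of two
  square integrable functions for every \<open>k\<close>, not only for almost every one.
\<close>

lemma conv_integrable:
  assumes s: "s > 1" and u: "hsq s u < \<infinity>"
  shows "integrable lborel (\<lambda>l. complex_of_real (S_kernel (k - l) l) * rep u (k - l) * rep v l)"
proof (rule Bochner_Integration.integrable_bound)
  have "(\<lambda>x. complex_of_real (sqrt (1 + \<bar>x\<bar> powr (2 * s))) * rep u x) \<in> L2"
    unfolding L2_iff_nn_integral
    using u by (auto simp: hsq_def norm_mult power_mult_distrib)
  then have "integrable lborel (\<lambda>l. (norm (complex_of_real (sqrt (1 + \<bar>k - l\<bar> powr (2 * s))) * rep u (k - l)))\<^sup>2)"
    using lborel_integrable_real_affine[OF L2_integrable, of "\<lambda>x. complex_of_real (sqrt (1 + \<bar>x\<bar> powr (2 * s))) * rep u x" "-1" k]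
    by simp
  then have *: "(\<lambda>l. complex_of_real (sqrt (1 + \<bar>k - l\<bar> powr (2 * s))) * rep u (k - l)) \<in> L2"
    by (simp add: L2_def)
  show "integrable lborel (\<lambda>l. norm (complex_of_real (sqrt (1 + \<bar>k - l\<bar> powr (2 * s))) * rep u (k - l)) * norm (rep v l))"
    by (rule integrable_L2_mult_norm[OF * rep_L2])
  show "AE l in lborel. norm (complex_of_real (S_kernel (k - l) l) * rep u (k - l) * rep v l)
    \<le> norm (norm (complex_of_real (sqrt (1 + \<bar>k - l\<bar> powr (2 * s))) * rep u (k - l)) * norm (rep v l))"
  proof (rule AE_I2)
    fix l
    have "S_kernel (k - l) l \<le> sqrt \<bar>k - l\<bar>" by (rule S_kernel_le1)
    also have "\<bar>k - l\<bar> \<le> 1 + \<bar>k - l\<bar> powr (2 * s)"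
    proof (cases "\<bar>k - l\<bar> \<le> 1")
      case False
      then have "\<bar>k - l\<bar> powr 1 \<le> \<bar>k - l\<bar> powr (2 * s)" using s by (intro powr_mono) auto
      then show ?thesis using False by simp
    qed (simp add: add_increasing2)
    finally have "S_kernel (k - l) l \<le> sqrt (1 + \<bar>k - l\<bar> powr (2 * s))" by simp
    then show "norm (complex_of_real (S_kernel (k - l) l) * rep u (k - l) * rep v l)
      \<le> norm (norm (complex_of_real (sqrt (1 + \<bar>k - l\<bar> powr (2 * s))) * rep u (k - l)) * norm (rep v l))"
      by (simp add: norm_mult S_kernel_nonneg mult_right_mono)
  qed
qed measurable

lemma B_add_right:
  assumes s: "s > 1" and u: "hsq s u < \<infinity>" and v: "hsq s v < \<infinity>" and w: "hsq s w < \<infinity>"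
  shows "B u (v + w) = B u v + B u w"
proof (rule l2_eqI)
  have conv: "conv (rep u) (rep (v + w)) k = conv (rep u) (rep v) k + conv (rep u) (rep w) k" for k
  proof -
    have "conv (rep u) (rep (v + w)) k = conv (rep u) (\<lambda>x. rep v x + rep w x) k"
      by (rule conv_cong) (use rep_add in auto)
    also have "\<dots> = conv (rep u) (rep v) k + conv (rep u) (rep w) k"
      unfolding conv_def using conv_integrable[OF s u, of k v] conv_integrable[OF s u, of k w]
      by (simp add: distrib_left)
    finally show ?thesis .
  qed
  show "AE k in lborel. rep (B u (v + w)) k = rep (B u v + B u w) k"
    using rep_B[OF s u hsq_add_finite[OF v w]] rep_B[OF s u v] rep_B[OF s u w] rep_add[of "B u v" "B u w"]
    by eventually_elim (simp only: bfun_def conv distrib_left minus_add_distrib)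
qed

lemma B_scaleR_right:
  assumes s: "s > 1" and u: "hsq s u < \<infinity>" and v: "hsq s v < \<infinity>"
  shows "B u (c *\<^sub>R v) = c *\<^sub>R B u v"
proof (rule l2_eqI)
  have conv: "conv (rep u) (rep (c *\<^sub>R v)) k = c *\<^sub>R conv (rep u) (rep v) k" for k
  proof -
    have "conv (rep u) (rep (c *\<^sub>R v)) k = conv (rep u) (\<lambda>x. c *\<^sub>R rep v x) k"
      by (rule conv_cong) (use rep_scaleR in auto)
    also have "\<dots> = c *\<^sub>R conv (rep u) (rep v) k"
      unfolding conv_def by simp
    finally show ?thesis .
  qed
  have "hsq s (c *\<^sub>R v) < \<infinity>" using v by (simp add: hsq_scaleR ennreal_mult_less_top)
  from rep_B[OF s u this] rep_B[OF s u v] rep_scaleR[of c "B u v"]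
  show "AE k in lborel. rep (B u (c *\<^sub>R v)) k = rep (c *\<^sub>R B u v) k"
    by eventually_elim (simp add: bfun_def conv)
qed

text \<open>
  Polarisation reduces differences of quadratic terms to the estimates of the bilinear form.
\<close>

lemma B_diff_sq:
  assumes s: "s > 1" and u: "hsq s u < \<infinity>" and v: "hsq s v < \<infinity>"
  shows "B u u - B v v = B (u + v) (u - v)"
proof -
  have m: "hsq s (- v) < \<infinity>" using v by (simp add: hsq_minus)
  have "B (u + v) (u - v) = B (u + v) u + B (u + v) (- v)"
    using B_add_right[OF s hsq_add_finite[OF u v] u m] by simp
  also have "B (u + v) u = B u u + B u v" using B_add_right[OF s u u v] B_commute by metis
  also have "B (u + v) (- v) = - B (u + v) v"
    using B_scaleR_right[OF s hsq_add_finite[OF u v] v, of "-1"] by simp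
  also have "B (u + v) v = B u v + B v v" using B_add_right[OF s v u v] B_commute by metis
  finally show ?thesis by simp
qed

lemma B_herm:
  assumes s: "s > 1" and u: "hsq s u < \<infinity>" and v: "hsq s v < \<infinity>" and "herm u" "herm v"
  shows "herm (B u v)"
proof -
  have eq: "bfun (rep u) (rep v) k = bfun (hrep u) (hrep v) k" for k
    unfolding bfun_def by (subst conv_cong[OF hrep_AE[OF assms(4)] hrep_AE[OF assms(5)]]) auto
  have "bfun (hrep u) (hrep v) (- k) = cnj (bfun (hrep u) (hrep v) k)" for k
    by (simp add: bfun_def conv_reflect[of "hrep u" "hrep v", OF hrep_herm hrep_herm])
  then have h: "bfun (rep u) (rep v) (- k) = cnj (bfun (rep u) (rep v) k)" for k by (simp add: eq)
  show ?thesis unfolding herm_def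
    using rep_B[OF s u v] AE_reflect[OF rep_B[OF s u v], of 0] by eventually_elim (simp add: h)
qed

section \<open>Energy identities\<close>

text \<open>
  The integrand of \<open>\<langle>f, conv z f\<rangle>\<close>, a function of the triple of frequencies \<open>k\<close>, \<open>l\<close>, \<open>k - l\<close>.
\<close>

definition tri :: "(real \<Rightarrow> complex) \<Rightarrow> (real \<Rightarrow> complex) \<Rightarrow> real \<Rightarrow> real \<Rightarrow> complex" where
  "tri z f k l = complex_of_real (S_kernel (k - l) l) * cnj (f k) * z (k - l) * f l"

lemma tri_measurable [measurable (raw)]:
  assumes [measurable]: "z \<in> borel_measurable borel" "f \<in> borel_measurable borel"
    "a \<in> borel_measurable M" "b \<in> borel_measurable M"
  shows "(\<lambda>x. tri z f (a x) (b x)) \<in> borel_measurable M"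
  unfolding tri_def by measurable

lemma tri_swap:
  assumes "\<And>x. z (- x) = cnj (z x)" shows "tri z f l k = cnj (tri z f k l)"
  using assms[of "k - l"] by (simp add: tri_def S_kernel_rotate ac_simps)

lemma tri_reflect: "tri f f k (k - l) = tri f f k l"
  by (simp add: tri_def S_kernel_commute ac_simps)

lemma cmod_tri: "cmod (tri z f k l) = S_kernel (k - l) l * cmod (f k) * cmod (z (k - l)) * cmod (f l)"
  by (simp add: tri_def norm_mult S_kernel_nonneg)

definition triint :: "(real \<Rightarrow> complex) \<Rightarrow> (real \<Rightarrow> complex) \<Rightarrow> (real \<Rightarrow> real) \<Rightarrow> complex" where
  "triint z f \<phi> = (LINT k|lborel. LINT l|lborel. complex_of_real (\<phi> k) * tri z f k l)"

context
  fixes z f :: "real \<Rightarrow> complex" and \<phi> :: "real \<Rightarrow> real"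
  assumes meas [measurable]: "z \<in> borel_measurable borel" "f \<in> borel_measurable borel" "\<phi> \<in> borel_measurable borel"
    and zh: "\<And>x. z (- x) = cnj (z x)"
    and fin: "(\<integral>\<^sup>+k. \<integral>\<^sup>+l. ennreal (\<bar>\<phi> k\<bar> * cmod (tri z f k l)) \<partial>lborel \<partial>lborel) < \<infinity>"
begin

lemma tri_integrable1:
  "integrable (lborel \<Otimes>\<^sub>M lborel) (\<lambda>(k, l). complex_of_real (\<phi> k) * tri z f k l)"
proof (rule integrableI_bounded)
  have "(\<integral>\<^sup>+x. ennreal (norm (case x of (k, l) \<Rightarrow> complex_of_real (\<phi> k) * tri z f k l)) \<partial>(lborel \<Otimes>\<^sub>M lborel))
     = (\<integral>\<^sup>+k. \<integral>\<^sup>+l. ennreal (\<bar>\<phi> k\<bar> * cmod (tri z f k l)) \<partial>lborel \<partial>lborel)"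
    by (subst lborel.nn_integral_fst[symmetric]) (auto simp: norm_mult)
  then show "(\<integral>\<^sup>+x. ennreal (norm (case x of (k, l) \<Rightarrow> complex_of_real (\<phi> k) * tri z f k l)) \<partial>(lborel \<Otimes>\<^sub>M lborel)) < \<infinity>"
    using fin by simp
qed measurable

lemma triint_eq:
  "triint z f \<phi> = (LINT x|(lborel \<Otimes>\<^sub>M lborel). (case x of (k, l) \<Rightarrow> complex_of_real (\<phi> k) * tri z f k l))"
  unfolding triint_def using lborel_pair.integral_fst'[OF tri_integrable1] by simp

lemma tri_swap_eq:
  "(case x of (k, l) \<Rightarrow> (case (l, k) of (k, l) \<Rightarrow> complex_of_real (\<phi> k) * tri z f k l))
      = cnj (case x of (k, l) \<Rightarrow> complex_of_real (\<phi> l) * tri z f k l)"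
  using tri_swap[of z f "snd x" "fst x", OF zh] by (simp add: case_prod_beta)

lemma tri_integrable2:
  "integrable (lborel \<Otimes>\<^sub>M lborel) (\<lambda>(k, l). complex_of_real (\<phi> l) * tri z f k l)"
proof -
  have "integrable (lborel \<Otimes>\<^sub>M lborel) (\<lambda>x. cnj (case x of (k, l) \<Rightarrow> complex_of_real (\<phi> l) * tri z f k l))"
    using lborel_pair.integrable_product_swap[OF tri_integrable1] unfolding tri_swap_eq .
  from integrable_cnj[OF this] show ?thesis by simp
qed

lemma triint_swap:
  "(LINT x|(lborel \<Otimes>\<^sub>M lborel). (case x of (k, l) \<Rightarrow> complex_of_real (\<phi> l) * tri z f k l)) = cnj (triint z f \<phi>)"
proof -
  have "triint z f \<phi> = (LINT x|(lborel \<Otimes>\<^sub>M lborel). (case x of (k, l) \<Rightarrow> (case (l, k) of (k, l) \<Rightarrow> complex_of_real (\<phi> k) * tri z f k l)))"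
    unfolding triint_eq by (rule lborel_pair.integral_product_swap[symmetric]) measurable
  also have "\<dots> = cnj (LINT x|(lborel \<Otimes>\<^sub>M lborel). (case x of (k, l) \<Rightarrow> complex_of_real (\<phi> l) * tri z f k l))"
    unfolding tri_swap_eq by (rule Bochner_Integration.integral_cnj)
  finally show ?thesis by simp
qed

end

lemma integral_pair_norm_le:
  fixes F :: "real \<Rightarrow> real \<Rightarrow> complex"
  assumes "integrable (lborel \<Otimes>\<^sub>M lborel) (\<lambda>(k, l). F k l)"
  shows "ennreal (cmod (LINT x|(lborel \<Otimes>\<^sub>M lborel). (case x of (k, l) \<Rightarrow> F k l)))
    \<le> (\<integral>\<^sup>+k. \<integral>\<^sup>+l. ennreal (cmod (F k l)) \<partial>lborel \<partial>lborel)"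
proof -
  have [measurable]: "(\<lambda>(k, l). F k l) \<in> borel_measurable (lborel \<Otimes>\<^sub>M lborel)" using assms by simp
  have m: "(\<lambda>x. ennreal (norm (case x of (k, l) \<Rightarrow> F k l))) \<in> borel_measurable (lborel \<Otimes>\<^sub>M lborel)" by measurable
  show ?thesis
    using integral_norm_bound_ennreal[OF assms] lborel.nn_integral_fst[OF m] by simp
qed

text \<open>
  Exchanging \<open>k\<close> and \<open>l\<close> conjugates the integrand if \<open>z\<close> is Hermitian, which replaces the factor
  \<open>k\<close> by \<open>k - l\<close>; together with the bound \<open>sqrt \<bar>k - l\<bar>\<close> for the kernel all derivatives fall on
  \<open>z\<close>.
\<close>

lemma triint_linear_bound:
  assumes [measurable]: "z \<in> borel_measurable borel" "f \<in> borel_measurable borel"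
    and zh: "\<And>x. z (- x) = cnj (z x)"
    and fin: "(\<integral>\<^sup>+k. \<integral>\<^sup>+l. ennreal (\<bar>k\<bar> * cmod (tri z f k l)) \<partial>lborel \<partial>lborel) < \<infinity>"
    and f: "(\<integral>\<^sup>+x. ennreal ((cmod (f x))\<^sup>2) \<partial>lborel) \<le> ennreal (Y\<^sup>2)" and Y: "Y \<ge> 0"
  shows "ennreal \<bar>2 * Im (triint z f (\<lambda>k. k))\<bar>
    \<le> (\<integral>\<^sup>+x. ennreal (\<bar>x\<bar> powr (3/2) * cmod (z x)) \<partial>lborel) * ennreal (Y\<^sup>2)"
proof -
  note [measurable] = borel_measurable_const
  have idm: "(\<lambda>k::real. k) \<in> borel_measurable borel" by measurable
  let ?X = "triint z f (\<lambda>k. k)"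
  note i1 = tri_integrable1[OF assms(1,2) idm zh fin] and i2 = tri_integrable2[OF assms(1,2) idm zh fin]
  have sub: "(\<lambda>(k, l). complex_of_real (k - l) * tri z f k l)
      = (\<lambda>x. (case x of (k, l) \<Rightarrow> complex_of_real k * tri z f k l) - (case x of (k, l) \<Rightarrow> complex_of_real l * tri z f k l))"
    by (auto simp: fun_eq_iff algebra_simps)
  have i: "integrable (lborel \<Otimes>\<^sub>M lborel) (\<lambda>(k, l). complex_of_real (k - l) * tri z f k l)"
    unfolding sub by (rule Bochner_Integration.integrable_diff[OF i1 i2])
  have "(LINT x|(lborel \<Otimes>\<^sub>M lborel). (case x of (k, l) \<Rightarrow> complex_of_real (k - l) * tri z f k l)) = ?X - cnj ?X"
    unfolding sub Bochner_Integration.integral_diff[OF i1 i2]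
      triint_eq[OF assms(1,2) idm zh fin, symmetric] triint_swap[OF assms(1,2) idm zh fin] ..
  moreover have "cmod (?X - cnj ?X) = \<bar>2 * Im ?X\<bar>"
    by (simp add: complex_diff_cnj norm_mult)
  ultimately have "ennreal \<bar>2 * Im ?X\<bar> \<le> (\<integral>\<^sup>+k. \<integral>\<^sup>+l. ennreal (cmod (complex_of_real (k - l) * tri z f k l)) \<partial>lborel \<partial>lborel)"
    using integral_pair_norm_le[OF i] by simp
  also have "\<dots> \<le> (\<integral>\<^sup>+k. \<integral>\<^sup>+l. ennreal (cmod (f k)) * ennreal (\<bar>k - l\<bar> powr (3/2) * cmod (z (k - l))) * ennreal (cmod (f l)) \<partial>lborel \<partial>lborel)"
  proof (intro nn_integral_mono)
    fix k l :: real
    have "\<bar>k - l\<bar> * S_kernel (k - l) l \<le> \<bar>k - l\<bar> * sqrt \<bar>k - l\<bar>"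
      by (intro mult_left_mono S_kernel_le1) simp
    also have "\<dots> = \<bar>k - l\<bar> powr (3/2)"
    proof -
      have "\<bar>k - l\<bar> powr (1 + 1/2) = \<bar>k - l\<bar> powr 1 * \<bar>k - l\<bar> powr (1/2)" by (rule powr_add)
      then show ?thesis by (simp add: powr_half_sqrt)
    qed
    finally have "(\<bar>k - l\<bar> * S_kernel (k - l) l) * (cmod (f k) * cmod (z (k - l)) * cmod (f l))
        \<le> \<bar>k - l\<bar> powr (3/2) * (cmod (f k) * cmod (z (k - l)) * cmod (f l))"
      by (rule mult_right_mono) simp
    then have "ennreal (cmod (complex_of_real (k - l) * tri z f k l))
      \<le> ennreal (cmod (f k) * (\<bar>k - l\<bar> powr (3/2) * cmod (z (k - l))) * cmod (f l))"
      by (intro ennreal_leI) (simp only: norm_mult norm_of_real cmod_tri ac_simps)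
    then show "ennreal (cmod (complex_of_real (k - l) * tri z f k l))
      \<le> ennreal (cmod (f k)) * ennreal (\<bar>k - l\<bar> powr (3/2) * cmod (z (k - l))) * ennreal (cmod (f l))"
      by (simp add: ennreal_mult)
  qed
  also have "\<dots> \<le> (\<integral>\<^sup>+x. ennreal (\<bar>x\<bar> powr (3/2) * cmod (z x)) \<partial>lborel) * ennreal (Y * Y)"
    by (rule trilinear_bound[where g = "\<lambda>x. ennreal (\<bar>x\<bar> powr (3/2) * cmod (z x))"]) (use f Y in auto)
  finally show ?thesis by (simp add: power2_eq_square)
qed

text \<open>
  The trilinear form is invariant under permutations of the three frequencies up to conjugation,
  which replaces the factor \<open>\<phi> k\<close> by \<open>\<phi> k - \<phi> l - \<phi> (k - l)\<close>.
\<close>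

lemma triint_symmetrised:
  assumes [measurable]: "f \<in> borel_measurable borel" "\<phi> \<in> borel_measurable borel"
    and fh: "\<And>x. f (- x) = cnj (f x)"
    and fin: "(\<integral>\<^sup>+k. \<integral>\<^sup>+l. ennreal (\<bar>\<phi> k\<bar> * cmod (tri f f k l)) \<partial>lborel \<partial>lborel) < \<infinity>"
  shows "ennreal (3 * \<bar>Im (triint f f \<phi>)\<bar>)
    \<le> (\<integral>\<^sup>+k. \<integral>\<^sup>+l. ennreal (\<bar>\<phi> k - \<phi> l - \<phi> (k - l)\<bar> * cmod (tri f f k l)) \<partial>lborel \<partial>lborel)"
proof -
  let ?X = "triint f f \<phi>"
  note i1 = tri_integrable1[OF assms(1,1,2) fh fin] and i2 = tri_integrable2[OF assms(1,1,2) fh fin]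
  have e2: "(LINT k|lborel. LINT l|lborel. complex_of_real (\<phi> l) * tri f f k l) = cnj ?X"
    using lborel_pair.integral_fst'[OF i2] triint_swap[OF assms(1,1,2) fh fin] by simp
  have i3: "integrable (lborel \<Otimes>\<^sub>M lborel) (\<lambda>(k, l). complex_of_real (\<phi> (k - l)) * tri f f k l)"
  proof (rule integrableI_bounded)
    have "(\<integral>\<^sup>+x. ennreal (norm (case x of (k, l) \<Rightarrow> complex_of_real (\<phi> (k - l)) * tri f f k l)) \<partial>(lborel \<Otimes>\<^sub>M lborel))
       = (\<integral>\<^sup>+k. \<integral>\<^sup>+l. ennreal (\<bar>\<phi> (k - l)\<bar> * cmod (tri f f k (k - l))) \<partial>lborel \<partial>lborel)"
      by (subst lborel.nn_integral_fst[symmetric]) (auto simp: norm_mult tri_reflect)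
    also have "\<dots> = (\<integral>\<^sup>+k. \<integral>\<^sup>+l. ennreal (\<bar>\<phi> l\<bar> * cmod (tri f f k l)) \<partial>lborel \<partial>lborel)"
    proof (rule nn_integral_cong)
      fix k
      show "(\<integral>\<^sup>+l. ennreal (\<bar>\<phi> (k - l)\<bar> * cmod (tri f f k (k - l))) \<partial>lborel) = (\<integral>\<^sup>+l. ennreal (\<bar>\<phi> l\<bar> * cmod (tri f f k l)) \<partial>lborel)"
        by (rule nn_integral_reflect[of "\<lambda>l. ennreal (\<bar>\<phi> l\<bar> * cmod (tri f f k l))" k]) measurable
    qed
    also have "\<dots> = (\<integral>\<^sup>+x. ennreal (norm (case x of (k, l) \<Rightarrow> complex_of_real (\<phi> l) * tri f f k l)) \<partial>(lborel \<Otimes>\<^sub>M lborel))"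
      by (subst lborel.nn_integral_fst[symmetric]) (auto simp: norm_mult)
    also have "\<dots> < \<infinity>" using i2 by (simp add: integrable_iff_bounded)
    finally show "(\<integral>\<^sup>+x. ennreal (norm (case x of (k, l) \<Rightarrow> complex_of_real (\<phi> (k - l)) * tri f f k l)) \<partial>(lborel \<Otimes>\<^sub>M lborel)) < \<infinity>" .
  qed measurable
  have e3: "(LINT x|(lborel \<Otimes>\<^sub>M lborel). (case x of (k, l) \<Rightarrow> complex_of_real (\<phi> (k - l)) * tri f f k l)) = cnj ?X"
  proof -
    have "(LINT l|lborel. complex_of_real (\<phi> (k - l)) * tri f f k l) = (LINT l|lborel. complex_of_real (\<phi> l) * tri f f k l)" for k
      using integral_reflect[of "\<lambda>l. complex_of_real (\<phi> l) * tri f f k l" k] by (simp add: tri_reflect)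
    then show ?thesis using lborel_pair.integral_fst'[OF i3] e2 by simp
  qed
  let ?F = "\<lambda>k l. complex_of_real (\<phi> k - \<phi> l - \<phi> (k - l)) * tri f f k l"
  have sub: "(\<lambda>(k, l). ?F k l)
      = (\<lambda>x. (case x of (k, l) \<Rightarrow> complex_of_real (\<phi> k) * tri f f k l) - (case x of (k, l) \<Rightarrow> complex_of_real (\<phi> l) * tri f f k l)
          - (case x of (k, l) \<Rightarrow> complex_of_real (\<phi> (k - l)) * tri f f k l))"
    by (auto simp: fun_eq_iff algebra_simps)
  have i: "integrable (lborel \<Otimes>\<^sub>M lborel) (\<lambda>(k, l). ?F k l)"
    unfolding sub by (intro Bochner_Integration.integrable_diff i1 i2 i3)
  have "(LINT x|(lborel \<Otimes>\<^sub>M lborel). (case x of (k, l) \<Rightarrow> ?F k l)) = ?X - cnj ?X - cnj ?X"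
    unfolding sub Bochner_Integration.integral_diff[OF Bochner_Integration.integrable_diff[OF i1 i2] i3]
      Bochner_Integration.integral_diff[OF i1 i2]
    unfolding e3 triint_eq[OF assms(1,1,2) fh fin, symmetric] triint_swap[OF assms(1,1,2) fh fin] ..
  then have *: "ennreal (cmod (?X - cnj ?X - cnj ?X)) \<le> (\<integral>\<^sup>+k. \<integral>\<^sup>+l. ennreal (cmod (?F k l)) \<partial>lborel \<partial>lborel)"
    using integral_pair_norm_le[OF i] by simp
  have "3 * \<bar>Im ?X\<bar> \<le> cmod (?X - cnj ?X - cnj ?X)"
    using abs_Im_le_cmod[of "?X - cnj ?X - cnj ?X"] by (simp add: abs_mult)
  then have "ennreal (3 * \<bar>Im ?X\<bar>) \<le> (\<integral>\<^sup>+k. \<integral>\<^sup>+l. ennreal (cmod (?F k l)) \<partial>lborel \<partial>lborel)"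
    by (rule order_trans[OF ennreal_leI *])
  then show ?thesis unfolding norm_mult norm_of_real .
qed

text \<open>
  Absolute convergence, which justifies the exchanges of integrals below.
\<close>

lemma tri_finite:
  assumes s: "s > 1" and z: "hsq s z < \<infinity>" and v: "hsq s v < \<infinity>"
    and [measurable]: "z' \<in> borel_measurable borel" "v' \<in> borel_measurable borel"
    and z': "AE k in lborel. rep z k = z' k" and v': "AE k in lborel. rep v k = v' k"
    and \<phi>: "\<And>k. \<bar>\<phi> k\<bar> \<le> K * \<bar>k\<bar>" 
  shows "(\<integral>\<^sup>+k. \<integral>\<^sup>+l. ennreal (\<bar>\<phi> k\<bar> * cmod (tri z' v' k l)) \<partial>lborel \<partial>lborel) < \<infinity>"
proof -
  have K: "K \<ge> 0" using \<phi>[of 1] by (simp add: order_trans[OF abs_ge_zero])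
  let ?w = "\<lambda>k. sqrt (1 + \<bar>k\<bar> powr (2 * (s - 1)))"
  let ?D = "\<lambda>k. ennreal (?w k * \<bar>k\<bar>) * abs_conv (rep z) (rep v) k"
  have "(\<integral>\<^sup>+k. \<integral>\<^sup>+l. ennreal (\<bar>\<phi> k\<bar> * cmod (tri z' v' k l)) \<partial>lborel \<partial>lborel)
     \<le> (\<integral>\<^sup>+k. ennreal K * (ennreal (cmod (v' k)) * ?D k) \<partial>lborel)"
  proof (rule nn_integral_mono)
    fix k
    have "(\<integral>\<^sup>+l. ennreal (\<bar>\<phi> k\<bar> * cmod (tri z' v' k l)) \<partial>lborel)
       = (\<integral>\<^sup>+l. ennreal (\<bar>\<phi> k\<bar> * cmod (v' k)) * ennreal (S_kernel (k - l) l * cmod (z' (k - l)) * cmod (v' l)) \<partial>lborel)"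
      by (intro nn_integral_cong) (simp add: cmod_tri ennreal_mult[symmetric] S_kernel_nonneg ac_simps)
    also have "\<dots> = ennreal (\<bar>\<phi> k\<bar> * cmod (v' k)) * abs_conv z' v' k"
      unfolding abs_conv_def by (rule nn_integral_cmult) measurable
    also have "abs_conv z' v' k = abs_conv (rep z) (rep v) k"
      using abs_conv_cong[OF z' v'] by simp
    also have "ennreal (\<bar>\<phi> k\<bar> * cmod (v' k)) \<le> ennreal (K * (cmod (v' k) * (?w k * \<bar>k\<bar>)))"
    proof (rule ennreal_leI)
      have "\<bar>\<phi> k\<bar> \<le> K * (?w k * \<bar>k\<bar>)"
        by (rule order_trans[OF \<phi>]) (intro mult_left_mono K, simp add: mult_le_cancel_right1)
      from mult_right_mono[OF this, of "cmod (v' k)"]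
      show "\<bar>\<phi> k\<bar> * cmod (v' k) \<le> K * (cmod (v' k) * (?w k * \<bar>k\<bar>))" by (simp add: ac_simps)
    qed
    finally show "(\<integral>\<^sup>+l. ennreal (\<bar>\<phi> k\<bar> * cmod (tri z' v' k l)) \<partial>lborel) \<le> ennreal K * (ennreal (cmod (v' k)) * ?D k)"
      using K by (simp add: ennreal_mult ac_simps mult_right_mono)
  qed
  also have "\<dots> = ennreal K * (\<integral>\<^sup>+k. ennreal (cmod (v' k)) * ?D k \<partial>lborel)"
    by (rule nn_integral_cmult) measurable
  also have "\<dots> < \<infinity>"
  proof -
    have "(\<integral>\<^sup>+k. ennreal (cmod (v' k)) * ?D k \<partial>lborel)\<^sup>2 \<le> (\<integral>\<^sup>+k. (ennreal (cmod (v' k)))\<^sup>2 \<partial>lborel) * (\<integral>\<^sup>+k. (?D k)\<^sup>2 \<partial>lborel)"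
      by (rule Cauchy_Schwarz_nn_integral) measurable
    also have "(\<integral>\<^sup>+k. (ennreal (cmod (v' k)))\<^sup>2 \<partial>lborel) = ennreal ((norm v)\<^sup>2)"
      unfolding nn_integral_rep[symmetric]
      by (rule nn_integral_cong_AE) (use v' in \<open>eventually_elim, simp add: ennreal_power\<close>)
    also have "ennreal ((norm v)\<^sup>2) * (\<integral>\<^sup>+k. (?D k)\<^sup>2 \<partial>lborel) < \<infinity>"
    proof -
      have "(\<integral>\<^sup>+k. (?D k)\<^sup>2 \<partial>lborel) \<le> ennreal (2 * (sqrt 2 * 2 powr s)\<^sup>2) * ((mom (1/2) v)\<^sup>2 * hsq s z + (mom (1/2) z)\<^sup>2 * hsq s v)"
        by (rule abs_conv_weighted_bound) (use s in simp)
      also have "\<dots> < \<infinity>"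
        using mom_finite[of "1/2" s z] mom_finite[of "1/2" s v] s z v
        by (simp add: ennreal_mult_less_top power2_eq_square)
      finally show ?thesis by (simp add: ennreal_mult_less_top)
    qed
    finally have "(\<integral>\<^sup>+k. ennreal (cmod (v' k)) * ?D k \<partial>lborel) < \<infinity>"
      by (cases "\<integral>\<^sup>+k. ennreal (cmod (v' k)) * ?D k \<partial>lborel") (auto simp: power2_eq_square)
    then show ?thesis by (simp add: ennreal_mult_less_top)
  qed
  finally show ?thesis .
qed

text \<open>
  The factor \<open>- i\<close> in \<open>B\<close> turns the real inner product into an imaginary part.
\<close>

lemma inner_mul_B:
  assumes s: "s > 1" and z: "hsq s z < \<infinity>" and v: "hsq s v < \<infinity>"
    and [measurable]: "z' \<in> borel_measurable borel" "v' \<in> borel_measurable borel"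
    and z': "AE k in lborel. rep z k = z' k" and v': "AE k in lborel. rep v k = v' k"
    and zh: "\<And>x. z' (- x) = cnj (z' x)" and W: "bmeas W"
  shows "inner (mul W v) (B z v) = Im (triint z' v' (\<lambda>k. k * W k))"
    and "(\<integral>\<^sup>+k. \<integral>\<^sup>+l. ennreal (\<bar>k * W k\<bar> * cmod (tri z' v' k l)) \<partial>lborel \<partial>lborel) < \<infinity>"
proof -
  note [measurable] = bmeas_measurable[OF W]
  obtain K where K: "\<And>x. \<bar>W x\<bar> \<le> K" using W by (auto simp: bmeas_def)
  show fin: "(\<integral>\<^sup>+k. \<integral>\<^sup>+l. ennreal (\<bar>k * W k\<bar> * cmod (tri z' v' k l)) \<partial>lborel \<partial>lborel) < \<infinity>"
  proof (rule tri_finite[OF s z v assms(4,5) z' v'])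
    show "\<bar>k * W k\<bar> \<le> K * \<bar>k\<bar>" for k
      using mult_left_mono[OF K[of k], of "\<bar>k\<bar>"] by (simp add: abs_mult mult.commute)
  qed
  have m: "(\<lambda>k. k * W k) \<in> borel_measurable borel" by measurable
  have "inner (mul W v) (B z v) = (LINT k|lborel. W k * (rep v k \<bullet> rep (B z v) k))" by (rule inner_mul[OF W])
  also have "\<dots> = (LINT k|lborel. Im (LINT l|lborel. complex_of_real (k * W k) * tri z' v' k l))"
  proof (rule integral_cong_AE)
    show "AE k in lborel. W k * (rep v k \<bullet> rep (B z v) k) = Im (LINT l|lborel. complex_of_real (k * W k) * tri z' v' k l)"
      using rep_B[OF s z v] v'
    proof eventually_elim
      case (elim k)
      have "(LINT l|lborel. complex_of_real (k * W k) * tri z' v' k l)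
         = (LINT l|lborel. (complex_of_real (k * W k) * cnj (v' k)) * (complex_of_real (S_kernel (k - l) l) * z' (k - l) * v' l))"
        by (simp add: tri_def ac_simps)
      also have "\<dots> = (complex_of_real (k * W k) * cnj (v' k)) * conv z' v' k"
        unfolding conv_def by (rule integral_mult_right_zero)
      also have "conv z' v' k = conv (rep z) (rep v) k"
        by (rule conv_cong) (use z' v' in auto)
      finally have E: "(LINT l|lborel. complex_of_real (k * W k) * tri z' v' k l)
         = (complex_of_real (k * W k) * cnj (v' k)) * conv (rep z) (rep v) k" .
      show ?case unfolding elim E
        by (simp add: bfun_def inner_complex_def algebra_simps)
    qed
  qed measurable
  also have "\<dots> = Im (LINT k|lborel. LINT l|lborel. complex_of_real (k * W k) * tri z' v' k l)"
  proof (rule integral_Im)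
    show "integrable lborel (\<lambda>k. LINT l|lborel. complex_of_real (k * W k) * tri z' v' k l)"
      using lborel_pair.integrable_fst'[OF tri_integrable1[OF assms(4,5) m zh fin]] by simp
  qed
  finally show "inner (mul W v) (B z v) = Im (triint z' v' (\<lambda>k. k * W k))" by (simp add: triint_def)
qed

text \<open>
  The \<open>L\<^sup>2\<close> estimate for the difference of two solutions, with their sum in the place of \<open>z\<close>.
\<close>

lemma inner_B_linear:
  assumes s: "s > 1" and z: "hsq s z < \<infinity>" and v: "hsq s v < \<infinity>" and h: "herm z"
  shows "ennreal \<bar>2 * inner v (B z v)\<bar> \<le> mom (3/2) z * ennreal ((norm v)\<^sup>2)"
proof -
  have W: "bmeas (\<lambda>x. 1)" by (rule bmeasI[of _ 1]) auto
  have vv: "mul (\<lambda>x. 1) v = v" by (simp add: mul_def)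
  have ae: "AE k in lborel. rep v k = rep v k" by simp
  note I = inner_mul_B[OF s z v hrep_measurable rep_measurable hrep_AE[OF h] ae hrep_herm W, unfolded mult_1_right]
  have "mom (3/2) z = (\<integral>\<^sup>+x. ennreal (\<bar>x\<bar> powr (3/2) * cmod (hrep z x)) \<partial>lborel)"
    unfolding mom_def by (rule nn_integral_cong_AE) (use hrep_AE[OF h] in \<open>eventually_elim, simp\<close>)
  then show ?thesis
    using triint_linear_bound[OF hrep_measurable rep_measurable hrep_herm I(2), of "norm v"] I(1)
    by (simp add: nn_integral_rep vv)
qed

text \<open>
  Even weights that increase with the modulus, in a way that is comparable to a power: the
  increment over a step \<open>x - y\<close> is at most that of a linear function of slope \<open>C * W y / y\<close>. The
  constant \<open>C\<close> is what enters the energy estimate.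
\<close>

definition energy_weight :: "real \<Rightarrow> (real \<Rightarrow> real) \<Rightarrow> bool" where
  "energy_weight C W \<longleftrightarrow> bmeas W \<and> (\<forall>x. 0 \<le> W x) \<and> (\<forall>x. W (- x) = W x) \<and>
     (\<forall>x y. 0 \<le> y \<longrightarrow> y \<le> x \<longrightarrow> W y \<le> W x) \<and>
     (\<forall>x y. 0 < y \<longrightarrow> y \<le> x \<longrightarrow> x \<le> 2 * y \<longrightarrow> y * (W x - W y) \<le> C * (x - y) * W y)"

text \<open>
  The difference is \<open>y (W (y + m) - W y) + m (W (y + m) - W m)\<close>. Both terms are of order
  \<open>m * W y\<close>, since the increment of \<open>W\<close> over the step \<open>m\<close> is at most \<open>C * m * W y / y\<close>.
\<close>

lemma energy_weight_increment:
  assumes W: "energy_weight C W" and m: "0 \<le> m" "m \<le> y" and C: "C \<ge> 0"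
  shows "\<bar>(y + m) * W (y + m) - y * W y - m * W m\<bar> \<le> (1 + 2 * C) * (m * (sqrt (W (y + m)) * sqrt (W y)))"
proof (cases "y = 0")
  case True
  then show ?thesis using m by simp
next
  case False
  then have y: "y > 0" using m by simp
  have mono: "\<And>a b. 0 \<le> a \<Longrightarrow> a \<le> b \<Longrightarrow> W a \<le> W b" using W by (auto simp: energy_weight_def)
  have W0: "\<And>a. W a \<ge> 0" using W by (auto simp: energy_weight_def)
  let ?x = "y + m"
  have Wxy: "W y \<le> W ?x" using mono[of y ?x] y m by simp
  have Wmx: "W m \<le> W ?x" using mono[of m ?x] m by simp
  have inc: "y * (W ?x - W y) \<le> C * m * W y"
    using W y m unfolding energy_weight_def by (metis add_diff_cancel_left' add_le_cancel_left le_add_same_cancel1 mult_2)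
  have le: "W ?x \<le> (1 + C) * W y"
  proof -
    have "y * (W ?x - W y) \<le> C * y * W y"
      using inc m C W0[of y] by (meson mult_left_mono mult_right_mono order_trans)
    then have "y * (W ?x - W y) \<le> y * (C * W y)" by (simp add: ac_simps)
    then have "W ?x - W y \<le> C * W y" using y by simp
    then show ?thesis by (simp add: algebra_simps)
  qed
  have sq: "W y \<le> sqrt (W ?x) * sqrt (W y)"
  proof -
    have "sqrt (W y) * sqrt (W y) \<le> sqrt (W ?x) * sqrt (W y)" using Wxy W0 by (intro mult_right_mono) auto
    then show ?thesis using W0 by simp
  qed
  have eq: "?x * W ?x - y * W y - m * W m = y * (W ?x - W y) + m * (W ?x - W m)" by (simp add: algebra_simps)
  have nn: "0 \<le> ?x * W ?x - y * W y - m * W m"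
    unfolding eq using Wxy Wmx m y by (intro add_nonneg_nonneg mult_nonneg_nonneg) auto
  have "m * (W ?x - W m) \<le> m * ((1 + C) * W y)" using le W0[of m] m by (intro mult_left_mono) auto
  then have "?x * W ?x - y * W y - m * W m \<le> C * m * W y + m * ((1 + C) * W y)"
    unfolding eq using inc by linarith
  also have "\<dots> = (1 + 2 * C) * (m * W y)" by (simp add: algebra_simps)
  also have "\<dots> \<le> (1 + 2 * C) * (m * (sqrt (W ?x) * sqrt (W y)))"
    using sq m C by (intro mult_left_mono) auto
  finally show ?thesis using nn by simp
qed

text \<open>
  The smaller frequency contributes one power from the increment and one half from the kernel.
\<close>

lemma energy_weight_tri:
  assumes W: "energy_weight C W" and C: "C \<ge> 0" and ym: "y \<ge> 0" "m \<ge> 0"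
    and S: "0 \<le> \<sigma>" "\<sigma> \<le> sqrt y" "\<sigma> \<le> sqrt m"
  shows "\<bar>(y + m) * W (y + m) - y * W y - m * W m\<bar> * \<sigma>
    \<le> (1 + 2 * C) * (m powr (3/2) * (sqrt (W (y + m)) * sqrt (W y)) + y powr (3/2) * (sqrt (W (y + m)) * sqrt (W m)))"
proof -
  have W0: "\<And>a. W a \<ge> 0" using W by (auto simp: energy_weight_def)
  have p: "x powr (3/2) = x * sqrt x" if "x \<ge> 0" for x :: real
    using powr_add[of x 1 "1/2"] that by (simp add: powr_half_sqrt)
  have main: "\<bar>(b + a) * W (b + a) - b * W b - a * W a\<bar> * \<sigma> \<le> (1 + 2 * C) * (a powr (3/2) * (sqrt (W (b + a)) * sqrt (W b)))"
    if a: "0 \<le> a" "a \<le> b" and s: "\<sigma> \<le> sqrt a" for a b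
  proof -
    have "\<bar>(b + a) * W (b + a) - b * W b - a * W a\<bar> * \<sigma> \<le> ((1 + 2 * C) * (a * (sqrt (W (b + a)) * sqrt (W b)))) * sqrt a"
      by (intro mult_mono energy_weight_increment[OF W a C] s) (use S a C W0 in auto)
    also have "\<dots> = (1 + 2 * C) * (a powr (3/2) * (sqrt (W (b + a)) * sqrt (W b)))"
      by (simp add: p[OF a(1)] ac_simps)
    finally show ?thesis .
  qed
  show ?thesis
  proof (cases "m \<le> y")
    case True
    have "(1 + 2 * C) * (m powr (3/2) * (sqrt (W (y + m)) * sqrt (W y)))
      \<le> (1 + 2 * C) * (m powr (3/2) * (sqrt (W (y + m)) * sqrt (W y)) + y powr (3/2) * (sqrt (W (y + m)) * sqrt (W m)))"
      using C W0 by (intro mult_left_mono) auto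
    then show ?thesis using main[OF ym(2) True S(3)] by linarith
  next
    case False
    have "\<bar>(m + y) * W (m + y) - m * W m - y * W y\<bar> * \<sigma> \<le> (1 + 2 * C) * (y powr (3/2) * (sqrt (W (m + y)) * sqrt (W m)))"
      by (rule main) (use False ym S in auto)
    also have "\<dots> \<le> (1 + 2 * C) * (m powr (3/2) * (sqrt (W (y + m)) * sqrt (W y)) + y powr (3/2) * (sqrt (W (y + m)) * sqrt (W m)))"
      using C W0 by (intro mult_left_mono) (auto simp: add.commute)
    also have "\<bar>(m + y) * W (m + y) - m * W m - y * W y\<bar> = \<bar>(y + m) * W (y + m) - y * W y - m * W m\<bar>"
      by (simp add: add.commute)
    finally show ?thesis .
  qed
qed

lemma abs_sum_same_sign:
  fixes a b c :: real
  assumes "a = b + c" "\<bar>a\<bar> = \<bar>b\<bar> + \<bar>c\<bar>"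
  shows "\<bar>a * x - b * y - c * z\<bar> = \<bar>\<bar>a\<bar> * x - \<bar>b\<bar> * y - \<bar>c\<bar> * z\<bar>"
proof (cases "a \<ge> 0")
  case True
  then have "\<bar>a\<bar> = a" "\<bar>b\<bar> = b" "\<bar>c\<bar> = c" using assms by linarith+
  then show ?thesis by simp
next
  case False
  then have "\<bar>a\<bar> = - a" "\<bar>b\<bar> = - b" "\<bar>c\<bar> = - c" using assms by linarith+
  then have "\<bar>a\<bar> * x - \<bar>b\<bar> * y - \<bar>c\<bar> * z = - (a * x - b * y - c * z)" by (simp add: algebra_simps)
  then show ?thesis by (simp only: abs_minus_cancel)
qed

text \<open>
  One of the three moduli is the sum of the other two. In each of the three cases the preceding
  estimate applies to these two, after the signs have been removed by \<open>abs_sum_same_sign\<close>.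
\<close>

lemma symmetrised_weight_bound:
  assumes W: "energy_weight C W" and C: "C \<ge> 0"
  shows "\<bar>k * W k - l * W l - (k - l) * W (k - l)\<bar> * S_kernel (k - l) l
    \<le> (1 + 2 * C) * (\<bar>k - l\<bar> powr (3/2) * (sqrt (W k) * sqrt (W l))
        + \<bar>l\<bar> powr (3/2) * (sqrt (W k) * sqrt (W (k - l)))
        + \<bar>k\<bar> powr (3/2) * (sqrt (W l) * sqrt (W (k - l))))"
proof -
  have e: "W (- x) = W x" for x using W unfolding energy_weight_def by blast
  have ev: "\<And>x. W \<bar>x\<bar> = W x" by (metis e abs_if)
  have W0: "\<And>a. W a \<ge> 0" using W by (auto simp: energy_weight_def)
  let ?j = "k - l" and ?S = "S_kernel (k - l) l"
  have S: "?S \<le> sqrt \<bar>?j\<bar>" "?S \<le> sqrt \<bar>l\<bar>" "?S \<le> sqrt \<bar>k\<bar>" "0 \<le> ?S"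
    by (rule S_kernel_le1 S_kernel_le2 S_kernel_le3 S_kernel_nonneg)+
  have P0: "0 \<le> (1 + 2 * C) * (\<bar>a\<bar> powr (3/2) * (sqrt (W b) * sqrt (W c)))" for a b c
    using C W0 by simp
  consider (k) "\<bar>k\<bar> = \<bar>l\<bar> + \<bar>?j\<bar>" | (l) "\<bar>l\<bar> = \<bar>k\<bar> + \<bar>?j\<bar>" | (j) "\<bar>?j\<bar> = \<bar>k\<bar> + \<bar>l\<bar>" by linarith
  then show ?thesis
  proof cases
    case k
    have E: "\<bar>k * W k - l * W l - ?j * W ?j\<bar> = \<bar>\<bar>k\<bar> * W k - \<bar>l\<bar> * W l - \<bar>?j\<bar> * W ?j\<bar>"
      by (rule abs_sum_same_sign[OF _ k]) simp
    have "\<bar>k * W k - l * W l - ?j * W ?j\<bar> * ?S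
      \<le> (1 + 2 * C) * (\<bar>?j\<bar> powr (3/2) * (sqrt (W k) * sqrt (W l)) + \<bar>l\<bar> powr (3/2) * (sqrt (W k) * sqrt (W ?j)))"
      unfolding E by (rule energy_weight_tri[OF W C, of "\<bar>l\<bar>" "\<bar>?j\<bar>" ?S, unfolded k[symmetric] ev]) (use S in auto)
    then show ?thesis using P0[of k l ?j] by (simp add: distrib_left)
  next
    case l
    have "\<bar>k * W k - l * W l - ?j * W ?j\<bar> = \<bar>l * W l - k * W k - (- ?j) * W ?j\<bar>"
      using abs_minus_cancel[of "l * W l - k * W k - (- ?j) * W ?j"] by (simp add: algebra_simps)
    also have "\<dots> = \<bar>\<bar>l\<bar> * W l - \<bar>k\<bar> * W k - \<bar>- ?j\<bar> * W ?j\<bar>"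
      by (rule abs_sum_same_sign) (use l in linarith)+
    finally have E: "\<bar>k * W k - l * W l - ?j * W ?j\<bar> = \<bar>\<bar>l\<bar> * W l - \<bar>k\<bar> * W k - \<bar>?j\<bar> * W ?j\<bar>"
      by (simp only: abs_minus_cancel)
    have "\<bar>k * W k - l * W l - ?j * W ?j\<bar> * ?S
      \<le> (1 + 2 * C) * (\<bar>?j\<bar> powr (3/2) * (sqrt (W l) * sqrt (W k)) + \<bar>k\<bar> powr (3/2) * (sqrt (W l) * sqrt (W ?j)))"
      unfolding E by (rule energy_weight_tri[OF W C, of "\<bar>k\<bar>" "\<bar>?j\<bar>" ?S, unfolded l[symmetric] ev]) (use S in auto)
    then show ?thesis using P0[of l k ?j] by (simp add: distrib_left mult.commute[of "sqrt (W l)" "sqrt (W k)"])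
  next
    case j
    have "\<bar>k * W k - l * W l - ?j * W ?j\<bar> = \<bar>?j * W ?j - k * W k - (- l) * W l\<bar>"
      using abs_minus_cancel[of "?j * W ?j - k * W k - (- l) * W l"] by (simp add: algebra_simps)
    also have "\<dots> = \<bar>\<bar>?j\<bar> * W ?j - \<bar>k\<bar> * W k - \<bar>- l\<bar> * W l\<bar>"
      by (rule abs_sum_same_sign) (use j in linarith)+
    finally have E: "\<bar>k * W k - l * W l - ?j * W ?j\<bar> = \<bar>\<bar>?j\<bar> * W ?j - \<bar>k\<bar> * W k - \<bar>l\<bar> * W l\<bar>"
      by (simp only: abs_minus_cancel)
    have "\<bar>k * W k - l * W l - ?j * W ?j\<bar> * ?S
      \<le> (1 + 2 * C) * (\<bar>l\<bar> powr (3/2) * (sqrt (W ?j) * sqrt (W k)) + \<bar>k\<bar> powr (3/2) * (sqrt (W ?j) * sqrt (W l)))"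
      unfolding E by (rule energy_weight_tri[OF W C, of "\<bar>k\<bar>" "\<bar>l\<bar>" ?S, unfolded j[symmetric] ev]) (use S in auto)
    then show ?thesis using P0[of ?j k l] by (simp add: distrib_left mult.commute[of "sqrt (W ?j)"])
  qed
qed

lemma symmetrised_integral_bound:
  fixes f :: "real \<Rightarrow> complex"
  assumes [measurable]: "f \<in> borel_measurable borel" and W: "energy_weight C W" and C: "C \<ge> 0"
    and E: "(\<integral>\<^sup>+x. ennreal (W x * (cmod (f x))\<^sup>2) \<partial>lborel) \<le> ennreal (Y\<^sup>2)" and Y: "Y \<ge> 0"
  shows "(\<integral>\<^sup>+k. \<integral>\<^sup>+l. ennreal (\<bar>k * W k - l * W l - (k - l) * W (k - l)\<bar> * cmod (tri f f k l)) \<partial>lborel \<partial>lborel)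
    \<le> ennreal (3 * (1 + 2 * C)) * ((\<integral>\<^sup>+x. ennreal (\<bar>x\<bar> powr (3/2) * cmod (f x)) \<partial>lborel) * ennreal (Y\<^sup>2))"
proof -
  have W0: "\<And>a. W a \<ge> 0" and [measurable]: "W \<in> borel_measurable borel"
    using W by (auto simp: energy_weight_def bmeas_def)
  define x where "x k = sqrt (W k) * cmod (f k)" for k
  define g where "g k = \<bar>k\<bar> powr (3/2) * cmod (f k)" for k
  have [measurable]: "x \<in> borel_measurable borel" "g \<in> borel_measurable borel"
    unfolding x_def g_def by measurable
  have nn: "x k \<ge> 0" "g k \<ge> 0" for k using W0 by (auto simp: x_def g_def)
  have x2: "(\<integral>\<^sup>+k. ennreal ((x k)\<^sup>2) \<partial>lborel) \<le> ennreal (Y\<^sup>2)"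
    using E by (simp add: x_def power_mult_distrib W0)
  let ?G = "\<integral>\<^sup>+k. ennreal (g k) \<partial>lborel"
  have t1: "(\<integral>\<^sup>+k. \<integral>\<^sup>+l. ennreal (x k) * ennreal (g (k - l)) * ennreal (x l) \<partial>lborel \<partial>lborel) \<le> ?G * ennreal (Y * Y)"
    by (rule trilinear_bound) (use x2 nn Y in auto)
  have t2: "(\<integral>\<^sup>+k. \<integral>\<^sup>+l. ennreal (x k) * ennreal (g l) * ennreal (x (k - l)) \<partial>lborel \<partial>lborel) \<le> ?G * ennreal (Y * Y)"
  proof -
    have "(\<integral>\<^sup>+l. ennreal (x k) * ennreal (g l) * ennreal (x (k - l)) \<partial>lborel)
        = (\<integral>\<^sup>+l. ennreal (x k) * ennreal (g (k - l)) * ennreal (x l) \<partial>lborel)" for k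
      using nn_integral_reflect[of "\<lambda>l. ennreal (x k) * ennreal (g (k - l)) * ennreal (x l)" k] by simp
    then show ?thesis using t1 by simp
  qed
  have t3: "(\<integral>\<^sup>+k. \<integral>\<^sup>+l. ennreal (g k) * (ennreal (x (k - l)) * ennreal (x l)) \<partial>lborel \<partial>lborel) \<le> ?G * ennreal (Y * Y)"
  proof -
    have "(\<integral>\<^sup>+k. \<integral>\<^sup>+l. ennreal (g k) * (ennreal (x (k - l)) * ennreal (x l)) \<partial>lborel \<partial>lborel)
       = (\<integral>\<^sup>+k. ennreal (g k) * (\<integral>\<^sup>+l. ennreal (x (k - l)) * ennreal (x l) \<partial>lborel) \<partial>lborel)"
      by (intro nn_integral_cong nn_integral_cmult) measurable
    also have "\<dots> \<le> (\<integral>\<^sup>+k. ennreal (g k) * ennreal (Y * Y) \<partial>lborel)"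
    proof (intro nn_integral_mono mult_left_mono Cauchy_Schwarz_nn)
      show "(\<integral>\<^sup>+l. ennreal ((x (k - l))\<^sup>2) \<partial>lborel) \<le> ennreal (Y\<^sup>2)" for k
        using x2 nn_integral_reflect[of "\<lambda>l. ennreal ((x l)\<^sup>2)" k] by simp
    qed (use x2 nn Y in auto)
    also have "\<dots> = ?G * ennreal (Y * Y)" by (rule nn_integral_multc) measurable
    finally show ?thesis .
  qed
  have "(\<integral>\<^sup>+k. \<integral>\<^sup>+l. ennreal (\<bar>k * W k - l * W l - (k - l) * W (k - l)\<bar> * cmod (tri f f k l)) \<partial>lborel \<partial>lborel)
    \<le> (\<integral>\<^sup>+k. \<integral>\<^sup>+l. ennreal (1 + 2 * C) * (ennreal (x k) * ennreal (g (k - l)) * ennreal (x l)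
        + ennreal (x k) * ennreal (g l) * ennreal (x (k - l)) + ennreal (g k) * (ennreal (x (k - l)) * ennreal (x l))) \<partial>lborel \<partial>lborel)"
  proof (intro nn_integral_mono)
    fix k l :: real
    let ?m = "cmod (f k) * cmod (f (k - l)) * cmod (f l)"
    have "\<bar>k * W k - l * W l - (k - l) * W (k - l)\<bar> * cmod (tri f f k l)
      = (\<bar>k * W k - l * W l - (k - l) * W (k - l)\<bar> * S_kernel (k - l) l) * ?m"
      by (simp only: cmod_tri ac_simps)
    also have "\<dots> \<le> ((1 + 2 * C) * (\<bar>k - l\<bar> powr (3/2) * (sqrt (W k) * sqrt (W l))
        + \<bar>l\<bar> powr (3/2) * (sqrt (W k) * sqrt (W (k - l)))
        + \<bar>k\<bar> powr (3/2) * (sqrt (W l) * sqrt (W (k - l))))) * ?m"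
      by (intro mult_right_mono symmetrised_weight_bound[OF W C]) auto
    also have "\<dots> = (1 + 2 * C) * (x k * g (k - l) * x l + x k * g l * x (k - l) + g k * (x (k - l) * x l))"
      unfolding x_def g_def by (simp only: distrib_left distrib_right ac_simps)
    finally have "ennreal (\<bar>k * W k - l * W l - (k - l) * W (k - l)\<bar> * cmod (tri f f k l))
      \<le> ennreal ((1 + 2 * C) * (x k * g (k - l) * x l + x k * g l * x (k - l) + g k * (x (k - l) * x l)))"
      by (rule ennreal_leI)
    also have "\<dots> = ennreal (1 + 2 * C) * (ennreal (x k) * ennreal (g (k - l)) * ennreal (x l)
        + ennreal (x k) * ennreal (g l) * ennreal (x (k - l)) + ennreal (g k) * (ennreal (x (k - l)) * ennreal (x l)))"
      using C nn by (simp only: ennreal_mult ennreal_plus mult_nonneg_nonneg add_nonneg_nonneg zero_le_one zero_le_numeral)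
    finally show "ennreal (\<bar>k * W k - l * W l - (k - l) * W (k - l)\<bar> * cmod (tri f f k l))
      \<le> ennreal (1 + 2 * C) * (ennreal (x k) * ennreal (g (k - l)) * ennreal (x l)
        + ennreal (x k) * ennreal (g l) * ennreal (x (k - l)) + ennreal (g k) * (ennreal (x (k - l)) * ennreal (x l)))" .
  qed
  also have "\<dots> = ennreal (1 + 2 * C) * ((\<integral>\<^sup>+k. \<integral>\<^sup>+l. ennreal (x k) * ennreal (g (k - l)) * ennreal (x l) \<partial>lborel \<partial>lborel)
        + (\<integral>\<^sup>+k. \<integral>\<^sup>+l. ennreal (x k) * ennreal (g l) * ennreal (x (k - l)) \<partial>lborel \<partial>lborel)
        + (\<integral>\<^sup>+k. \<integral>\<^sup>+l. ennreal (g k) * (ennreal (x (k - l)) * ennreal (x l)) \<partial>lborel \<partial>lborel))"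
    by (simp add: nn_integral_cmult nn_integral_add)
  also have "\<dots> \<le> ennreal (1 + 2 * C) * (?G * ennreal (Y * Y) + ?G * ennreal (Y * Y) + ?G * ennreal (Y * Y))"
    by (intro mult_left_mono add_mono t1 t2 t3) simp
  also have "\<dots> = ennreal (1 + 2 * C) * (3 * (?G * ennreal (Y\<^sup>2)))"
  proof -
    have "a + a + a = 3 * a" for a :: ennreal
      by (metis mult_2 numeral_Bit1 numeral_One distrib_right mult_1 numeral_Bit0)
    then show ?thesis by (simp add: power2_eq_square)
  qed
  also have "\<dots> = ennreal (3 * (1 + 2 * C)) * (?G * ennreal (Y\<^sup>2))"
  proof -
    have "ennreal (3 * (1 + 2 * C)) = ennreal 3 * ennreal (1 + 2 * C)"
      using C by (intro ennreal_mult) auto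
    then show ?thesis by (simp only: ennreal_numeral ac_simps)
  qed
  finally show ?thesis by (simp add: g_def)
qed

text \<open>
  After symmetrisation every factor that could cost a derivative has been traded for the moment of
  order \<open>3/2\<close>; Young's inequality with this moment in the \<open>L\<^sup>1\<close> slot does the rest.
\<close>

lemma inner_B_energy:
  assumes s: "s > 1" and u: "hsq s u < \<infinity>" and h: "herm u" and W: "energy_weight C W" and C: "C \<ge> 0"
  shows "ennreal \<bar>2 * inner (mul W u) (B u u)\<bar> \<le> ennreal (2 + 4 * C) * (mom (3/2) u * ennreal (inner (mul W u) u))"
proof -
  have bW: "bmeas W" and W0: "\<And>x. W x \<ge> 0" using W by (auto simp: energy_weight_def)
  note [measurable] = bmeas_measurable[OF bW]
  note I = inner_mul_B[OF s u u hrep_measurable hrep_measurable hrep_AE[OF h] hrep_AE[OF h] hrep_herm bW]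
  have m: "(\<lambda>k. k * W k) \<in> borel_measurable borel" by measurable
  let ?E = "inner (mul W u) u"
  have EE: "ennreal ?E = (\<integral>\<^sup>+x. ennreal (W x * (cmod (hrep u x))\<^sup>2) \<partial>lborel)"
    unfolding inner_mul_self[OF bW W0]
    by (rule nn_integral_cong_AE) (use hrep_AE[OF h] in \<open>eventually_elim, simp\<close>)
  have E0: "?E \<ge> 0" unfolding inner_mul[OF bW] using W0 by (intro integral_nonneg_AE) auto
  have M: "mom (3/2) u = (\<integral>\<^sup>+x. ennreal (\<bar>x\<bar> powr (3/2) * cmod (hrep u x)) \<partial>lborel)"
    unfolding mom_def by (rule nn_integral_cong_AE) (use hrep_AE[OF h] in \<open>eventually_elim, simp\<close>)
  have "ennreal (3 * \<bar>inner (mul W u) (B u u)\<bar>)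
    \<le> (\<integral>\<^sup>+k. \<integral>\<^sup>+l. ennreal (\<bar>k * W k - l * W l - (k - l) * W (k - l)\<bar> * cmod (tri (hrep u) (hrep u) k l)) \<partial>lborel \<partial>lborel)"
    unfolding I(1) by (rule triint_symmetrised[OF hrep_measurable m hrep_herm I(2)])
  also have "\<dots> \<le> ennreal (3 * (1 + 2 * C)) * ((\<integral>\<^sup>+x. ennreal (\<bar>x\<bar> powr (3/2) * cmod (hrep u x)) \<partial>lborel) * ennreal ((sqrt ?E)\<^sup>2))"
    by (rule symmetrised_integral_bound[OF hrep_measurable W C]) (use EE E0 in auto)
  finally have "ennreal (3 * \<bar>inner (mul W u) (B u u)\<bar>) \<le> ennreal (3 * (1 + 2 * C)) * (mom (3/2) u * ennreal ?E)"
    using E0 by (simp add: M)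
  then have "ennreal (2/3) * ennreal (3 * \<bar>inner (mul W u) (B u u)\<bar>)
     \<le> ennreal (2/3) * (ennreal (3 * (1 + 2 * C)) * (mom (3/2) u * ennreal ?E))"
    by (rule mult_left_mono) simp
  moreover have "ennreal (2/3) * ennreal (3 * \<bar>inner (mul W u) (B u u)\<bar>) = ennreal \<bar>2 * inner (mul W u) (B u u)\<bar>"
    by (subst ennreal_mult[symmetric]) (auto simp: abs_mult)
  moreover have "ennreal (2/3) * ennreal (3 * (1 + 2 * C)) = ennreal (2 + 4 * C)"
    using C by (subst ennreal_mult[symmetric]) (auto simp: algebra_simps)
  ultimately show ?thesis by (simp only: mult.assoc[symmetric])
qed

text \<open>
  For the weight \<open>1\<close> the symmetrised factor \<open>k - l - (k - l)\<close> vanishes.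
\<close>

lemma inner_B_conserved:
  assumes s: "s > 1" and u: "hsq s u < \<infinity>" and h: "herm u"
  shows "inner u (B u u) = 0"
proof -
  have bW: "bmeas (\<lambda>x. 1)" by (rule bmeasI[of _ 1]) auto
  have idm: "(\<lambda>k::real. k) \<in> borel_measurable borel" by measurable
  note I = inner_mul_B[OF s u u hrep_measurable hrep_measurable hrep_AE[OF h] hrep_AE[OF h] hrep_herm bW, unfolded mult_1_right]
  have "ennreal (3 * \<bar>Im (triint (hrep u) (hrep u) (\<lambda>k. k))\<bar>)
    \<le> (\<integral>\<^sup>+k. \<integral>\<^sup>+l. ennreal (\<bar>k - l - (k - l)\<bar> * cmod (tri (hrep u) (hrep u) k l)) \<partial>lborel \<partial>lborel)"
    by (rule triint_symmetrised[OF hrep_measurable idm hrep_herm I(2)])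
  then have "Im (triint (hrep u) (hrep u) (\<lambda>k. k)) = 0" by (simp add: ennreal_eq_0_iff)
  then show ?thesis using I(1) by (simp add: mul_def)
qed

section \<open>Ordinary differential equations in Hilbert space\<close>

instance l2 :: banach ..

text \<open>
  For a globally Lipschitz right-hand side the Picard iteration converges uniformly on any
  interval.
\<close>

lemma Picard_Lindeloef_global:
  fixes F :: "'a::banach \<Rightarrow> 'a"
  assumes lip: "\<And>x y. norm (F x - F y) \<le> L * norm (x - y)" and L: "L > 0" and T: "T > 0"
  shows "\<exists>u. u 0 = x0 \<and> (\<forall>t\<in>{0..T}. (u has_vector_derivative F (u t)) (at t within {0..T}))"
proof -
  define X :: "nat \<Rightarrow> real \<Rightarrow> 'a" where "X = rec_nat (\<lambda>t. x0) (\<lambda>n Y t. x0 + integral {0..t} (\<lambda>r. F (Y r)))"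
  have X0: "X 0 = (\<lambda>t. x0)" and XS: "X (Suc n) = (\<lambda>t. x0 + integral {0..t} (\<lambda>r. F (X n r)))" for n
    by (simp_all add: X_def)
  have contF: "continuous_on UNIV F"
  proof (rule lipschitz_on_continuous_on)
    show "L-lipschitz_on UNIV F" using lip L by (intro lipschitz_onI) (auto simp: dist_norm)
  qed
  have cont: "continuous_on {0..T} (X n)" and
    der: "\<And>t. t \<in> {0..T} \<Longrightarrow> (X (Suc n) has_vector_derivative F (X n t)) (at t within {0..T})" for n
  proof (induction n)
    case 0
    have c: "continuous_on {0..T} (\<lambda>r. F (X 0 r))" by (simp add: X0)
    { case 1 show ?case by (simp add: X0) }
    { case 2 show ?case unfolding XS
        using integral_has_vector_derivative[OF c 2] by (intro derivative_eq_intros) auto }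
  next
    case (Suc n)
    have 1: "continuous_on {0..T} (X (Suc n))"
      unfolding continuous_on_eq_continuous_within
      by (intro ballI has_vector_derivative_continuous[OF Suc(2)])
    have c: "continuous_on {0..T} (\<lambda>r. F (X (Suc n) r))"
      by (rule continuous_on_compose2[OF contF 1]) auto
    { case 1 show ?case by fact }
    { case 2 show ?case unfolding XS[of "Suc n"]
        using integral_has_vector_derivative[OF c 2] by (intro derivative_eq_intros) auto }
  qed
  have at0: "X n 0 = x0" for n by (cases n) (simp_all add: X0 XS)
  define M where "M = T * norm (F x0)"
  have M: "M \<ge> 0" using T by (simp add: M_def)
  \<comment> \<open>In the norm weighted by \<open>exp (-2 L t)\<close> the Picard map is a contraction with factor \<open>1/2\<close>.\<close>
  have diff: "norm (X (Suc n) t - X n t) \<le> M * (1/2)^n * exp (2 * L * t)" if "t \<in> {0..T}" for n t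
    using that
  proof (induction n arbitrary: t)
    case 0
    then have "norm (X (Suc 0) t - X 0 t) = t * norm (F x0)" by (simp add: X0 XS)
    also have "\<dots> \<le> M" using 0 by (auto simp: M_def intro: mult_right_mono)
    also have "\<dots> \<le> M * exp (2 * L * t)" using M L 0 by (simp add: mult_le_cancel_left1)
    finally show ?case by simp
  next
    case (Suc n)
    show ?case
    proof (cases "t = 0")
      case True
      then show ?thesis using M by (simp add: at0)
    next
      case False
      then have t: "0 < t" "t \<le> T" using Suc.prems by auto
      define \<phi> where "\<phi> r = M * (1/2)^Suc n * exp (2 * L * r)" for r
      have "norm ((\<lambda>r. X (Suc (Suc n)) r - X (Suc n) r) t - (\<lambda>r. X (Suc (Suc n)) r - X (Suc n) r) 0) \<le> \<phi> t - \<phi> 0"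
      proof (rule differentiable_bound_general[OF t(1)])
        show "continuous_on {0..t} (\<lambda>r. X (Suc (Suc n)) r - X (Suc n) r)"
          by (intro continuous_intros continuous_on_subset[OF cont]) (use t in auto)
        show "continuous_on {0..t} \<phi>" unfolding \<phi>_def by (intro continuous_intros)
        fix r assume r: "0 < r" "r < t"
        have at: "at r within {0..T} = at r" using r t by (intro at_within_Icc_at) auto
        show "((\<lambda>r. X (Suc (Suc n)) r - X (Suc n) r) has_vector_derivative F (X (Suc n) r) - F (X n r)) (at r)"
          using der[of r "Suc n"] der[of r n] r t unfolding at by (intro derivative_intros) auto
        show "(\<phi> has_vector_derivative M * (1/2)^n * exp (2 * L * r) * L) (at r)"
          unfolding \<phi>_def has_real_derivative_iff_has_vector_derivative[symmetric]
          by (auto intro!: derivative_eq_intros)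
        have "norm (F (X (Suc n) r) - F (X n r)) \<le> L * norm (X (Suc n) r - X n r)" by (rule lip)
        also have "\<dots> \<le> L * (M * (1/2)^n * exp (2 * L * r))" using Suc.IH[of r] L r t by (intro mult_left_mono) auto
        finally show "norm (F (X (Suc n) r) - F (X n r)) \<le> M * (1/2)^n * exp (2 * L * r) * L" by (simp add: ac_simps)
      qed
      moreover have "\<phi> 0 \<ge> 0" using M by (simp add: \<phi>_def)
      ultimately show ?thesis by (simp add: at0 \<phi>_def)
    qed
  qed
  define C where "C = M * exp (2 * L * T)"
  have C: "C \<ge> 0" using M by (simp add: C_def)
  have diff': "norm (X (Suc n) t - X n t) \<le> C * (1/2)^n" if "t \<in> {0..T}" for n t
  proof -
    have "M * (1/2)^n * exp (2 * L * t) \<le> M * (1/2)^n * exp (2 * L * T)"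
      using M L that by (intro mult_left_mono) auto
    then show ?thesis using diff[OF that, of n] by (simp add: C_def ac_simps)
  qed
  have ul: "uniform_limit {0..T} (\<lambda>n t. \<Sum>i<n. X (Suc i) t - X i t) (\<lambda>t. \<Sum>i. X (Suc i) t - X i t) sequentially"
    by (rule Weierstrass_m_test[where M = "\<lambda>n. C * (1/2)^n"]) (use diff' in \<open>auto intro!: summable_mult summable_geometric\<close>)
  define u where "u t = (\<Sum>i. X (Suc i) t - X i t) + x0" for t
  have ulX: "uniform_limit {0..T} X u sequentially"
  proof -
    have "uniform_limit {0..T} (\<lambda>n t. (\<Sum>i<n. X (Suc i) t - X i t) + x0) u sequentially"
      unfolding u_def by (intro uniform_limit_intros ul)
    moreover have "(\<Sum>i<n. X (Suc i) t - X i t) + x0 = X n t" for n t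
      by (simp add: sum_lessThan_telescope[of "\<lambda>i. X i t"] X0)
    ultimately show ?thesis by simp
  qed
  have "\<exists>g. \<forall>t\<in>{0..T}. (\<lambda>n. X (Suc n) t) \<longlonglongrightarrow> g t \<and> (g has_derivative (\<lambda>h. h *\<^sub>R F (u t))) (at t within {0..T})"
  proof (rule has_derivative_sequence[where f' = "\<lambda>n t h. h *\<^sub>R F (X n t)" and ?x0.0 = 0 and l = x0])
    show "(X (Suc n) has_derivative (\<lambda>h. h *\<^sub>R F (X n t))) (at t within {0..T})" if "t \<in> {0..T}" for n t
      using der[OF that, of n] by (simp add: has_vector_derivative_def)
    show "\<forall>\<^sub>F n in sequentially. \<forall>t\<in>{0..T}. \<forall>h. norm (h *\<^sub>R F (X n t) - h *\<^sub>R F (u t)) \<le> e * norm h" if e: "e > 0" for e :: real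
    proof -
      have "\<forall>\<^sub>F n in sequentially. \<forall>t\<in>{0..T}. dist (X n t) (u t) < e / L"
        using ulX e L unfolding uniform_limit_iff by simp
      then show ?thesis
      proof eventually_elim
        case (elim n)
        show ?case
        proof (intro ballI allI)
          fix t h assume t: "t \<in> {0..T}"
          have "norm (F (X n t) - F (u t)) \<le> L * norm (X n t - u t)" by (rule lip)
          also have "\<dots> \<le> L * (e / L)" using elim t L by (intro mult_left_mono) (auto simp: dist_norm less_imp_le)
          also have "\<dots> = e" using L by simp
          finally have "norm (F (X n t) - F (u t)) \<le> e" .
          from mult_left_mono[OF this, of "\<bar>h\<bar>"]
          show "norm (h *\<^sub>R F (X n t) - h *\<^sub>R F (u t)) \<le> e * norm h"
            by (simp add: scaleR_diff_right[symmetric] mult.commute del: scaleR_diff_right)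
        qed
      qed
    qed
  qed (use T in \<open>auto simp: at0\<close>)
  then obtain g where g: "\<And>t. t \<in> {0..T} \<Longrightarrow> (\<lambda>n. X (Suc n) t) \<longlonglongrightarrow> g t"
    "\<And>t. t \<in> {0..T} \<Longrightarrow> (g has_vector_derivative F (u t)) (at t within {0..T})"
    unfolding has_vector_derivative_def by blast
  have gu: "g t = u t" if "t \<in> {0..T}" for t
    using LIMSEQ_unique[OF g(1)[OF that]] LIMSEQ_Suc[OF tendsto_uniform_limitI[OF ulX that]] by blast
  have "g 0 = x0" using LIMSEQ_unique[OF g(1)[of 0], of x0] T by (simp add: at0)
  then show ?thesis using g(2) gu by (intro exI[of _ g]) auto
qed

lemma nonincreasing_of_deriv:
  fixes f :: "real \<Rightarrow> real"
  assumes "a \<le> b" and d: "\<And>t. t \<in> {a..b} \<Longrightarrow> (f has_real_derivative f' t) (at t within {a..b})"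
    and le: "\<And>t. t \<in> {a<..<b} \<Longrightarrow> f' t \<le> 0"
  shows "f b \<le> f a"
proof (rule DERIV_nonpos_imp_decreasing_open[OF assms(1)])
  show "continuous_on {a..b} f"
    by (rule DERIV_continuous_on) (rule d)
  fix x assume x: "a < x" "x < b"
  then have "at x within {a..b} = at x" by (intro at_within_Icc_at) auto
  then show "\<exists>y. (f has_real_derivative y) (at x) \<and> y \<le> 0" using d[of x] le[of x] x by auto
qed

text \<open>
  The function \<open>exp (- A t) * f t - b * t\<close> is nonincreasing.
\<close>

lemma Gronwall_differential:
  fixes f A :: "real \<Rightarrow> real"
  assumes T: "0 \<le> T"
    and d: "\<And>t. t \<in> {0..T} \<Longrightarrow> (f has_real_derivative f' t) (at t within {0..T})"
    and A: "\<And>t. t \<in> {0..T} \<Longrightarrow> (A has_real_derivative \<alpha> t) (at t within {0..T})"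
    and A0: "A 0 = 0" "\<And>t. t \<in> {0..T} \<Longrightarrow> A t \<ge> 0"
    and le: "\<And>t. t \<in> {0<..<T} \<Longrightarrow> f' t \<le> \<alpha> t * f t + b" and b: "b \<ge> 0"
  shows "f T \<le> exp (A T) * (f 0 + b * T)"
proof -
  have "(\<lambda>t. exp (- A t) * f t - b * t) T \<le> (\<lambda>t. exp (- A t) * f t - b * t) 0"
  proof (rule nonincreasing_of_deriv[OF T])
    fix t assume t: "t \<in> {0..T}"
    show "((\<lambda>t. exp (- A t) * f t - b * t) has_real_derivative (exp (- A t) * (f' t - \<alpha> t * f t) - b)) (at t within {0..T})"
      by (rule derivative_eq_intros d[OF t] A[OF t] refl | simp add: algebra_simps)+
  next
    fix t assume t: "t \<in> {0<..<T}"
    have "exp (- A t) * (f' t - \<alpha> t * f t) \<le> exp (- A t) * b" using le[OF t] by (intro mult_left_mono) auto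
    also have "\<dots> \<le> 1 * b" using A0(2)[of t] t b by (intro mult_right_mono) auto
    finally show "exp (- A t) * (f' t - \<alpha> t * f t) - b \<le> 0" by simp
  qed
  then have "exp (- A T) * f T \<le> f 0 + b * T" by (simp add: A0)
  then have "exp (A T) * (exp (- A T) * f T) \<le> exp (A T) * (f 0 + b * T)" by (rule mult_left_mono) simp
  then show ?thesis by (simp add: mult.assoc[symmetric] exp_add[symmetric])
qed

text \<open>
  The reciprocal square root of \<open>f\<close> decreases at rate at most \<open>c / 2\<close>, so it is at least half of
  its initial value as long as \<open>c * T * sqrt (f 0) \<le> 1\<close>.
\<close>

lemma three_halves_bound:
  fixes f :: "real \<Rightarrow> real"
  assumes T: "0 \<le> T"
    and d: "\<And>t. t \<in> {0..T} \<Longrightarrow> (f has_real_derivative f' t) (at t within {0..T})"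
    and pos: "\<And>t. t \<in> {0..T} \<Longrightarrow> f t > 0"
    and le: "\<And>t. t \<in> {0<..<T} \<Longrightarrow> f' t \<le> c * f t * sqrt (f t)"
    and c: "c \<ge> 0" and small: "c * T * sqrt (f 0) \<le> 1"
  shows "f T \<le> 4 * f 0"
proof -
  have "(\<lambda>t. - inverse (sqrt (f t)) - c / 2 * t) T \<le> (\<lambda>t. - inverse (sqrt (f t)) - c / 2 * t) 0"
  proof (rule nonincreasing_of_deriv[OF T])
    fix t assume t: "t \<in> {0..T}"
    have p: "f t > 0" "sqrt (f t) \<noteq> 0" using pos[OF t] by auto
    have ds: "((\<lambda>t. sqrt (f t)) has_real_derivative (inverse (sqrt (f t)) / 2 * f' t)) (at t within {0..T})"
      by (rule DERIV_chain2[OF DERIV_real_sqrt[OF p(1)] d[OF t]])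
    show "((\<lambda>t. - inverse (sqrt (f t)) - c / 2 * t) has_real_derivative
        (f' t / (2 * (sqrt (f t) * sqrt (f t) * sqrt (f t))) - c / 2)) (at t within {0..T})"
      by (rule DERIV_cong[OF DERIV_diff[OF DERIV_minus[OF DERIV_inverse'[OF ds p(2)]] DERIV_cmult_Id[of "c / 2"]]])
        (use p in \<open>simp add: field_simps\<close>)
  next
    fix t assume t: "t \<in> {0<..<T}"
    then have p: "f t > 0" using pos by auto
    then have "f' t / (2 * (sqrt (f t) * sqrt (f t) * sqrt (f t))) \<le> (c * f t * sqrt (f t)) / (2 * (sqrt (f t) * sqrt (f t) * sqrt (f t)))"
      using le[OF t] by (intro divide_right_mono) auto
    also have "\<dots> = c / 2" using p by simp
    finally show "f' t / (2 * (sqrt (f t) * sqrt (f t) * sqrt (f t))) - c / 2 \<le> 0" by simp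
  qed
  then have 1: "inverse (sqrt (f 0)) - c / 2 * T \<le> inverse (sqrt (f T))" by simp
  have p: "f 0 > 0" "f T > 0" using pos T by auto
  have "c * T \<le> inverse (sqrt (f 0))" using small p by (simp add: field_simps)
  with 1 have "inverse (sqrt (f 0)) / 2 \<le> inverse (sqrt (f T))" by linarith
  then have "sqrt (f T) \<le> 2 * sqrt (f 0)" using p by (simp add: field_simps)
  then have "sqrt (f T) \<le> sqrt (4 * f 0)" by (simp add: real_sqrt_mult)
  then show ?thesis by simp
qed

text \<open>
  The right-hand side is cut off outside of a ball, which makes it globally Lipschitz; as it is
  orthogonal to the solution, the norm is constant and the solution never feels the cut-off. The
  range of the projection \<open>Q\<close> stands for the band-limited Hermitian classes.
\<close>

lemma quadratic_ODE:
  fixes G :: "'a::{real_inner, banach} \<Rightarrow> 'a"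
  assumes lip: "\<And>x y. norm (G x - G y) \<le> K * (norm x + norm y) * norm (x - y)"
    and G0: "G 0 = 0" and K: "K > 0" and Q: "bounded_linear Q" and QG: "\<And>x. Q (G x) = G x"
    and orth: "\<And>x. Q x = x \<Longrightarrow> inner x (G x) = 0" and x0: "Q x0 = x0" and T: "T > 0"
  shows "\<exists>u. u 0 = x0 \<and> (\<forall>t\<in>{0..T}. (u has_vector_derivative G (u t)) (at t within {0..T})) \<and>
     (\<forall>t\<in>{0..T}. Q (u t) = u t \<and> norm (u t) = norm x0)"
proof -
  define m where "m = norm x0 + 1"
  have m: "m > 0" by (simp add: m_def add_nonneg_pos)
  \<comment> \<open>The cut-off equals \<open>1\<close> up to radius \<open>m\<close>, which exceeds the norm of \<open>x0\<close>, and vanishes from \<open>2 * m\<close> on.\<close>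
  define ct where "ct r = max 0 (min 1 (2 - r / m))" for r :: real
  have ct1: "0 \<le> ct r" "ct r \<le> 1" for r by (auto simp: ct_def)
  have ct0: "ct r = 0" if "r \<ge> 2 * m" for r using that m by (simp add: ct_def field_simps)
  have ctL: "\<bar>ct r - ct r'\<bar> \<le> \<bar>r - r'\<bar> / m" for r r'
  proof -
    have "\<bar>ct r - ct r'\<bar> \<le> \<bar>r / m - r' / m\<bar>" unfolding ct_def by linarith
    also have "\<dots> = \<bar>r - r'\<bar> / m" using m by (simp add: diff_divide_distrib[symmetric])
    finally show ?thesis .
  qed
  define F where "F x = ct (norm x) *\<^sub>R G x" for x
  have Gb: "norm (G x) \<le> K * norm x * norm x" for x using lip[of x 0] by (simp add: G0)
  have wlog: "norm (F x - F y) \<le> (8 * K * m) * norm (x - y)" if x: "norm x \<le> 2 * m" for x y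
  proof -
    have eq: "F x - F y = (ct (norm x) - ct (norm y)) *\<^sub>R G x + ct (norm y) *\<^sub>R (G x - G y)"
      by (simp add: F_def algebra_simps)
    have a: "norm ((ct (norm x) - ct (norm y)) *\<^sub>R G x) \<le> (norm (x - y) / m) * (K * (2 * m) * (2 * m))"
    proof -
      have "\<bar>ct (norm x) - ct (norm y)\<bar> \<le> \<bar>norm x - norm y\<bar> / m" by (rule ctL)
      also have "\<dots> \<le> norm (x - y) / m" using m by (intro divide_right_mono norm_triangle_ineq3) auto
      finally have 1: "\<bar>ct (norm x) - ct (norm y)\<bar> \<le> norm (x - y) / m" .
      have "norm (G x) \<le> K * norm x * norm x" by (rule Gb)
      also have "\<dots> \<le> K * (2 * m) * (2 * m)" using x K m by (intro mult_mono) auto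
      finally show ?thesis using 1 m by (simp only: norm_scaleR) (intro mult_mono, auto)
    qed
    have b: "norm (ct (norm y) *\<^sub>R (G x - G y)) \<le> K * (2 * m + 2 * m) * norm (x - y)"
    proof (cases "norm y \<le> 2 * m")
      case True
      have "norm (ct (norm y) *\<^sub>R (G x - G y)) \<le> 1 * norm (G x - G y)"
        unfolding norm_scaleR using ct1 by (intro mult_right_mono) auto
      also have "\<dots> \<le> K * (norm x + norm y) * norm (x - y)" using lip by simp
      also have "\<dots> \<le> K * (2 * m + 2 * m) * norm (x - y)"
        using x True K by (intro mult_right_mono mult_left_mono) auto
      finally show ?thesis .
    next
      case False
      then show ?thesis using ct0[of "norm y"] K m by simp
    qed
    have "norm (F x - F y) \<le> (norm (x - y) / m) * (K * (2 * m) * (2 * m)) + K * (2 * m + 2 * m) * norm (x - y)"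
      unfolding eq by (rule norm_triangle_le) (use a b in linarith)
    also have "\<dots> = (8 * K * m) * norm (x - y)" using m by (simp add: field_simps)
    finally show ?thesis .
  qed
  have lipF: "norm (F x - F y) \<le> (8 * K * m) * norm (x - y)" for x y
  proof (cases "norm x \<le> 2 * m")
    case True then show ?thesis by (rule wlog)
  next
    case x: False
    show ?thesis
    proof (cases "norm y \<le> 2 * m")
      case True
      then show ?thesis using wlog[of y x] by (simp add: norm_minus_commute)
    next
      case False
      then have "F x = 0" "F y = 0" using x ct0 by (auto simp: F_def)
      then show ?thesis using K m by simp
    qed
  qed
  have L: "8 * K * m > 0" using K m by simp
  obtain u where u0: "u 0 = x0" and u: "\<And>t. t \<in> {0..T} \<Longrightarrow> (u has_vector_derivative F (u t)) (at t within {0..T})"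
    using Picard_Lindeloef_global[OF lipF L T, of x0] by blast
  have QF: "Q (F x) = F x" for x
    using QG[of x] by (simp add: F_def linear_cmul[OF bounded_linear.linear[OF Q]])
  have Qu: "Q (u t) = u t" if t: "t \<in> {0..T}" for t
  proof -
    have "((\<lambda>t. Q (u t) - u t) has_vector_derivative 0) (at r within {0..T})" if "r \<in> {0..T}" for r
      using has_vector_derivative_diff[OF bounded_linear.has_vector_derivative[OF Q u[OF that]] u[OF that]]
      by (simp add: QF)
    then obtain c where c: "\<And>r. r \<in> {0..T} \<Longrightarrow> Q (u r) - u r = c"
      using has_vector_derivative_zero_constant[of "{0..T}" "\<lambda>t. Q (u t) - u t"] by blast
    have "c = 0" using c[of 0] T by (simp add: u0 x0)
    then show ?thesis using c[OF t] by simp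
  qed
  have nu: "norm (u t) = norm x0" if t: "t \<in> {0..T}" for t
  proof -
    have "((\<lambda>t. inner (u t) (u t)) has_vector_derivative 0) (at r within {0..T})" if r: "r \<in> {0..T}" for r
    proof -
      have "((\<lambda>t. inner (u t) (u t)) has_derivative (\<lambda>h. inner (u r) (h *\<^sub>R F (u r)) + inner (h *\<^sub>R F (u r)) (u r))) (at r within {0..T})"
        using u[OF r] unfolding has_vector_derivative_def by (intro has_derivative_inner)
      moreover have "inner (u r) (F (u r)) = 0" using orth[OF Qu[OF r]] by (simp add: F_def)
      ultimately show ?thesis by (simp add: has_vector_derivative_def inner_commute)
    qed
    then obtain c where c: "\<And>r. r \<in> {0..T} \<Longrightarrow> inner (u r) (u r) = c"
      using has_vector_derivative_zero_constant[of "{0..T}" "\<lambda>t. inner (u t) (u t)"] by blast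
    have "inner (u t) (u t) = inner x0 x0" using c[OF t] c[of 0] T by (simp add: u0)
    then show ?thesis by (simp add: norm_eq_sqrt_inner)
  qed
  have "F (u t) = G (u t)" if "t \<in> {0..T}" for t
    using nu[OF that] m by (simp add: F_def ct_def m_def field_simps)
  then show ?thesis using u u0 Qu nu by (intro exI[of _ u]) auto
qed

section \<open>Reality condition and spectral truncation\<close>

definition refl_cnj :: "l2 \<Rightarrow> l2" where
  "refl_cnj u = cls (\<lambda>k. cnj (rep u (- k)))"

lemma L2_refl_cnj: "(\<lambda>k. cnj (rep u (- k))) \<in> L2"
proof -
  have "integrable lborel (\<lambda>x. (norm (rep u (- x)))\<^sup>2)"
    using lborel_integrable_real_affine[OF L2_integrable[OF rep_L2], of "-1" u 0] by simp
  then show ?thesis by (simp add: L2_def)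
qed

lemma rep_refl_cnj: "AE k in lborel. rep (refl_cnj u) k = cnj (rep u (- k))"
  unfolding refl_cnj_def by (rule rep_cls[OF L2_refl_cnj])

lemma AE_minus: "AE x in lborel. P (x::real) \<Longrightarrow> AE x in lborel. P (- x)"
  using AE_reflect[of P 0] by simp

lemma herm_iff: "herm u \<longleftrightarrow> refl_cnj u = u"
proof
  assume "herm u"
  then have h: "AE k in lborel. rep u (- k) = cnj (rep u k)" by (simp add: herm_def)
  show "refl_cnj u = u"
    by (intro l2_eqI) (use h rep_refl_cnj[of u] in \<open>eventually_elim, simp\<close>)
next
  assume eq: "refl_cnj u = u"
  have "AE k in lborel. rep u k = cnj (rep u (- k))" using rep_refl_cnj[of u] unfolding eq .
  then show "herm u" unfolding herm_def by eventually_elim simp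
qed

lemma refl_cnj_refl_cnj: "refl_cnj (refl_cnj u) = u"
  by (intro l2_eqI) (use rep_refl_cnj[of "refl_cnj u"] AE_minus[OF rep_refl_cnj[of u]] in \<open>eventually_elim, simp\<close>)

lemma bounded_linear_refl_cnj: "bounded_linear refl_cnj"
proof (rule bounded_linear_intro[where K = 1])
  show "refl_cnj (u + v) = refl_cnj u + refl_cnj v" for u v
    by (intro l2_eqI) (use rep_refl_cnj[of "u + v"] rep_refl_cnj[of u] rep_refl_cnj[of v] rep_add[of "refl_cnj u" "refl_cnj v"]
        AE_minus[OF rep_add[of u v]] in \<open>eventually_elim, simp\<close>)
  show "refl_cnj (c *\<^sub>R u) = c *\<^sub>R refl_cnj u" for c u
    by (intro l2_eqI) (use rep_refl_cnj[of "c *\<^sub>R u"] rep_refl_cnj[of u] rep_scaleR[of c "refl_cnj u"]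
        AE_minus[OF rep_scaleR[of c u]] in \<open>eventually_elim, simp\<close>)
  show "norm (refl_cnj u) \<le> norm u * 1" for u
  proof -
    have "ennreal ((norm (refl_cnj u))\<^sup>2) = (\<integral>\<^sup>+x. ennreal ((cmod (cnj (rep u (0 - x))))\<^sup>2) \<partial>lborel)"
      unfolding nn_integral_rep[symmetric]
      by (rule nn_integral_cong_AE) (use rep_refl_cnj[of u] in \<open>eventually_elim, simp\<close>)
    also have "\<dots> = ennreal ((norm u)\<^sup>2)"
      using nn_integral_reflect[of "\<lambda>x. ennreal ((cmod (rep u x))\<^sup>2)" 0] by (simp add: nn_integral_rep)
    finally have "(norm (refl_cnj u))\<^sup>2 = (norm u)\<^sup>2" by simp
    then show ?thesis by (simp add: power2_eq_iff_nonneg)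
  qed
qed

lemma refl_cnj_mul: "bmeas m \<Longrightarrow> (\<And>x. m (- x) = m x) \<Longrightarrow> refl_cnj (mul m u) = mul m (refl_cnj u)"
proof (rule l2_eqI)
  assume m: "bmeas m" and e: "\<And>x. m (- x) = m x"
  show "AE k in lborel. rep (refl_cnj (mul m u)) k = rep (mul m (refl_cnj u)) k"
    using rep_refl_cnj[of "mul m u"] rep_mul[OF m, of "refl_cnj u"] rep_refl_cnj[of u] AE_minus[OF rep_mul[OF m, of u]]
    by eventually_elim (simp add: e)
qed

lemma herm_mul: "bmeas m \<Longrightarrow> (\<And>x. m (- x) = m x) \<Longrightarrow> herm u \<Longrightarrow> herm (mul m u)"
  unfolding herm_iff by (subst refl_cnj_mul) simp_all

lemma herm_add: "herm u \<Longrightarrow> herm v \<Longrightarrow> herm (u + v)"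
  unfolding herm_iff using linear_add[OF bounded_linear.linear[OF bounded_linear_refl_cnj]] by simp

lemma herm_LIMSEQ:
  assumes "\<And>n. herm (X n)" "X \<longlonglongrightarrow> u" shows "herm u"
proof -
  have "(\<lambda>n. refl_cnj (X n)) \<longlonglongrightarrow> refl_cnj u"
    by (rule bounded_linear.tendsto[OF bounded_linear_refl_cnj assms(2)])
  then have "X \<longlonglongrightarrow> refl_cnj u" using assms(1) by (simp add: herm_iff)
  then show ?thesis using assms(2) LIMSEQ_unique unfolding herm_iff by blast
qed

text \<open>
  The projection onto the Hermitian classes.
\<close>

definition hpart :: "l2 \<Rightarrow> l2" where "hpart u = (1/2) *\<^sub>R (u + refl_cnj u)"

lemma bounded_linear_hpart: "bounded_linear hpart"
proof -
  have "bounded_linear (\<lambda>u. (1/2::real) *\<^sub>R (u + refl_cnj u))"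
    by (intro bounded_linear_const_scaleR bounded_linear_add bounded_linear_ident bounded_linear_refl_cnj)
  then show ?thesis by (simp add: hpart_def[abs_def])
qed

lemma herm_hpart: "herm (hpart u)"
proof -
  interpret J: bounded_linear refl_cnj by (rule bounded_linear_refl_cnj)
  show ?thesis unfolding herm_iff hpart_def by (simp add: J.scaleR J.add refl_cnj_refl_cnj add.commute)
qed

lemma hpart_herm: "herm u \<Longrightarrow> hpart u = u"
  by (simp add: herm_iff hpart_def scaleR_add_right[symmetric] scaleR_half_double)

definition cut :: "real \<Rightarrow> l2 \<Rightarrow> l2" where "cut N = mul (indicator {-N..N})"

lemma bmeas_ind: "bmeas (indicator {-N..N::real})"
  by (rule bmeasI[of _ 1]) (auto simp: indicator_def)

lemma rep_cut: "AE k in lborel. rep (cut N u) k = (if \<bar>k\<bar> \<le> N then rep u k else 0)"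
  unfolding cut_def using rep_mul[OF bmeas_ind[of N], of u]
  by eventually_elim (auto simp: indicator_def abs_le_iff)

lemma cut_cut: "cut N (cut N u) = cut N u"
  by (intro l2_eqI) (use rep_cut[of N "cut N u"] rep_cut[of N u] in \<open>eventually_elim, simp\<close>)

lemma cut_cut_le: "N \<le> M \<Longrightarrow> cut M (cut N u) = cut N u"
  by (intro l2_eqI) (use rep_cut[of M "cut N u"] rep_cut[of N u] in \<open>eventually_elim, auto\<close>)

lemma bounded_linear_cut: "bounded_linear (cut N)"
  unfolding cut_def by (rule bounded_linear_mul[OF bmeas_ind])

lemma norm_cut_le: "norm (cut N u) \<le> norm u"
  unfolding cut_def using norm_mul_le[of "indicator {-N..N}" 1 u] by (auto simp: indicator_def)

lemma inner_cut: "inner (cut N u) v = inner u (cut N v)"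
  unfolding cut_def by (rule inner_mul_commute[OF bmeas_ind])

lemma herm_cut: "herm u \<Longrightarrow> herm (cut N u)"
  unfolding cut_def by (rule herm_mul[OF bmeas_ind]) (auto simp: indicator_def)

lemma mul_cut_commute: "bmeas m \<Longrightarrow> mul m (cut N u) = cut N (mul m u)"
proof (rule l2_eqI)
  assume m: "bmeas m"
  show "AE k in lborel. rep (mul m (cut N u)) k = rep (cut N (mul m u)) k"
    using rep_mul[OF m, of "cut N u"] rep_cut[of N u] rep_cut[of N "mul m u"] rep_mul[OF m, of u]
    by eventually_elim auto
qed

lemma hsq_cut_le_norm: "N \<ge> 0 \<Longrightarrow> s \<ge> 0 \<Longrightarrow> hsq s (cut N u) \<le> ennreal ((1 + N powr (2 * s)) * (norm u)\<^sup>2)"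
proof -
  assume N: "N \<ge> 0" and s: "s \<ge> 0"
  have "hsq s (cut N u) \<le> (\<integral>\<^sup>+k. ennreal (1 + N powr (2 * s)) * ennreal ((cmod (rep u k))\<^sup>2) \<partial>lborel)"
    unfolding hsq_def
  proof (rule nn_integral_mono_AE)
    show "AE k in lborel. ennreal ((1 + \<bar>k\<bar> powr (2 * s)) * (cmod (rep (cut N u) k))\<^sup>2)
      \<le> ennreal (1 + N powr (2 * s)) * ennreal ((cmod (rep u k))\<^sup>2)"
      using rep_cut[of N u]
    proof eventually_elim
      case (elim k)
      have "\<bar>k\<bar> powr (2 * s) \<le> N powr (2 * s)" if "\<bar>k\<bar> \<le> N" using that s by (intro powr_mono2) auto
      then show ?case unfolding elim
        by (subst ennreal_mult[symmetric]) (auto intro!: ennreal_leI mult_right_mono)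
    qed
  qed
  also have "\<dots> = ennreal ((1 + N powr (2 * s)) * (norm u)\<^sup>2)"
    by (subst nn_integral_cmult) (auto simp: nn_integral_rep ennreal_mult)
  finally show ?thesis .
qed

lemma norm_cut_tail:
  assumes N: "N \<ge> 0" and s: "s \<ge> 0"
  shows "ennreal (N powr (2 * s) * (norm (u - cut N u))\<^sup>2) \<le> hsq s u"
proof -
  have "ennreal (N powr (2 * s) * (norm (u - cut N u))\<^sup>2)
     = (\<integral>\<^sup>+k. ennreal (N powr (2 * s)) * ennreal ((cmod (rep (u - cut N u) k))\<^sup>2) \<partial>lborel)"
    by (subst nn_integral_cmult) (auto simp: nn_integral_rep ennreal_mult)
  also have "\<dots> \<le> hsq s u" unfolding hsq_def
  proof (rule nn_integral_mono_AE)
    show "AE k in lborel. ennreal (N powr (2 * s)) * ennreal ((cmod (rep (u - cut N u) k))\<^sup>2)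
      \<le> ennreal ((1 + \<bar>k\<bar> powr (2 * s)) * (cmod (rep u k))\<^sup>2)"
      using rep_cut[of N u] rep_diff[of u "cut N u"]
    proof eventually_elim
      case (elim k)
      have "N powr (2 * s) \<le> 1 + \<bar>k\<bar> powr (2 * s)" if "\<not> \<bar>k\<bar> \<le> N"
      proof -
        have "N powr (2 * s) \<le> \<bar>k\<bar> powr (2 * s)" using that s N by (intro powr_mono2) auto
        then show ?thesis by simp
      qed
      then show ?case unfolding elim
        by (subst ennreal_mult[symmetric]) (auto intro!: ennreal_leI mult_right_mono)
    qed
  qed
  finally show ?thesis .
qed

section \<open>Truncated Sobolev weights\<close>

text \<open>
  Even functions \<open>c\<close> between \<open>0\<close> and \<open>1\<close>, nondecreasing in the modulus and with \<open>c x / x\<close>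
  nonincreasing for positive \<open>x\<close>, such as \<open>1\<close> and \<open>min 1 (\<bar>x\<bar> / R)\<close>. This condition is invariant
  under dilations, so that the energy estimates with the weights \<open>wt s N k * c k\<close> have the same
  constant for all \<open>R\<close>.
\<close>

definition slow_ramp :: "(real \<Rightarrow> real) \<Rightarrow> bool" where
  "slow_ramp c \<longleftrightarrow> c \<in> borel_measurable borel \<and> (\<forall>x. 0 \<le> c x \<and> c x \<le> 1 \<and> c (- x) = c x) \<and>
     (\<forall>x y. 0 \<le> y \<longrightarrow> y \<le> x \<longrightarrow> c y \<le> c x) \<and>
     (\<forall>x y. 0 < y \<longrightarrow> y \<le> x \<longrightarrow> y * (c x - c y) \<le> (x - y) * c y)"

lemma slow_ramp_one: "slow_ramp (\<lambda>x. 1)" by (simp add: slow_ramp_def)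

lemma slow_ramp_min:
  assumes R: "R > 0" shows "slow_ramp (\<lambda>x. min 1 (\<bar>x\<bar> / R))"
proof -
  have key: "y * (min 1 (\<bar>x\<bar> / R) - min 1 (\<bar>y\<bar> / R)) \<le> (x - y) * min 1 (\<bar>y\<bar> / R)" if y: "0 < y" "y \<le> x" for x y
  proof (cases "y \<ge> R")
    case True
    then show ?thesis using y R by (simp add: min_def)
  next
    case False
    have "y * (min 1 (\<bar>x\<bar> / R) - min 1 (\<bar>y\<bar> / R)) \<le> y * (x / R - y / R)"
      using False y R by (intro mult_left_mono) (auto simp: min_def)
    also have "\<dots> = (x - y) * (y / R)" by (simp add: algebra_simps diff_divide_distrib)
    also have "\<dots> = (x - y) * min 1 (\<bar>y\<bar> / R)" using False y R by (simp add: min_def)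
    finally show ?thesis .
  qed
  have mono: "min 1 (\<bar>y\<bar> / R) \<le> min 1 (\<bar>x\<bar> / R)" if "0 \<le> y" "y \<le> x" for x y
    using that R by (intro min.mono) (auto intro: divide_right_mono)
  show ?thesis unfolding slow_ramp_def using key mono R by auto
qed

text \<open>
  The Sobolev weight, made bounded by truncation at \<open>N\<close>, so that the energy is finite and
  differentiable for every differentiable curve in \<open>L\<^sup>2\<close>.
\<close>

definition wt :: "real \<Rightarrow> real \<Rightarrow> real \<Rightarrow> real" where
  "wt s N k = 1 + (min \<bar>k\<bar> N) powr (2 * s)"

text \<open>
  The constant of the class \<open>energy_weight\<close> for truncated Sobolev weights, uniform in the
  truncation and in the ramp.
\<close>

definition wconst :: "real \<Rightarrow> real" where
  "wconst s = 1 + 2 * (2 * s * 2 powr (2 * s))"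

lemma wt_measurable [measurable]: "wt s N \<in> borel_measurable borel"
  unfolding wt_def by measurable

text \<open>
  The mean value theorem, where the intermediate point is at most \<open>2 * y\<close>.
\<close>

lemma powr_increment:
  fixes x y :: real
  assumes y: "0 < y" "y \<le> x" "x \<le> 2 * y" and p: "p \<ge> 1"
  shows "y * (x powr p - y powr p) \<le> (p * 2 powr p) * (x - y) * y powr p"
proof (cases "x = y")
  case False
  then have xy: "y < x" using y by simp
  have der: "((\<lambda>z. z powr p) has_real_derivative p * z powr (p - 1)) (at z)" if "y \<le> z" "z \<le> x" for z
    using y that by (intro has_real_derivative_powr) auto
  obtain z where z: "y < z" "z < x" "x powr p - y powr p = (x - y) * (p * z powr (p - 1))"
    using MVT2[OF xy der] by blast
  have "z powr (p - 1) \<le> (2 * y) powr (p - 1)" using z y p by (intro powr_mono2) auto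
  also have "\<dots> = 2 powr (p - 1) * y powr (p - 1)" using y by (simp add: powr_mult)
  also have "\<dots> \<le> 2 powr p * y powr (p - 1)" by (intro mult_right_mono powr_mono) auto
  finally have "y * z powr (p - 1) \<le> y * (2 powr p * y powr (p - 1))" using y by (intro mult_left_mono) auto
  also have "\<dots> = 2 powr p * y powr p"
  proof -
    have "y powr (1 + (p - 1)) = y * y powr (p - 1)" using y by (simp only: powr_add) simp
    then show ?thesis by simp
  qed
  finally have "(x - y) * p * (y * z powr (p - 1)) \<le> (x - y) * p * (2 powr p * y powr p)"
    using xy p by (intro mult_left_mono) auto
  then show ?thesis unfolding z(3) by (simp add: ac_simps)
qed simp

text \<open>
  The product rule for increments.
\<close>

lemma energy_weight_wt:
  assumes s: "s \<ge> 1" and N: "N \<ge> 0" and c: "slow_ramp c"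
  shows "energy_weight (wconst s) (\<lambda>k. wt s N k * c k)"
proof -
  have cm [measurable]: "c \<in> borel_measurable borel" and c01: "\<And>x. 0 \<le> c x" "\<And>x. c x \<le> 1" and ce: "\<And>x. c (- x) = c x"
    and cmono: "\<And>x y. 0 \<le> y \<Longrightarrow> y \<le> x \<Longrightarrow> c y \<le> c x"
    and cinc: "\<And>x y. 0 < y \<Longrightarrow> y \<le> x \<Longrightarrow> y * (c x - c y) \<le> (x - y) * c y"
    using c unfolding slow_ramp_def by blast+
  define q where "q = 2 * s * 2 powr (2 * s)"
  have q: "q \<ge> 0" using s by (simp add: q_def)
  have w1: "1 \<le> wt s N x" for x by (simp add: wt_def)
  have w0: "0 \<le> wt s N x" for x using w1[of x] by linarith
  have wb: "wt s N x \<le> 1 + N powr (2 * s)" for x using s N by (auto simp: wt_def intro!: powr_mono2)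
  have wmono: "wt s N y \<le> wt s N x" if "0 \<le> y" "y \<le> x" for x y
    using that s N by (auto simp: wt_def intro!: powr_mono2)
  have winc: "y * (wt s N x - wt s N y) \<le> q * (x - y) * wt s N y" if y: "0 < y" "y \<le> x" "x \<le> 2 * y" for x y
  proof (cases "N \<le> y")
    case True
    then have "min \<bar>x\<bar> N = min \<bar>y\<bar> N" using y by linarith
    then have "wt s N x = wt s N y" by (simp add: wt_def)
    then show ?thesis using q y w0[of y] by simp
  next
    case False
    have "wt s N x \<le> 1 + x powr (2 * s)" using y s N by (auto simp: wt_def intro!: powr_mono2)
    moreover have wy: "wt s N y = 1 + y powr (2 * s)" using False y by (simp add: wt_def min_def)
    ultimately have "y * (wt s N x - wt s N y) \<le> y * (x powr (2 * s) - y powr (2 * s))"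
      using y by (intro mult_left_mono) auto
    also have "\<dots> \<le> q * (x - y) * y powr (2 * s)" unfolding q_def by (rule powr_increment) (use y s in auto)
    also have "\<dots> \<le> q * (x - y) * wt s N y" using q y unfolding wy by (intro mult_left_mono) auto
    finally show ?thesis .
  qed
  have inc: "y * (wt s N x * c x - wt s N y * c y) \<le> wconst s * (x - y) * (wt s N y * c y)"
    if y: "0 < y" "y \<le> x" "x \<le> 2 * y" for x y
  proof -
    have "y * (wt s N x - wt s N y) \<le> q * y * wt s N y"
      by (rule order_trans[OF winc[OF y]]) (use y q w0[of y] in \<open>intro mult_right_mono mult_left_mono, auto\<close>)
    then have "y * (wt s N x - wt s N y) \<le> y * (q * wt s N y)" by (simp add: ac_simps)
    then have "wt s N x - wt s N y \<le> q * wt s N y" using y by simp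
    then have le: "wt s N x \<le> (1 + q) * wt s N y" by (simp add: algebra_simps)
    have "y * (wt s N x * c x - wt s N y * c y) = wt s N x * (y * (c x - c y)) + c y * (y * (wt s N x - wt s N y))"
      by (simp add: algebra_simps)
    also have "\<dots> \<le> ((1 + q) * wt s N y) * ((x - y) * c y) + c y * (q * (x - y) * wt s N y)"
    proof (rule add_mono)
      have nn: "0 \<le> y * (c x - c y)" using y cmono[of y x] by simp
      show "wt s N x * (y * (c x - c y)) \<le> ((1 + q) * wt s N y) * ((x - y) * c y)"
        by (rule mult_mono[OF le cinc[OF y(1,2)]]) (use q w0[of y] nn in auto)
      show "c y * (y * (wt s N x - wt s N y)) \<le> c y * (q * (x - y) * wt s N y)"
        by (intro mult_left_mono winc[OF y] c01)
    qed
    also have "\<dots> = (1 + 2 * q) * (x - y) * (wt s N y * c y)" by (simp add: algebra_simps)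
    finally show ?thesis by (simp add: wconst_def q_def)
  qed
  have "bmeas (\<lambda>k. wt s N k * c k)"
  proof (rule bmeasI)
    show "\<bar>wt s N x * c x\<bar> \<le> (1 + N powr (2 * s)) * 1" for x
      using w0[of x] wb[of x] c01[of x] by (simp only: abs_mult abs_of_nonneg) (intro mult_mono, auto)
  qed measurable
  moreover have "wt s N (- x) * c (- x) = wt s N x * c x" for x by (simp add: wt_def ce)
  moreover have "wt s N y * c y \<le> wt s N x * c x" if "0 \<le> y" "y \<le> x" for x y
    using that w0 c01 by (intro mult_mono wmono cmono) auto
  ultimately show ?thesis unfolding energy_weight_def using w0 c01 inc by simp
qed

text \<open>
  The part of \<open>hsq s u\<close> that is selected by \<open>c\<close>; for the ramp \<open>min 1 (\<bar>x\<bar> / R)\<close> this is the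
  contribution of high frequencies.
\<close>

definition hsq_ramp :: "real \<Rightarrow> (real \<Rightarrow> real) \<Rightarrow> l2 \<Rightarrow> ennreal" where
  "hsq_ramp s c u = (\<integral>\<^sup>+k. ennreal ((1 + \<bar>k\<bar> powr (2 * s)) * c k * (cmod (rep u k))\<^sup>2) \<partial>lborel)"

lemma hsq_eq_hsq_ramp: "hsq s u = hsq_ramp s (\<lambda>x. 1) u"
  by (simp add: hsq_def hsq_ramp_def)

text \<open>
  Energies with bounded weights increase to the full one.
\<close>

lemma hsq_ramp_SUP:
  assumes s: "s \<ge> 1" and c: "slow_ramp c"
  shows "hsq_ramp s c u = (SUP N::nat. ennreal (inner (mul (\<lambda>k. wt s (real N) k * c k) u) u))"
proof -
  have [measurable]: "c \<in> borel_measurable borel" and c0: "\<And>x. 0 \<le> c x" using c unfolding slow_ramp_def by blast+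
  let ?f = "\<lambda>N k. ennreal (wt s (real N) k * c k * (cmod (rep u k))\<^sup>2)"
  have eq: "ennreal (inner (mul (\<lambda>k. wt s (real N) k * c k) u) u) = (\<integral>\<^sup>+k. ?f N k \<partial>lborel)" for N
    using energy_weight_wt[OF s _ c, of "real N"] by (intro inner_mul_self) (auto simp: energy_weight_def)
  have le: "wt s (real N) k \<le> wt s (real M) k" if "N \<le> M" for N M k
    using that s by (auto simp: wt_def intro!: powr_mono2)
  have inc: "incseq ?f"
    unfolding incseq_def le_fun_def using le c0 by (auto intro!: ennreal_leI mult_right_mono)
  have "(SUP N. ?f N k) = ennreal ((1 + \<bar>k\<bar> powr (2 * s)) * c k * (cmod (rep u k))\<^sup>2)" for k
  proof (rule antisym)
    have w: "wt s (real N) k \<le> 1 + \<bar>k\<bar> powr (2 * s)" for N using s by (auto simp: wt_def intro!: powr_mono2)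
    show "(SUP N. ?f N k) \<le> ennreal ((1 + \<bar>k\<bar> powr (2 * s)) * c k * (cmod (rep u k))\<^sup>2)"
      using w c0 by (intro SUP_least ennreal_leI mult_right_mono) auto
    obtain N :: nat where N: "\<bar>k\<bar> \<le> real N" using real_arch_simple by blast
    then have "wt s (real N) k = 1 + \<bar>k\<bar> powr (2 * s)" by (simp add: wt_def min_def)
    then show "ennreal ((1 + \<bar>k\<bar> powr (2 * s)) * c k * (cmod (rep u k))\<^sup>2) \<le> (SUP N. ?f N k)"
      by (intro SUP_upper2[of N]) auto
  qed
  then have "hsq_ramp s c u = (\<integral>\<^sup>+k. (SUP N. ?f N k) \<partial>lborel)" by (simp add: hsq_ramp_def)
  also have "\<dots> = (SUP N. \<integral>\<^sup>+k. ?f N k \<partial>lborel)"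
    by (rule nn_integral_monotone_convergence_SUP[OF inc]) measurable
  finally show ?thesis by (simp add: eq)
qed

lemma inner_wt_le_hsq_ramp:
  assumes s: "s \<ge> 1" and c: "slow_ramp c" and N: "N \<ge> 0"
  shows "ennreal (inner (mul (\<lambda>k. wt s N k * c k) u) u) \<le> hsq_ramp s c u"
proof -
  have W: "energy_weight (wconst s) (\<lambda>k. wt s N k * c k)" by (rule energy_weight_wt[OF s N c])
  have c0: "\<And>x. 0 \<le> c x" using c unfolding slow_ramp_def by blast
  have w: "wt s N k \<le> 1 + \<bar>k\<bar> powr (2 * s)" for k using s N by (auto simp: wt_def intro!: powr_mono2)
  have "ennreal (inner (mul (\<lambda>k. wt s N k * c k) u) u) = (\<integral>\<^sup>+k. ennreal (wt s N k * c k * (cmod (rep u k))\<^sup>2) \<partial>lborel)"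
    using W by (intro inner_mul_self) (auto simp: energy_weight_def)
  also have "\<dots> \<le> hsq_ramp s c u" unfolding hsq_ramp_def
    using w c0 by (intro nn_integral_mono ennreal_leI mult_right_mono) auto
  finally show ?thesis .
qed

lemma hsq_ramp_add_le: "slow_ramp c \<Longrightarrow> hsq_ramp s c (u + v) \<le> 2 * hsq_ramp s c u + 2 * hsq_ramp s c v"
proof -
  assume c: "slow_ramp c"
  then have [measurable]: "c \<in> borel_measurable borel" and c0: "\<And>x. 0 \<le> c x" unfolding slow_ramp_def by blast+
  have "hsq_ramp s c (u + v) \<le> (\<integral>\<^sup>+k. 2 * ennreal ((1 + \<bar>k\<bar> powr (2 * s)) * c k * (cmod (rep u k))\<^sup>2)
      + 2 * ennreal ((1 + \<bar>k\<bar> powr (2 * s)) * c k * (cmod (rep v k))\<^sup>2) \<partial>lborel)"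
    unfolding hsq_ramp_def
  proof (rule nn_integral_mono_AE)
    show "AE k in lborel. ennreal ((1 + \<bar>k\<bar> powr (2 * s)) * c k * (cmod (rep (u + v) k))\<^sup>2)
      \<le> 2 * ennreal ((1 + \<bar>k\<bar> powr (2 * s)) * c k * (cmod (rep u k))\<^sup>2)
        + 2 * ennreal ((1 + \<bar>k\<bar> powr (2 * s)) * c k * (cmod (rep v k))\<^sup>2)"
      using rep_add[of u v]
    proof eventually_elim
      case (elim k)
      define w where "w = (1 + \<bar>k\<bar> powr (2 * s)) * c k"
      have w: "w \<ge> 0" using c0 by (simp add: w_def)
      have "(cmod (rep u k + rep v k))\<^sup>2 \<le> (cmod (rep u k) + cmod (rep v k))\<^sup>2"
        by (intro power_mono norm_triangle_ineq) auto
      also have "\<dots> \<le> 2 * (cmod (rep u k))\<^sup>2 + 2 * (cmod (rep v k))\<^sup>2"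
        using sum_squares_bound[of "cmod (rep u k)" "cmod (rep v k)"] by (simp add: power2_sum)
      finally have "w * (cmod (rep u k + rep v k))\<^sup>2 \<le> w * (2 * (cmod (rep u k))\<^sup>2 + 2 * (cmod (rep v k))\<^sup>2)"
        by (rule mult_left_mono) (rule w)
      also have "\<dots> = 2 * (w * (cmod (rep u k))\<^sup>2) + 2 * (w * (cmod (rep v k))\<^sup>2)"
        by (simp add: algebra_simps)
      finally have "ennreal (w * (cmod (rep (u + v) k))\<^sup>2)
          \<le> ennreal (2 * (w * (cmod (rep u k))\<^sup>2) + 2 * (w * (cmod (rep v k))\<^sup>2))"
        unfolding elim by (rule ennreal_leI)
      also have "\<dots> = 2 * ennreal (w * (cmod (rep u k))\<^sup>2) + 2 * ennreal (w * (cmod (rep v k))\<^sup>2)"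
        using w by (subst ennreal_plus) (simp_all add: ennreal_mult)
      finally show ?case by (simp add: w_def)
    qed
  qed
  also have "\<dots> = 2 * hsq_ramp s c u + 2 * hsq_ramp s c v"
    unfolding hsq_ramp_def by (subst nn_integral_add) (auto simp: nn_integral_cmult)
  finally show ?thesis .
qed

lemma hsq_ramp_minus: "hsq_ramp s c (- u) = hsq_ramp s c u"
  unfolding hsq_ramp_def by (rule nn_integral_cong_AE) (use rep_minus[of u] in \<open>eventually_elim, simp\<close>)

lemma hsq_ramp_diff_le: "slow_ramp c \<Longrightarrow> hsq_ramp s c (u - v) \<le> 2 * hsq_ramp s c u + 2 * hsq_ramp s c v"
  using hsq_ramp_add_le[of c s u "- v"] by (simp add: hsq_ramp_minus)

lemma hsq_ramp_cut_le: "slow_ramp c \<Longrightarrow> hsq_ramp s c (cut N u) \<le> hsq_ramp s c u"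
proof -
  assume c: "slow_ramp c"
  then have c0: "\<And>x. 0 \<le> c x" unfolding slow_ramp_def by blast
  show ?thesis unfolding hsq_ramp_def
  proof (rule nn_integral_mono_AE)
    show "AE k in lborel. ennreal ((1 + \<bar>k\<bar> powr (2 * s)) * c k * (cmod (rep (cut N u) k))\<^sup>2)
       \<le> ennreal ((1 + \<bar>k\<bar> powr (2 * s)) * c k * (cmod (rep u k))\<^sup>2)"
      using rep_cut[of N u] by eventually_elim (use c0 in auto)
  qed
qed

text \<open>
  The ramp equals \<open>1\<close> for \<open>\<bar>k\<bar> \<ge> R\<close>, and the Sobolev weight is bounded for \<open>\<bar>k\<bar> \<le> R\<close>.
\<close>

lemma hsq_split_tail:
  assumes R: "R > 0" and s: "s \<ge> 0"
  shows "hsq s u \<le> ennreal ((1 + R powr (2 * s)) * (norm u)\<^sup>2) + hsq_ramp s (\<lambda>x. min 1 (\<bar>x\<bar> / R)) u"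
proof -
  have "hsq s u \<le> (\<integral>\<^sup>+k. ennreal (1 + R powr (2 * s)) * ennreal ((cmod (rep u k))\<^sup>2)
     + ennreal ((1 + \<bar>k\<bar> powr (2 * s)) * min 1 (\<bar>k\<bar> / R) * (cmod (rep u k))\<^sup>2) \<partial>lborel)"
    unfolding hsq_def
  proof (rule nn_integral_mono)
    fix k :: real
    show "ennreal ((1 + \<bar>k\<bar> powr (2 * s)) * (cmod (rep u k))\<^sup>2) \<le> ennreal (1 + R powr (2 * s)) * ennreal ((cmod (rep u k))\<^sup>2)
     + ennreal ((1 + \<bar>k\<bar> powr (2 * s)) * min 1 (\<bar>k\<bar> / R) * (cmod (rep u k))\<^sup>2)"
    proof (cases "\<bar>k\<bar> \<le> R")
      case True
      then have "\<bar>k\<bar> powr (2 * s) \<le> R powr (2 * s)" using s by (intro powr_mono2) auto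
      then have "ennreal ((1 + \<bar>k\<bar> powr (2 * s)) * (cmod (rep u k))\<^sup>2) \<le> ennreal (1 + R powr (2 * s)) * ennreal ((cmod (rep u k))\<^sup>2)"
        by (subst ennreal_mult[symmetric]) (auto intro!: ennreal_leI mult_right_mono)
      then show ?thesis by (rule order_trans) simp
    next
      case False
      then have "min 1 (\<bar>k\<bar> / R) = 1" using R by (simp add: min_def)
      then show ?thesis by simp
    qed
  qed
  also have "\<dots> = ennreal ((1 + R powr (2 * s)) * (norm u)\<^sup>2) + hsq_ramp s (\<lambda>x. min 1 (\<bar>x\<bar> / R)) u"
    unfolding hsq_ramp_def
    by (subst nn_integral_add, measurable, measurable, subst nn_integral_cmult) (auto simp: nn_integral_rep ennreal_mult)
  finally show ?thesis .
qed

lemma hsq_ramp_vanishes: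
  assumes u: "hsq s u < \<infinity>"
  shows "(\<lambda>n. hsq_ramp s (\<lambda>x. min 1 (\<bar>x\<bar> / real (Suc n))) u) \<longlonglongrightarrow> 0"
proof -
  have "(\<lambda>n. hsq_ramp s (\<lambda>x. min 1 (\<bar>x\<bar> / real (Suc n))) u) \<longlonglongrightarrow> (\<integral>\<^sup>+k. 0 \<partial>(lborel :: real measure))"
    unfolding hsq_ramp_def
  proof (rule nn_integral_dominated_convergence[where w = "\<lambda>k. ennreal ((1 + \<bar>k\<bar> powr (2 * s)) * (cmod (rep u k))\<^sup>2)"])
    show "(\<integral>\<^sup>+k. ennreal ((1 + \<bar>k\<bar> powr (2 * s)) * (cmod (rep u k))\<^sup>2) \<partial>lborel) < \<infinity>" using u by (simp add: hsq_def)
    show "AE k in lborel. ennreal ((1 + \<bar>k\<bar> powr (2 * s)) * min 1 (\<bar>k\<bar> / real (Suc j)) * (cmod (rep u k))\<^sup>2)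
       \<le> ennreal ((1 + \<bar>k\<bar> powr (2 * s)) * (cmod (rep u k))\<^sup>2)" for j
      by (intro AE_I2 ennreal_leI mult_right_mono) (auto intro!: mult_left_le)
    show "AE k in lborel. (\<lambda>n. ennreal ((1 + \<bar>k\<bar> powr (2 * s)) * min 1 (\<bar>k\<bar> / real (Suc n)) * (cmod (rep u k))\<^sup>2)) \<longlonglongrightarrow> 0"
    proof (rule AE_I2)
      fix k :: real
      have "(\<lambda>n. \<bar>k\<bar> / real (Suc n)) \<longlonglongrightarrow> 0" using LIMSEQ_Suc[OF lim_const_over_n[of "\<bar>k\<bar>"]] by simp
      then have "(\<lambda>n. min 1 (\<bar>k\<bar> / real (Suc n))) \<longlonglongrightarrow> min 1 0" by (intro tendsto_intros)
      then have "(\<lambda>n. (1 + \<bar>k\<bar> powr (2 * s)) * min 1 (\<bar>k\<bar> / real (Suc n)) * (cmod (rep u k))\<^sup>2)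
         \<longlonglongrightarrow> (1 + \<bar>k\<bar> powr (2 * s)) * min 1 0 * (cmod (rep u k))\<^sup>2"
        by (intro tendsto_mult tendsto_const)
      then show "(\<lambda>n. ennreal ((1 + \<bar>k\<bar> powr (2 * s)) * min 1 (\<bar>k\<bar> / real (Suc n)) * (cmod (rep u k))\<^sup>2)) \<longlonglongrightarrow> 0"
        by (subst ennreal_0[symmetric], intro tendsto_ennrealI) simp
    qed
  qed measurable
  then show ?thesis by simp
qed

text \<open>
  As a supremum of continuous functions on \<open>L\<^sup>2\<close>, \<open>hsq\<close> is lower semicontinuous.
\<close>

lemma hsq_lsc:
  assumes s: "s \<ge> 1" and X: "X \<longlonglongrightarrow> u" and bd: "\<And>n. n \<ge> k \<Longrightarrow> hsq s (X n) \<le> C"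
  shows "hsq s u \<le> C"
proof -
  have "ennreal (inner (mul (\<lambda>k. wt s (real N) k * 1) u) u) \<le> C" for N
  proof -
    have W: "bmeas (\<lambda>k. wt s (real N) k * 1)" using energy_weight_wt[OF s _ slow_ramp_one, of "real N"] by (simp add: energy_weight_def)
    have "(\<lambda>n. ennreal (inner (mul (\<lambda>k. wt s (real N) k * 1) (X n)) (X n))) \<longlonglongrightarrow> ennreal (inner (mul (\<lambda>k. wt s (real N) k * 1) u) u)"
      by (intro tendsto_ennrealI tendsto_inner bounded_linear.tendsto[OF bounded_linear_mul[OF W]] X)
    then show ?thesis
    proof (rule LIMSEQ_le_const2)
      show "\<exists>M. \<forall>n\<ge>M. ennreal (inner (mul (\<lambda>k. wt s (real N) k * 1) (X n)) (X n)) \<le> C"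
        using inner_wt_le_hsq_ramp[OF s slow_ramp_one, of "real N"] bd by (auto simp: hsq_eq_hsq_ramp intro: order_trans)
    qed
  qed
  then show ?thesis unfolding hsq_eq_hsq_ramp hsq_ramp_SUP[OF s slow_ramp_one] by (intro SUP_least)
qed

section \<open>Growth of weighted energies\<close>

lemma wconst_nonneg: "s \<ge> 0 \<Longrightarrow> wconst s \<ge> 0"
  by (simp add: wconst_def)

lemma has_real_derivative_energy:
  assumes W: "bmeas W" and u: "(u has_vector_derivative d) (at t within S)"
  shows "((\<lambda>t. inner (mul W (u t)) (u t)) has_real_derivative 2 * inner (mul W (u t)) d) (at t within S)"
proof -
  have m: "((\<lambda>t. mul W (u t)) has_vector_derivative mul W d) (at t within S)"
    by (rule bounded_linear.has_vector_derivative[OF bounded_linear_mul[OF W] u])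
  have "((\<lambda>t. inner (mul W (u t)) (u t)) has_derivative
      (\<lambda>h. inner (mul W (u t)) (h *\<^sub>R d) + inner (h *\<^sub>R mul W d) (u t))) (at t within S)"
    using m u unfolding has_vector_derivative_def by (intro has_derivative_inner)
  moreover have "inner (mul W d) (u t) = inner (mul W (u t)) d"
    by (subst inner_mul_commute[OF W]) (rule inner_commute)
  then have "(\<lambda>h. inner (mul W (u t)) (h *\<^sub>R d) + inner (h *\<^sub>R mul W d) (u t)) = (*) (2 * inner (mul W (u t)) d)"
    by (auto simp: fun_eq_iff)
  ultimately show ?thesis
    unfolding has_field_derivative_def by simp
qed

lemma has_real_derivative_norm_sq:
  fixes u :: "real \<Rightarrow> 'a::real_inner"
  assumes u: "(u has_vector_derivative d) (at t within S)"
  shows "((\<lambda>t. (norm (u t))\<^sup>2) has_real_derivative 2 * inner (u t) d) (at t within S)"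
proof -
  have "((\<lambda>t. inner (u t) (u t)) has_derivative
      (\<lambda>h. inner (u t) (h *\<^sub>R d) + inner (h *\<^sub>R d) (u t))) (at t within S)"
    using u unfolding has_vector_derivative_def by (intro has_derivative_inner)
  moreover have "(\<lambda>h. inner (u t) (h *\<^sub>R d) + inner (h *\<^sub>R d) (u t)) = (*) (2 * inner (u t) d)"
    by (auto simp: fun_eq_iff inner_commute[of d])
  ultimately show ?thesis
    unfolding has_field_derivative_def power2_norm_eq_inner by simp
qed

lemma inner_mul_nonneg: "energy_weight C W \<Longrightarrow> 0 \<le> inner (mul W u) u"
  unfolding energy_weight_def by (subst inner_mul) (auto intro!: integral_nonneg_AE)

text \<open>
  All weighted energies with weights of the class grow at the rate given by the moment of order
  \<open>3/2\<close>, for every curve whose derivative tests like \<open>B (u t) (u t)\<close> against weighted multiples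
  of \<open>u t\<close>; this covers both exact solutions and spectral truncations.
\<close>

lemma energy_growth:
  fixes u :: "real \<Rightarrow> l2"
  assumes T: "0 \<le> T" and s: "s > 1" and C: "C \<ge> 0" and W: "energy_weight C W"
    and u: "\<And>t. t \<in> {0..T} \<Longrightarrow> (u has_vector_derivative d t) (at t within {0..T})"
    and d: "\<And>t. t \<in> {0..T} \<Longrightarrow> inner (mul W (u t)) (d t) = inner (mul W (u t)) (B (u t) (u t))"
    and h: "\<And>t. t \<in> {0..T} \<Longrightarrow> herm (u t)" and fin: "\<And>t. t \<in> {0..T} \<Longrightarrow> hsq s (u t) < \<infinity>"
    and mom: "\<And>t. t \<in> {0..T} \<Longrightarrow> mom (3/2) (u t) \<le> ennreal (\<alpha> t)" and \<alpha>: "\<And>t. t \<in> {0..T} \<Longrightarrow> \<alpha> t \<ge> 0"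
    and A: "\<And>t. t \<in> {0..T} \<Longrightarrow> (A has_real_derivative \<alpha> t) (at t within {0..T})"
    and A0: "A 0 = 0" "\<And>t. t \<in> {0..T} \<Longrightarrow> A t \<ge> 0"
  shows "inner (mul W (u T)) (u T) \<le> exp ((2 + 4 * C) * A T) * inner (mul W (u 0)) (u 0)"
proof -
  have bW: "bmeas W" using W by (simp add: energy_weight_def)
  have "inner (mul W (u T)) (u T) \<le> exp ((2 + 4 * C) * A T) * (inner (mul W (u 0)) (u 0) + 0 * T)"
  proof (rule Gronwall_differential[OF T, where f = "\<lambda>t. inner (mul W (u t)) (u t)" and A = "\<lambda>t. (2 + 4 * C) * A t"
        and f' = "\<lambda>t. 2 * inner (mul W (u t)) (d t)" and \<alpha> = "\<lambda>t. (2 + 4 * C) * \<alpha> t" and b = 0])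
    fix t assume t: "t \<in> {0..T}"
    show "((\<lambda>t. inner (mul W (u t)) (u t)) has_real_derivative 2 * inner (mul W (u t)) (d t)) (at t within {0..T})"
      by (rule has_real_derivative_energy[OF bW u[OF t]])
    show "((\<lambda>t. (2 + 4 * C) * A t) has_real_derivative (2 + 4 * C) * \<alpha> t) (at t within {0..T})"
      by (rule DERIV_cmult[OF A[OF t]])
    show "0 \<le> (2 + 4 * C) * A t" using C A0(2)[OF t] by simp
  next
    fix t assume "t \<in> {0<..<T}"
    then have t: "t \<in> {0..T}" by auto
    let ?E = "inner (mul W (u t)) (u t)"
    have E: "?E \<ge> 0" by (rule inner_mul_nonneg[OF W])
    have "ennreal \<bar>2 * inner (mul W (u t)) (B (u t) (u t))\<bar> \<le> ennreal (2 + 4 * C) * (mom (3/2) (u t) * ennreal ?E)"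
      by (rule inner_B_energy[OF s fin[OF t] h[OF t] W C])
    also have "\<dots> \<le> ennreal (2 + 4 * C) * (ennreal (\<alpha> t) * ennreal ?E)"
      by (intro mult_left_mono mult_right_mono mom t) auto
    also have "\<dots> = ennreal ((2 + 4 * C) * \<alpha> t * ?E)"
    proof -
      have "0 \<le> 2 + 4 * C" using C by simp
      then show ?thesis by (simp only: mult.assoc ennreal_mult mult_nonneg_nonneg \<alpha>[OF t] E)
    qed
    finally have "\<bar>2 * inner (mul W (u t)) (B (u t) (u t))\<bar> \<le> (2 + 4 * C) * \<alpha> t * ?E"
      using C \<alpha>[OF t] E by (subst (asm) ennreal_le_iff) auto
    then show "2 * inner (mul W (u t)) (d t) \<le> (2 + 4 * C) * \<alpha> t * ?E + 0" unfolding d[OF t] by linarith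
  qed (use A0 in auto)
  then show ?thesis by simp
qed

text \<open>
  The growth bound for the truncated weights has a constant that is independent of the truncation
  and of the ramp, so it passes to the supremum.
\<close>

lemma hsq_ramp_growth:
  fixes u :: "real \<Rightarrow> l2"
  assumes T: "0 \<le> T" and s: "s > 1" and c: "slow_ramp c"
    and u: "\<And>t. t \<in> {0..T} \<Longrightarrow> (u has_vector_derivative d t) (at t within {0..T})"
    and d: "\<And>W t. bmeas W \<Longrightarrow> t \<in> {0..T} \<Longrightarrow> inner (mul W (u t)) (d t) = inner (mul W (u t)) (B (u t) (u t))"
    and h: "\<And>t. t \<in> {0..T} \<Longrightarrow> herm (u t)" and fin: "\<And>t. t \<in> {0..T} \<Longrightarrow> hsq s (u t) < \<infinity>"
    and mom: "\<And>t. t \<in> {0..T} \<Longrightarrow> mom (3/2) (u t) \<le> ennreal (\<alpha> t)" and \<alpha>: "\<And>t. t \<in> {0..T} \<Longrightarrow> \<alpha> t \<ge> 0"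
    and A: "\<And>t. t \<in> {0..T} \<Longrightarrow> (A has_real_derivative \<alpha> t) (at t within {0..T})"
    and A0: "A 0 = 0" "\<And>t. t \<in> {0..T} \<Longrightarrow> A t \<ge> 0"
  shows "hsq_ramp s c (u T) \<le> ennreal (exp ((2 + 4 * wconst s) * A T)) * hsq_ramp s c (u 0)"
proof -
  have s1: "s \<ge> 1" using s by simp
  have "ennreal (inner (mul (\<lambda>k. wt s (real N) k * c k) (u T)) (u T)) \<le> ennreal (exp ((2 + 4 * wconst s) * A T)) * hsq_ramp s c (u 0)" for N :: nat
  proof -
    have W: "energy_weight (wconst s) (\<lambda>k. wt s (real N) k * c k)" by (rule energy_weight_wt[OF s1 _ c]) simp
    then have bW: "bmeas (\<lambda>k. wt s (real N) k * c k)" by (simp add: energy_weight_def)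
    have "inner (mul (\<lambda>k. wt s (real N) k * c k) (u T)) (u T)
      \<le> exp ((2 + 4 * wconst s) * A T) * inner (mul (\<lambda>k. wt s (real N) k * c k) (u 0)) (u 0)"
      by (rule energy_growth[OF T s _ W u d[OF bW] h fin mom \<alpha> A A0]) (use s in \<open>auto simp: wconst_nonneg\<close>)
    then have "ennreal (inner (mul (\<lambda>k. wt s (real N) k * c k) (u T)) (u T))
      \<le> ennreal (exp ((2 + 4 * wconst s) * A T)) * ennreal (inner (mul (\<lambda>k. wt s (real N) k * c k) (u 0)) (u 0))"
      using inner_mul_nonneg[OF W] by (subst ennreal_mult[symmetric]) (auto intro: ennreal_leI)
    also have "\<dots> \<le> ennreal (exp ((2 + 4 * wconst s) * A T)) * hsq_ramp s c (u 0)"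
      by (intro mult_left_mono inner_wt_le_hsq_ramp[OF s1 c]) auto
    finally show ?thesis .
  qed
  then show ?thesis unfolding hsq_ramp_SUP[OF s1 c, of "u T"] by (intro SUP_least)
qed

section \<open>Quantitative bounds for the quadratic form\<close>

text \<open>
  The constant of the estimate for \<open>B\<close>, as a real number.
\<close>

definition kb :: "real \<Rightarrow> real" where "kb s = enn2real (KB s)"

lemma kb_nonneg: "kb s \<ge> 0" by (simp add: kb_def)

lemma hsq_B_le:
  assumes s: "s > 1" and u: "hsq s u \<le> ennreal a" and v: "hsq s v \<le> ennreal b" and a: "a \<ge> 0" and b: "b \<ge> 0"
  shows "hsq (s - 1) (B u v) \<le> ennreal (kb s * a * b)"
proof -
  have fin: "hsq s u < \<infinity>" "hsq s v < \<infinity>" using u v by (auto intro: le_less_trans)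
  have k: "KB s = ennreal (kb s)" using KB_finite[OF s] by (simp add: kb_def)
  have "hsq (s - 1) (B u v) \<le> KB s * hsq s u * hsq s v" by (rule hsq_B[OF s fin])
  also have "\<dots> \<le> KB s * ennreal a * ennreal b" by (intro mult_mono u v) auto
  also have "\<dots> = ennreal (kb s * a * b)" unfolding k using a b kb_nonneg[of s] by (simp add: ennreal_mult)
  finally show ?thesis .
qed

lemma norm_B_le:
  assumes s: "s > 1" and u: "hsq s u \<le> ennreal a" and v: "hsq s v \<le> ennreal b" and a: "a \<ge> 0" and b: "b \<ge> 0"
  shows "norm (B u v) \<le> sqrt (kb s * a * b)"
proof -
  have "ennreal ((norm (B u v))\<^sup>2) \<le> ennreal (kb s * a * b)"
    by (rule order_trans[OF norm_le_hsq[of _ "s - 1"] hsq_B_le[OF assms]])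
  then have "(norm (B u v))\<^sup>2 \<le> kb s * a * b" using a b kb_nonneg[of s] by (subst (asm) ennreal_le_iff) auto
  then show ?thesis by (rule real_le_rsqrt)
qed

lemma norm_le_of_hsq: "hsq s u \<le> ennreal a \<Longrightarrow> a \<ge> 0 \<Longrightarrow> norm u \<le> sqrt a"
proof -
  assume u: "hsq s u \<le> ennreal a" and a: "a \<ge> 0"
  have "ennreal ((norm u)\<^sup>2) \<le> ennreal a" by (rule order_trans[OF norm_le_hsq u])
  then have "(norm u)\<^sup>2 \<le> a" using a by (subst (asm) ennreal_le_iff) auto
  then show ?thesis by (rule real_le_rsqrt)
qed

text \<open>
  The constant that bounds the moment of order \<open>3/2\<close> by the norm of \<open>H\<^sup>s\<close>.
\<close>

definition kp :: "real \<Rightarrow> real" where "kp s = enn2real (kap (3/2) s)"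

lemma kp_nonneg: "kp s \<ge> 0" by (simp add: kp_def)

lemma mom_le_sqrt:
  assumes s: "s > 2" and u: "hsq s u \<le> ennreal a" and a: "a \<ge> 0"
  shows "mom (3/2) u \<le> ennreal (sqrt (kp s * a))"
proof (rule ennreal_le_of_sq)
  have k: "kap (3/2) s = ennreal (kp s)" using kap_finite[of "3/2" s] s by (simp add: kp_def)
  have "(mom (3/2) u)\<^sup>2 \<le> kap (3/2) s * hsq s u" by (rule mom_le)
  also have "\<dots> \<le> ennreal (kp s) * ennreal a" unfolding k by (intro mult_left_mono u) auto
  also have "\<dots> = (ennreal (sqrt (kp s * a)))\<^sup>2"
    using a kp_nonneg[of s] by (simp add: ennreal_power ennreal_mult[symmetric])
  finally show "(mom (3/2) u)\<^sup>2 \<le> (ennreal (sqrt (kp s * a)))\<^sup>2" .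
qed (use a kp_nonneg in auto)

lemma B_zero: "(s::real) > 1 \<Longrightarrow> B 0 0 = 0"
  using B_scaleR_right[of s 0 0 0] by simp

section \<open>Spectral truncation of the equation\<close>

text \<open>
  On band-limited classes \<open>B\<close> is bounded in \<open>L\<^sup>2\<close>. Composing it with the projection \<open>Q\<close> onto the
  Hermitian classes of band \<open>N\<close> gives an ordinary differential equation on all of \<open>L\<^sup>2\<close>.
\<close>

lemma Galerkin_solution:
  fixes s N T :: real
  assumes s: "s > 1" and N: "N \<ge> 0" and u0: "herm u0" and T: "T > 0"
  shows "\<exists>u. u 0 = cut N u0 \<and>
     (\<forall>t\<in>{0..T}. (u has_vector_derivative cut N (B (u t) (u t))) (at t within {0..T})) \<and>
     (\<forall>t\<in>{0..T}. cut N (u t) = u t \<and> herm (u t) \<and> norm (u t) = norm (cut N u0))"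
proof -
  interpret c: bounded_linear "cut N" by (rule bounded_linear_cut)
  interpret h: bounded_linear hpart by (rule bounded_linear_hpart)
  define Q where "Q u = cut N (hpart u)" for u
  have Qlin: "bounded_linear Q" unfolding Q_def[abs_def] by (rule bounded_linear_compose[OF bounded_linear_cut bounded_linear_hpart])
  interpret Q: bounded_linear Q by (rule Qlin)
  have Qh: "herm (Q u)" for u unfolding Q_def by (intro herm_cut herm_hpart)
  have Qc: "cut N (Q u) = Q u" for u by (simp add: Q_def cut_cut)
  have Qid: "Q u = u" if "herm u" "cut N u = u" for u using that by (simp add: Q_def hpart_herm)
  have normJ: "norm (hpart u) \<le> norm u" for u
  proof -
    have "norm (refl_cnj u) \<le> norm u"
    proof -
      have "ennreal ((norm (refl_cnj u))\<^sup>2) = (\<integral>\<^sup>+x. ennreal ((cmod (cnj (rep u (0 - x))))\<^sup>2) \<partial>lborel)"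
        unfolding nn_integral_rep[symmetric]
        by (rule nn_integral_cong_AE) (use rep_refl_cnj[of u] in \<open>eventually_elim, simp\<close>)
      also have "\<dots> = ennreal ((norm u)\<^sup>2)"
        using nn_integral_reflect[of "\<lambda>x. ennreal ((cmod (rep u x))\<^sup>2)" 0] by (simp add: nn_integral_rep)
      finally have "(norm (refl_cnj u))\<^sup>2 = (norm u)\<^sup>2" by simp
      then show ?thesis by (simp add: power2_eq_iff_nonneg)
    qed
    then have "norm (u + refl_cnj u) \<le> 2 * norm u" using norm_triangle_ineq[of u "refl_cnj u"] by linarith
    then show ?thesis by (simp add: hpart_def)
  qed
  have normQ: "norm (Q u) \<le> norm u" for u unfolding Q_def using norm_cut_le[of N "hpart u"] normJ[of u] by linarith
  define w where "w = 1 + N powr (2 * s)"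
  have w: "w > 0" by (simp add: w_def add_pos_nonneg)
  have hQ: "hsq s (Q u) \<le> ennreal (w * (norm u)\<^sup>2)" for u
  proof -
    have "hsq s (cut N (Q u)) \<le> ennreal (w * (norm (Q u))\<^sup>2)" unfolding w_def by (rule hsq_cut_le_norm[OF N]) (use s in simp)
    also have "\<dots> \<le> ennreal (w * (norm u)\<^sup>2)" using normQ w by (intro ennreal_leI mult_left_mono power_mono) auto
    finally show ?thesis by (simp add: Qc)
  qed
  have fin: "hsq s (Q u) < \<infinity>" for u using hQ[of u] by (auto intro: le_less_trans)
  define G where "G u = cut N (B (Q u) (Q u))" for u
  define K where "K = sqrt (kb s) * w + 1"
  have K: "K > 0" using kb_nonneg[of s] w by (simp add: K_def add_nonneg_pos)
  have lip: "norm (G x - G y) \<le> K * (norm x + norm y) * norm (x - y)" for x y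
  proof -
    have "G x - G y = cut N (B (Q (x + y)) (Q (x - y)))"
      unfolding G_def c.diff[symmetric] B_diff_sq[OF s fin fin] Q.add[symmetric] Q.diff[symmetric] ..
    then have "norm (G x - G y) \<le> norm (B (Q (x + y)) (Q (x - y)))" by (simp add: norm_cut_le)
    also have "\<dots> \<le> sqrt (kb s * (w * (norm (x + y))\<^sup>2) * (w * (norm (x - y))\<^sup>2))"
      by (rule norm_B_le[OF s hQ hQ]) (use w in auto)
    also have "kb s * (w * (norm (x + y))\<^sup>2) * (w * (norm (x - y))\<^sup>2) = kb s * (w * (norm (x + y) * norm (x - y)))\<^sup>2"
      by (simp add: power2_eq_square ac_simps)
    also have "sqrt \<dots> = sqrt (kb s) * w * (norm (x + y) * norm (x - y))"
      using w by (simp add: real_sqrt_mult)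
    also have "\<dots> \<le> K * ((norm x + norm y) * norm (x - y))"
      using w kb_nonneg[of s] by (intro mult_mono mult_right_mono norm_triangle_ineq) (auto simp: K_def)
    finally show ?thesis by (simp add: mult.assoc)
  qed
  have G0: "G 0 = 0" by (simp add: G_def Q.zero B_zero[OF s] c.zero)
  have QG: "Q (G x) = G x" for x
  proof (rule Qid)
    show "herm (G x)" unfolding G_def by (intro herm_cut B_herm[OF s fin fin] Qh)
    show "cut N (G x) = G x" by (simp add: G_def cut_cut)
  qed
  have orth: "inner x (G x) = 0" if "Q x = x" for x
  proof -
    have "inner x (G x) = inner (cut N x) (B x x)" by (simp add: G_def that inner_cut)
    also have "cut N x = x" using Qc[of x] that by simp
    also have "inner x (B x x) = 0" using inner_B_conserved[OF s, of x] fin[of x] Qh[of x] that by simp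
    finally show ?thesis .
  qed
  have x0: "Q (cut N u0) = cut N u0" by (intro Qid herm_cut u0 cut_cut)
  obtain u where u: "u 0 = cut N u0" "\<And>t. t \<in> {0..T} \<Longrightarrow> (u has_vector_derivative G (u t)) (at t within {0..T})"
    "\<And>t. t \<in> {0..T} \<Longrightarrow> Q (u t) = u t \<and> norm (u t) = norm (cut N u0)"
    using quadratic_ODE[OF lip G0 K Qlin QG orth x0 T] by blast
  have "cut N (u t) = u t \<and> herm (u t)" if "t \<in> {0..T}" for t
    using u(3)[OF that] Qc[of "u t"] Qh[of "u t"] by simp
  moreover have "(u has_vector_derivative cut N (B (u t) (u t))) (at t within {0..T})" if "t \<in> {0..T}" for t
    using u(2)[OF that] u(3)[OF that] by (simp add: G_def)
  ultimately show ?thesis using u(1,3) by blast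
qed

section \<open>Local existence\<close>

text \<open>
  Solutions on the Fourier side: continuous with values in \<open>H\<^sup>s\<close>, and differentiable with values
  in \<open>L\<^sup>2\<close>. That the derivative exists even in \<open>H\<^bsup>s-1\<^esup>\<close> is a consequence, \<open>fsol_deriv_hsq\<close>.
\<close>

definition fsol :: "real \<Rightarrow> real set \<Rightarrow> (real \<Rightarrow> l2) \<Rightarrow> bool" where
  "fsol s I u \<longleftrightarrow> (\<forall>t\<in>I. herm (u t) \<and> hsq s (u t) < \<infinity>) \<and>
     (\<forall>t\<in>I. ((\<lambda>r. hsq s (u r - u t)) \<longlongrightarrow> 0) (at t within I)) \<and>
     (\<forall>t\<in>I. (u has_vector_derivative B (u t) (u t)) (at t within I))"

lemma inner_B_energy_real:
  assumes s: "s > 2" and u: "hsq s u \<le> ennreal a" and a: "a \<ge> 0" and h: "herm u" and W: "energy_weight C W" and C: "C \<ge> 0"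
  shows "\<bar>2 * inner (mul W u) (B u u)\<bar> \<le> (2 + 4 * C) * sqrt (kp s * a) * inner (mul W u) u"
proof -
  have fin: "hsq s u < \<infinity>" using u by (auto intro: le_less_trans)
  have E: "inner (mul W u) u \<ge> 0" by (rule inner_mul_nonneg[OF W])
  have nn: "0 \<le> 2 + 4 * C" "0 \<le> sqrt (kp s * a)" using C a kp_nonneg[of s] by auto
  have "ennreal \<bar>2 * inner (mul W u) (B u u)\<bar> \<le> ennreal (2 + 4 * C) * (mom (3/2) u * ennreal (inner (mul W u) u))"
    by (rule inner_B_energy[OF _ fin h W C]) (use s in simp)
  also have "\<dots> \<le> ennreal (2 + 4 * C) * (ennreal (sqrt (kp s * a)) * ennreal (inner (mul W u) u))"
    by (intro mult_left_mono mult_right_mono mom_le_sqrt[OF s u a]) auto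
  also have "\<dots> = ennreal ((2 + 4 * C) * sqrt (kp s * a) * inner (mul W u) u)"
    by (simp only: mult.assoc ennreal_mult mult_nonneg_nonneg nn E)
  finally show ?thesis using nn E by (subst (asm) ennreal_le_iff) (auto intro!: mult_nonneg_nonneg)
qed

lemma inner_B_linear_real:
  assumes s: "s > 2" and z: "hsq s z \<le> ennreal a" and a: "a \<ge> 0" and h: "herm z" and v: "hsq s v < \<infinity>"
  shows "\<bar>2 * inner v (B z v)\<bar> \<le> sqrt (kp s * a) * (norm v)\<^sup>2"
proof -
  have fin: "hsq s z < \<infinity>" using z by (auto intro: le_less_trans)
  have "ennreal \<bar>2 * inner v (B z v)\<bar> \<le> mom (3/2) z * ennreal ((norm v)\<^sup>2)"
    by (rule inner_B_linear[OF _ fin v h]) (use s in simp)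
  also have "\<dots> \<le> ennreal (sqrt (kp s * a)) * ennreal ((norm v)\<^sup>2)"
    by (intro mult_right_mono mom_le_sqrt[OF s z a]) auto
  also have "\<dots> = ennreal (sqrt (kp s * a) * (norm v)\<^sup>2)"
    using a kp_nonneg[of s] by (simp add: ennreal_mult)
  finally show ?thesis using a kp_nonneg[of s] by (subst (asm) ennreal_le_iff) auto
qed

lemma hsq_band:
  assumes s: "s \<ge> 1" and N: "N \<ge> 0" and u: "cut N u = u"
  shows "hsq s u = ennreal (inner (mul (\<lambda>k. wt s N k * 1) u) u)"
proof -
  have W: "energy_weight (wconst s) (\<lambda>k. wt s N k * 1)" by (rule energy_weight_wt[OF s N slow_ramp_one])
  have "ennreal (inner (mul (\<lambda>k. wt s N k * 1) u) u) = (\<integral>\<^sup>+k. ennreal (wt s N k * 1 * (cmod (rep u k))\<^sup>2) \<partial>lborel)"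
    using W by (intro inner_mul_self) (auto simp: energy_weight_def)
  also have "\<dots> = hsq s u" unfolding hsq_def
  proof (rule nn_integral_cong_AE)
    show "AE k in lborel. ennreal (wt s N k * 1 * (cmod (rep u k))\<^sup>2) = ennreal ((1 + \<bar>k\<bar> powr (2 * s)) * (cmod (rep u k))\<^sup>2)"
      using rep_cut[of N u] unfolding u
    proof eventually_elim
      case (elim k)
      show ?case
      proof (cases "\<bar>k\<bar> \<le> N")
        case True
        then show ?thesis by (simp add: wt_def min_def)
      next
        case False
        then have "rep u k = 0" using elim by simp
        then show ?thesis by simp
      qed
    qed
  qed
  finally show ?thesis by simp
qed

text \<open>
  A truncation of the right-hand side is not seen by an energy of band-limited classes.
\<close>

lemma inner_mul_cut:
  assumes "bmeas W" "cut N u = u" shows "inner (mul W u) (cut N b) = inner (mul W u) b"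
  using inner_cut[of N "mul W u" b] mul_cut_commute[OF assms(1), of N u] assms(2) by simp

lemma cut_tail_le:
  assumes w: "hsq p w \<le> ennreal a" and a: "a \<ge> 0" and p: "p \<ge> 0" and N: "N > 0"
  shows "norm (w - cut N w) \<le> sqrt a / N powr p"
proof -
  have "ennreal (N powr (2 * p) * (norm (w - cut N w))\<^sup>2) \<le> ennreal a"
    by (rule order_trans[OF norm_cut_tail w]) (use p N in auto)
  then have "(N powr p * norm (w - cut N w))\<^sup>2 \<le> a" using a
    by (subst (asm) ennreal_le_iff) (auto simp: power_mult_distrib powr_sq)
  then have "N powr p * norm (w - cut N w) \<le> sqrt a" by (rule real_le_rsqrt)
  then show ?thesis using N by (simp add: field_simps)
qed

lemma hsq_add_le_real:
  assumes "hsq s u \<le> ennreal a" "hsq s v \<le> ennreal b" "a \<ge> 0" "b \<ge> 0"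
  shows "hsq s (u + v) \<le> ennreal (2 * a + 2 * b)"
proof -
  have "hsq s (u + v) \<le> 2 * hsq s u + 2 * hsq s v" by (rule hsq_add_le)
  also have "\<dots> \<le> 2 * ennreal a + 2 * ennreal b" by (intro add_mono mult_left_mono assms) auto
  also have "\<dots> = ennreal (2 * a + 2 * b)" using assms by (simp add: ennreal_plus ennreal_mult)
  finally show ?thesis .
qed

lemma hsq_diff_commute: "hsq s (u - v) = hsq s (v - u)"
  using hsq_minus[of s "u - v"] by simp

lemma ennreal_tendsto_0I:
  fixes f :: "'a \<Rightarrow> ennreal"
  assumes "\<And>e::real. e > 0 \<Longrightarrow> eventually (\<lambda>x. f x \<le> ennreal e) F"
  shows "(f \<longlongrightarrow> 0) F"
proof (rule order_tendstoI)
  fix a :: ennreal assume "0 < a"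
  then obtain e where e: "0 < e" "ennreal e < a"
  proof (cases a)
    case (real r)
    then show ?thesis using \<open>0 < a\<close> that[of "r / 2"] by (simp add: ennreal_less_iff)
  next
    case top
    then show ?thesis using that[of 1] by simp
  qed
  show "eventually (\<lambda>x. f x < a) F"
    using assms[OF e(1)] by eventually_elim (use e(2) in \<open>auto intro: le_less_trans\<close>)
qed simp

lemma ennreal_tendsto_0D:
  fixes f :: "'a \<Rightarrow> ennreal"
  assumes "(f \<longlongrightarrow> 0) F" "e > 0" shows "eventually (\<lambda>x. f x \<le> ennreal e) F"
  using order_tendstoD(2)[OF assms(1), of "ennreal e"] assms(2) by (auto elim: eventually_mono)

lemma eventually_at_within_mem: "eventually (\<lambda>x. x \<in> S) (at a within S)"
  by (simp add: eventually_at_filter)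

lemma hsq_tendsto_0_imp:
  assumes "((\<lambda>r. hsq s (X r)) \<longlongrightarrow> 0) G" shows "(X \<longlongrightarrow> 0) G"
proof (rule tendstoI)
  fix e :: real assume e: "e > 0"
  have "eventually (\<lambda>r. hsq s (X r) \<le> ennreal ((e / 2)\<^sup>2)) G"
    by (rule ennreal_tendsto_0D[OF assms]) (use e in simp)
  then show "eventually (\<lambda>r. dist (X r) 0 < e) G"
  proof eventually_elim
    case (elim r)
    have "norm (X r) \<le> sqrt ((e / 2)\<^sup>2)" by (rule norm_le_of_hsq[OF elim]) simp
    then show ?case using e by simp
  qed
qed

text \<open>
  Compactness: a family whose high frequencies are dominated by those of a fixed \<open>u0\<close> has the same
  convergence in \<open>L\<^sup>2\<close> and in \<open>H\<^sup>s\<close>. The ramp is chosen such that its part of \<open>u0\<close> is below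
  \<open>\<epsilon> / (8 * G)\<close>.
\<close>

lemma hsq_close_of_tails:
  assumes s: "s \<ge> 0" and fin: "hsq s u0 < \<infinity>" and G: "G > 0" and \<epsilon>: "\<epsilon> > 0"
  obtains C where "C \<ge> 0"
    "\<And>x y. (\<And>w. slow_ramp w \<Longrightarrow> hsq_ramp s w x \<le> ennreal G * hsq_ramp s w u0) \<Longrightarrow> (\<And>w. slow_ramp w \<Longrightarrow> hsq_ramp s w y \<le> ennreal G * hsq_ramp s w u0)
      \<Longrightarrow> C * (norm (x - y))\<^sup>2 \<le> \<epsilon> / 2 \<Longrightarrow> hsq s (x - y) \<le> ennreal \<epsilon>"
proof -
  have "\<epsilon> / (8 * G) > 0" using \<epsilon> G by simp
  from eventually_happens[OF ennreal_tendsto_0D[OF hsq_ramp_vanishes[OF fin] this]] sequentially_bot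
  obtain j where j: "hsq_ramp s (\<lambda>x. min 1 (\<bar>x\<bar> / real (Suc j))) u0 \<le> ennreal (\<epsilon> / (8 * G))" by auto
  define R where "R = real (Suc j)"
  have R: "R > 0" by (simp add: R_def)
  let ?w = "\<lambda>x. min 1 (\<bar>x\<bar> / R)"
  have w: "slow_ramp ?w" by (rule slow_ramp_min[OF R])
  have small: "hsq_ramp s ?w x \<le> ennreal (\<epsilon> / 8)" if "\<And>w. slow_ramp w \<Longrightarrow> hsq_ramp s w x \<le> ennreal G * hsq_ramp s w u0" for x
  proof -
    have "hsq_ramp s ?w x \<le> ennreal G * hsq_ramp s ?w u0" by (rule that[OF w])
    also have "\<dots> \<le> ennreal G * ennreal (\<epsilon> / (8 * G))" using j by (intro mult_left_mono) (auto simp: R_def)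
    also have "\<dots> = ennreal (\<epsilon> / 8)" using G \<epsilon> by (simp add: ennreal_mult[symmetric])
    finally show ?thesis .
  qed
  have "hsq s (x - y) \<le> ennreal \<epsilon>"
    if x: "\<And>w. slow_ramp w \<Longrightarrow> hsq_ramp s w x \<le> ennreal G * hsq_ramp s w u0" and y: "\<And>w. slow_ramp w \<Longrightarrow> hsq_ramp s w y \<le> ennreal G * hsq_ramp s w u0"
      and low: "(1 + R powr (2 * s)) * (norm (x - y))\<^sup>2 \<le> \<epsilon> / 2" for x y
  proof -
    have "hsq s (x - y) \<le> ennreal ((1 + R powr (2 * s)) * (norm (x - y))\<^sup>2) + hsq_ramp s ?w (x - y)"
      by (rule hsq_split_tail[OF R s])
    also have "\<dots> \<le> ennreal (\<epsilon> / 2) + (2 * ennreal (\<epsilon> / 8) + 2 * ennreal (\<epsilon> / 8))"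
    proof (intro add_mono ennreal_leI low)
      have "hsq_ramp s ?w (x - y) \<le> 2 * hsq_ramp s ?w x + 2 * hsq_ramp s ?w y" by (rule hsq_ramp_diff_le[OF w])
      also have "\<dots> \<le> 2 * ennreal (\<epsilon> / 8) + 2 * ennreal (\<epsilon> / 8)" by (intro add_mono mult_left_mono small x y) auto
      finally show "hsq_ramp s ?w (x - y) \<le> 2 * ennreal (\<epsilon> / 8) + 2 * ennreal (\<epsilon> / 8)" .
    qed
    also have "\<dots> = ennreal \<epsilon>"
    proof -
      have "2 * ennreal (\<epsilon> / 8) = ennreal (\<epsilon> / 4)" using \<epsilon> by (simp add: ennreal_mult[symmetric] flip: ennreal_numeral)
      then show ?thesis using \<epsilon> by (simp add: ennreal_plus[symmetric] del: ennreal_plus)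
    qed
    finally show ?thesis .
  qed
  then show ?thesis by (intro that[of "1 + R powr (2 * s)"]) auto
qed

lemma powr_nat_inverse_tendsto: "p > 0 \<Longrightarrow> (\<lambda>n. inverse (real (Suc n) powr p)) \<longlonglongrightarrow> 0"
proof -
  assume p: "p > 0"
  have "filterlim (\<lambda>n. real (Suc n)) at_top sequentially"
    by (rule filterlim_compose[OF filterlim_real_sequentially filterlim_Suc])
  then have "(\<lambda>n. real (Suc n) powr (- p)) \<longlonglongrightarrow> 0" by (rule tendsto_neg_powr[rotated]) (use p in simp)
  then show ?thesis by (simp add: powr_minus)
qed

text \<open>
  The truncated solutions satisfy the energy estimates with constants that do not depend on the
  truncation, which bounds them in \<open>H\<^sup>s\<close> on a common interval and controls their high frequencies.
  In \<open>L\<^sup>2\<close> they form a Cauchy sequence, since the truncation error is small there; hence they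
  converge in \<open>H\<^sup>s\<close>.
\<close>

lemma local_existence:
  assumes s: "s > 2" and h0: "herm u0" and fin0: "hsq s u0 < \<infinity>"
  shows "\<exists>\<delta>>0. \<exists>u. u 0 = u0 \<and> fsol s {0..\<delta>} u"
proof -
  have s1: "s > 1" "s \<ge> 1" "s \<ge> 0" using s by auto
  obtain M0 where M0: "hsq s u0 = ennreal M0" "M0 \<ge> 0" using fin0 by (cases "hsq s u0") auto
  define N where "N n = real (Suc n)" for n
  have N: "N n > 0" "N n \<ge> 0" for n by (simp_all add: N_def)
  have "\<forall>n. \<exists>u. u 0 = cut (N n) u0 \<and>
     (\<forall>t\<in>{0..1}. (u has_vector_derivative cut (N n) (B (u t) (u t))) (at t within {0..1})) \<and>
     (\<forall>t\<in>{0..1}. cut (N n) (u t) = u t \<and> herm (u t) \<and> norm (u t) = norm (cut (N n) u0))"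
    using Galerkin_solution[OF s1(1) N(2) h0, of 1] by simp
  then obtain U where U0: "\<And>n. U n 0 = cut (N n) u0"
    and U1: "\<And>n t. t \<in> {0..1} \<Longrightarrow> (U n has_vector_derivative cut (N n) (B (U n t) (U n t))) (at t within {0..1})"
    and Uc: "\<And>n t. t \<in> {0..1} \<Longrightarrow> cut (N n) (U n t) = U n t"
    and Uh: "\<And>n t. t \<in> {0..1} \<Longrightarrow> herm (U n t)"
    and Un: "\<And>n t. t \<in> {0..1} \<Longrightarrow> norm (U n t) = norm (cut (N n) u0)"
    by metis
  define cC where "cC = 2 + 4 * wconst s"
  have cC: "cC \<ge> 0" using wconst_nonneg[OF s1(3)] by (simp add: cC_def)
  define c where "c = cC * sqrt (kp s)"
  have c: "c \<ge> 0" using cC kp_nonneg[of s] by (simp add: c_def)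
  \<comment> \<open>A time on which \<open>three_halves_bound\<close> applies to the energy plus \<open>1\<close>; the summand keeps it positive.\<close>
  define \<delta> where "\<delta> = min 1 (1 / (c * sqrt (M0 + 1) + 1))"
  have D: "c * sqrt (M0 + 1) + 1 > 0" using c M0 by (simp add: add_nonneg_pos)
  have \<delta>: "\<delta> > 0" "\<delta> \<le> 1" using D by (auto simp: \<delta>_def)
  have \<delta>c: "c * \<delta> * sqrt (M0 + 1) \<le> 1"
  proof -
    have "c * \<delta> * sqrt (M0 + 1) \<le> c * (1 / (c * sqrt (M0 + 1) + 1)) * sqrt (M0 + 1)"
      using c M0 by (intro mult_right_mono mult_left_mono) (auto simp: \<delta>_def)
    also have "\<dots> = (c * sqrt (M0 + 1)) / (c * sqrt (M0 + 1) + 1)" by simp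
    also have "\<dots> \<le> 1" using D by simp
    finally show ?thesis .
  qed
  have sub: "t \<in> {0..1}" if "t \<in> {0..\<delta>}" for t using that \<delta> by auto
  have Uder: "(U n has_vector_derivative cut (N n) (B (U n r) (U n r))) (at r within {0..t})"
    if "t \<in> {0..\<delta>}" "r \<in> {0..t}" for n t r
    by (rule has_vector_derivative_within_subset[OF U1]) (use that \<delta> in auto)
  define M where "M = 4 * (M0 + 1)"
  have M: "M \<ge> 0" using M0 by (simp add: M_def)
  \<comment> \<open>For \<open>U n\<close>, which has band \<open>N n\<close>, the energy with the weight truncated at \<open>N n\<close> is all of \<open>hsq\<close>.\<close>
  have A: "hsq s (U n t) \<le> ennreal M" if t: "t \<in> {0..\<delta>}" for n t
  proof -
    define W where "W k = wt s (N n) k * 1" for k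
    have W: "energy_weight (wconst s) W" unfolding W_def by (rule energy_weight_wt[OF s1(2) N(2) slow_ramp_one])
    have bW: "bmeas W" using W by (simp add: energy_weight_def)
    define E where "E r = inner (mul W (U n r)) (U n r)" for r
    have E0: "E r \<ge> 0" for r unfolding E_def by (rule inner_mul_nonneg[OF W])
    have hE: "hsq s (U n r) = ennreal (E r)" if "r \<in> {0..1}" for r
      unfolding E_def W_def by (rule hsq_band[OF s1(2) N(2) Uc[OF that]])
    have "ennreal (E 0) \<le> ennreal M0"
      using hE[of 0] hsq_ramp_cut_le[OF slow_ramp_one, of s "N n" u0] M0 by (simp add: U0 hsq_eq_hsq_ramp)
    then have E00: "E 0 \<le> M0" using M0 by simp
    have "E t + 1 \<le> 4 * (E 0 + 1)"
    proof (rule three_halves_bound[where f = "\<lambda>r. E r + 1" and c = c and f' = "\<lambda>r. 2 * inner (mul W (U n r)) (cut (N n) (B (U n r) (U n r)))"])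
      show "0 \<le> t" using t by simp
      fix r assume r: "r \<in> {0..t}"
      have "(E has_real_derivative 2 * inner (mul W (U n r)) (cut (N n) (B (U n r) (U n r)))) (at r within {0..t})"
        unfolding E_def by (rule has_real_derivative_energy[OF bW Uder[OF t r]])
      then show "((\<lambda>r. E r + 1) has_real_derivative 2 * inner (mul W (U n r)) (cut (N n) (B (U n r) (U n r)))) (at r within {0..t})"
        by (auto intro!: derivative_eq_intros)
      show "0 < E r + 1" using E0[of r] by simp
    next
      fix r assume "r \<in> {0<..<t}"
      then have r: "r \<in> {0..1}" using t \<delta> by auto
      have "2 * inner (mul W (U n r)) (cut (N n) (B (U n r) (U n r))) = 2 * inner (mul W (U n r)) (B (U n r) (U n r))"
        by (simp only: inner_mul_cut[OF bW Uc[OF r]])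
      also have "\<dots> \<le> cC * sqrt (kp s * E r) * E r"
        using inner_B_energy_real[OF s _ E0 Uh[OF r] W wconst_nonneg[OF s1(3)]] hE[OF r]
        unfolding cC_def E_def by (smt (verit, best) order_refl)
      also have "\<dots> = c * (E r * sqrt (E r))" by (simp add: c_def real_sqrt_mult)
      also have "\<dots> \<le> c * ((E r + 1) * sqrt (E r + 1))"
        using c E0[of r] by (intro mult_left_mono mult_mono) auto
      finally show "2 * inner (mul W (U n r)) (cut (N n) (B (U n r) (U n r))) \<le> c * (E r + 1) * sqrt (E r + 1)"
        by (simp add: mult.assoc)
    next
      have "c * t * sqrt (E 0 + 1) \<le> c * \<delta> * sqrt (M0 + 1)"
        using c t E00 E0[of 0] \<delta> by (intro mult_mono) auto
      then show "c * t * sqrt (E 0 + 1) \<le> 1" using \<delta>c by linarith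
    qed (rule c)
    then have "E t \<le> M" using E00 by (simp add: M_def)
    then show ?thesis using hE[OF sub[OF t]] by (simp add: ennreal_leI)
  qed
  have Ufin: "hsq s (U n t) < \<infinity>" if "t \<in> {0..\<delta>}" for n t
    using A[OF that, of n] by (auto intro: le_less_trans)
  define a where "a = sqrt (kp s * M)"
  have a: "a \<ge> 0" using kp_nonneg[of s] M by (simp add: a_def)
  define G where "G = exp (cC * a)"
  have G: "G > 0" by (simp add: G_def)
  have tails: "hsq_ramp s w (U n t) \<le> ennreal G * hsq_ramp s w u0" if t: "t \<in> {0..\<delta>}" and w: "slow_ramp w" for n t w
  proof -
    have "hsq_ramp s w (U n t) \<le> ennreal (exp ((2 + 4 * wconst s) * (a * t))) * hsq_ramp s w (U n 0)"
    proof (rule hsq_ramp_growth[where \<alpha> = "\<lambda>_. a" and A = "\<lambda>t. a * t"])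
      show "0 \<le> t" using t by simp
      fix r assume r: "r \<in> {0..t}"
      then have r': "r \<in> {0..\<delta>}" using t by auto
      show "(U n has_vector_derivative cut (N n) (B (U n r) (U n r))) (at r within {0..t})" by (rule Uder[OF t r])
      show "inner (mul W (U n r)) (cut (N n) (B (U n r) (U n r))) = inner (mul W (U n r)) (B (U n r) (U n r))" if "bmeas W" for W
        by (rule inner_mul_cut[OF that Uc[OF sub[OF r']]])
      show "herm (U n r)" by (rule Uh[OF sub[OF r']])
      show "hsq s (U n r) < \<infinity>" by (rule Ufin[OF r'])
      show "mom (3/2) (U n r) \<le> ennreal a" unfolding a_def by (rule mom_le_sqrt[OF s A[OF r'] M])
      show "((*) a has_real_derivative a) (at r within {0..t})" by (rule DERIV_cmult_Id)
      show "0 \<le> a * r" using a r by simp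
    qed (use s1 w a in auto)
    also have "\<dots> \<le> ennreal G * hsq_ramp s w u0"
    proof (intro mult_mono ennreal_leI)
      have "cC * (a * t) \<le> cC * (a * 1)" using t \<delta> a cC by (intro mult_left_mono) auto
      then show "exp ((2 + 4 * wconst s) * (a * t)) \<le> G" by (simp add: G_def cC_def)
      show "hsq_ramp s w (U n 0) \<le> hsq_ramp s w u0" unfolding U0 by (rule hsq_ramp_cut_le[OF w])
    qed auto
    finally show ?thesis .
  qed
  define e where "e n = sqrt (kb s * M * M) / N n powr (s - 1)" for n
  have e0: "e n \<ge> 0" for n using kb_nonneg[of s] M by (simp add: e_def)
  have tailB: "norm (B (U n t) (U n t) - cut (N n) (B (U n t) (U n t))) \<le> e n" if "t \<in> {0..\<delta>}" for n t
    unfolding e_def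
    by (rule cut_tail_le[OF hsq_B_le[OF s1(1) A[OF that] A[OF that] M M]]) (use kb_nonneg[of s] M s N in auto)
  have nu0: "norm u0 \<le> sqrt M0" by (rule norm_le_of_hsq[of s]) (use M0 in auto)
  have cut0: "norm (u0 - cut (N n) u0) \<le> sqrt M0 / N n powr s" for n
    by (rule cut_tail_le) (use M0 s N in auto)
  define a2 where "a2 = sqrt (kp s * (4 * M))"
  have a2: "a2 \<ge> 0" using kp_nonneg[of s] M by (simp add: a2_def)
  \<comment> \<open>Gronwall bound for differences: the first summand stems from truncating the initial value, the
    second one from truncating the right-hand side.\<close>
  define \<beta> where "\<beta> n = exp a2 * ((2 * (sqrt M0 / N n powr s))\<^sup>2 + 4 * sqrt M0 * e n)" for n
  have \<beta>0: "\<beta> n \<ge> 0" for n using e0[of n] M0 by (simp add: \<beta>_def)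
  have diff: "(norm (U n t - U m t))\<^sup>2 \<le> \<beta> n" if t: "t \<in> {0..\<delta>}" and nm: "n \<le> m" for n m t
  proof -
    define b where "b = 4 * sqrt M0 * e n"
    have b: "b \<ge> 0" using e0[of n] M0 by (simp add: b_def)
    have Nnm: "N n \<le> N m" using nm by (simp add: N_def)
    have "(norm (U n t - U m t))\<^sup>2 \<le> exp (a2 * t) * ((norm (U n 0 - U m 0))\<^sup>2 + b * t)"
    proof (rule Gronwall_differential[where f = "\<lambda>r. (norm (U n r - U m r))\<^sup>2" and A = "\<lambda>t. a2 * t" and \<alpha> = "\<lambda>_. a2"
        and f' = "\<lambda>r. 2 * inner (U n r - U m r) (cut (N n) (B (U n r) (U n r)) - cut (N m) (B (U m r) (U m r)))"])
      show "0 \<le> t" using t by simp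
      fix r assume r: "r \<in> {0..t}"
      show "((\<lambda>r. (norm (U n r - U m r))\<^sup>2) has_real_derivative
          2 * inner (U n r - U m r) (cut (N n) (B (U n r) (U n r)) - cut (N m) (B (U m r) (U m r)))) (at r within {0..t})"
        by (intro has_real_derivative_norm_sq has_vector_derivative_diff Uder[OF t r])
      show "((*) a2 has_real_derivative a2) (at r within {0..t})" by (rule DERIV_cmult_Id)
      show "0 \<le> a2 * r" using a2 r by simp
    next
      fix r assume "r \<in> {0<..<t}"
      then have r: "r \<in> {0..\<delta>}" using t by auto
      let ?u = "U n r" and ?v = "U m r"
      let ?x = "?u - ?v"
      have cx: "cut (N m) ?x = ?x"
      proof -
        have "cut (N m) ?u = ?u" using cut_cut_le[OF Nnm, of ?u] Uc[OF sub[OF r], of n] by simp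
        then show ?thesis
          using linear_diff[OF bounded_linear.linear[OF bounded_linear_cut], of "N m" ?u ?v] Uc[OF sub[OF r]] by simp
      qed
      have "inner ?x (cut (N m) (B ?v ?v)) = inner ?x (B ?v ?v)"
        using inner_cut[of "N m" ?x "B ?v ?v"] cx by simp
      then have eq: "inner ?x (cut (N n) (B ?u ?u) - cut (N m) (B ?v ?v))
          = inner ?x (B ?u ?u - B ?v ?v) - inner ?x (B ?u ?u - cut (N n) (B ?u ?u))"
        by (simp add: inner_diff_right)
      have fx: "hsq s ?x < \<infinity>" by (rule hsq_diff_finite[OF Ufin[OF r] Ufin[OF r]])
      have hz: "hsq s (?u + ?v) \<le> ennreal (4 * M)" using hsq_add_le_real[OF A[OF r] A[OF r] M M] by simp
      have "2 * inner ?x (B ?u ?u - B ?v ?v) \<le> a2 * (norm ?x)\<^sup>2"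
        unfolding B_diff_sq[OF s1(1) Ufin[OF r] Ufin[OF r]] a2_def
        using inner_B_linear_real[OF s hz _ herm_add[OF Uh Uh] fx] M sub[OF r] by auto
      moreover have "- (2 * inner ?x (B ?u ?u - cut (N n) (B ?u ?u))) \<le> b"
      proof -
        have nx: "norm ?x \<le> 2 * sqrt M0"
          using norm_triangle_ineq4[of ?u ?v] Un[OF sub[OF r], of n] Un[OF sub[OF r], of m]
            norm_cut_le[of "N n" u0] norm_cut_le[of "N m" u0] nu0 by linarith
        have "- inner ?x (B ?u ?u - cut (N n) (B ?u ?u)) \<le> norm ?x * norm (B ?u ?u - cut (N n) (B ?u ?u))"
          using Cauchy_Schwarz_ineq2[of ?x "B ?u ?u - cut (N n) (B ?u ?u)"] by linarith
        also have "\<dots> \<le> (2 * sqrt M0) * e n" by (rule mult_mono[OF nx tailB[OF r]]) (use M0 in auto)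
        finally show ?thesis by (simp add: b_def)
      qed
      ultimately show "2 * inner ?x (cut (N n) (B ?u ?u) - cut (N m) (B ?v ?v)) \<le> a2 * (norm ?x)\<^sup>2 + b"
        unfolding eq by (simp add: right_diff_distrib)
    qed (use b in auto)
    also have "\<dots> \<le> exp a2 * ((2 * (sqrt M0 / N n powr s))\<^sup>2 + b)"
    proof (intro mult_mono add_mono)
      have "a2 * t \<le> a2 * 1" using t \<delta> a2 by (intro mult_left_mono) auto
      then show "exp (a2 * t) \<le> exp a2" by simp
      have "sqrt M0 / N m powr s \<le> sqrt M0 / N n powr s"
        using Nnm N[of n] M0 s by (intro divide_left_mono powr_mono2) auto
      then have "norm (U n 0 - U m 0) \<le> 2 * (sqrt M0 / N n powr s)"
        using cut0[of n] cut0[of m] norm_triangle_ineq4[of "u0 - cut (N m) u0" "u0 - cut (N n) u0"] by (simp add: U0)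
      then show "(norm (U n 0 - U m 0))\<^sup>2 \<le> (2 * (sqrt M0 / N n powr s))\<^sup>2" by (intro power_mono) auto
      show "b * t \<le> b" using b t \<delta> by (intro mult_left_le) auto
    qed (use b t in auto)
    finally show ?thesis by (simp add: \<beta>_def b_def)
  qed
  have e_lim: "e \<longlonglongrightarrow> 0"
  proof -
    have "(\<lambda>n. sqrt (kb s * M * M) * inverse (real (Suc n) powr (s - 1))) \<longlonglongrightarrow> sqrt (kb s * M * M) * 0"
      by (intro tendsto_mult tendsto_const powr_nat_inverse_tendsto) (use s in simp)
    then show ?thesis by (simp add: e_def[abs_def] N_def divide_inverse)
  qed
  have cut_lim: "(\<lambda>n. sqrt M0 / N n powr s) \<longlonglongrightarrow> 0"
  proof -
    have "(\<lambda>n. sqrt M0 * inverse (real (Suc n) powr s)) \<longlonglongrightarrow> sqrt M0 * 0"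
      by (intro tendsto_mult tendsto_const powr_nat_inverse_tendsto) (use s in simp)
    then show ?thesis by (simp add: N_def divide_inverse)
  qed
  have \<beta>_lim: "\<beta> \<longlonglongrightarrow> 0"
  proof -
    have "\<beta> \<longlonglongrightarrow> exp a2 * ((2 * 0)\<^sup>2 + 4 * sqrt M0 * 0)"
      unfolding \<beta>_def[abs_def] by (intro tendsto_intros cut_lim e_lim)
    then show ?thesis by simp
  qed
  \<comment> \<open>Low frequencies converge by the estimate in \<open>L\<^sup>2\<close>; high frequencies are uniformly small.\<close>
  have unif: "\<exists>n0. \<forall>n\<ge>n0. \<forall>m\<ge>n. \<forall>t\<in>{0..\<delta>}. hsq s (U n t - U m t) \<le> ennreal \<epsilon>" if \<epsilon>: "\<epsilon> > 0" for \<epsilon>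
  proof -
    obtain C where C: "C \<ge> 0" and close: "\<And>x y. (\<And>w. slow_ramp w \<Longrightarrow> hsq_ramp s w x \<le> ennreal G * hsq_ramp s w u0)
        \<Longrightarrow> (\<And>w. slow_ramp w \<Longrightarrow> hsq_ramp s w y \<le> ennreal G * hsq_ramp s w u0) \<Longrightarrow> C * (norm (x - y))\<^sup>2 \<le> \<epsilon> / 2 \<Longrightarrow> hsq s (x - y) \<le> ennreal \<epsilon>"
      using hsq_close_of_tails[OF s1(3) fin0 G \<epsilon>] by blast
    have "(\<lambda>n. C * \<beta> n) \<longlonglongrightarrow> C * 0" by (intro tendsto_mult tendsto_const \<beta>_lim)
    then have "eventually (\<lambda>n. C * \<beta> n < \<epsilon> / 2) sequentially" by (rule order_tendstoD) (use \<epsilon> in simp)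
    then obtain n0 where n0: "\<And>n. n \<ge> n0 \<Longrightarrow> C * \<beta> n < \<epsilon> / 2" by (auto simp: eventually_sequentially)
    have "hsq s (U n t - U m t) \<le> ennreal \<epsilon>" if n: "n \<ge> n0" "m \<ge> n" and t: "t \<in> {0..\<delta>}" for n m t
    proof (rule close[OF tails[OF t] tails[OF t]])
      have "C * (norm (U n t - U m t))\<^sup>2 \<le> C * \<beta> n" by (intro mult_left_mono diff[OF t n(2)] C)
      then show "C * (norm (U n t - U m t))\<^sup>2 \<le> \<epsilon> / 2" using n0[OF n(1)] by linarith
    qed
    then show ?thesis by blast
  qed
  define u where "u t = lim (\<lambda>n. U n t)" for t
  have lim: "(\<lambda>n. U n t) \<longlonglongrightarrow> u t" if t: "t \<in> {0..\<delta>}" for t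
  proof -
    have "Cauchy (\<lambda>n. U n t)"
    proof (rule CauchyI')
      fix \<epsilon> :: real assume "\<epsilon> > 0"
      then have "eventually (\<lambda>n. \<beta> n < \<epsilon>\<^sup>2) sequentially" by (intro order_tendstoD[OF \<beta>_lim]) simp
      then obtain n0 where n0: "\<And>n. n \<ge> n0 \<Longrightarrow> \<beta> n < \<epsilon>\<^sup>2" by (auto simp: eventually_sequentially)
      have "dist (U n t) (U m t) < \<epsilon>" if "n \<ge> n0" "m > n" for n m
      proof -
        have "(norm (U n t - U m t))\<^sup>2 < \<epsilon>\<^sup>2" using diff[OF t, of n m] n0[of n] that by simp
        then show ?thesis using \<open>\<epsilon> > 0\<close> by (simp add: dist_norm power_less_imp_less_base)
      qed
      then show "\<exists>M. \<forall>m\<ge>M. \<forall>n>m. dist (U m t) (U n t) < \<epsilon>" by blast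
    qed
    then show ?thesis unfolding u_def by (simp add: Cauchy_convergent_iff convergent_LIMSEQ_iff)
  qed
  have close: "\<exists>n0. \<forall>n\<ge>n0. \<forall>t\<in>{0..\<delta>}. hsq s (U n t - u t) \<le> ennreal \<epsilon>" if \<epsilon>: "\<epsilon> > 0" for \<epsilon>
  proof -
    obtain n0 where n0: "\<forall>n\<ge>n0. \<forall>m\<ge>n. \<forall>t\<in>{0..\<delta>}. hsq s (U n t - U m t) \<le> ennreal \<epsilon>" using unif[OF \<epsilon>] by blast
    have "hsq s (U n t - u t) \<le> ennreal \<epsilon>" if n: "n \<ge> n0" and t: "t \<in> {0..\<delta>}" for n t
      by (rule hsq_lsc[OF s1(2), where X = "\<lambda>m. U n t - U m t" and k = n]) (use n0 n t lim[OF t] in \<open>auto intro!: tendsto_intros\<close>)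
    then show ?thesis by blast
  qed
  have uM: "hsq s (u t) \<le> ennreal M" if t: "t \<in> {0..\<delta>}" for t
    by (rule hsq_lsc[OF s1(2) lim[OF t]]) (rule A[OF t])
  have ufin: "hsq s (u t) < \<infinity>" if "t \<in> {0..\<delta>}" for t using uM[OF that] by (auto intro: le_less_trans)
  have uh: "herm (u t)" if t: "t \<in> {0..\<delta>}" for t
    by (rule herm_LIMSEQ[OF _ lim[OF t]]) (rule Uh[OF sub[OF t]])
  have u_0: "u 0 = u0"
  proof -
    have "(\<lambda>n. U n 0 - u0) \<longlonglongrightarrow> 0"
      by (rule Lim_null_comparison[OF _ cut_lim]) (use cut0 in \<open>simp add: U0 norm_minus_commute\<close>)
    then have "(\<lambda>n. U n 0) \<longlonglongrightarrow> u0" by (rule LIM_zero_cancel)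
    then show ?thesis using lim[of 0] \<delta> LIMSEQ_unique by auto
  qed
  have cont: "((\<lambda>r. hsq s (u r - u t)) \<longlongrightarrow> 0) (at t within {0..\<delta>})" if t: "t \<in> {0..\<delta>}" for t
  proof (rule ennreal_tendsto_0I)
    fix e' :: real assume e': "e' > 0"
    \<comment> \<open>Two applications of \<open>hsq_add_le\<close> to three summands: \<open>2 + 2 * (2 + 2) = 10\<close>.\<close>
    define \<epsilon> where "\<epsilon> = e' / 10"
    have \<epsilon>: "\<epsilon> > 0" "\<epsilon> \<ge> 0" using e' by (auto simp: \<epsilon>_def)
    obtain n where n: "\<And>t. t \<in> {0..\<delta>} \<Longrightarrow> hsq s (U n t - u t) \<le> ennreal \<epsilon>" using close[OF \<epsilon>(1)] by blast
    define w where "w = 1 + N n powr (2 * s)"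
    have w: "w > 0" by (simp add: w_def add_pos_nonneg)
    have "(U n \<longlongrightarrow> U n t) (at t within {0..\<delta>})"
      using has_vector_derivative_continuous[OF Uder[of \<delta> t n]] t \<delta> by (simp add: continuous_within)
    then have "((\<lambda>r. w * (norm (U n r - U n t))\<^sup>2) \<longlongrightarrow> w * (norm (U n t - U n t))\<^sup>2) (at t within {0..\<delta>})"
      by (intro tendsto_intros)
    then have "eventually (\<lambda>r. w * (norm (U n r - U n t))\<^sup>2 < \<epsilon>) (at t within {0..\<delta>})"
      by (rule order_tendstoD) (use \<epsilon> in simp)
    moreover have "eventually (\<lambda>r. r \<in> {0..\<delta>}) (at t within {0..\<delta>})" by (rule eventually_at_within_mem)
    ultimately show "eventually (\<lambda>r. hsq s (u r - u t) \<le> ennreal e') (at t within {0..\<delta>})"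
    proof eventually_elim
      case (elim r)
      have "cut (N n) (U n r - U n t) = U n r - U n t"
        using linear_diff[OF bounded_linear.linear[OF bounded_linear_cut], of "N n" "U n r" "U n t"]
          Uc[OF sub[OF t]] Uc[OF sub[OF elim(2)]] by simp
      then have "hsq s (U n r - U n t) \<le> ennreal (w * (norm (U n r - U n t))\<^sup>2)"
        using hsq_cut_le_norm[OF N(2) s1(3), of n "U n r - U n t"] by (simp add: w_def)
      also have "\<dots> \<le> ennreal \<epsilon>" using elim(1) by (intro ennreal_leI) simp
      finally have 1: "hsq s (U n r - U n t) \<le> ennreal \<epsilon>" .
      have 2: "hsq s (u r - U n r) \<le> ennreal \<epsilon>" using n[OF elim(2)] by (simp add: hsq_diff_commute)
      have 3: "hsq s ((U n r - U n t) + (U n t - u t)) \<le> ennreal (2 * \<epsilon> + 2 * \<epsilon>)"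
        by (rule hsq_add_le_real[OF 1 n[OF t] \<epsilon>(2,2)])
      have "hsq s ((u r - U n r) + ((U n r - U n t) + (U n t - u t))) \<le> ennreal (2 * \<epsilon> + 2 * (2 * \<epsilon> + 2 * \<epsilon>))"
        by (rule hsq_add_le_real[OF 2 3]) (use \<epsilon> in auto)
      then show ?case by (simp add: \<epsilon>_def)
    qed
  qed
  have deriv: "\<exists>g. \<forall>t\<in>{0..\<delta>}. (\<lambda>n. U n t) \<longlonglongrightarrow> g t \<and> (g has_derivative (\<lambda>h. h *\<^sub>R B (u t) (u t))) (at t within {0..\<delta>})"
  proof (rule has_derivative_sequence[where f' = "\<lambda>n t h. h *\<^sub>R cut (N n) (B (U n t) (U n t))" and ?x0.0 = 0 and l = "u 0"])
    show "(U n has_derivative (\<lambda>h. h *\<^sub>R cut (N n) (B (U n t) (U n t)))) (at t within {0..\<delta>})" if "t \<in> {0..\<delta>}" for n t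
      using Uder[of \<delta> t n] that \<delta> by (simp add: has_vector_derivative_def)
    fix e' :: real assume e': "e' > 0"
    define q where "q = kb s * (4 * M) + 1"
    have q: "q > 0" using kb_nonneg[of s] M by (simp add: q_def add_nonneg_pos)
    define \<epsilon> where "\<epsilon> = (e' / 2)\<^sup>2 / q"
    have \<epsilon>: "\<epsilon> > 0" using e' q by (simp add: \<epsilon>_def)
    obtain n1 where n1: "\<forall>n\<ge>n1. \<forall>t\<in>{0..\<delta>}. hsq s (U n t - u t) \<le> ennreal \<epsilon>" using close[OF \<epsilon>] by blast
    have "eventually (\<lambda>n. e n < e' / 2) sequentially" by (rule order_tendstoD[OF e_lim]) (use e' in simp)
    then show "\<forall>\<^sub>F n in sequentially. \<forall>t\<in>{0..\<delta>}. \<forall>h. norm (h *\<^sub>R cut (N n) (B (U n t) (U n t)) - h *\<^sub>R B (u t) (u t)) \<le> e' * norm h"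
      using eventually_ge_at_top[of n1]
    proof eventually_elim
      case (elim n)
      show ?case
      proof (intro ballI allI)
        fix t h assume t: "t \<in> {0..\<delta>}"
        have hd: "hsq s (U n t - u t) \<le> ennreal \<epsilon>" using n1 elim(2) t by blast
        have hs: "hsq s (U n t + u t) \<le> ennreal (2 * M + 2 * M)" by (rule hsq_add_le_real[OF A[OF t] uM[OF t] M M])
        have "norm (B (U n t) (U n t) - B (u t) (u t)) \<le> sqrt (kb s * (2 * M + 2 * M) * \<epsilon>)"
          unfolding B_diff_sq[OF s1(1) Ufin[OF t] ufin[OF t]]
          by (rule norm_B_le[OF s1(1) hs hd]) (use M \<epsilon> in auto)
        also have "\<dots> \<le> sqrt (q * \<epsilon>)" using \<epsilon> by (intro real_sqrt_le_mono mult_right_mono) (auto simp: q_def)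
        also have "\<dots> = e' / 2" using q e' by (simp add: \<epsilon>_def)
        finally have "norm (B (U n t) (U n t) - B (u t) (u t)) \<le> e' / 2" .
        moreover have "norm (cut (N n) (B (U n t) (U n t)) - B (U n t) (U n t)) \<le> e' / 2"
          using tailB[OF t, of n] elim(1) by (simp add: norm_minus_commute)
        ultimately have "norm (cut (N n) (B (U n t) (U n t)) - B (u t) (u t)) \<le> e'"
          using norm_triangle_ineq[of "cut (N n) (B (U n t) (U n t)) - B (U n t) (U n t)" "B (U n t) (U n t) - B (u t) (u t)"] by simp
        from mult_left_mono[OF this, of "\<bar>h\<bar>"]
        show "norm (h *\<^sub>R cut (N n) (B (U n t) (U n t)) - h *\<^sub>R B (u t) (u t)) \<le> e' * norm h"
          by (simp add: scaleR_diff_right[symmetric] mult.commute del: scaleR_diff_right)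
      qed
    qed
  qed (use \<delta> lim[of 0] in auto)
  then obtain g where g: "\<And>t. t \<in> {0..\<delta>} \<Longrightarrow> (\<lambda>n. U n t) \<longlonglongrightarrow> g t"
    "\<And>t. t \<in> {0..\<delta>} \<Longrightarrow> (g has_vector_derivative B (u t) (u t)) (at t within {0..\<delta>})"
    unfolding has_vector_derivative_def by blast
  have gu: "g t = u t" if "t \<in> {0..\<delta>}" for t using LIMSEQ_unique[OF g(1)[OF that] lim[OF that]] .
  have "(u has_vector_derivative B (u t) (u t)) (at t within {0..\<delta>})" if "t \<in> {0..\<delta>}" for t
    by (rule has_vector_derivative_transform[OF that _ g(2)[OF that]]) (simp add: gu)
  then have "fsol s {0..\<delta>} u" unfolding fsol_def using uh ufin cont by blast
  then show ?thesis using \<delta> u_0 by blast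
qed

section \<open>Time derivatives in the Sobolev norm\<close>

lemma norm_mul_sqrt:
  assumes W: "energy_weight C W" shows "(norm (mul (\<lambda>k. sqrt (W k)) x))\<^sup>2 = inner (mul W x) x" "bmeas (\<lambda>k. sqrt (W k))"
proof -
  have bW: "bmeas W" and W0: "\<And>x. W x \<ge> 0" using W by (auto simp: energy_weight_def)
  obtain K where K: "\<And>x. \<bar>W x\<bar> \<le> K" using bW by (auto simp: bmeas_def)
  note [measurable] = bmeas_measurable[OF bW]
  show b: "bmeas (\<lambda>k. sqrt (W k))"
    by (rule bmeasI[of _ "sqrt K"]) (use K W0 in \<open>auto simp: real_sqrt_abs2 abs_of_nonneg intro!: real_sqrt_le_mono\<close>)
  have "(norm (mul (\<lambda>k. sqrt (W k)) x))\<^sup>2 = inner (mul (\<lambda>k. sqrt (W k)) (mul (\<lambda>k. sqrt (W k)) x)) x"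
    by (simp add: power2_norm_eq_inner inner_mul_commute[OF b])
  also have "\<dots> = inner (mul W x) x" by (simp add: mul_mul[OF b b] W0)
  finally show "(norm (mul (\<lambda>k. sqrt (W k)) x))\<^sup>2 = inner (mul W x) x" .
qed

text \<open>
  Each truncated weight gives a bounded operator on \<open>L\<^sup>2\<close>, to which the mean value inequality
  applies; \<open>hsq\<close> is the supremum of the corresponding seminorms.
\<close>

lemma hsq_increment:
  fixes u :: "real \<Rightarrow> l2"
  assumes ab: "a < b" and p: "p \<ge> 1" and cont: "continuous_on {a..b} u"
    and der: "\<And>t. a < t \<Longrightarrow> t < b \<Longrightarrow> (u has_vector_derivative d t) (at t)"
    and le: "\<And>t. a < t \<Longrightarrow> t < b \<Longrightarrow> hsq p (d t - z) \<le> ennreal \<epsilon>" and \<epsilon>: "\<epsilon> \<ge> 0"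
  shows "hsq p (u b - u a - (b - a) *\<^sub>R z) \<le> ennreal ((b - a)\<^sup>2 * \<epsilon>)"
proof -
  let ?x = "u b - u a - (b - a) *\<^sub>R z"
  have "ennreal (inner (mul (\<lambda>k. wt p (real N) k * 1) ?x) ?x) \<le> ennreal ((b - a)\<^sup>2 * \<epsilon>)" for N :: nat
  proof -
    define W where "W k = wt p (real N) k * 1" for k
    have W: "energy_weight (wconst p) W" unfolding W_def by (rule energy_weight_wt[OF p _ slow_ramp_one]) simp
    define L where "L = mul (\<lambda>k. sqrt (W k))"
    have L2: "(norm (L x))\<^sup>2 = inner (mul W x) x" for x unfolding L_def by (rule norm_mul_sqrt[OF W])
    have Lb: "bounded_linear L" unfolding L_def by (rule bounded_linear_mul[OF norm_mul_sqrt(2)[OF W]])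
    interpret L: bounded_linear L by (rule Lb)
    define f where "f t = L (u t) - t *\<^sub>R L z" for t
    have "norm (f b - f a) \<le> sqrt \<epsilon> * b - sqrt \<epsilon> * a"
    proof (rule differentiable_bound_general[OF ab])
      show "continuous_on {a..b} f" unfolding f_def
        by (intro continuous_intros L.continuous_on cont)
      show "continuous_on {a..b} ((*) (sqrt \<epsilon>))" by (intro continuous_intros)
      fix t assume t: "a < t" "t < b"
      show "(f has_vector_derivative L (d t) - L z) (at t)"
        unfolding f_def
        by (auto intro!: derivative_eq_intros L.has_vector_derivative der t)
      show "((*) (sqrt \<epsilon>) has_vector_derivative sqrt \<epsilon>) (at t)"
        unfolding has_real_derivative_iff_has_vector_derivative[symmetric] by (rule DERIV_cmult_Id)
      have "ennreal ((norm (L (d t - z)))\<^sup>2) \<le> hsq p (d t - z)"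
        unfolding L2 hsq_eq_hsq_ramp W_def by (rule inner_wt_le_hsq_ramp[OF p slow_ramp_one]) simp
      also have "\<dots> \<le> ennreal \<epsilon>" by (rule le[OF t])
      finally have "(norm (L (d t - z)))\<^sup>2 \<le> \<epsilon>" using \<epsilon> by (subst (asm) ennreal_le_iff) auto
      then show "norm (L (d t) - L z) \<le> sqrt \<epsilon>" by (simp add: L.diff[symmetric] real_le_rsqrt)
    qed
    moreover have "f b - f a = L ?x" by (simp only: f_def L.diff L.scaleR) (simp add: algebra_simps)
    ultimately have "norm (L ?x) \<le> (b - a) * sqrt \<epsilon>" by (simp add: algebra_simps)
    then have "(norm (L ?x))\<^sup>2 \<le> ((b - a) * sqrt \<epsilon>)\<^sup>2" by (intro power_mono) auto
    then have "inner (mul W ?x) ?x \<le> (b - a)\<^sup>2 * \<epsilon>" using \<epsilon> by (simp add: L2 power_mult_distrib)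
    then show ?thesis unfolding W_def by (rule ennreal_leI)
  qed
  then show ?thesis unfolding hsq_eq_hsq_ramp hsq_ramp_SUP[OF p slow_ramp_one] by (intro SUP_least)
qed

lemma hsq_B_close:
  assumes s: "s > 1" and v: "hsq s v \<le> ennreal m" and m: "m \<ge> 0" and d: "hsq s (u - v) \<le> ennreal e" and e: "0 \<le> e" "e \<le> 1"
  shows "hsq (s - 1) (B u u - B v v) \<le> ennreal (kb s * (2 + 8 * m) * e)"
proof -
  have vf: "hsq s v < \<infinity>" using v by (auto intro: le_less_trans)
  have "hsq s (u - v) < \<infinity>" using d by (auto intro: le_less_trans)
  from hsq_add_finite[OF this vf] have uf: "hsq s u < \<infinity>" by simp
  have "hsq s (2 *\<^sub>R v) \<le> ennreal (4 * m)"
  proof -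
    have "hsq s (2 *\<^sub>R v) \<le> ennreal 4 * ennreal m" unfolding hsq_scaleR using v by (intro mult_mono) auto
    then show ?thesis using m by (subst ennreal_mult) auto
  qed
  from hsq_add_le_real[OF d this] have "hsq s ((u - v) + 2 *\<^sub>R v) \<le> ennreal (2 * e + 2 * (4 * m))" using e m by simp
  moreover have "(u - v) + 2 *\<^sub>R v = u + v" by (simp add: scaleR_2)
  moreover have "ennreal (2 * e + 2 * (4 * m)) \<le> ennreal (2 + 8 * m)" using e by (intro ennreal_leI) simp
  ultimately have 1: "hsq s (u + v) \<le> ennreal (2 + 8 * m)" by (auto intro: order_trans)
  show ?thesis unfolding B_diff_sq[OF s uf vf] by (rule hsq_B_le[OF s 1 d]) (use m e in auto)
qed

text \<open>
  While \<open>w\<close> stays close to \<open>z\<close> in \<open>H\<^sup>s\<close>, its velocity stays close to \<open>B z z\<close> in \<open>H\<^bsup>s-1\<^esup>\<close>.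
\<close>

lemma increment_B:
  fixes w :: "real \<Rightarrow> l2"
  assumes ab: "a < b" and s: "s > 2" and cont: "continuous_on {a..b} w"
    and der: "\<And>t. a < t \<Longrightarrow> t < b \<Longrightarrow> (w has_vector_derivative B (w t) (w t)) (at t)"
    and z: "hsq s z \<le> ennreal m" and m: "m \<ge> 0"
    and le: "\<And>t. a < t \<Longrightarrow> t < b \<Longrightarrow> hsq s (w t - z) \<le> ennreal e" and e: "0 \<le> e" "e \<le> 1"
  shows "hsq (s - 1) (w b - w a - (b - a) *\<^sub>R B z z) \<le> ennreal ((b - a)\<^sup>2 * (kb s * (2 + 8 * m) * e))"
proof (rule hsq_increment[OF ab _ cont der])
  show "hsq (s - 1) (B (w t) (w t) - B z z) \<le> ennreal (kb s * (2 + 8 * m) * e)" if "a < t" "t < b" for t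
    by (rule hsq_B_close[OF _ z m le[OF that] e]) (use s in simp)
qed (use s e m kb_nonneg[of s] in auto)

lemma fsol_continuous_on: "fsol s I u \<Longrightarrow> continuous_on I u"
  unfolding fsol_def continuous_on_eq_continuous_within by (blast intro: has_vector_derivative_continuous)

lemma fsol_subset: "fsol s I u \<Longrightarrow> J \<subseteq> I \<Longrightarrow> fsol s J u"
  unfolding fsol_def
  by (meson has_vector_derivative_within_subset subsetD tendsto_within_subset)

lemma small_of_pos:
  fixes C e :: real assumes "e > 0" "C \<ge> 0"
  obtains d where "0 < d" "d \<le> 1" "C * d \<le> e"
proof
  show "0 < min 1 (e / (C + 1))" "min 1 (e / (C + 1)) \<le> 1" using assms by auto
  have "C * min 1 (e / (C + 1)) \<le> (C + 1) * (e / (C + 1))" using assms by (intro mult_mono) auto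
  then show "C * min 1 (e / (C + 1)) \<le> e" using assms by simp
qed

text \<open>
  The mean value inequality in \<open>H\<^bsup>s-1\<^esup>\<close> on a short interval on either side of \<open>t\<close>, on which \<open>u\<close> is
  close to \<open>u t\<close> in \<open>H\<^sup>s\<close> by continuity.
\<close>

lemma fsol_deriv_hsq:
  assumes sol: "fsol s {0..<T} u" and s: "s > 2" and t: "t \<in> {0..<T}"
  shows "((\<lambda>r. hsq (s - 1) ((1 / (r - t)) *\<^sub>R (u r - u t) - B (u t) (u t))) \<longlongrightarrow> 0) (at t within {0..<T})"
proof (rule ennreal_tendsto_0I)
  fix e :: real assume e: "e > 0"
  have "hsq s (u t) < \<infinity>" using sol t unfolding fsol_def by blast
  then obtain m where m: "hsq s (u t) = ennreal m" "m \<ge> 0" by (cases "hsq s (u t)") auto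
  have C: "kb s * (2 + 8 * m) \<ge> 0" using kb_nonneg[of s] m by simp
  obtain d where d: "0 < d" "d \<le> 1" "kb s * (2 + 8 * m) * d \<le> e" using small_of_pos[OF e C] by blast
  have "((\<lambda>r. hsq s (u r - u t)) \<longlongrightarrow> 0) (at t within {0..<T})" using sol t unfolding fsol_def by blast
  from ennreal_tendsto_0D[OF this d(1)]
  obtain \<eta> where \<eta>: "\<eta> > 0" "\<And>r. r \<in> {0..<T} \<Longrightarrow> r \<noteq> t \<Longrightarrow> dist r t < \<eta> \<Longrightarrow> hsq s (u r - u t) \<le> ennreal d"
    unfolding eventually_at by blast
  have cont: "continuous_on {0..<T} u" by (rule fsol_continuous_on[OF sol])
  have der: "(u has_vector_derivative B (u r) (u r)) (at r)" if "r \<in> {0<..<T}" for r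
  proof -
    have "at r within {0..<T} = at r" by (rule at_within_interior) (use that in \<open>auto simp: interior_atLeastLessThan\<close>)
    then show ?thesis using sol that unfolding fsol_def by (metis greaterThanLessThan_subseteq_atLeastLessThan_iff in_mono order_refl)
  qed
  have main: "hsq (s - 1) (u b - u a - (b - a) *\<^sub>R B (u t) (u t)) \<le> ennreal ((b - a)\<^sup>2 * e)"
    if ab: "a < b" "a \<in> {0..<T}" "b \<in> {0..<T}" and near: "\<And>r. a < r \<Longrightarrow> r < b \<Longrightarrow> r \<noteq> t \<and> dist r t < \<eta>" for a b
  proof -
    have "hsq (s - 1) (u b - u a - (b - a) *\<^sub>R B (u t) (u t)) \<le> ennreal ((b - a)\<^sup>2 * (kb s * (2 + 8 * m) * d))"
    proof (rule increment_B[OF ab(1) s])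
      show "continuous_on {a..b} u" by (rule continuous_on_subset[OF cont]) (use ab in auto)
      show "(u has_vector_derivative B (u r) (u r)) (at r)" if "a < r" "r < b" for r by (rule der) (use that ab in auto)
      show "hsq s (u r - u t) \<le> ennreal d" if "a < r" "r < b" for r by (rule \<eta>(2)) (use that ab near[OF that] in auto)
    qed (use m d in auto)
    also have "\<dots> \<le> ennreal ((b - a)\<^sup>2 * e)" by (intro ennreal_leI mult_left_mono d) auto
    finally show ?thesis .
  qed
  show "\<forall>\<^sub>F r in at t within {0..<T}. hsq (s - 1) ((1 / (r - t)) *\<^sub>R (u r - u t) - B (u t) (u t)) \<le> ennreal e"
    unfolding eventually_at
  proof (intro exI[of _ \<eta>] conjI ballI impI \<eta>(1))
    fix r assume r: "r \<in> {0..<T}" "r \<noteq> t \<and> dist r t < \<eta>"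
    have le: "hsq (s - 1) (u r - u t - (r - t) *\<^sub>R B (u t) (u t)) \<le> ennreal ((r - t)\<^sup>2 * e)"
    proof (cases "r > t")
      case True
      then show ?thesis using main[of t r] t r by (auto simp: dist_real_def)
    next
      case False
      then have "hsq (s - 1) (u t - u r - (t - r) *\<^sub>R B (u t) (u t)) \<le> ennreal ((t - r)\<^sup>2 * e)"
        using main[of r t] t r by (auto simp: dist_real_def)
      moreover have "u t - u r - (t - r) *\<^sub>R B (u t) (u t) = - (u r - u t - (r - t) *\<^sub>R B (u t) (u t))" by (simp add: algebra_simps)
      ultimately show ?thesis by (simp only: hsq_minus power2_commute)
    qed
    have rt: "r - t \<noteq> 0" using r by simp
    have "(1 / (r - t)) *\<^sub>R (u r - u t) - B (u t) (u t) = (1 / (r - t)) *\<^sub>R (u r - u t - (r - t) *\<^sub>R B (u t) (u t))"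
      using rt by (simp add: scaleR_diff_right)
    then have "hsq (s - 1) ((1 / (r - t)) *\<^sub>R (u r - u t) - B (u t) (u t))
        = ennreal ((1 / (r - t))\<^sup>2) * hsq (s - 1) (u r - u t - (r - t) *\<^sub>R B (u t) (u t))"
      by (simp only: hsq_scaleR)
    also have "\<dots> \<le> ennreal ((1 / (r - t))\<^sup>2) * ennreal ((r - t)\<^sup>2 * e)" by (intro mult_left_mono le) auto
    also have "\<dots> = ennreal e" using rt e by (simp add: ennreal_mult[symmetric] power_divide)
    finally show "hsq (s - 1) ((1 / (r - t)) *\<^sub>R (u r - u t) - B (u t) (u t)) \<le> ennreal e" .
  qed
qed

section \<open>The limit at the final time\<close>

lemma mom_triangle: "mom p (u + v) \<le> mom p u + mom p v"
proof -
  have "mom p (u + v) \<le> (\<integral>\<^sup>+k. ennreal (\<bar>k\<bar> powr p * cmod (rep u k)) + ennreal (\<bar>k\<bar> powr p * cmod (rep v k)) \<partial>lborel)"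
    unfolding mom_def
  proof (rule nn_integral_mono_AE)
    show "AE k in lborel. ennreal (\<bar>k\<bar> powr p * cmod (rep (u + v) k))
      \<le> ennreal (\<bar>k\<bar> powr p * cmod (rep u k)) + ennreal (\<bar>k\<bar> powr p * cmod (rep v k))"
      using rep_add[of u v]
    proof eventually_elim
      case (elim k)
      have "\<bar>k\<bar> powr p * cmod (rep (u + v) k) \<le> \<bar>k\<bar> powr p * (cmod (rep u k) + cmod (rep v k))"
        unfolding elim by (intro mult_left_mono norm_triangle_ineq) auto
      also have "\<dots> = \<bar>k\<bar> powr p * cmod (rep u k) + \<bar>k\<bar> powr p * cmod (rep v k)" by (rule distrib_left)
      finally have "ennreal (\<bar>k\<bar> powr p * cmod (rep (u + v) k))
        \<le> ennreal (\<bar>k\<bar> powr p * cmod (rep u k) + \<bar>k\<bar> powr p * cmod (rep v k))" by (rule ennreal_leI)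
      then show ?case by (subst (asm) ennreal_plus) auto
    qed
  qed
  also have "\<dots> = mom p u + mom p v" unfolding mom_def by (rule nn_integral_add) measurable
  finally show ?thesis .
qed

lemma fsol_mom_continuous:
  assumes sol: "fsol s I u" and s: "s > 2"
  shows "continuous_on I (\<lambda>t. enn2real (mom (3/2) (u t)))"
    and "\<And>t. t \<in> I \<Longrightarrow> mom (3/2) (u t) = ennreal (enn2real (mom (3/2) (u t)))"
proof -
  have fin: "mom (3/2) x < \<infinity>" if "hsq s x < \<infinity>" for x using mom_finite[of "3/2" s x] s that by simp
  have uf: "hsq s (u t) < \<infinity>" if "t \<in> I" for t using sol that unfolding fsol_def by blast
  show e: "mom (3/2) (u t) = ennreal (enn2real (mom (3/2) (u t)))" if "t \<in> I" for t using fin[OF uf[OF that]] by simp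
  have diff: "\<bar>enn2real (mom (3/2) (u r)) - enn2real (mom (3/2) (u t))\<bar> \<le> sqrt (kp s * a)"
    if "t \<in> I" "r \<in> I" "hsq s (u r - u t) \<le> ennreal a" "a \<ge> 0" for r t a
  proof -
    have m: "mom (3/2) (u r - u t) \<le> ennreal (sqrt (kp s * a))" by (rule mom_le_sqrt[OF s that(3,4)])
    have q: "sqrt (kp s * a) \<ge> 0" using that kp_nonneg[of s] by simp
    have "mom (3/2) ((u r - u t) + u t) \<le> ennreal (sqrt (kp s * a)) + mom (3/2) (u t)"
      by (rule order_trans[OF mom_triangle add_right_mono[OF m]])
    then have 1: "enn2real (mom (3/2) (u r)) \<le> sqrt (kp s * a) + enn2real (mom (3/2) (u t))"
      using q e[OF that(1)] e[OF that(2)] by (metis add_nonneg_nonneg diff_add_cancel enn2real_nonneg ennreal_le_iff ennreal_plus)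
    have "mom (3/2) (u t - u r) = mom (3/2) (u r - u t)"
      unfolding mom_def by (rule nn_integral_cong_AE)
        (use rep_diff[of "u t" "u r"] rep_diff[of "u r" "u t"] in \<open>eventually_elim, simp add: norm_minus_commute\<close>)
    then have "mom (3/2) ((u t - u r) + u r) \<le> ennreal (sqrt (kp s * a)) + mom (3/2) (u r)"
      using order_trans[OF mom_triangle[of "3/2" "u t - u r" "u r"] add_right_mono[of "mom (3/2) (u t - u r)"]] m by simp
    then have 2: "enn2real (mom (3/2) (u t)) \<le> sqrt (kp s * a) + enn2real (mom (3/2) (u r))"
      using q e[OF that(1)] e[OF that(2)] by (metis add_nonneg_nonneg diff_add_cancel enn2real_nonneg ennreal_le_iff ennreal_plus)
    show ?thesis using 1 2 by linarith
  qed
  show "continuous_on I (\<lambda>t. enn2real (mom (3/2) (u t)))"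
    unfolding continuous_on_def
  proof
    fix t assume t: "t \<in> I"
    show "((\<lambda>t. enn2real (mom (3/2) (u t))) \<longlongrightarrow> enn2real (mom (3/2) (u t))) (at t within I)"
    proof (rule tendstoI)
      fix e' :: real assume e': "e' > 0"
      obtain d where d: "0 < d" "kp s * d \<le> (e' / 2)\<^sup>2" using small_of_pos[of "(e' / 2)\<^sup>2" "kp s"] e' kp_nonneg[of s] by auto
      have "((\<lambda>r. hsq s (u r - u t)) \<longlongrightarrow> 0) (at t within I)" using sol t unfolding fsol_def by blast
      from ennreal_tendsto_0D[OF this d(1)] have "eventually (\<lambda>r. hsq s (u r - u t) \<le> ennreal d) (at t within I)" .
      moreover have "eventually (\<lambda>r. r \<in> I) (at t within I)" by (simp add: eventually_at_filter)
      ultimately show "eventually (\<lambda>r. dist (enn2real (mom (3/2) (u r))) (enn2real (mom (3/2) (u t))) < e') (at t within I)"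
      proof eventually_elim
        case (elim r)
        have "\<bar>enn2real (mom (3/2) (u r)) - enn2real (mom (3/2) (u t))\<bar> \<le> sqrt (kp s * d)"
          by (rule diff[OF t elim(2,1)]) (use d in simp)
        also have "\<dots> \<le> sqrt ((e' / 2)\<^sup>2)" using d by (intro real_sqrt_le_mono) simp
        also have "\<dots> < e'" using e' by simp
        finally show ?case by (simp add: dist_real_def)
      qed
    qed
  qed
qed

text \<open>
  The integral of the moment bounds the growth factor of all weighted energies. This yields a
  bound in \<open>H\<^sup>s\<close>, hence a Lipschitz bound in \<open>L\<^sup>2\<close>, and a uniform control of high frequencies by
  those of the initial value; by \<open>hsq_close_of_tails\<close> the values near \<open>T\<close> form a Cauchy family in
  \<open>H\<^sup>s\<close>.
\<close>

lemma fsol_limit: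
  assumes sol: "fsol s {0..<T} u" and s: "s > 2" and T: "T > 0"
    and int: "(\<integral>\<^sup>+t\<in>{0..<T}. mom (3/2) (u t) \<partial>lborel) < \<infinity>"
  shows "\<exists>uT. herm uT \<and> hsq s uT < \<infinity> \<and> ((\<lambda>t. hsq s (u t - uT)) \<longlongrightarrow> 0) (at T within {0..<T})"
proof -
  have s1: "s > 1" "s \<ge> 1" "s \<ge> 0" using s by auto
  have uh: "herm (u t)" and uf: "hsq s (u t) < \<infinity>" and ud: "(u has_vector_derivative B (u t) (u t)) (at t within {0..<T})"
    if "t \<in> {0..<T}" for t using sol that unfolding fsol_def by auto
  define \<alpha> where "\<alpha> t = enn2real (mom (3/2) (u t))" for t
  have \<alpha>c: "continuous_on {0..<T} \<alpha>" unfolding \<alpha>_def by (rule fsol_mom_continuous[OF sol s])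
  have \<alpha>e: "mom (3/2) (u t) = ennreal (\<alpha> t)" if "t \<in> {0..<T}" for t
    unfolding \<alpha>_def using that by (rule fsol_mom_continuous(2)[OF sol s])
  have \<alpha>0: "\<alpha> t \<ge> 0" for t by (simp add: \<alpha>_def)
  define A where "A t = integral {0..t} \<alpha>" for t
  obtain K where K: "(\<integral>\<^sup>+t\<in>{0..<T}. mom (3/2) (u t) \<partial>lborel) = ennreal K" "K \<ge> 0" using int
    by (cases "\<integral>\<^sup>+t\<in>{0..<T}. mom (3/2) (u t) \<partial>lborel") auto
  have AK: "A t \<le> K" "A t \<ge> 0" if t: "t \<in> {0..<T}" for t
  proof -
    have c: "continuous_on {0..t} \<alpha>" by (rule continuous_on_subset[OF \<alpha>c]) (use t in auto)
    have si: "set_integrable lborel {0..t} \<alpha>" by (rule borel_integrable_compact[OF _ c, folded set_integrable_def]) simp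
    have "A t = (LINT r:{0..t}|lborel. \<alpha> r)" unfolding A_def by (rule set_borel_integral_eq_integral(2)[OF si, symmetric])
    then have e: "A t = (LINT r|lborel. indicator {0..t} r * \<alpha> r)" by (simp add: set_lebesgue_integral_def)
    show "A t \<ge> 0" unfolding e using \<alpha>0 by (intro integral_nonneg_AE) auto
    have "ennreal (A t) = (\<integral>\<^sup>+r. ennreal (indicator {0..t} r * \<alpha> r) \<partial>lborel)"
      unfolding e using si \<alpha>0 by (intro nn_integral_eq_integral[symmetric]) (auto simp: set_integrable_def)
    also have "\<dots> \<le> (\<integral>\<^sup>+r\<in>{0..<T}. mom (3/2) (u r) \<partial>lborel)"
      using t \<alpha>e by (intro nn_integral_mono) (auto simp: indicator_def)
    finally show "A t \<le> K" using K by (simp add: ennreal_le_iff)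
  qed
  define G where "G = exp ((2 + 4 * wconst s) * K)"
  have G: "G > 0" by (simp add: G_def)
  have tails: "hsq_ramp s w (u t) \<le> ennreal G * hsq_ramp s w (u 0)" if t: "t \<in> {0..<T}" and w: "slow_ramp w" for t w
  proof -
    have "hsq_ramp s w (u t) \<le> ennreal (exp ((2 + 4 * wconst s) * A t)) * hsq_ramp s w (u 0)"
    proof (rule hsq_ramp_growth[where \<alpha> = \<alpha>])
      show "0 \<le> t" using t by simp
      fix r assume r: "r \<in> {0..t}"
      then have r': "r \<in> {0..<T}" using t by auto
      show "(u has_vector_derivative B (u r) (u r)) (at r within {0..t})"
        by (rule has_vector_derivative_within_subset[OF ud[OF r']]) (use t in auto)
      show "herm (u r)" "hsq s (u r) < \<infinity>" using uh[OF r'] uf[OF r'] by auto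
      show "mom (3/2) (u r) \<le> ennreal (\<alpha> r)" using \<alpha>e[OF r'] by simp
      show "0 \<le> \<alpha> r" by (rule \<alpha>0)
      show "0 \<le> A r" by (rule AK[OF r'])
      have c: "continuous_on {0..t} \<alpha>" by (rule continuous_on_subset[OF \<alpha>c]) (use t in auto)
      show "(A has_real_derivative \<alpha> r) (at r within {0..t})" unfolding A_def
        by (rule integral_has_real_derivative[OF c r])
    qed (use s1 w in \<open>auto simp: A_def\<close>)
    also have "\<dots> \<le> ennreal G * hsq_ramp s w (u 0)"
      unfolding G_def using AK[OF t] wconst_nonneg[OF s1(3)]
      by (intro mult_right_mono ennreal_leI) (auto intro!: mult_left_mono)
    finally show ?thesis .
  qed
  have 0: "0 \<in> {0..<T}" using T by simp
  obtain M0 where M0: "hsq s (u 0) = ennreal M0" "M0 \<ge> 0" using uf[OF 0] by (cases "hsq s (u 0)") auto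
  define M where "M = G * M0"
  have M: "M \<ge> 0" using G M0 by (simp add: M_def)
  have uM: "hsq s (u t) \<le> ennreal M" if "t \<in> {0..<T}" for t
    using tails[OF that slow_ramp_one] G M0 by (simp add: hsq_eq_hsq_ramp[symmetric] M_def ennreal_mult)
  define L where "L = sqrt (kb s * M * M)"
  have L: "L \<ge> 0" using kb_nonneg[of s] M by (simp add: L_def)
  have lip: "norm (u t - u r) \<le> L * \<bar>t - r\<bar>" if "t \<in> {0..<T}" "r \<in> {0..<T}" for t r
  proof -
    have "norm (u t - u r) \<le> L * norm (t - r)"
    proof (rule differentiable_bound[where S = "{0..<T}" and f' = "\<lambda>t h. h *\<^sub>R B (u t) (u t)"])
      fix r assume r: "r \<in> {0..<T}"
      show "(u has_derivative (\<lambda>h. h *\<^sub>R B (u r) (u r))) (at r within {0..<T})"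
        using ud[OF r] by (simp add: has_vector_derivative_def)
      have "norm (B (u r) (u r)) \<le> L" unfolding L_def by (rule norm_B_le[OF s1(1) uM[OF r] uM[OF r] M M])
      then show "onorm (\<lambda>h. h *\<^sub>R B (u r) (u r)) \<le> L"
        by (intro onorm_bound L) (simp add: mult.commute[of L] mult_left_mono)
    qed (use that in auto)
    then show ?thesis by simp
  qed
  have unif: "\<exists>\<eta>>0. \<forall>t\<in>{0..<T}. \<forall>r\<in>{0..<T}. T - \<eta> < t \<longrightarrow> T - \<eta> < r \<longrightarrow> hsq s (u t - u r) \<le> ennreal \<epsilon>" if \<epsilon>: "\<epsilon> > 0" for \<epsilon>
  proof -
    obtain C where C: "C \<ge> 0" and close: "\<And>x y. (\<And>w. slow_ramp w \<Longrightarrow> hsq_ramp s w x \<le> ennreal G * hsq_ramp s w (u 0))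
        \<Longrightarrow> (\<And>w. slow_ramp w \<Longrightarrow> hsq_ramp s w y \<le> ennreal G * hsq_ramp s w (u 0)) \<Longrightarrow> C * (norm (x - y))\<^sup>2 \<le> \<epsilon> / 2 \<Longrightarrow> hsq s (x - y) \<le> ennreal \<epsilon>"
      using hsq_close_of_tails[OF s1(3) uf[OF 0] G \<epsilon>] by blast
    have CL: "C * L\<^sup>2 \<ge> 0" using C by simp
    obtain \<eta> where \<eta>: "0 < \<eta>" "\<eta> \<le> 1" "C * L\<^sup>2 * \<eta> \<le> \<epsilon> / 2" using small_of_pos[of "\<epsilon> / 2", OF _ CL] \<epsilon> by auto
    have "hsq s (u t - u r) \<le> ennreal \<epsilon>" if t: "t \<in> {0..<T}" "r \<in> {0..<T}" "T - \<eta> < t" "T - \<eta> < r" for t r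
    proof (rule close[OF tails[OF t(1)] tails[OF t(2)]])
      have d: "\<bar>t - r\<bar> \<le> \<eta>" using t by auto
      then have "\<bar>t - r\<bar>\<^sup>2 \<le> \<eta>\<^sup>2" by (intro power_mono) auto
      also have "\<dots> \<le> \<eta>" using \<eta> by (simp add: power2_eq_square mult_left_le)
      finally have d2: "\<bar>t - r\<bar>\<^sup>2 \<le> \<eta>" .
      have "norm (u t - u r) \<le> L * \<bar>t - r\<bar>" by (rule lip[OF t(1,2)])
      then have "(norm (u t - u r))\<^sup>2 \<le> (L * \<bar>t - r\<bar>)\<^sup>2" by (intro power_mono) auto
      also have "\<dots> \<le> L\<^sup>2 * \<eta>" unfolding power_mult_distrib by (intro mult_left_mono d2) simp
      finally have "C * (norm (u t - u r))\<^sup>2 \<le> C * (L\<^sup>2 * \<eta>)" using C by (intro mult_left_mono)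
      then show "C * (norm (u t - u r))\<^sup>2 \<le> \<epsilon> / 2" using \<eta>(3) by (simp add: mult.assoc)
    qed
    then show ?thesis using \<eta>(1) by blast
  qed
  define \<tau> where "\<tau> n = T - T / real (Suc n)" for n
  have \<tau>: "\<tau> n \<in> {0..<T}" for n using T by (simp add: \<tau>_def field_simps)
  have \<tau>lim: "\<tau> \<longlonglongrightarrow> T"
  proof -
    have "(\<lambda>n. T - T / real (Suc n)) \<longlonglongrightarrow> T - 0"
      by (intro tendsto_intros LIMSEQ_Suc[OF lim_const_over_n[of T]])
    then show ?thesis by (simp add: \<tau>_def[abs_def])
  qed
  have near: "\<exists>n0. \<forall>n\<ge>n0. T - \<eta> < \<tau> n" if "\<eta> > 0" for \<eta>
    using order_tendstoD(1)[OF \<tau>lim, of "T - \<eta>"] that by (simp add: eventually_sequentially)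
  have "Cauchy (\<lambda>n. u (\<tau> n))"
  proof (rule CauchyI')
    fix e :: real assume e: "e > 0"
    then have "(e / 2)\<^sup>2 > 0" by simp
    from unif[OF this] obtain \<eta> where \<eta>: "\<eta> > 0"
      "\<forall>t\<in>{0..<T}. \<forall>r\<in>{0..<T}. T - \<eta> < t \<longrightarrow> T - \<eta> < r \<longrightarrow> hsq s (u t - u r) \<le> ennreal ((e / 2)\<^sup>2)" by blast
    obtain n0 where n0: "\<forall>n\<ge>n0. T - \<eta> < \<tau> n" using near[OF \<eta>(1)] by blast
    have "dist (u (\<tau> m)) (u (\<tau> n)) < e" if "m \<ge> n0" "n > m" for m n
    proof -
      have "hsq s (u (\<tau> m) - u (\<tau> n)) \<le> ennreal ((e / 2)\<^sup>2)" using \<eta>(2) n0 \<tau> that by auto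
      then have "norm (u (\<tau> m) - u (\<tau> n)) \<le> sqrt ((e / 2)\<^sup>2)" by (rule norm_le_of_hsq) simp
      then show ?thesis using e by (simp add: dist_norm)
    qed
    then show "\<exists>M. \<forall>m\<ge>M. \<forall>n>m. dist (u (\<tau> m)) (u (\<tau> n)) < e" by blast
  qed
  then obtain uT where uT: "(\<lambda>n. u (\<tau> n)) \<longlonglongrightarrow> uT" by (auto simp: Cauchy_convergent_iff convergent_def)
  have "herm uT" by (rule herm_LIMSEQ[OF uh[OF \<tau>] uT])
  moreover have "hsq s uT < \<infinity>"
    using hsq_lsc[OF s1(2) uT uM[OF \<tau>]] by (auto intro: le_less_trans)
  moreover have "((\<lambda>t. hsq s (u t - uT)) \<longlongrightarrow> 0) (at T within {0..<T})"
  proof (rule ennreal_tendsto_0I)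
    fix e :: real assume e: "e > 0"
    from unif[OF e] obtain \<eta> where \<eta>: "\<eta> > 0"
      "\<forall>t\<in>{0..<T}. \<forall>r\<in>{0..<T}. T - \<eta> < t \<longrightarrow> T - \<eta> < r \<longrightarrow> hsq s (u t - u r) \<le> ennreal e" by blast
    obtain n0 where n0: "\<forall>n\<ge>n0. T - \<eta> < \<tau> n" using near[OF \<eta>(1)] by blast
    show "\<forall>\<^sub>F t in at T within {0..<T}. hsq s (u t - uT) \<le> ennreal e"
      unfolding eventually_at
    proof (intro exI[of _ \<eta>] conjI ballI impI \<eta>(1))
      fix t assume t: "t \<in> {0..<T}" "t \<noteq> T \<and> dist t T < \<eta>"
      then have t': "T - \<eta> < t" by (auto simp: dist_real_def)
      show "hsq s (u t - uT) \<le> ennreal e"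
        by (rule hsq_lsc[OF s1(2), where X = "\<lambda>n. u t - u (\<tau> n)" and k = n0])
          (use \<eta>(2) n0 t t' \<tau> uT in \<open>auto intro!: tendsto_intros\<close>)
    qed
  qed
  ultimately show ?thesis by blast
qed

section \<open>Gluing\<close>

lemma has_vector_derivative_union:
  assumes "(f has_vector_derivative d) (at t within S)" "(f has_vector_derivative d) (at t within S')"
  shows "(f has_vector_derivative d) (at t within (S \<union> S'))"
  using assms unfolding has_vector_derivative_def has_derivative_within
  unfolding at_within_union by (blast intro: filterlim_sup)

lemma at_within_bot: "t \<notin> S \<Longrightarrow> closed S \<Longrightarrow> at t within S = bot"
  using at_within_eq_bot_iff[of t S] closure_closed[of S] by auto

text \<open>
  At a point that is isolated from \<open>S\<close> every vector is a derivative; this treats the side of \<open>T\<close>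
  on which a point does not lie.
\<close>

lemma has_vector_derivative_bot:
  assumes "at t within S = bot" shows "(f has_vector_derivative d) (at t within S)"
  unfolding has_vector_derivative_def has_derivative_within assms by (auto intro: bounded_linear_scaleR_left)

text \<open>
  At \<open>T\<close> itself the left derivative is at issue. It exists and has the right value by
  \<open>increment_B\<close>, since the solution converges in \<open>H\<^sup>s\<close>.
\<close>

lemma fsol_glue:
  assumes sol: "fsol s {0..<T} u" and s: "s > 2" and T: "T > 0" and \<delta>: "\<delta> > 0"
    and vsol: "fsol s {0..\<delta>} v"
    and lim: "((\<lambda>t. hsq s (u t - v 0)) \<longlongrightarrow> 0) (at T within {0..<T})"
  shows "fsol s {0..<T + \<delta>} (\<lambda>t. if t < T then u t else v (t - T))"
proof -
  define w where "w t = (if t < T then u t else v (t - T))" for t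
  define I where "I = {0..<T} \<union> {T..T + \<delta>}"
  have wl: "w t = u t" if "t \<in> {0..<T}" for t using that by (simp add: w_def)
  have wr: "w t = v (t - T)" if "t \<in> {T..T + \<delta>}" for t using that by (simp add: w_def)
  have uh: "herm (u t)" and uf: "hsq s (u t) < \<infinity>" and uc: "((\<lambda>r. hsq s (u r - u t)) \<longlongrightarrow> 0) (at t within {0..<T})"
    and ud: "(u has_vector_derivative B (u t) (u t)) (at t within {0..<T})"
    if "t \<in> {0..<T}" for t using sol that unfolding fsol_def by auto
  have vh: "herm (v t)" and vf: "hsq s (v t) < \<infinity>" and vc: "((\<lambda>r. hsq s (v r - v t)) \<longlongrightarrow> 0) (at t within {0..\<delta>})"
    and vd: "(v has_vector_derivative B (v t) (v t)) (at t within {0..\<delta>})"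
    if "t \<in> {0..\<delta>}" for t using vsol that unfolding fsol_def by auto
  have right_bot: "at t within {T..T + \<delta>} = bot" if "t < T" for t by (rule at_within_bot) (use that in auto)
  have left_bot: "at t within {0..<T} = bot" if "t > T" for t
  proof -
    have "at t within {0..T} = bot" by (rule at_within_bot) (use that in auto)
    moreover have "at t within {0..<T} \<le> at t within {0..T}" by (rule at_le) auto
    ultimately show ?thesis by (simp add: bot_unique)
  qed
  have shift: "filterlim (\<lambda>r. r - T) (at (t - T) within {0..\<delta>}) (at t within {T..T + \<delta>})" for t
    by (auto simp: filterlim_at eventually_at_filter intro!: tendsto_eq_intros)
  have cont: "((\<lambda>r. hsq s (w r - w t)) \<longlongrightarrow> 0) (at t within I)" if t: "t \<in> I" for t
    unfolding I_def at_within_union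
  proof (rule filterlim_sup)
    show "((\<lambda>r. hsq s (w r - w t)) \<longlongrightarrow> 0) (at t within {0..<T})"
    proof -
      consider "t > T" | "t = T" | "t \<in> {0..<T}" using t by (force simp: I_def)
      then show ?thesis
      proof cases
        case 1 then show ?thesis by (simp add: left_bot)
      next
        case 2
        have "eventually (\<lambda>r. hsq s (u r - v 0) = hsq s (w r - w t)) (at t within {0..<T})"
          using 2 by (auto simp: eventually_at_filter w_def)
        then show ?thesis using lim 2 by (auto intro: Lim_transform_eventually)
      next
        case 3
        have "eventually (\<lambda>r. hsq s (u r - u t) = hsq s (w r - w t)) (at t within {0..<T})"
          using 3 by (auto simp: eventually_at_filter w_def)
        then show ?thesis using uc[OF 3] by (auto intro: Lim_transform_eventually)
      qed
    qed
    show "((\<lambda>r. hsq s (w r - w t)) \<longlongrightarrow> 0) (at t within {T..T + \<delta>})"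
    proof (cases "t < T")
      case True then show ?thesis by (simp add: right_bot)
    next
      case False
      then have t': "t - T \<in> {0..\<delta>}" using t by (auto simp: I_def)
      have "((\<lambda>r. hsq s (v (r - T) - v (t - T))) \<longlongrightarrow> 0) (at t within {T..T + \<delta>})"
        by (rule filterlim_compose[OF vc[OF t'] shift])
      moreover have "eventually (\<lambda>r. hsq s (v (r - T) - v (t - T)) = hsq s (w r - w t)) (at t within {T..T + \<delta>})"
        using False by (auto simp: eventually_at_filter w_def)
      ultimately show ?thesis by (auto intro: Lim_transform_eventually)
    qed
  qed
  have derT: "(w has_vector_derivative B (w T) (w T)) (at T within {0..<T})"
  proof -
    have wT: "w T = v 0" by (simp add: w_def)
    have v0: "0 \<in> {0..\<delta>}" using \<delta> by simp
    obtain m where m: "hsq s (v 0) = ennreal m" "m \<ge> 0" using vf[OF v0] by (cases "hsq s (v 0)") auto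
    have wcont: "continuous (at T within {0..T}) w"
    proof -
      have "(w \<longlongrightarrow> w T) (at T within {0..<T})"
      proof -
        have "((\<lambda>t. u t - v 0) \<longlongrightarrow> 0) (at T within {0..<T})" by (rule hsq_tendsto_0_imp[OF lim])
        then have "(u \<longlongrightarrow> w T) (at T within {0..<T})" unfolding wT by (rule LIM_zero_cancel)
        moreover have "eventually (\<lambda>t. u t = w t) (at T within {0..<T})"
          using eventually_at_within_mem by eventually_elim (simp add: wl)
        ultimately show ?thesis by (rule Lim_transform_eventually)
      qed
      moreover have "at T within {0..T} = at T within {0..<T}"
      proof -
        have "{0..T} - {T} = {0..<T} - {T}" by auto
        then show ?thesis by (metis at_within_def)
      qed
      ultimately show ?thesis by (simp add: continuous_within)
    qed
    have wc: "continuous_on {0..T} w"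
      unfolding continuous_on_eq_continuous_within
    proof
      fix r assume r: "r \<in> {0..T}"
      show "continuous (at r within {0..T}) w"
      proof (cases "r = T")
        case True then show ?thesis using wcont by simp
      next
        case False
        then have r': "r \<in> {0..<T}" using r by auto
        have "(w has_vector_derivative B (u r) (u r)) (at r within {0..<T})"
          by (rule has_vector_derivative_transform[OF r' wl ud[OF r']])
        then have c: "continuous (at r within {0..<T}) w" by (rule has_vector_derivative_continuous)
        have "at r within {0..T} = at r within {0..<T}"
          by (rule at_within_nhd[of r "{..<T}"]) (use r' in auto)
        then show ?thesis using c by (simp add: continuous_within)
      qed
    qed
    have wd: "(w has_vector_derivative B (w r) (w r)) (at r)" if r: "0 < r" "r < T" for r
    proof -
      have r': "r \<in> {0..<T}" using r by simp
      have a: "at r within {0..<T} = at r" by (rule at_within_interior) (use r in \<open>auto simp: interior_atLeastLessThan\<close>)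
      have "(w has_vector_derivative B (u r) (u r)) (at r within {0..<T})"
        by (rule has_vector_derivative_transform[OF r' wl ud[OF r']])
      then show ?thesis by (simp add: a wl[OF r'])
    qed
    have C: "kb s * (2 + 8 * m) \<ge> 0" using kb_nonneg[of s] m by simp
    have "((\<lambda>r. (1 / norm (r - T)) *\<^sub>R (w r - (w T + (r - T) *\<^sub>R B (w T) (w T)))) \<longlongrightarrow> 0) (at T within {0..<T})"
    proof (rule tendstoI)
      fix e :: real assume e: "e > 0"
      then have "(e / 2)\<^sup>2 > 0" by simp
      obtain d where d: "0 < d" "d \<le> 1" "kb s * (2 + 8 * m) * d \<le> (e / 2)\<^sup>2" using small_of_pos[OF \<open>(e / 2)\<^sup>2 > 0\<close> C] by blast
      from ennreal_tendsto_0D[OF lim d(1)]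
      obtain \<eta> where \<eta>: "\<eta> > 0" "\<And>r. r \<in> {0..<T} \<Longrightarrow> r \<noteq> T \<Longrightarrow> dist r T < \<eta> \<Longrightarrow> hsq s (u r - v 0) \<le> ennreal d"
        unfolding eventually_at by blast
      show "\<forall>\<^sub>F r in at T within {0..<T}. dist ((1 / norm (r - T)) *\<^sub>R (w r - (w T + (r - T) *\<^sub>R B (w T) (w T)))) 0 < e"
        unfolding eventually_at
      proof (intro exI[of _ \<eta>] conjI ballI impI \<eta>(1))
        fix r assume r: "r \<in> {0..<T}" "r \<noteq> T \<and> dist r T < \<eta>"
        then have rT: "r < T" by auto
        have "hsq (s - 1) (w T - w r - (T - r) *\<^sub>R B (v 0) (v 0)) \<le> ennreal ((T - r)\<^sup>2 * (kb s * (2 + 8 * m) * d))"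
        proof (rule increment_B[OF rT s])
          show "continuous_on {r..T} w" by (rule continuous_on_subset[OF wc]) (use r in auto)
          show "(w has_vector_derivative B (w q) (w q)) (at q)" if "r < q" "q < T" for q by (rule wd) (use that r in auto)
          show "hsq s (w q - v 0) \<le> ennreal d" if "r < q" "q < T" for q
            using \<eta>(2)[of q] that r wl[of q] by (auto simp: dist_real_def)
        qed (use m d in auto)
        then have "norm (w T - w r - (T - r) *\<^sub>R B (v 0) (v 0)) \<le> sqrt ((T - r)\<^sup>2 * (kb s * (2 + 8 * m) * d))"
          using C d by (intro norm_le_of_hsq) auto
        also have "\<dots> \<le> sqrt ((T - r)\<^sup>2 * (e / 2)\<^sup>2)" by (intro real_sqrt_le_mono mult_left_mono d) auto
        also have "\<dots> = (T - r) * (e / 2)" using rT e by (simp add: real_sqrt_mult)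
        finally have "norm (w T - w r - (T - r) *\<^sub>R B (v 0) (v 0)) \<le> (T - r) * (e / 2)" .
        moreover have "w r - (w T + (r - T) *\<^sub>R B (w T) (w T)) = - (w T - w r - (T - r) *\<^sub>R B (v 0) (v 0))"
          by (simp add: wT algebra_simps)
        ultimately have "norm (w r - (w T + (r - T) *\<^sub>R B (w T) (w T))) \<le> (T - r) * (e / 2)"
          by (simp only: norm_minus_cancel)
        then have "(1 / (T - r)) * norm (w r - (w T + (r - T) *\<^sub>R B (w T) (w T))) \<le> (1 / (T - r)) * ((T - r) * (e / 2))"
          using rT by (intro mult_left_mono) auto
        also have "\<dots> < e" using rT e by simp
        finally show "dist ((1 / norm (r - T)) *\<^sub>R (w r - (w T + (r - T) *\<^sub>R B (w T) (w T)))) 0 < e"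
          using rT by (simp add: abs_minus_commute)
      qed
    qed
    then show ?thesis unfolding has_vector_derivative_def has_derivative_within by (auto intro: bounded_linear_scaleR_left)
  qed
  have der: "(w has_vector_derivative B (w t) (w t)) (at t within I)" if t: "t \<in> I" for t
    unfolding I_def
  proof (rule has_vector_derivative_union)
    show "(w has_vector_derivative B (w t) (w t)) (at t within {0..<T})"
    proof -
      consider "t > T" | "t = T" | "t \<in> {0..<T}" using t by (force simp: I_def)
      then show ?thesis
      proof cases
        case 1 then show ?thesis by (intro has_vector_derivative_bot left_bot)
      next
        case 2 then show ?thesis using derT by simp
      next
        case 3
        have "(w has_vector_derivative B (u t) (u t)) (at t within {0..<T})"
          by (rule has_vector_derivative_transform[OF 3 wl ud[OF 3]])
        then show ?thesis by (simp add: wl[OF 3])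
      qed
    qed
    show "(w has_vector_derivative B (w t) (w t)) (at t within {T..T + \<delta>})"
    proof (cases "t < T")
      case True then show ?thesis by (intro has_vector_derivative_bot right_bot)
    next
      case False
      then have t': "t - T \<in> {0..\<delta>}" "t \<in> {T..T + \<delta>}" using t by (auto simp: I_def)
      have im: "(\<lambda>r. r - T) ` {T..T + \<delta>} \<subseteq> {0..\<delta>}" by auto
      have "(v has_vector_derivative B (v (t - T)) (v (t - T))) (at (t - T) within (\<lambda>r. r - T) ` {T..T + \<delta>})"
        by (rule has_vector_derivative_within_subset[OF vd[OF t'(1)] im])
      moreover have "((\<lambda>r. r - T) has_vector_derivative 1) (at t within {T..T + \<delta>})"
        by (auto intro!: derivative_eq_intros)
      ultimately have "((v \<circ> (\<lambda>r. r - T)) has_vector_derivative 1 *\<^sub>R B (v (t - T)) (v (t - T))) (at t within {T..T + \<delta>})"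
        by (intro vector_diff_chain_within)
      then have "((\<lambda>r. v (r - T)) has_vector_derivative B (w t) (w t)) (at t within {T..T + \<delta>})"
        by (simp add: o_def wr[OF t'(2)])
      then show ?thesis
        using has_vector_derivative_transform[of t "{T..T + \<delta>}" w "\<lambda>r. v (r - T)"] t'(2) wr by blast
    qed
  qed
  have "herm (w t) \<and> hsq s (w t) < \<infinity>" if t: "t \<in> I" for t
  proof (cases "t < T")
    case True then show ?thesis using t uh uf by (auto simp: I_def w_def)
  next
    case False then show ?thesis using t vh[of "t - T"] vf[of "t - T"] by (auto simp: I_def w_def)
  qed
  then have "fsol s I w" unfolding fsol_def using cont der by blast
  then show ?thesis unfolding w_def[abs_def, symmetric]
    by (rule fsol_subset) (auto simp: I_def)
qed

section \<open>Plancherel's theorem\<close>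

text \<open>
  The transform without the factor \<open>1 / (2 * pi)\<close>, so that it is symmetric in both variables.
\<close>

definition ft :: "(real \<Rightarrow> complex) \<Rightarrow> real \<Rightarrow> complex" where
  "ft g k = (LINT x|lborel. g x * exp (- (\<i> * complex_of_real k * complex_of_real x)))"

lemma cmod_phase [simp]: "cmod (exp (- (\<i> * complex_of_real k * complex_of_real x))) = 1"
  by (simp add: norm_exp_eq_Re)

lemma ft_measurable [measurable]:
  assumes [measurable]: "g \<in> borel_measurable borel" shows "ft g \<in> borel_measurable borel"
  unfolding ft_def by measurable

lemma integrable_phase:
  assumes "integrable lborel g"
  shows "integrable lborel (\<lambda>x. g x * exp (- (\<i> * complex_of_real k * complex_of_real x)))"
proof -
  have [measurable]: "g \<in> borel_measurable borel" using assms by simp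
  show ?thesis by (rule Bochner_Integration.integrable_bound[OF assms]) (auto simp: norm_mult)
qed

lemma ft_add: "integrable lborel f \<Longrightarrow> integrable lborel g \<Longrightarrow> ft (\<lambda>x. f x + g x) k = ft f k + ft g k"
  unfolding ft_def by (simp add: distrib_right integrable_phase)

lemma ft_scaleR: "ft (\<lambda>x. c *\<^sub>R f x) k = c *\<^sub>R ft f k"
  unfolding ft_def by simp

lemma ft_diff: "integrable lborel f \<Longrightarrow> integrable lborel g \<Longrightarrow> ft (\<lambda>x. f x - g x) k = ft f k - ft g k"
  unfolding ft_def by (simp add: left_diff_distrib integrable_phase)

lemma ft_cong_AE:
  assumes "AE x in lborel. f x = g x" and [measurable]: "f \<in> borel_measurable borel" "g \<in> borel_measurable borel"
  shows "ft f k = ft g k"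
  unfolding ft_def by (rule integral_cong_AE) (use assms(1) in auto)

lemma ft_cnj: "ft (\<lambda>x. cnj (g x)) k = cnj (ft g (- k))"
  unfolding ft_def by (simp add: exp_cnj flip: Bochner_Integration.integral_cnj)

lemma ft_bounded: "integrable lborel g \<Longrightarrow> cmod (ft g k) \<le> (LINT x|lborel. cmod (g x))"
  unfolding ft_def by (rule order_trans[OF integral_norm_bound]) (simp add: norm_mult)

lemma integrable_pair:
  fixes f h :: "real \<Rightarrow> complex" and c :: "real \<Rightarrow> real \<Rightarrow> complex"
  assumes f: "integrable lborel f" and h: "integrable lborel h"
    and [measurable]: "(\<lambda>(x, y). c x y) \<in> borel_measurable (borel \<Otimes>\<^sub>M borel)" and c: "\<And>x y. cmod (c x y) \<le> 1"
  shows "integrable (lborel \<Otimes>\<^sub>M lborel) (\<lambda>(x, y). f x * h y * c x y)"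
proof (rule integrableI_bounded)
  have [measurable]: "f \<in> borel_measurable borel" "h \<in> borel_measurable borel" using f h by simp_all
  show "(\<lambda>(x, y). f x * h y * c x y) \<in> borel_measurable (lborel \<Otimes>\<^sub>M lborel)" by measurable
  have "(\<integral>\<^sup>+x. ennreal (norm (case x of (x, y) \<Rightarrow> f x * h y * c x y)) \<partial>(lborel \<Otimes>\<^sub>M lborel))
     = (\<integral>\<^sup>+x. \<integral>\<^sup>+y. ennreal (norm (f x * h y * c x y)) \<partial>lborel \<partial>lborel)"
    by (subst lborel.nn_integral_fst[symmetric]) auto
  also have "\<dots> \<le> (\<integral>\<^sup>+x. \<integral>\<^sup>+y. ennreal (norm (f x)) * ennreal (norm (h y)) \<partial>lborel \<partial>lborel)"
  proof (intro nn_integral_mono)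
    fix x y :: real
    have "norm (f x * h y * c x y) \<le> norm (f x) * norm (h y) * 1"
      unfolding norm_mult by (intro mult_left_mono c) auto
    then show "ennreal (norm (f x * h y * c x y)) \<le> ennreal (norm (f x)) * ennreal (norm (h y))"
      by (simp add: ennreal_mult[symmetric] ennreal_leI)
  qed
  also have "\<dots> = (\<integral>\<^sup>+x. ennreal (norm (f x)) \<partial>lborel) * (\<integral>\<^sup>+y. ennreal (norm (h y)) \<partial>lborel)"
    by (simp add: nn_integral_cmult nn_integral_multc)
  also have "\<dots> < \<infinity>" using f h by (simp add: integrable_iff_bounded ennreal_mult_less_top)
  finally show "(\<integral>\<^sup>+x. ennreal (norm (case x of (x, y) \<Rightarrow> f x * h y * c x y)) \<partial>(lborel \<Otimes>\<^sub>M lborel)) < \<infinity>" .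
qed

text \<open>
  Fubini, and the symmetry of the phase in both variables.
\<close>

lemma ft_adjoint:
  assumes f: "integrable lborel f" and h: "integrable lborel h"
  shows "(LINT k|lborel. ft f k * h k) = (LINT x|lborel. f x * ft h x)"
proof -
  let ?c = "\<lambda>x k. exp (- (\<i> * complex_of_real k * complex_of_real x))"
  have [measurable]: "f \<in> borel_measurable borel" "h \<in> borel_measurable borel" using f h by simp_all
  have i: "integrable (lborel \<Otimes>\<^sub>M lborel) (\<lambda>(x, k). f x * h k * ?c x k)"
    by (rule integrable_pair[OF f h]) auto
  have "(LINT k|lborel. ft f k * h k) = (LINT k|lborel. LINT x|lborel. f x * h k * ?c x k)"
  proof (rule Bochner_Integration.integral_cong[OF refl])
    fix k
    have "ft f k * h k = (LINT x|lborel. (f x * ?c x k) * h k)" unfolding ft_def by simp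
    then show "ft f k * h k = (LINT x|lborel. f x * h k * ?c x k)" by (simp add: ac_simps)
  qed
  also have "\<dots> = (LINT x|lborel. LINT k|lborel. f x * h k * ?c x k)"
    by (rule lborel_pair.Fubini_integral[OF i])
  also have "\<dots> = (LINT x|lborel. f x * ft h x)"
  proof (rule Bochner_Integration.integral_cong[OF refl])
    fix x
    have "f x * ft h x = (LINT k|lborel. f x * (h k * ?c k x))" unfolding ft_def by simp
    also have "\<dots> = (LINT k|lborel. f x * h k * ?c x k)"
      by (intro Bochner_Integration.integral_cong refl) (simp add: ac_simps)
    finally show "(LINT k|lborel. f x * h k * ?c x k) = f x * ft h x" ..
  qed
  finally show ?thesis .
qed

text \<open>
  The characteristic function of the standard normal distribution, rescaled.
\<close>

lemma ft_gaussian: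
  assumes \<epsilon>: "\<epsilon> > 0"
  shows "ft (\<lambda>k. complex_of_real (exp (- (\<epsilon> * k)\<^sup>2 / 2))) x = complex_of_real (2 * pi * normal_density 0 \<epsilon> x)"
    "integrable lborel (\<lambda>k. complex_of_real (exp (- (\<epsilon> * k)\<^sup>2 / 2)))"
proof -
  have std: "std_normal_density y = exp (- y\<^sup>2 / 2) / sqrt (2 * pi)" for y by (simp add: std_normal_density_def)
  have char: "(LINT y|lborel. complex_of_real (std_normal_density y) * iexp (t * y)) = complex_of_real (exp (- t\<^sup>2 / 2))" for t
  proof -
    have "char std_normal_distribution t = complex_of_real (exp (- t\<^sup>2 / 2))"
      using char_std_normal_distribution by (simp add: fun_eq_iff)
    moreover have "char std_normal_distribution t = (LINT y|lborel. std_normal_density y *\<^sub>R iexp (t * y))"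
      unfolding char_def by (subst integral_density) auto
    ultimately show ?thesis by (simp add: scaleR_conv_of_real)
  qed
  have "integrable lborel (\<lambda>y::real. exp (- y\<^sup>2 / 2))"
  proof -
    have "integrable lborel (\<lambda>y. sqrt (2 * pi) * std_normal_density y)"
      by (intro Bochner_Integration.integrable_mult_right integrable_normal_density) simp
    then show ?thesis by (simp add: std)
  qed
  from lborel_integrable_real_affine[OF this, of \<epsilon> 0] \<epsilon>
  have i: "integrable lborel (\<lambda>k. exp (- (\<epsilon> * k)\<^sup>2 / 2))" by simp
  then show "integrable lborel (\<lambda>k. complex_of_real (exp (- (\<epsilon> * k)\<^sup>2 / 2)))" by (rule integrable_of_real)
  have stdE: "complex_of_real (exp (- y\<^sup>2 / 2)) = complex_of_real (sqrt (2 * pi)) * complex_of_real (std_normal_density y)" for y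
  proof -
    have "sqrt (2 * pi) * std_normal_density y = exp (- y\<^sup>2 / 2)" by (simp add: std)
    then show ?thesis by (simp only: of_real_mult[symmetric])
  qed
  have "(LINT y|lborel. complex_of_real (exp (- y\<^sup>2 / 2)) * iexp (- x / \<epsilon> * y))
     = (LINT y|lborel. complex_of_real (sqrt (2 * pi)) * (complex_of_real (std_normal_density y) * iexp (- x / \<epsilon> * y)))"
    by (simp only: stdE mult.assoc)
  also have "\<dots> = complex_of_real (sqrt (2 * pi)) * (LINT y|lborel. complex_of_real (std_normal_density y) * iexp (- x / \<epsilon> * y))"
    by (rule integral_mult_right_zero)
  also have "\<dots> = complex_of_real (sqrt (2 * pi) * exp (- (x / \<epsilon>)\<^sup>2 / 2))" unfolding char by simp
  finally have g: "(LINT y|lborel. complex_of_real (exp (- y\<^sup>2 / 2)) * iexp (- x / \<epsilon> * y)) = complex_of_real (sqrt (2 * pi) * exp (- (x / \<epsilon>)\<^sup>2 / 2))" .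
  have "(LINT y|lborel. complex_of_real (exp (- y\<^sup>2 / 2)) * iexp (- x / \<epsilon> * y))
     = \<bar>\<epsilon>\<bar> *\<^sub>R (LINT k|lborel. complex_of_real (exp (- (0 + \<epsilon> * k)\<^sup>2 / 2)) * iexp (- x / \<epsilon> * (0 + \<epsilon> * k)))"
    using \<epsilon> by (intro lborel_integral_real_affine) simp
  also have "(LINT k|lborel. complex_of_real (exp (- (0 + \<epsilon> * k)\<^sup>2 / 2)) * iexp (- x / \<epsilon> * (0 + \<epsilon> * k)))
     = ft (\<lambda>k. complex_of_real (exp (- (\<epsilon> * k)\<^sup>2 / 2))) x"
    unfolding ft_def using \<epsilon> by (intro Bochner_Integration.integral_cong refl) (simp add: ac_simps)
  finally have "\<epsilon> *\<^sub>R ft (\<lambda>k. complex_of_real (exp (- (\<epsilon> * k)\<^sup>2 / 2))) x = complex_of_real (sqrt (2 * pi) * exp (- (x / \<epsilon>)\<^sup>2 / 2))"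
    using g \<epsilon> by simp
  then have "ft (\<lambda>k. complex_of_real (exp (- (\<epsilon> * k)\<^sup>2 / 2))) x = complex_of_real (sqrt (2 * pi) * exp (- (x / \<epsilon>)\<^sup>2 / 2) / \<epsilon>)"
    using \<epsilon> by (simp add: scaleR_conv_of_real field_simps)
  moreover have "sqrt (2 * pi) * exp (- (x / \<epsilon>)\<^sup>2 / 2) / \<epsilon> = 2 * pi * normal_density 0 \<epsilon> x"
  proof -
    have "sqrt (2 * pi) * sqrt (2 * pi) = 2 * pi" by simp
    then show ?thesis using \<epsilon> by (simp add: normal_density_def real_sqrt_mult power_divide field_simps)
  qed
  ultimately show "ft (\<lambda>k. complex_of_real (exp (- (\<epsilon> * k)\<^sup>2 / 2))) x = complex_of_real (2 * pi * normal_density 0 \<epsilon> x)" by (simp only:)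
qed

lemma ft_times_gaussian_integrable:
  assumes g: "integrable lborel g" and \<epsilon>: "\<epsilon> > 0"
  shows "integrable lborel (\<lambda>k. ft g k * complex_of_real (exp (- (\<epsilon> * k)\<^sup>2 / 2)))"
proof -
  have [measurable]: "g \<in> borel_measurable borel" using g by simp
  have "integrable lborel (\<lambda>k. complex_of_real (LINT x|lborel. cmod (g x)) * complex_of_real (exp (- (\<epsilon> * k)\<^sup>2 / 2)))"
    using ft_gaussian(2)[OF \<epsilon>] by simp
  then show ?thesis
    by (rule Bochner_Integration.integrable_bound) (use ft_bounded[OF g] in \<open>auto simp: norm_mult intro!: AE_I2 mult_right_mono order_trans[OF _ abs_ge_self]\<close>)
qed

text \<open>
  The transform of a Gaussian is a Gaussian, so that a Gaussian factor in frequency becomes a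
  Gaussian average in space.
\<close>

lemma ft_gaussian_regularised:
  assumes g: "integrable lborel g" and \<epsilon>: "\<epsilon> > 0"
  shows "(LINT k|lborel. complex_of_real ((cmod (ft g k))\<^sup>2 * exp (- (\<epsilon> * k)\<^sup>2 / 2)))
    = complex_of_real (2 * pi) * (LINT x|lborel. g x * (LINT y|lborel. cnj (g y) * complex_of_real (normal_density 0 \<epsilon> (x - y))))"
proof -
  let ?G = "\<lambda>k. complex_of_real (exp (- (\<epsilon> * k)\<^sup>2 / 2))"
  have [measurable]: "g \<in> borel_measurable borel" using g by simp
  have gc: "integrable lborel (\<lambda>y. cnj (g y))" using g by simp
  define h where "h k = cnj (ft g k) * ?G k" for k
  have h: "integrable lborel h"
  proof -
    have "integrable lborel (\<lambda>k. cnj (ft g k * ?G k))" using ft_times_gaussian_integrable[OF g \<epsilon>] by (rule integrable_cnj)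
    then show ?thesis by (simp add: h_def[abs_def])
  qed
  have fth: "ft h x = complex_of_real (2 * pi) * (LINT y|lborel. cnj (g y) * complex_of_real (normal_density 0 \<epsilon> (x - y)))" for x
  proof -
    let ?e = "\<lambda>k. exp (- (\<i> * complex_of_real x * complex_of_real k))"
    have Ge: "integrable lborel (\<lambda>k. ?G k * ?e k)" by (rule integrable_phase[OF ft_gaussian(2)[OF \<epsilon>]])
    have ftG: "ft (\<lambda>k. ?G k * ?e k) y = complex_of_real (2 * pi * normal_density 0 \<epsilon> (x + y))" for y
    proof -
      have "ft (\<lambda>k. ?G k * ?e k) y = ft ?G (x + y)"
        unfolding ft_def
      proof (intro Bochner_Integration.integral_cong refl)
        fix k
        have "?e k * exp (- (\<i> * complex_of_real y * complex_of_real k)) = exp (- (\<i> * complex_of_real (x + y) * complex_of_real k))"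
          by (simp add: exp_add[symmetric] algebra_simps)
        then show "?G k * ?e k * exp (- (\<i> * complex_of_real y * complex_of_real k)) = ?G k * exp (- (\<i> * complex_of_real (x + y) * complex_of_real k))"
          by (simp only: mult.assoc)
      qed
      then show ?thesis by (simp only: ft_gaussian(1)[OF \<epsilon>])
    qed
    have "ft h x = (LINT k|lborel. ft (\<lambda>y. cnj (g (0 - y))) k * (?G k * ?e k))"
    proof -
      have "ft (\<lambda>y. cnj (g (0 - y))) k = cnj (ft g k)" for k
      proof -
        have "ft (\<lambda>y. cnj (g (0 - y))) k = cnj (LINT y|lborel. g (0 - y) * exp (- (\<i> * complex_of_real (- k) * complex_of_real y)))"
          unfolding ft_cnj ft_def ..
        also have "(LINT y|lborel. g (0 - y) * exp (- (\<i> * complex_of_real (- k) * complex_of_real y))) = ft g k"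
          unfolding ft_def using integral_reflect[of "\<lambda>y. g y * exp (- (\<i> * complex_of_real k * complex_of_real y))" 0] by simp
        finally show ?thesis .
      qed
      then show ?thesis unfolding ft_def[of h] h_def by (simp add: mult.assoc)
    qed
    also have "\<dots> = (LINT y|lborel. cnj (g (0 - y)) * ft (\<lambda>k. ?G k * ?e k) y)"
      by (rule ft_adjoint[OF _ Ge]) (use lborel_integrable_real_affine[OF gc, of "-1" 0] in simp)
    also have "\<dots> = (LINT y|lborel. cnj (g (0 - y)) * complex_of_real (2 * pi * normal_density 0 \<epsilon> (x + y)))"
      by (simp only: ftG)
    also have "\<dots> = (LINT y|lborel. cnj (g y) * complex_of_real (2 * pi * normal_density 0 \<epsilon> (x - y)))"
      using integral_reflect[of "\<lambda>y. cnj (g y) * complex_of_real (2 * pi * normal_density 0 \<epsilon> (x - y))" 0] by simp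
    also have "\<dots> = (LINT y|lborel. complex_of_real (2 * pi) * (cnj (g y) * complex_of_real (normal_density 0 \<epsilon> (x - y))))"
      by (intro Bochner_Integration.integral_cong refl) simp
    also have "\<dots> = complex_of_real (2 * pi) * (LINT y|lborel. cnj (g y) * complex_of_real (normal_density 0 \<epsilon> (x - y)))"
      by (rule integral_mult_right_zero)
    finally show ?thesis .
  qed
  have "(LINT k|lborel. complex_of_real ((cmod (ft g k))\<^sup>2 * exp (- (\<epsilon> * k)\<^sup>2 / 2))) = (LINT k|lborel. ft g k * h k)"
    by (intro Bochner_Integration.integral_cong refl)
      (simp only: h_def of_real_mult complex_norm_square mult.assoc)
  also have "\<dots> = (LINT x|lborel. g x * ft h x)" by (rule ft_adjoint[OF g h])
  also have "\<dots> = (LINT x|lborel. g x * (complex_of_real (2 * pi) * (LINT y|lborel. cnj (g y) * complex_of_real (normal_density 0 \<epsilon> (x - y)))))"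
    by (simp only: fth)
  also have "\<dots>
     = (LINT x|lborel. complex_of_real (2 * pi) * (g x * (LINT y|lborel. cnj (g y) * complex_of_real (normal_density 0 \<epsilon> (x - y)))))"
    by (simp add: ac_simps)
  also have "\<dots> = complex_of_real (2 * pi) * (LINT x|lborel. g x * (LINT y|lborel. cnj (g y) * complex_of_real (normal_density 0 \<epsilon> (x - y))))"
    by (rule integral_mult_right_zero)
  finally show ?thesis .
qed

lemma normal_density_nn: "\<epsilon> > 0 \<Longrightarrow> (\<integral>\<^sup>+x. ennreal (normal_density 0 \<epsilon> x) \<partial>lborel) = 1"
  using integrable_normal_density[of \<epsilon> 0] by (subst nn_integral_eq_integral) auto

text \<open>
  The Gaussian factors increase to \<open>1\<close>.
\<close>

lemma ft_regularised_SUP: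
  assumes [measurable]: "g \<in> borel_measurable borel"
  shows "(\<integral>\<^sup>+k. ennreal ((cmod (ft g k))\<^sup>2) \<partial>lborel)
     = (SUP n. \<integral>\<^sup>+k. ennreal ((cmod (ft g k))\<^sup>2 * exp (- (inverse (real (Suc n)) * k)\<^sup>2 / 2)) \<partial>lborel)"
    "(\<lambda>n. \<integral>\<^sup>+k. ennreal ((cmod (ft g k))\<^sup>2 * exp (- (inverse (real (Suc n)) * k)\<^sup>2 / 2)) \<partial>lborel)
       \<longlonglongrightarrow> (\<integral>\<^sup>+k. ennreal ((cmod (ft g k))\<^sup>2) \<partial>lborel)"
proof -
  let ?f = "\<lambda>n k. ennreal ((cmod (ft g k))\<^sup>2 * exp (- (inverse (real (Suc n)) * k)\<^sup>2 / 2))"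
  have inc: "incseq ?f"
    unfolding incseq_def le_fun_def
  proof (intro allI impI ennreal_leI mult_left_mono)
    fix m n :: nat and k :: real assume "m \<le> n"
    then have "inverse (real (Suc n)) \<le> inverse (real (Suc m))" by (intro le_imp_inverse_le) auto
    then have "(inverse (real (Suc n)))\<^sup>2 * k\<^sup>2 \<le> (inverse (real (Suc m)))\<^sup>2 * k\<^sup>2"
      by (intro mult_right_mono power_mono) auto
    then show "exp (- (inverse (real (Suc m)) * k)\<^sup>2 / 2) \<le> exp (- (inverse (real (Suc n)) * k)\<^sup>2 / 2)"
      by (simp only: power_mult_distrib exp_le_cancel_iff)
  qed simp
  have lim: "(\<lambda>n. ?f n k) \<longlonglongrightarrow> ennreal ((cmod (ft g k))\<^sup>2)" for k
  proof -
    have "(\<lambda>n. (cmod (ft g k))\<^sup>2 * exp (- (inverse (real (Suc n)) * k)\<^sup>2 / 2)) \<longlonglongrightarrow> (cmod (ft g k))\<^sup>2 * exp (- (0 * k)\<^sup>2 / 2)"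
      by (intro tendsto_intros LIMSEQ_inverse_real_of_nat) simp
    then show ?thesis by (intro tendsto_ennrealI) simp
  qed
  have sup: "(SUP n. ?f n k) = ennreal ((cmod (ft g k))\<^sup>2)" for k
    using LIMSEQ_unique[OF lim LIMSEQ_SUP[of "\<lambda>n. ?f n k"]] inc by (auto simp: incseq_def le_fun_def)
  have *: "(\<integral>\<^sup>+k. (SUP n. ?f n k) \<partial>lborel) = (SUP n. \<integral>\<^sup>+k. ?f n k \<partial>lborel)"
    by (rule nn_integral_monotone_convergence_SUP[OF inc]) measurable
  then show 1: "(\<integral>\<^sup>+k. ennreal ((cmod (ft g k))\<^sup>2) \<partial>lborel) = (SUP n. \<integral>\<^sup>+k. ?f n k \<partial>lborel)" by (simp only: sup)
  have "incseq (\<lambda>n. \<integral>\<^sup>+k. ?f n k \<partial>lborel)"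
    unfolding incseq_def by (intro allI impI nn_integral_mono) (use inc in \<open>auto simp: incseq_def le_fun_def\<close>)
  from LIMSEQ_SUP[OF this] show "(\<lambda>n. \<integral>\<^sup>+k. ?f n k \<partial>lborel) \<longlonglongrightarrow> (\<integral>\<^sup>+k. ennreal ((cmod (ft g k))\<^sup>2) \<partial>lborel)"
    unfolding 1 .
qed

lemma ft_regularised_nn:
  assumes g: "integrable lborel g" and \<epsilon>: "\<epsilon> > 0"
  shows "(\<integral>\<^sup>+k. ennreal ((cmod (ft g k))\<^sup>2 * exp (- (\<epsilon> * k)\<^sup>2 / 2)) \<partial>lborel)
    = ennreal (2 * pi * cmod (LINT x|lborel. g x * (LINT y|lborel. cnj (g y) * complex_of_real (normal_density 0 \<epsilon> (x - y)))))"
proof -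
  have [measurable]: "g \<in> borel_measurable borel" using g by simp
  have i: "integrable lborel (\<lambda>k. (cmod (ft g k))\<^sup>2 * exp (- (\<epsilon> * k)\<^sup>2 / 2))"
  proof (rule Bochner_Integration.integrable_bound)
    show "integrable lborel (\<lambda>k. complex_of_real ((LINT x|lborel. cmod (g x))\<^sup>2) * complex_of_real (exp (- (\<epsilon> * k)\<^sup>2 / 2)))"
      using ft_gaussian(2)[OF \<epsilon>] by simp
    have "(cmod (ft g k))\<^sup>2 \<le> (LINT x|lborel. cmod (g x))\<^sup>2" for k by (intro power_mono ft_bounded g) auto
    then show "AE k in lborel. norm ((cmod (ft g k))\<^sup>2 * exp (- (\<epsilon> * k)\<^sup>2 / 2))
      \<le> norm (complex_of_real ((LINT x|lborel. cmod (g x))\<^sup>2) * complex_of_real (exp (- (\<epsilon> * k)\<^sup>2 / 2)))"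
      by (auto simp: norm_mult norm_power intro!: AE_I2 mult_right_mono)
  qed measurable
  have "(\<integral>\<^sup>+k. ennreal ((cmod (ft g k))\<^sup>2 * exp (- (\<epsilon> * k)\<^sup>2 / 2)) \<partial>lborel)
     = ennreal (LINT k|lborel. (cmod (ft g k))\<^sup>2 * exp (- (\<epsilon> * k)\<^sup>2 / 2))"
    by (rule nn_integral_eq_integral[OF i]) simp
  also have "(LINT k|lborel. (cmod (ft g k))\<^sup>2 * exp (- (\<epsilon> * k)\<^sup>2 / 2))
     = cmod (complex_of_real (LINT k|lborel. (cmod (ft g k))\<^sup>2 * exp (- (\<epsilon> * k)\<^sup>2 / 2)))"
    by (simp add: integral_nonneg_AE)
  also have "complex_of_real (LINT k|lborel. (cmod (ft g k))\<^sup>2 * exp (- (\<epsilon> * k)\<^sup>2 / 2))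
     = (LINT k|lborel. complex_of_real ((cmod (ft g k))\<^sup>2 * exp (- (\<epsilon> * k)\<^sup>2 / 2)))"
    by (rule integral_complex_of_real[symmetric])
  finally show ?thesis unfolding ft_gaussian_regularised[OF g \<epsilon>] by (simp add: norm_mult)
qed

text \<open>
  Averaging against a probability density does not increase the \<open>L\<^sup>2\<close> norm, whatever the width.
\<close>

lemma gaussian_form_bound:
  assumes [measurable]: "g \<in> borel_measurable borel" and gL2: "(\<integral>\<^sup>+x. ennreal ((cmod (g x))\<^sup>2) \<partial>lborel) \<le> ennreal (Y\<^sup>2)"
    and Y: "Y \<ge> 0" and \<epsilon>: "\<epsilon> > 0"
  shows "(\<integral>\<^sup>+x. \<integral>\<^sup>+y. ennreal (cmod (g x) * normal_density 0 \<epsilon> (x - y) * cmod (g y)) \<partial>lborel \<partial>lborel) \<le> ennreal (Y\<^sup>2)"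
proof -
  have "(\<integral>\<^sup>+x. \<integral>\<^sup>+y. ennreal (cmod (g x) * normal_density 0 \<epsilon> (x - y) * cmod (g y)) \<partial>lborel \<partial>lborel)
     = (\<integral>\<^sup>+x. \<integral>\<^sup>+y. ennreal (cmod (g x)) * ennreal (normal_density 0 \<epsilon> (x - y)) * ennreal (cmod (g y)) \<partial>lborel \<partial>lborel)"
    by (intro nn_integral_cong) (simp add: ennreal_mult)
  also have "\<dots> \<le> (\<integral>\<^sup>+x. ennreal (normal_density 0 \<epsilon> x) \<partial>lborel) * ennreal (Y * Y)"
    by (rule trilinear_bound[where g = "\<lambda>x. ennreal (normal_density 0 \<epsilon> x)"]) (use gL2 Y in auto)
  also have "\<dots> = ennreal (Y\<^sup>2)" by (simp add: normal_density_nn[OF \<epsilon>] power2_eq_square)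
  finally show ?thesis .
qed

lemma ft_L2_bound:
  assumes g: "integrable lborel g" and gL2: "(\<integral>\<^sup>+x. ennreal ((cmod (g x))\<^sup>2) \<partial>lborel) \<le> ennreal (Y\<^sup>2)" and Y: "Y \<ge> 0"
  shows "(\<integral>\<^sup>+k. ennreal ((cmod (ft g k))\<^sup>2) \<partial>lborel) \<le> ennreal (2 * pi * Y\<^sup>2)"
proof -
  have [measurable]: "g \<in> borel_measurable borel" using g by simp
  have le: "(\<integral>\<^sup>+k. ennreal ((cmod (ft g k))\<^sup>2 * exp (- (\<epsilon> * k)\<^sup>2 / 2)) \<partial>lborel) \<le> ennreal (2 * pi * Y\<^sup>2)" if \<epsilon>: "\<epsilon> > 0" for \<epsilon>
  proof -
    let ?I = "\<lambda>x. LINT y|lborel. cnj (g y) * complex_of_real (normal_density 0 \<epsilon> (x - y))"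
    have nb: "ennreal (cmod (LINT x|lborel. h x)) \<le> (\<integral>\<^sup>+x. ennreal (cmod (h x)) \<partial>lborel)" for h :: "real \<Rightarrow> complex"
    proof (cases "integrable lborel h")
      case True then show ?thesis by (rule integral_norm_bound_ennreal)
    next
      case False then show ?thesis by (simp add: not_integrable_integral_eq)
    qed
    have "ennreal (cmod (LINT x|lborel. g x * ?I x)) \<le> (\<integral>\<^sup>+x. ennreal (cmod (g x * ?I x)) \<partial>lborel)" by (rule nb)
    also have "\<dots> \<le> (\<integral>\<^sup>+x. \<integral>\<^sup>+y. ennreal (cmod (g x) * normal_density 0 \<epsilon> (x - y) * cmod (g y)) \<partial>lborel \<partial>lborel)"
    proof (rule nn_integral_mono)
      fix x
      have "ennreal (cmod (g x * ?I x)) = ennreal (cmod (g x)) * ennreal (cmod (?I x))" by (simp add: norm_mult ennreal_mult)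
      also have "\<dots> \<le> ennreal (cmod (g x)) * (\<integral>\<^sup>+y. ennreal (cmod (cnj (g y) * complex_of_real (normal_density 0 \<epsilon> (x - y)))) \<partial>lborel)"
        by (intro mult_left_mono nb) simp
      also have "\<dots> = (\<integral>\<^sup>+y. ennreal (cmod (g x)) * ennreal (cmod (cnj (g y) * complex_of_real (normal_density 0 \<epsilon> (x - y)))) \<partial>lborel)"
        by (rule nn_integral_cmult[symmetric]) measurable
      also have "\<dots> = (\<integral>\<^sup>+y. ennreal (cmod (g x) * normal_density 0 \<epsilon> (x - y) * cmod (g y)) \<partial>lborel)"
        by (intro nn_integral_cong) (simp add: norm_mult ennreal_mult[symmetric] ac_simps)
      finally show "ennreal (cmod (g x * ?I x)) \<le> (\<integral>\<^sup>+y. ennreal (cmod (g x) * normal_density 0 \<epsilon> (x - y) * cmod (g y)) \<partial>lborel)" .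
    qed
    also have "\<dots> \<le> ennreal (Y\<^sup>2)" by (rule gaussian_form_bound[OF _ gL2 Y \<epsilon>]) measurable
    finally have "cmod (LINT x|lborel. g x * ?I x) \<le> Y\<^sup>2" by (subst (asm) ennreal_le_iff) auto
    then show ?thesis unfolding ft_regularised_nn[OF g \<epsilon>] by (intro ennreal_leI mult_left_mono) auto
  qed
  show ?thesis
    unfolding ft_regularised_SUP(1)[OF \<open>g \<in> borel_measurable borel\<close>]
    by (intro SUP_least le) simp
qed

text \<open>
  As \<open>\<epsilon>\<close> tends to \<open>0\<close> the Gaussian average of a continuous function tends to the function itself,
  boundedly; after the substitution \<open>y = x - \<epsilon> t\<close> dominated convergence applies with a fixed
  Gaussian.
\<close>

lemma ft_isometry_continuous:
  assumes gc: "continuous_on UNIV g" and b: "\<And>x. cmod (g x) \<le> b" and supp: "\<And>x. \<bar>x\<bar> > R \<Longrightarrow> g x = 0"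
  shows "(\<integral>\<^sup>+k. ennreal ((cmod (ft g k))\<^sup>2) \<partial>lborel) = ennreal (2 * pi * (LINT x|lborel. (cmod (g x))\<^sup>2))"
    "integrable lborel g"
proof -
  have b0: "b \<ge> 0" using b[of 0] norm_ge_zero order_trans by blast
  have gm [measurable]: "g \<in> borel_measurable borel" using gc by (rule borel_measurable_continuous_onI)
  have gi: "integrable lborel g"
  proof (rule Bochner_Integration.integrable_bound)
    show "integrable lborel (\<lambda>x. b * indicator {-R..R} x)"
      by (intro Bochner_Integration.integrable_mult_right integrable_real_indicator) (auto simp: emeasure_lborel_Icc_eq)
    have "cmod (g x) \<le> b * indicator {-R..R} x" for x using b[of x] supp[of x] by (auto simp: indicator_def)
    then show "AE x in lborel. norm (g x) \<le> norm (b * indicator {-R..R} x)" by (auto intro: order_trans[OF _ abs_ge_self])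
  qed measurable
  then show "integrable lborel g" .
  define \<epsilon> where "\<epsilon> n = inverse (real (Suc n))" for n
  have \<epsilon>: "\<epsilon> n > 0" for n by (simp add: \<epsilon>_def)
  have \<epsilon>lim: "\<epsilon> \<longlonglongrightarrow> 0" unfolding \<epsilon>_def[abs_def] by (rule LIMSEQ_inverse_real_of_nat)
  define J where "J n = (LINT x|lborel. g x * (LINT y|lborel. cnj (g y) * complex_of_real (normal_density 0 (\<epsilon> n) (x - y))))" for n
  let ?N = "\<lambda>t. complex_of_real (std_normal_density t)"
  have Ni: "integrable lborel ?N" by (intro integrable_of_real integrable_normal_density) simp
  have J: "J n = (LINT z|(lborel \<Otimes>\<^sub>M lborel). (case z of (x, t) \<Rightarrow> g x * ?N t * cnj (g (x - \<epsilon> n * t))))" for n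
  proof -
    have inner: "(LINT y|lborel. cnj (g y) * complex_of_real (normal_density 0 (\<epsilon> n) (x - y))) = (LINT t|lborel. ?N t * cnj (g (x - \<epsilon> n * t)))" for x
    proof -
      have "(LINT y|lborel. cnj (g y) * complex_of_real (normal_density 0 (\<epsilon> n) (x - y)))
        = \<bar>- \<epsilon> n\<bar> *\<^sub>R (LINT t|lborel. cnj (g (x + (- \<epsilon> n) * t)) * complex_of_real (normal_density 0 (\<epsilon> n) (x - (x + (- \<epsilon> n) * t))))"
        using \<epsilon>[of n] by (intro lborel_integral_real_affine) simp
      also have "\<dots> = (LINT t|lborel. \<bar>- \<epsilon> n\<bar> *\<^sub>R (cnj (g (x + (- \<epsilon> n) * t)) * complex_of_real (normal_density 0 (\<epsilon> n) (x - (x + (- \<epsilon> n) * t)))))"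
        by (rule integral_scaleR_right[symmetric])
      also have "\<dots> = (LINT t|lborel. ?N t * cnj (g (x - \<epsilon> n * t)))"
      proof (intro Bochner_Integration.integral_cong refl)
        fix t
        have "\<epsilon> n * normal_density 0 (\<epsilon> n) (\<epsilon> n * t) = std_normal_density t"
          using \<epsilon>[of n] by (simp add: normal_density_def real_sqrt_mult power_mult_distrib field_simps)
        then have "complex_of_real (\<epsilon> n) * complex_of_real (normal_density 0 (\<epsilon> n) (\<epsilon> n * t)) = ?N t"
          by (simp only: of_real_mult[symmetric])
        then show "\<bar>- \<epsilon> n\<bar> *\<^sub>R (cnj (g (x + (- \<epsilon> n) * t)) * complex_of_real (normal_density 0 (\<epsilon> n) (x - (x + (- \<epsilon> n) * t))))
            = ?N t * cnj (g (x - \<epsilon> n * t))"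
          using \<epsilon>[of n] by (simp add: scaleR_conv_of_real ac_simps)
      qed
      finally show ?thesis .
    qed
    have i: "integrable (lborel \<Otimes>\<^sub>M lborel) (\<lambda>(x, t). (complex_of_real b * g x) * ?N t * (cnj (g (x - \<epsilon> n * t)) / complex_of_real b))"
      by (rule integrable_pair[OF _ Ni]) (use gi b b0 in \<open>auto simp: norm_divide divide_le_eq_1 intro: le_neq_trans\<close>)
    have i': "integrable (lborel \<Otimes>\<^sub>M lborel) (\<lambda>(x, t). g x * ?N t * cnj (g (x - \<epsilon> n * t)))"
    proof (cases "b = 0")
      case True
      then have "g x = 0" for x using b[of x] by simp
      then show ?thesis by (simp add: case_prod_unfold)
    next
      case False
      then show ?thesis using i by (simp add: field_simps)
    qed
    have "J n = (LINT x|lborel. LINT t|lborel. g x * ?N t * cnj (g (x - \<epsilon> n * t)))"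
      unfolding J_def inner by (simp add: mult.assoc)
    then show ?thesis using lborel_pair.integral_fst'[OF i'] by simp
  qed
  have "(\<lambda>n. J n) \<longlonglongrightarrow> (LINT z|(lborel \<Otimes>\<^sub>M lborel). (case z of (x, t) \<Rightarrow> g x * ?N t * cnj (g x)))"
    unfolding J
  proof (rule integral_dominated_convergence)
    show "integrable (lborel \<Otimes>\<^sub>M lborel) (\<lambda>z. norm (case z of (x, t) \<Rightarrow> (complex_of_real b * g x) * ?N t * 1))"
      by (intro integrable_norm integrable_pair[OF _ Ni]) (use gi in auto)
    show "AE z in lborel \<Otimes>\<^sub>M lborel. norm (case z of (x, t) \<Rightarrow> g x * ?N t * cnj (g (x - \<epsilon> n * t)))
       \<le> norm (case z of (x, t) \<Rightarrow> (complex_of_real b * g x) * ?N t * 1)" for n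
    proof (rule AE_I2)
      fix z :: "real \<times> real"
      obtain x t where z: "z = (x, t)" by (cases z)
      have "norm (g x * ?N t) * cmod (g (x - \<epsilon> n * t)) \<le> norm (g x * ?N t) * b" by (intro mult_left_mono b) simp
      then show "norm (case z of (x, t) \<Rightarrow> g x * ?N t * cnj (g (x - \<epsilon> n * t)))
       \<le> norm (case z of (x, t) \<Rightarrow> (complex_of_real b * g x) * ?N t * 1)" using b0 by (simp add: z norm_mult ac_simps)
    qed
    show "AE z in lborel \<Otimes>\<^sub>M lborel. (\<lambda>n. case z of (x, t) \<Rightarrow> g x * ?N t * cnj (g (x - \<epsilon> n * t))) \<longlonglongrightarrow> (case z of (x, t) \<Rightarrow> g x * ?N t * cnj (g x))"
    proof (rule AE_I2)
      fix z :: "real \<times> real"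
      obtain x t where z: "z = (x, t)" by (cases z)
      have "(\<lambda>n. x - \<epsilon> n * t) \<longlonglongrightarrow> x - 0 * t" by (intro tendsto_intros \<epsilon>lim)
      then have "(\<lambda>n. g (x - \<epsilon> n * t)) \<longlonglongrightarrow> g x"
        using continuous_on_tendsto_compose[OF gc, of "\<lambda>n. x - \<epsilon> n * t" x] by simp
      then show "(\<lambda>n. case z of (x, t) \<Rightarrow> g x * ?N t * cnj (g (x - \<epsilon> n * t))) \<longlonglongrightarrow> (case z of (x, t) \<Rightarrow> g x * ?N t * cnj (g x))"
        unfolding z prod.case by (intro tendsto_intros)
    qed
  qed measurable
  also have "(LINT z|(lborel \<Otimes>\<^sub>M lborel). (case z of (x, t) \<Rightarrow> g x * ?N t * cnj (g x))) = complex_of_real (LINT x|lborel. (cmod (g x))\<^sup>2)"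
  proof -
    have i: "integrable (lborel \<Otimes>\<^sub>M lborel) (\<lambda>(x, t). (g x * cnj (g x)) * ?N t * 1)"
    proof (rule integrable_pair[OF _ Ni])
      show "integrable lborel (\<lambda>x. g x * cnj (g x))"
      proof (rule Bochner_Integration.integrable_bound)
        show "integrable lborel (\<lambda>x. complex_of_real b * g x)" using gi by simp
        show "AE x in lborel. norm (g x * cnj (g x)) \<le> norm (complex_of_real b * g x)"
          using b b0 by (auto simp: norm_mult intro!: AE_I2 mult_right_mono)
      qed measurable
    qed auto
    have "(LINT z|(lborel \<Otimes>\<^sub>M lborel). (case z of (x, t) \<Rightarrow> g x * ?N t * cnj (g x))) = (LINT x|lborel. LINT t|lborel. (g x * cnj (g x)) * ?N t * 1)"
      using lborel_pair.integral_fst'[OF i] by (simp add: ac_simps)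
    also have "\<dots> = (LINT x|lborel. complex_of_real ((cmod (g x))\<^sup>2))"
    proof (intro Bochner_Integration.integral_cong refl)
      fix x
      have "(LINT t|lborel. ?N t) = 1" using integral_normal_density[of 1 0] by (simp add: integral_complex_of_real)
      moreover have "(LINT t|lborel. (g x * cnj (g x)) * ?N t * 1) = (g x * cnj (g x)) * (LINT t|lborel. ?N t)" by simp
      ultimately show "(LINT t|lborel. (g x * cnj (g x)) * ?N t * 1) = complex_of_real ((cmod (g x))\<^sup>2)"
        by (simp only: complex_norm_square mult_1_right)
    qed
    also have "\<dots> = complex_of_real (LINT x|lborel. (cmod (g x))\<^sup>2)" by (rule integral_complex_of_real)
    finally show ?thesis .
  qed
  finally have "(\<lambda>n. ennreal (2 * pi * cmod (J n))) \<longlonglongrightarrow> ennreal (2 * pi * cmod (complex_of_real (LINT x|lborel. (cmod (g x))\<^sup>2)))"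
    by (intro tendsto_ennrealI tendsto_mult tendsto_const tendsto_norm)
  moreover have "(\<lambda>n. ennreal (2 * pi * cmod (J n))) \<longlonglongrightarrow> (\<integral>\<^sup>+k. ennreal ((cmod (ft g k))\<^sup>2) \<partial>lborel)"
    using ft_regularised_SUP(2)[OF gm] unfolding ft_regularised_nn[OF gi \<epsilon>[unfolded \<epsilon>_def]] J_def \<epsilon>_def .
  ultimately have "(\<integral>\<^sup>+k. ennreal ((cmod (ft g k))\<^sup>2) \<partial>lborel) = ennreal (2 * pi * cmod (complex_of_real (LINT x|lborel. (cmod (g x))\<^sup>2)))"
    using LIMSEQ_unique by blast
  then show "(\<integral>\<^sup>+k. ennreal ((cmod (ft g k))\<^sup>2) \<partial>lborel) = ennreal (2 * pi * (LINT x|lborel. (cmod (g x))\<^sup>2))"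
    by (simp add: integral_nonneg_AE)
qed

lemma norm_cls_sq: "f \<in> L2 \<Longrightarrow> (norm (cls f))\<^sup>2 = (LINT x|lborel. (cmod (f x))\<^sup>2)"
  by (simp add: power2_norm_eq_inner inner_cls)

lemma L2_dominated_convergence:
  fixes X :: "nat \<Rightarrow> real \<Rightarrow> complex"
  assumes [measurable]: "\<And>n. X n \<in> borel_measurable borel" and h: "h \<in> L2" and f: "f \<in> L2"
    and b: "\<And>n x. cmod (X n x) \<le> cmod (h x)" and lim: "AE x in lborel. (\<lambda>n. X n x) \<longlonglongrightarrow> f x"
  shows "\<And>n. X n \<in> L2" "(\<lambda>n. cls (X n)) \<longlonglongrightarrow> cls f"
proof -
  note [measurable] = L2_measurable[OF f] L2_measurable[OF h]
  show X: "X n \<in> L2" for n by (rule L2_mono[OF h, of _ 1]) (use b in auto)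
  have fh: "AE x in lborel. cmod (f x) \<le> cmod (h x)"
    using lim
  proof eventually_elim
    case (elim x)
    show ?case by (rule LIMSEQ_le_const2[OF tendsto_norm[OF elim]]) (use b in auto)
  qed
  have "(\<lambda>n. LINT x|lborel. (cmod (X n x - f x))\<^sup>2) \<longlonglongrightarrow> (LINT x|(lborel :: real measure). 0)"
  proof (rule integral_dominated_convergence)
    show "integrable lborel (\<lambda>x. 4 * (cmod (h x))\<^sup>2)" using L2_integrable[OF h] by simp
    show "AE x in lborel. (\<lambda>n. (cmod (X n x - f x))\<^sup>2) \<longlonglongrightarrow> 0"
      using lim
    proof eventually_elim
      case (elim x)
      have "(\<lambda>n. (cmod (X n x - f x))\<^sup>2) \<longlonglongrightarrow> (cmod (f x - f x))\<^sup>2" by (intro tendsto_intros elim)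
      then show ?case by simp
    qed
    show "AE x in lborel. norm ((cmod (X n x - f x))\<^sup>2) \<le> 4 * (cmod (h x))\<^sup>2" for n
      using fh
    proof eventually_elim
      case (elim x)
      have "cmod (X n x - f x) \<le> 2 * cmod (h x)"
        using norm_triangle_ineq4[of "X n x" "f x"] b[of n x] elim by linarith
      then have "(cmod (X n x - f x))\<^sup>2 \<le> (2 * cmod (h x))\<^sup>2" by (intro power_mono) auto
      then show ?case by (simp add: power_mult_distrib)
    qed
  qed measurable
  then have "(\<lambda>n. (norm (cls (X n) - cls f))\<^sup>2) \<longlonglongrightarrow> 0"
    by (simp add: cls_diff[OF X f, symmetric] norm_cls_sq[OF L2_diff[OF X f]])
  from tendsto_real_sqrt[OF this] have "(\<lambda>n. norm (cls (X n) - cls f)) \<longlonglongrightarrow> 0" by simp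
  then show "(\<lambda>n. cls (X n)) \<longlonglongrightarrow> cls f" by (simp add: tendsto_norm_zero_iff LIM_zero_iff)
qed

text \<open>
  Continuous functions with compact support are dense in \<open>L\<^sup>2\<close>: a bounded function with bounded
  support is the pointwise limit of continuous functions, which can be clamped in modulus and
  cut off in space without losing the convergence.
\<close>

lemma continuous_dense_L2:
  fixes u :: l2
  assumes e: "e > 0"
  shows "\<exists>g R b. continuous_on UNIV g \<and> (\<forall>x. cmod (g x) \<le> b) \<and> (\<forall>x. \<bar>x\<bar> > R \<longrightarrow> g x = 0) \<and> g \<in> L2 \<and> norm (u - cls g) < e"
proof -
  define f where "f m x = (if \<bar>x\<bar> \<le> real m \<and> cmod (rep u x) \<le> real m then rep u x else 0)" for m x
  have fm [measurable]: "f m \<in> borel_measurable borel" for m unfolding f_def by measurable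
  have fb: "cmod (f m x) \<le> cmod (rep u x)" "cmod (f m x) \<le> real m" for m x by (auto simp: f_def)
  have "(\<lambda>n. f n x) \<longlonglongrightarrow> rep u x" for x
  proof -
    obtain M :: nat where M: "max \<bar>x\<bar> (cmod (rep u x)) \<le> real M" using real_arch_simple by blast
    have "eventually (\<lambda>n. f n x = rep u x) sequentially"
      using eventually_ge_at_top[of M] by eventually_elim (use M in \<open>auto simp: f_def\<close>)
    then show ?thesis by (rule tendsto_eventually)
  qed
  then have "(\<lambda>n. cls (f n)) \<longlonglongrightarrow> cls (rep u)"
    by (intro L2_dominated_convergence(2)[OF fm rep_L2 rep_L2 fb(1)]) auto
  then have "eventually (\<lambda>n. dist (cls (f n)) u < e / 2) sequentially" using e by (intro tendstoD) auto
  then obtain m where m: "norm (u - cls (f m)) < e / 2"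
    by (auto simp: dist_norm norm_minus_commute eventually_sequentially)
  have "f m \<in> borel_measurable lebesgue" by (rule measurable_completion) (use fm[of m] in simp)
  then have "(f m) measurable_on UNIV" by (rule lebesgue_measurable_imp_measurable_on) simp
  then obtain N g where N: "negligible N" and g: "\<And>n. continuous_on UNIV (g n :: real \<Rightarrow> complex)"
    and gl: "\<And>x. x \<notin> N \<Longrightarrow> (\<lambda>n. g n x) \<longlonglongrightarrow> f m x" unfolding measurable_on_def by auto
  define q where "q x = max 0 (min 1 (real m + 1 - \<bar>x\<bar>))" for x :: real
  define b where "b = real m + 1"
  have b: "b > 0" by (simp add: b_def)
  \<comment> \<open>Clamping of the modulus at \<open>b\<close>.\<close>
  define k where "k z = inverse (max 1 (cmod z / b)) *\<^sub>R z" for z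
  have kc: "continuous_on UNIV k" unfolding k_def
    by (intro continuous_intros) (use b in \<open>auto simp: max_def\<close>)
  have kb: "cmod (k z) \<le> b" for z
  proof -
    have "cmod z \<le> b * max 1 (cmod z / b)" using b by (simp add: max_def)
    then show ?thesis by (simp add: k_def field_simps max_def split: if_splits)
  qed
  have kid: "k z = z" if "cmod z \<le> b" for z using that b by (simp add: k_def max_def)
  have q01: "0 \<le> q x" "q x \<le> 1" for x by (auto simp: q_def)
  define G where "G n x = q x *\<^sub>R k (g n x)" for n x
  have Gc: "continuous_on UNIV (G n)" for n
    unfolding G_def q_def by (intro continuous_intros continuous_on_compose2[OF kc g]) auto
  have Gm: "G n \<in> borel_measurable borel" for n by (rule borel_measurable_continuous_onI[OF Gc])
  have Gs: "G n x = 0" if "\<bar>x\<bar> > b" for n x using that by (simp add: G_def q_def b_def)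
  have Gb: "cmod (G n x) \<le> b" for n x
  proof -
    have "q x * cmod (k (g n x)) \<le> 1 * b" using q01[of x] kb[of "g n x"] b by (intro mult_mono) auto
    then show ?thesis using q01[of x] by (simp add: G_def)
  qed
  define h where "h x = complex_of_real (b * indicator {-b..b} x)" for x
  have hL2: "h \<in> L2" unfolding L2_iff_nn_integral
  proof
    have "(\<integral>\<^sup>+x. ennreal ((cmod (h x))\<^sup>2) \<partial>lborel) = (\<integral>\<^sup>+x. ennreal (b\<^sup>2) * indicator {-b..b} x \<partial>lborel)"
      by (intro nn_integral_cong) (simp add: h_def indicator_def power_mult_distrib)
    also have "\<dots> < \<infinity>" using b by (simp add: nn_integral_cmult_indicator emeasure_lborel_Icc_eq ennreal_mult_less_top)
    finally show "(\<integral>\<^sup>+x. ennreal ((cmod (h x))\<^sup>2) \<partial>lborel) < \<infinity>" .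
  qed (simp add: h_def[abs_def])
  have Gh: "cmod (G n x) \<le> cmod (h x)" for n x
    using Gb[of n x] Gs[of x n] b by (auto simp: h_def indicator_def)
  have aeN: "AE x in lborel. x \<notin> N"
  proof -
    have "N \<in> null_sets lebesgue" using N by (simp add: negligible_iff_null_sets)
    then have "AE x in lebesgue. x \<notin> N" by (rule AE_not_in)
    then show ?thesis by (simp add: AE_completion_iff)
  qed
  have Glim: "AE x in lborel. (\<lambda>n. G n x) \<longlonglongrightarrow> f m x"
    using aeN
  proof eventually_elim
    case (elim x)
    have "(\<lambda>n. k (g n x)) \<longlonglongrightarrow> k (f m x)"
      using continuous_on_tendsto_compose[OF kc gl[OF elim]] by simp
    moreover have "k (f m x) = f m x" by (rule kid) (use fb(2)[of m x] in \<open>simp add: b_def\<close>)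
    ultimately have "(\<lambda>n. G n x) \<longlonglongrightarrow> q x *\<^sub>R f m x" unfolding G_def by (intro tendsto_intros) simp
    moreover have "q x *\<^sub>R f m x = f m x" by (cases "\<bar>x\<bar> \<le> real m") (auto simp: q_def f_def)
    ultimately show ?case by simp
  qed
  have fL2: "f m \<in> L2" by (rule L2_mono[OF rep_L2[of u] fm, of _ 1]) (use fb in auto)
  note G = L2_dominated_convergence[of G, OF Gm hL2 fL2 Gh Glim]
  from G(2) have "eventually (\<lambda>n. dist (cls (G n)) (cls (f m)) < e / 2) sequentially" using e by (intro tendstoD) auto
  then obtain n where n: "norm (cls (f m) - cls (G n)) < e / 2"
    by (auto simp: dist_norm norm_minus_commute eventually_sequentially)
  have "norm (u - cls (G n)) < e"
    using norm_triangle_ineq[of "u - cls (f m)" "cls (f m) - cls (G n)"] m n by simp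
  then show ?thesis using Gc Gb Gs G(1) by blast
qed

lemma L2_compact_integrable:
  assumes f: "f \<in> L2" and s: "\<And>x. \<bar>x\<bar> > R \<Longrightarrow> f x = (0::complex)"
  shows "integrable lborel f"
proof -
  note [measurable] = L2_measurable[OF f]
  have "(\<lambda>x. complex_of_real (indicator {-R..R} x)) \<in> L2"
    unfolding L2_iff_nn_integral
  proof
    have "(\<integral>\<^sup>+x. ennreal ((cmod (complex_of_real (indicator {-R..R} x)))\<^sup>2) \<partial>lborel) = (\<integral>\<^sup>+x. indicator {-R..R} x \<partial>lborel)"
      by (intro nn_integral_cong) (simp add: indicator_def)
    also have "\<dots> < \<infinity>" by (simp add: emeasure_lborel_Icc_eq)
    finally show "(\<integral>\<^sup>+x. ennreal ((cmod (complex_of_real (indicator {-R..R} x)))\<^sup>2) \<partial>lborel) < \<infinity>" .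
  qed measurable
  from integrable_L2_mult_norm[OF this f] show ?thesis
  proof (rule Bochner_Integration.integrable_bound)
    show "AE x in lborel. norm (f x) \<le> norm (norm (complex_of_real (indicator {-R..R} x)) * norm (f x))"
      using s by (intro AE_I2) (auto simp: indicator_def)
  qed measurable
qed

lemma ft_L2:
  assumes f: "f \<in> L2" and i: "integrable lborel f"
  shows "ft f \<in> L2" "(norm (cls (ft f)))\<^sup>2 \<le> 2 * pi * (norm (cls f))\<^sup>2"
proof -
  note [measurable] = L2_measurable[OF f]
  have le: "(\<integral>\<^sup>+k. ennreal ((cmod (ft f k))\<^sup>2) \<partial>lborel) \<le> ennreal (2 * pi * (norm (cls f))\<^sup>2)"
    by (rule ft_L2_bound[OF i]) (simp_all add: nn_integral_cls[OF f])
  then show L: "ft f \<in> L2" unfolding L2_iff_nn_integral by (auto intro: le_less_trans)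
  show "(norm (cls (ft f)))\<^sup>2 \<le> 2 * pi * (norm (cls f))\<^sup>2"
    using le unfolding nn_integral_cls[OF L] by (subst (asm) ennreal_le_iff) auto
qed

text \<open>
  Both sides are continuous in the norm of \<open>L\<^sup>2\<close> by the bound \<open>ft_L2\<close>, and they agree on a dense
  set.
\<close>

lemma ft_isometry:
  assumes f: "f \<in> L2" and i: "integrable lborel f"
  shows "(norm (cls (ft f)))\<^sup>2 = 2 * pi * (norm (cls f))\<^sup>2"
proof -
  have "\<forall>n. \<exists>g R b. continuous_on UNIV g \<and> (\<forall>x. cmod (g x) \<le> b) \<and> (\<forall>x. \<bar>x\<bar> > R \<longrightarrow> g x = 0) \<and> g \<in> L2
      \<and> norm (cls f - cls g) < inverse (real (Suc n))"
    using continuous_dense_L2 by simp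
  then obtain g R b where g: "\<And>n. continuous_on UNIV (g n)" "\<And>n x. cmod (g n x) \<le> b n" "\<And>n x. \<bar>x\<bar> > R n \<Longrightarrow> g n x = 0"
    "\<And>n. g n \<in> L2" "\<And>n. norm (cls f - cls (g n)) < inverse (real (Suc n))" by metis
  have gi: "integrable lborel (g n)" for n by (rule ft_isometry_continuous(2)[OF g(1,2,3)])
  have iso: "(norm (cls (ft (g n))))\<^sup>2 = 2 * pi * (norm (cls (g n)))\<^sup>2" for n
  proof -
    have "ennreal ((norm (cls (ft (g n))))\<^sup>2) = ennreal (2 * pi * (norm (cls (g n)))\<^sup>2)"
      using ft_isometry_continuous(1)[OF g(1,2,3)] nn_integral_cls[OF ft_L2(1)[OF g(4) gi]] by (simp add: norm_cls_sq[OF g(4)])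
    then show ?thesis by simp
  qed
  have glim: "(\<lambda>n. cls (g n)) \<longlonglongrightarrow> cls f"
  proof -
    have "(\<lambda>n. cls f - cls (g n)) \<longlonglongrightarrow> 0"
      by (rule Lim_null_comparison[OF _ LIMSEQ_inverse_real_of_nat]) (intro always_eventually allI less_imp_le g(5))
    from tendsto_diff[OF tendsto_const[of "cls f"] this] show ?thesis by simp
  qed
  have flim: "(\<lambda>n. cls (ft (g n))) \<longlonglongrightarrow> cls (ft f)"
  proof -
    have "norm (cls (ft (g n)) - cls (ft f)) \<le> sqrt (2 * pi) * norm (cls (g n) - cls f)" for n
    proof -
      have eq: "(\<lambda>k. ft (g n) k - ft f k) = ft (\<lambda>x. g n x - f x)" by (rule ext) (simp add: ft_diff[OF gi i])
      have d1: "cls (\<lambda>x. g n x - f x) = cls (g n) - cls f" by (rule cls_diff[OF g(4) f])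
      have d2: "cls (\<lambda>k. ft (g n) k - ft f k) = cls (ft (g n)) - cls (ft f)"
        by (rule cls_diff[OF ft_L2(1)[OF g(4) gi] ft_L2(1)[OF f i]])
      have "(norm (cls (ft (\<lambda>x. g n x - f x))))\<^sup>2 \<le> 2 * pi * (norm (cls (\<lambda>x. g n x - f x)))\<^sup>2"
        by (rule ft_L2(2)[OF L2_diff[OF g(4) f] Bochner_Integration.integrable_diff[OF gi i]])
      then have "(norm (cls (ft (g n)) - cls (ft f)))\<^sup>2 \<le> 2 * pi * (norm (cls (g n) - cls f))\<^sup>2"
        by (simp only: d1 eq[symmetric] d2)
      then have "norm (cls (ft (g n)) - cls (ft f)) \<le> sqrt (2 * pi * (norm (cls (g n) - cls f))\<^sup>2)" by (rule real_le_rsqrt)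
      then show ?thesis by (simp add: real_sqrt_mult)
    qed
    note le = this
    have "(\<lambda>n. sqrt (2 * pi) * norm (cls (g n) - cls f)) \<longlonglongrightarrow> sqrt (2 * pi) * norm (cls f - cls f)"
      by (intro tendsto_intros glim)
    then have z: "(\<lambda>n. sqrt (2 * pi) * norm (cls (g n) - cls f)) \<longlonglongrightarrow> 0" by simp
    have "(\<lambda>n. cls (ft (g n)) - cls (ft f)) \<longlonglongrightarrow> 0"
      by (rule Lim_null_comparison[OF _ z]) (intro always_eventually allI le)
    then show ?thesis by (rule LIM_zero_cancel)
  qed
  have "(\<lambda>n. (norm (cls (ft (g n))))\<^sup>2) \<longlonglongrightarrow> (norm (cls (ft f)))\<^sup>2" by (intro tendsto_intros flim)
  moreover have "(\<lambda>n. 2 * pi * (norm (cls (g n)))\<^sup>2) \<longlonglongrightarrow> 2 * pi * (norm (cls f))\<^sup>2" by (intro tendsto_intros glim)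
  ultimately show ?thesis unfolding iso by (rule LIMSEQ_unique)
qed

section \<open>The Fourier transform as an operator\<close>

definition cutf :: "real \<Rightarrow> l2 \<Rightarrow> real \<Rightarrow> complex" where
  "cutf R u x = (if \<bar>x\<bar> \<le> R then rep u x else 0)"

text \<open>
  The integral over \<open>[-R, R]\<close>, which is defined on all of \<open>L\<^sup>2\<close> because square integrable
  functions are integrable over bounded intervals.
\<close>

definition FR :: "real \<Rightarrow> l2 \<Rightarrow> l2" where "FR R u = cls (ft (cutf R u))"

lemma cutf_measurable [measurable]: "cutf R u \<in> borel_measurable borel"
  unfolding cutf_def by measurable

lemma cutf_L2: "cutf R u \<in> L2"
  by (rule L2_mono[OF rep_L2[of u], of _ 1]) (auto simp: cutf_def)

lemma cutf_integrable: "integrable lborel (cutf R u)"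
  by (rule L2_compact_integrable[OF cutf_L2, of R]) (simp add: cutf_def)

lemma cls_cutf: "cls (cutf R u) = cut R u"
  by (intro l2_eqI) (use rep_cls[OF cutf_L2[of R u]] rep_cut[of R u] in \<open>eventually_elim, simp add: cutf_def\<close>)

lemma rep_FR: "AE k in lborel. rep (FR R u) k = ft (cutf R u) k"
  unfolding FR_def by (rule rep_cls[OF ft_L2(1)[OF cutf_L2 cutf_integrable]])

lemma norm_FR: "norm (FR R u) = sqrt (2 * pi) * norm (cut R u)"
proof -
  have "(norm (FR R u))\<^sup>2 = (sqrt (2 * pi) * norm (cut R u))\<^sup>2"
    using ft_isometry[OF cutf_L2 cutf_integrable, of R u] by (simp add: FR_def cls_cutf power_mult_distrib)
  then show ?thesis by (simp add: power2_eq_iff_nonneg)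
qed

lemma FR_eqI:
  assumes "AE x in lborel. cutf R u x = f x" and [measurable]: "f \<in> borel_measurable borel"
  shows "AE k in lborel. rep (FR R u) k = ft f k"
  using rep_FR[of R u] ft_cong_AE[OF assms(1)] by simp

lemma FR_add: "FR R (u + v) = FR R u + FR R v"
proof (rule l2_eqI)
  have "AE x in lborel. cutf R (u + v) x = cutf R u x + cutf R v x"
    using rep_add[of u v] by eventually_elim (simp add: cutf_def)
  from FR_eqI[OF this] have "AE k in lborel. rep (FR R (u + v)) k = ft (\<lambda>x. cutf R u x + cutf R v x) k" by simp
  then show "AE k in lborel. rep (FR R (u + v)) k = rep (FR R u + FR R v) k"
    using rep_FR[of R u] rep_FR[of R v] rep_add[of "FR R u" "FR R v"]
    by eventually_elim (simp add: ft_add[OF cutf_integrable cutf_integrable])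
qed

lemma FR_scaleR: "FR R (c *\<^sub>R u) = c *\<^sub>R FR R u"
proof (rule l2_eqI)
  have "AE x in lborel. cutf R (c *\<^sub>R u) x = c *\<^sub>R cutf R u x"
    using rep_scaleR[of c u] by eventually_elim (simp add: cutf_def)
  from FR_eqI[OF this] have "AE k in lborel. rep (FR R (c *\<^sub>R u)) k = ft (\<lambda>x. c *\<^sub>R cutf R u x) k" by simp
  then show "AE k in lborel. rep (FR R (c *\<^sub>R u)) k = rep (c *\<^sub>R FR R u) k"
    using rep_FR[of R u] rep_scaleR[of c "FR R u"]
    by eventually_elim (simp only: ft_scaleR)
qed

lemma linear_FR: "linear (FR R)"
  by (rule linearI) (rule FR_add FR_scaleR)+

lemma FR_cut:
  assumes "R \<le> R'" shows "FR R' (cut R u) = FR R u"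
proof (rule l2_eqI)
  have "AE x in lborel. cutf R' (cut R u) x = cutf R u x"
    using rep_cut[of R u] by eventually_elim (use assms in \<open>auto simp: cutf_def\<close>)
  from FR_eqI[OF this] show "AE k in lborel. rep (FR R' (cut R u)) k = rep (FR R u) k"
    using rep_FR[of R u] by (auto elim: eventually_elim2)
qed

lemma FR_diff_le:
  assumes "R \<le> R'" shows "norm (FR R' u - FR R u) \<le> sqrt (2 * pi) * norm (u - cut R u)"
proof -
  have "FR R' u - FR R u = FR R' (u - cut R u)"
    by (simp add: linear_diff[OF linear_FR] FR_cut[OF assms])
  then show ?thesis using norm_cut_le[of R' "u - cut R u"] by (simp add: norm_FR)
qed

lemma cut_tendsto: "((\<lambda>R. cut R u) \<longlongrightarrow> u) at_top"
proof (rule tendstoI)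
  fix e :: real assume e: "e > 0"
  have "(\<lambda>n. cls (cutf (real n) u)) \<longlonglongrightarrow> cls (rep u)"
  proof (rule L2_dominated_convergence(2)[OF cutf_measurable rep_L2 rep_L2])
    show "cmod (cutf (real n) u x) \<le> cmod (rep u x)" for n x by (simp add: cutf_def)
    show "AE x in lborel. (\<lambda>n. cutf (real n) u x) \<longlonglongrightarrow> rep u x"
    proof (rule AE_I2)
      fix x
      obtain M :: nat where M: "\<bar>x\<bar> \<le> real M" using real_arch_simple by blast
      have "eventually (\<lambda>n. cutf (real n) u x = rep u x) sequentially"
        using eventually_ge_at_top[of M] by eventually_elim (use M in \<open>auto simp: cutf_def\<close>)
      then show "(\<lambda>n. cutf (real n) u x) \<longlonglongrightarrow> rep u x" by (rule tendsto_eventually)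
    qed
  qed
  then have "eventually (\<lambda>n. dist (cut (real n) u) u < e) sequentially" using e by (intro tendstoD) (auto simp: cls_cutf)
  then obtain n where n: "dist (cut (real n) u) u < e" by (auto simp: eventually_sequentially)
  have "dist (cut R u) u < e" if R: "R \<ge> real n" for R
  proof -
    interpret c: bounded_linear "cut R" by (rule bounded_linear_cut)
    have "u - cut R u = (u - cut (real n) u) - cut R (u - cut (real n) u)"
      by (simp add: c.diff cut_cut_le[OF R])
    moreover have "norm (x - cut R x) \<le> norm x" for x
    proof -
      have "norm (mul (\<lambda>k. 1 - indicator {-R..R} k) x) \<le> 1 * norm x"
        by (rule norm_mul_le) (auto simp: indicator_def)
      moreover have "mul (\<lambda>k. 1 - indicator {-R..R} k) x = x - cut R x"
      proof (rule l2_eqI)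
        have b: "bmeas (\<lambda>k. 1 - indicator {-R..R} k)" by (rule bmeasI[of _ 1]) (auto simp: indicator_def)
        show "AE k in lborel. rep (mul (\<lambda>k. 1 - indicator {-R..R} k) x) k = rep (x - cut R x) k"
          using rep_mul[OF b, of x] rep_cut[of R x] rep_diff[of x "cut R x"]
          by eventually_elim (auto simp: indicator_def abs_le_iff)
      qed
      ultimately show ?thesis by simp
    qed
    ultimately have "norm (u - cut R u) \<le> norm (u - cut (real n) u)" by metis
    then show ?thesis using n by (simp add: dist_norm norm_minus_commute)
  qed
  then show "eventually (\<lambda>R. dist (cut R u) u < e) at_top" by (auto intro: eventually_at_top_linorderI)
qed

text \<open>
  The limit exists because \<open>FR R u\<close> depends on \<open>R\<close> only through a tail of \<open>u\<close>; see \<open>FR_diff_le\<close>.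
\<close>

definition plancherel :: "l2 \<Rightarrow> l2" where "plancherel u = lim (\<lambda>n. FR (real n) u)"

lemma cut_seq_tendsto: "(\<lambda>n. cut (real n) u) \<longlonglongrightarrow> u"
  by (rule filterlim_compose[OF cut_tendsto filterlim_real_sequentially])

lemma FR_tendsto_plancherel: "(\<lambda>n. FR (real n) u) \<longlonglongrightarrow> plancherel u"
proof -
  have lim0: "(\<lambda>n. sqrt (2 * pi) * norm (u - cut (real n) u)) \<longlonglongrightarrow> 0"
    using tendsto_mult[OF tendsto_const tendsto_norm[OF tendsto_diff[OF tendsto_const[of u] cut_seq_tendsto[of u]]], of "sqrt (2 * pi)"] by simp
  have "Cauchy (\<lambda>n. FR (real n) u)"
  proof (rule CauchyI')
    fix e :: real assume "e > 0"
    from order_tendstoD(2)[OF lim0 this] obtain M where M: "\<And>n. n \<ge> M \<Longrightarrow> sqrt (2 * pi) * norm (u - cut (real n) u) < e"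
      by (auto simp: eventually_sequentially)
    have "dist (FR (real m) u) (FR (real n) u) < e" if "m \<ge> M" "n > m" for m n
      using FR_diff_le[of "real m" "real n" u] M[of m] that by (simp add: dist_norm norm_minus_commute)
    then show "\<exists>M. \<forall>m\<ge>M. \<forall>n>m. dist (FR (real m) u) (FR (real n) u) < e" by blast
  qed
  then show ?thesis unfolding plancherel_def by (simp add: Cauchy_convergent_iff convergent_LIMSEQ_iff)
qed

lemma plancherel_FR_le: "norm (plancherel u - FR R u) \<le> sqrt (2 * pi) * norm (u - cut R u)"
proof (rule LIMSEQ_le_const2)
  show "(\<lambda>n. norm (FR (real n) u - FR R u)) \<longlonglongrightarrow> norm (plancherel u - FR R u)" by (intro tendsto_intros FR_tendsto_plancherel)
  obtain M :: nat where "R \<le> real M" using real_arch_simple by blast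
  then show "\<exists>N. \<forall>n\<ge>N. norm (FR (real n) u - FR R u) \<le> sqrt (2 * pi) * norm (u - cut R u)"
    by (intro exI[of _ M]) (auto intro!: FR_diff_le)
qed

lemma FR_tendsto_plancherel_at_top: "((\<lambda>R. FR R u) \<longlongrightarrow> plancherel u) at_top"
proof -
  have "((\<lambda>R. sqrt (2 * pi) * norm (u - cut R u)) \<longlongrightarrow> 0) at_top"
    using tendsto_mult[OF tendsto_const tendsto_norm[OF tendsto_diff[OF tendsto_const[of u] cut_tendsto[of u]]], of "sqrt (2 * pi)"] by simp
  then have "((\<lambda>R. plancherel u - FR R u) \<longlongrightarrow> 0) at_top"
    by (rule Lim_null_comparison[rotated]) (simp add: plancherel_FR_le)
  from tendsto_diff[OF tendsto_const[of "plancherel u"] this] show ?thesis by simp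
qed

lemma plancherel_add: "plancherel (u + v) = plancherel u + plancherel v"
  using LIMSEQ_unique[OF FR_tendsto_plancherel[of "u + v"]] tendsto_add[OF FR_tendsto_plancherel[of u] FR_tendsto_plancherel[of v]]
  by (simp add: FR_add)

lemma plancherel_scaleR: "plancherel (c *\<^sub>R u) = c *\<^sub>R plancherel u"
  using LIMSEQ_unique[OF FR_tendsto_plancherel[of "c *\<^sub>R u"]] tendsto_scaleR[OF tendsto_const[of c] FR_tendsto_plancherel[of u]]
  by (simp add: FR_scaleR)

lemma linear_plancherel: "linear plancherel"
  by (rule linearI) (rule plancherel_add plancherel_scaleR)+

lemma norm_plancherel: "norm (plancherel u) = sqrt (2 * pi) * norm u"
proof (rule LIMSEQ_unique)
  show "(\<lambda>n. norm (FR (real n) u)) \<longlonglongrightarrow> norm (plancherel u)" by (intro tendsto_intros FR_tendsto_plancherel)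
  show "(\<lambda>n. norm (FR (real n) u)) \<longlonglongrightarrow> sqrt (2 * pi) * norm u"
    unfolding norm_FR by (intro tendsto_intros cut_seq_tendsto)
qed

definition conj2 :: "l2 \<Rightarrow> l2" where "conj2 u = cls (\<lambda>x. cnj (rep u x))"

lemma L2_cnj: "f \<in> L2 \<Longrightarrow> (\<lambda>x. cnj (f x)) \<in> L2"
proof -
  assume f: "f \<in> L2"
  note [measurable] = L2_measurable[OF f]
  show ?thesis by (rule L2_mono[OF f, of _ 1]) auto
qed

lemma rep_conj2: "AE x in lborel. rep (conj2 u) x = cnj (rep u x)"
  unfolding conj2_def by (rule rep_cls[OF L2_cnj[OF rep_L2]])

lemma conj2_conj2: "conj2 (conj2 u) = u"
  by (intro l2_eqI) (use rep_conj2[of "conj2 u"] rep_conj2[of u] in \<open>eventually_elim, simp\<close>)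

lemma norm_conj2: "norm (conj2 u) = norm u"
proof -
  have "ennreal ((norm (conj2 u))\<^sup>2) = ennreal ((norm u)\<^sup>2)"
    unfolding nn_integral_rep[symmetric]
    by (rule nn_integral_cong_AE) (use rep_conj2[of u] in \<open>eventually_elim, simp\<close>)
  then show ?thesis by (simp add: power2_eq_iff_nonneg)
qed

lemma conj2_tendsto:
  assumes "(X \<longlonglongrightarrow> u)" shows "(\<lambda>n. conj2 (X n)) \<longlonglongrightarrow> conj2 u"
proof -
  have d: "conj2 x - conj2 y = conj2 (x - y)" for x y
    by (intro l2_eqI) (use rep_conj2[of x] rep_conj2[of y] rep_conj2[of "x - y"] rep_diff[of x y] rep_diff[of "conj2 x" "conj2 y"]
        in \<open>eventually_elim, simp\<close>)
  have "(\<lambda>n. norm (X n - u)) \<longlonglongrightarrow> 0" using assms by (simp add: tendsto_norm_zero_iff LIM_zero)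
  then have "(\<lambda>n. norm (conj2 (X n) - conj2 u)) \<longlonglongrightarrow> 0" by (simp add: d norm_conj2)
  then show ?thesis by (simp add: tendsto_norm_zero_iff LIM_zero_iff)
qed

lemma FR_adjoint: "inner (FR R u) (conj2 (cut R v)) = inner (FR R v) (conj2 (cut R u))"
proof -
  have *: "inner (FR R u) (conj2 (cut R v)) = Re (LINT k|lborel. ft (cutf R u) k * cutf R v k)" for u v
  proof -
    have "inner (FR R u) (conj2 (cut R v)) = (LINT k|lborel. Re (ft (cutf R u) k * cutf R v k))"
      unfolding inner_l2_def
    proof (rule integral_cong_AE)
      show "AE k in lborel. rep (FR R u) k \<bullet> rep (conj2 (cut R v)) k = Re (ft (cutf R u) k * cutf R v k)"
        using rep_FR[of R u] rep_conj2[of "cut R v"] rep_cut[of R v]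
        by eventually_elim (simp add: inner_complex_def cutf_def)
    qed measurable
    also have "\<dots> = Re (LINT k|lborel. ft (cutf R u) k * cutf R v k)"
    proof (rule integral_Re, rule Bochner_Integration.integrable_bound)
      show "integrable lborel (\<lambda>k. complex_of_real (LINT x|lborel. cmod (cutf R u x)) * cutf R v k)"
        using cutf_integrable by simp
      show "AE k in lborel. norm (ft (cutf R u) k * cutf R v k) \<le> norm (complex_of_real (LINT x|lborel. cmod (cutf R u x)) * cutf R v k)"
        using ft_bounded[OF cutf_integrable, of R u]
        by (auto simp: norm_mult intro!: AE_I2 mult_right_mono order_trans[OF _ abs_ge_self])
    qed measurable
    finally show ?thesis .
  qed
  have "(LINT k|lborel. ft (cutf R u) k * cutf R v k) = (LINT k|lborel. ft (cutf R v) k * cutf R u k)"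
    using ft_adjoint[OF cutf_integrable cutf_integrable, of R u R v] by (simp add: mult.commute)
  then show ?thesis by (simp add: *)
qed

text \<open>
  Both sides are the real part of the bilinear pairing \<open>\<integral> plancherel u * v\<close>, which is symmetric by
  \<open>ft_adjoint\<close>; the conjugation makes up for the one in the inner product.
\<close>

lemma plancherel_adjoint: "inner (plancherel u) (conj2 v) = inner (plancherel v) (conj2 u)"
proof (rule LIMSEQ_unique)
  have l: "(\<lambda>n. inner (FR (real n) u) (conj2 (cut (real n) v))) \<longlonglongrightarrow> inner (plancherel u) (conj2 v)" for u v
    by (intro tendsto_inner FR_tendsto_plancherel conj2_tendsto cut_seq_tendsto)
  show "(\<lambda>n. inner (FR (real n) u) (conj2 (cut (real n) v))) \<longlonglongrightarrow> inner (plancherel u) (conj2 v)" by (rule l)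
  show "(\<lambda>n. inner (FR (real n) u) (conj2 (cut (real n) v))) \<longlonglongrightarrow> inner (plancherel v) (conj2 u)"
    unfolding FR_adjoint[of _ u v] by (rule l)
qed

text \<open>
  Inversion: \<open>plancherel\<close> is a multiple of an isometry and its adjoint is its own conjugate, so the
  composition of both is a multiple of the identity.
\<close>

lemma plancherel_inversion: "plancherel (conj2 (plancherel (conj2 u))) = (2 * pi) *\<^sub>R u"
proof -
  let ?w = "conj2 (plancherel (conj2 u))"
  have nw: "norm ?w = sqrt (2 * pi) * norm u" by (simp add: norm_conj2 norm_plancherel)
  have "inner (plancherel ?w) u = inner (plancherel ?w) (conj2 (conj2 u))" by (simp add: conj2_conj2)
  also have "\<dots> = inner (plancherel (conj2 u)) (plancherel (conj2 u))" by (subst plancherel_adjoint) (simp add: conj2_conj2)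
  also have "\<dots> = (norm (plancherel (conj2 u)))\<^sup>2" by (simp add: power2_norm_eq_inner)
  also have "\<dots> = 2 * pi * (norm u)\<^sup>2" by (simp add: norm_plancherel norm_conj2 power_mult_distrib)
  finally have i: "inner (plancherel ?w) u = 2 * pi * (norm u)\<^sup>2" .
  have n: "inner (plancherel ?w) (plancherel ?w) = (2 * pi)\<^sup>2 * (norm u)\<^sup>2"
    unfolding power2_norm_eq_inner[symmetric] norm_plancherel nw by (simp add: power_mult_distrib power2_eq_square)
  have "inner (x - c *\<^sub>R u) (x - c *\<^sub>R u) = inner x x - 2 * c * inner x u + c\<^sup>2 * (norm u)\<^sup>2" for x c
    unfolding power2_norm_eq_inner
    by (simp add: inner_diff_left inner_diff_right inner_commute[of u x] power2_eq_square algebra_simps)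
  from this[of "plancherel ?w" "2 * pi"] have "inner (plancherel ?w - (2 * pi) *\<^sub>R u) (plancherel ?w - (2 * pi) *\<^sub>R u) = 0"
    unfolding i n by (simp add: power2_eq_square)
  then show ?thesis by (simp only: inner_eq_zero_iff right_minus_eq)
qed

text \<open>
  Conjugation in space is conjugation together with reflection in frequency.
\<close>

lemma plancherel_conj2: "plancherel (conj2 u) = refl_cnj (plancherel u)"
proof (rule LIMSEQ_unique)
  show "(\<lambda>n. FR (real n) (conj2 u)) \<longlonglongrightarrow> plancherel (conj2 u)" by (rule FR_tendsto_plancherel)
  have "FR R (conj2 u) = refl_cnj (FR R u)" for R
  proof (rule l2_eqI)
    have "AE x in lborel. cutf R (conj2 u) x = cnj (cutf R u x)"
      using rep_conj2[of u] by eventually_elim (simp add: cutf_def)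
    from FR_eqI[OF this] have "AE k in lborel. rep (FR R (conj2 u)) k = ft (\<lambda>x. cnj (cutf R u x)) k" by simp
    then show "AE k in lborel. rep (FR R (conj2 u)) k = rep (refl_cnj (FR R u)) k"
      using rep_refl_cnj[of "FR R u"] AE_minus[OF rep_FR[of R u]]
      by eventually_elim (simp add: ft_cnj)
  qed
  then show "(\<lambda>n. FR (real n) (conj2 u)) \<longlonglongrightarrow> refl_cnj (plancherel u)"
    using bounded_linear.tendsto[OF bounded_linear_refl_cnj FR_tendsto_plancherel[of u]] by simp
qed

lemma plancherel_inj: "plancherel u = plancherel v \<Longrightarrow> u = v"
proof -
  assume "plancherel u = plancherel v"
  then have "plancherel (u - v) = 0" using linear_diff[OF linear_plancherel, of u v] by simp
  then have "norm (u - v) = 0" using norm_plancherel[of "u - v"] by simp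
  then show ?thesis by simp
qed

section \<open>The Fourier transform of real functions\<close>

lemma L2_of_real: "f \<in> L2 \<Longrightarrow> (\<lambda>x. complex_of_real (f x)) \<in> L2"
  unfolding L2_def by (auto intro: borel_measurable_of_real)

text \<open>
  The class of the Fourier transform of a real function, with the normalisation \<open>1 / (2 * pi)\<close>.
\<close>

definition fourier_l2 :: "(real \<Rightarrow> real) \<Rightarrow> l2" where
  "fourier_l2 f = (1 / (2 * pi)) *\<^sub>R plancherel (cls (\<lambda>x. complex_of_real (f x)))"

lemma truncated_fourier_eq_FR:
  assumes f: "f \<in> L2"
  shows "AE k in lborel. truncated_fourier R f k = rep ((1 / (2 * pi)) *\<^sub>R FR R (cls (\<lambda>x. complex_of_real (f x)))) k"
proof -
  note [measurable] = L2_measurable[OF f]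
  let ?c = "cls (\<lambda>x. complex_of_real (f x))"
  have "AE x in lborel. cutf R ?c x = indicator {-R..R} x *\<^sub>R complex_of_real (f x)"
    using rep_cls[OF L2_of_real[OF f]] by eventually_elim (auto simp: cutf_def indicator_def abs_le_iff)
  from FR_eqI[OF this]
  have "AE k in lborel. rep (FR R ?c) k = ft (\<lambda>x. indicator {-R..R} x *\<^sub>R complex_of_real (f x)) k" by simp
  moreover have "truncated_fourier R f k = (1 / (2 * pi)) *\<^sub>R ft (\<lambda>x. indicator {-R..R} x *\<^sub>R complex_of_real (f x)) k" for k
    unfolding truncated_fourier_def ft_def set_lebesgue_integral_def by (simp add: scaleR_conv_of_real mult.assoc)
  ultimately show ?thesis using rep_scaleR[of "1 / (2 * pi)" "FR R ?c"] by (auto elim: eventually_elim2)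
qed

text \<open>
  The truncated integrals are \<open>FR R\<close> up to normalisation, and these converge; the limit in \<open>L\<^sup>2\<close>
  is unique.
\<close>

lemma has_fourier_transform_iff:
  "has_fourier_transform f g \<longleftrightarrow> f \<in> L2 \<and> g \<in> L2 \<and> cls g = fourier_l2 f"
proof (cases "f \<in> L2 \<and> g \<in> L2")
  case True
  then have f: "f \<in> L2" and g: "g \<in> L2" by auto
  define G where "G R = (1 / (2 * pi)) *\<^sub>R FR R (cls (\<lambda>x. complex_of_real (f x)))" for R
  have lim: "(G \<longlongrightarrow> fourier_l2 f) at_top"
    unfolding G_def[abs_def] fourier_l2_def by (intro tendsto_intros FR_tendsto_plancherel_at_top)
  have "(\<integral>\<^sup>+k. ennreal ((cmod (truncated_fourier R f k - g k))\<^sup>2) \<partial>lborel) = ennreal ((norm (G R - cls g))\<^sup>2)" for R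
    unfolding nn_integral_rep[symmetric]
  proof (rule nn_integral_cong_AE)
    show "AE k in lborel. ennreal ((cmod (truncated_fourier R f k - g k))\<^sup>2) = ennreal ((cmod (rep (G R - cls g) k))\<^sup>2)"
      using truncated_fourier_eq_FR[OF f, of R] rep_cls[OF g] rep_diff[of "G R" "cls g"]
      by eventually_elim (simp add: G_def)
  qed
  then have "has_fourier_transform f g \<longleftrightarrow> ((\<lambda>R. ennreal ((norm (G R - cls g))\<^sup>2)) \<longlongrightarrow> 0) at_top"
    using True by (simp add: has_fourier_transform_def)
  also have "\<dots> \<longleftrightarrow> ((\<lambda>R. (norm (G R - cls g))\<^sup>2) \<longlongrightarrow> 0) at_top"
    using tendsto_ennreal_iff[of "\<lambda>R. (norm (G R - cls g))\<^sup>2" at_top 0] by simp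
  also have "\<dots> \<longleftrightarrow> (G \<longlongrightarrow> cls g) at_top"
  proof
    assume "((\<lambda>R. (norm (G R - cls g))\<^sup>2) \<longlongrightarrow> 0) at_top"
    from tendsto_real_sqrt[OF this] have "((\<lambda>R. G R - cls g) \<longlongrightarrow> 0) at_top" by (simp add: tendsto_norm_zero_iff)
    then show "(G \<longlongrightarrow> cls g) at_top" by (rule LIM_zero_cancel)
  next
    assume "(G \<longlongrightarrow> cls g) at_top"
    then have "((\<lambda>R. (norm (G R - cls g))\<^sup>2) \<longlongrightarrow> (norm (cls g - cls g))\<^sup>2) at_top" by (intro tendsto_intros)
    then show "((\<lambda>R. (norm (G R - cls g))\<^sup>2) \<longlongrightarrow> 0) at_top" by simp
  qed
  also have "\<dots> \<longleftrightarrow> cls g = fourier_l2 f"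
    using lim by (metis tendsto_unique trivial_limit_at_top_linorder)
  finally show ?thesis using True by simp
qed (auto simp: has_fourier_transform_def)

lemma fourier_L2:
  assumes f: "f \<in> L2"
  shows "fourier f \<in> L2" "cls (fourier f) = fourier_l2 f" "AE k in lborel. fourier f k = rep (fourier_l2 f) k"
proof -
  have "has_fourier_transform f (rep (fourier_l2 f))" by (simp add: has_fourier_transform_iff f)
  then have "has_fourier_transform f (fourier f)" unfolding fourier_def by (rule someI[of "has_fourier_transform f"])
  then show g: "fourier f \<in> L2" "cls (fourier f) = fourier_l2 f" by (auto simp: has_fourier_transform_iff)
  show "AE k in lborel. fourier f k = rep (fourier_l2 f) k"
    using rep_cls[OF g(1)] unfolding g(2) by (auto elim!: eventually_mono)
qed

lemma fourier_l2_cong_AE: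
  assumes "f \<in> L2" "g \<in> L2" "AE x in lborel. f x = g x"
  shows "fourier_l2 f = fourier_l2 g"
proof -
  have "cls (\<lambda>x. complex_of_real (f x)) = cls (\<lambda>x. complex_of_real (g x))"
    using assms by (simp add: cls_eq_iff L2_of_real)
  then show ?thesis by (simp add: fourier_l2_def)
qed

lemma fourier_l2_diff:
  assumes f: "f \<in> L2" and g: "g \<in> L2" shows "fourier_l2 (\<lambda>x. f x - g x) = fourier_l2 f - fourier_l2 g"
  using cls_diff[OF L2_of_real[OF f] L2_of_real[OF g]]
  by (simp add: fourier_l2_def linear_diff[OF linear_plancherel] scaleR_diff_right)

lemma fourier_l2_scaleR:
  assumes f: "f \<in> L2" shows "fourier_l2 (\<lambda>x. c * f x) = c *\<^sub>R fourier_l2 f"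
proof -
  have "cls (\<lambda>x. complex_of_real (c * f x)) = c *\<^sub>R cls (\<lambda>x. complex_of_real (f x))"
    using cls_scaleR[OF L2_of_real[OF f], of c] by (simp add: scaleR_conv_of_real)
  then show ?thesis by (simp add: fourier_l2_def plancherel_scaleR)
qed

lemma fourier_l2_minus:
  assumes f: "f \<in> L2" shows "fourier_l2 (\<lambda>x. - f x) = - fourier_l2 f"
  using fourier_l2_scaleR[OF f, of "- 1"] by simp

lemma herm_fourier_l2:
  assumes f: "f \<in> L2" shows "herm (fourier_l2 f)"
proof -
  let ?c = "cls (\<lambda>x. complex_of_real (f x))"
  have "conj2 ?c = ?c"
    by (intro l2_eqI) (use rep_conj2[of ?c] rep_cls[OF L2_of_real[OF f]] in \<open>eventually_elim, simp\<close>)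
  then have "refl_cnj (plancherel ?c) = plancherel ?c" using plancherel_conj2[of ?c] by simp
  then show ?thesis
    unfolding herm_iff fourier_l2_def using linear_cmul[OF bounded_linear.linear[OF bounded_linear_refl_cnj], of "1 / (2 * pi)" "plancherel ?c"]
    by simp
qed

text \<open>
  Conversely, a Hermitian class is the transform of a real function: by the inversion formula it
  is the transform of some \<open>u\<close>, the transform of \<open>conj2 u\<close> is the same class, and so \<open>u\<close> is real.
\<close>

lemma fourier_l2_surj:
  assumes h: "herm w" shows "\<exists>f. f \<in> L2 \<and> fourier_l2 f = w"
proof -
  define u where "u = conj2 (plancherel (conj2 w))"
  have Fu: "plancherel u = (2 * pi) *\<^sub>R w" unfolding u_def by (rule plancherel_inversion)
  have r: "refl_cnj (plancherel u) = plancherel u"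
    unfolding Fu using h linear_cmul[OF bounded_linear.linear[OF bounded_linear_refl_cnj], of "2 * pi" w] by (simp add: herm_iff)
  have "conj2 u = u" by (rule plancherel_inj) (simp add: plancherel_conj2 r)
  then have re: "AE x in lborel. rep u x = complex_of_real (Re (rep u x))"
    using rep_conj2[of u] by (auto elim!: eventually_mono simp: complex_eq_iff)
  have L: "(\<lambda>x. Re (rep u x)) \<in> L2"
    by (rule L2_mono[OF rep_L2[of u], of _ 1]) (auto simp: abs_Re_le_cmod)
  have "cls (\<lambda>x. complex_of_real (Re (rep u x))) = u"
    by (intro l2_eqI) (use re rep_cls[OF L2_of_real[OF L]] in \<open>eventually_elim, simp\<close>)
  then have "fourier_l2 (\<lambda>x. Re (rep u x)) = w" by (simp add: fourier_l2_def Fu)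
  with L show ?thesis by blast
qed

section \<open>Sobolev norms and the equation in Fourier variables\<close>

lemma ennpow_less_top_iff: "ennpow x p < top \<longleftrightarrow> x < top"
  by (auto simp: ennpow_def less_top[symmetric])

lemma ennpow_half_le_iff:
  assumes "e \<ge> 0" shows "ennpow x (1 / 2) \<le> ennreal e \<longleftrightarrow> x \<le> ennreal (e\<^sup>2)"
proof (cases x)
  case (real r)
  then have "ennpow x (1 / 2) = ennreal (sqrt r)" by (simp add: ennpow_def powr_half_sqrt)
  then show ?thesis using real assms by (simp add: real_sqrt_le_iff' real_le_lsqrt)
qed (simp add: ennpow_def top_unique)

lemma ennpow_half_tendsto_0_iff: "((\<lambda>x. ennpow (f x) (1 / 2)) \<longlongrightarrow> 0) G \<longleftrightarrow> (f \<longlongrightarrow> 0) G"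
proof
  assume l: "((\<lambda>x. ennpow (f x) (1 / 2)) \<longlongrightarrow> 0) G"
  show "(f \<longlongrightarrow> 0) G"
  proof (rule ennreal_tendsto_0I)
    fix e :: real assume "e > 0"
    then have "eventually (\<lambda>x. ennpow (f x) (1 / 2) \<le> ennreal (sqrt e)) G" by (intro ennreal_tendsto_0D[OF l]) simp
    then show "eventually (\<lambda>x. f x \<le> ennreal e) G"
      by eventually_elim (use \<open>e > 0\<close> in \<open>simp add: ennpow_half_le_iff\<close>)
  qed
next
  assume l: "(f \<longlongrightarrow> 0) G"
  show "((\<lambda>x. ennpow (f x) (1 / 2)) \<longlongrightarrow> 0) G"
  proof (rule ennreal_tendsto_0I)
    fix e :: real assume "e > 0"
    then have "eventually (\<lambda>x. f x \<le> ennreal (e\<^sup>2)) G" by (intro ennreal_tendsto_0D[OF l]) simp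
    then show "eventually (\<lambda>x. ennpow (f x) (1 / 2) \<le> ennreal e) G"
      by eventually_elim (use \<open>e > 0\<close> in \<open>simp add: ennpow_half_le_iff\<close>)
  qed
qed

text \<open>
  The square of the homogeneous norm.
\<close>

definition dsq :: "real \<Rightarrow> l2 \<Rightarrow> ennreal" where
  "dsq r u = (\<integral>\<^sup>+k. ennreal (\<bar>k\<bar> powr (2 * r) * (cmod (rep u k))\<^sup>2) \<partial>lborel)"

lemma Hs_norm_eq: assumes f: "f \<in> L2" shows "Hs_norm s f = ennpow (hsq s (fourier_l2 f)) (1 / 2)"
proof -
  have "(\<integral>\<^sup>+k. ennreal ((1 + \<bar>k\<bar> powr (2 * s)) * (cmod (fourier f k))\<^sup>2) \<partial>lborel) = hsq s (fourier_l2 f)"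
    unfolding hsq_def
    by (rule nn_integral_cong_AE) (use fourier_L2(3)[OF f] in \<open>eventually_elim, simp\<close>)
  then show ?thesis by (simp add: Hs_norm_def)
qed

lemma hom_norm_eq: assumes f: "f \<in> L2" shows "hom_norm r f = ennpow (dsq r (fourier_l2 f)) (1 / 2)"
proof -
  have "(\<integral>\<^sup>+k. ennreal (\<bar>k\<bar> powr (2 * r) * (cmod (fourier f k))\<^sup>2) \<partial>lborel) = dsq r (fourier_l2 f)"
    unfolding dsq_def
    by (rule nn_integral_cong_AE) (use fourier_L2(3)[OF f] in \<open>eventually_elim, simp\<close>)
  then show ?thesis by (simp add: hom_norm_def)
qed

lemma Hs_iff: "f \<in> Hs s \<longleftrightarrow> f \<in> L2 \<and> hsq s (fourier_l2 f) < \<infinity>"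
  by (auto simp: Hs_def Hs_norm_eq ennpow_less_top_iff)

lemma a_hat_eq_conv:
  assumes f: "f \<in> L2" and g: "g \<in> L2"
  shows "a_hat f g = conv (rep (fourier_l2 f)) (rep (fourier_l2 g))"
proof
  fix k
  have "a_hat f g k = conv (fourier f) (fourier g) k" by (simp add: a_hat_def conv_def)
  also have "\<dots> = conv (rep (fourier_l2 f)) (rep (fourier_l2 g)) k"
    using fourier_L2(1)[OF f] fourier_L2(1)[OF g]
    by (intro conv_cong fourier_L2(3) f g) (auto intro: L2_measurable)
  finally show "a_hat f g k = conv (rep (fourier_l2 f)) (rep (fourier_l2 g)) k" .
qed

text \<open>
  Without the factor \<open>k\<close>, the weighted estimate for \<open>B\<close> says nothing about low frequencies;
  Young's inequality with the kernel bounded by \<open>sqrt \<bar>k - l\<bar>\<close> covers them.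
\<close>

lemma conv_L2:
  assumes s: "s > 1" and u: "hsq s u < \<infinity>"
  shows "conv (rep u) (rep v) \<in> L2"
  unfolding L2_iff_nn_integral
proof
  have "(\<integral>\<^sup>+k. ennreal ((cmod (conv (rep u) (rep v) k))\<^sup>2) \<partial>lborel)
    \<le> (\<integral>\<^sup>+k. (\<integral>\<^sup>+l. ennreal ((\<bar>k - l\<bar> powr (1 / 2) * cmod (rep u (k - l))) * cmod (rep v l)) \<partial>lborel)\<^sup>2 \<partial>lborel)"
  proof (rule nn_integral_mono)
    fix k
    have "ennreal (cmod (conv (rep u) (rep v) k)) \<le> abs_conv (rep u) (rep v) k" by (rule cmod_conv_le_abs_conv)
    also have "\<dots> \<le> (\<integral>\<^sup>+l. ennreal ((\<bar>k - l\<bar> powr (1 / 2) * cmod (rep u (k - l))) * cmod (rep v l)) \<partial>lborel)"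
      unfolding abs_conv_def
      by (intro nn_integral_mono ennreal_leI mult_right_mono) (auto simp: powr_half_sqrt S_kernel_le1)
    finally show "ennreal ((cmod (conv (rep u) (rep v) k))\<^sup>2)
      \<le> (\<integral>\<^sup>+l. ennreal ((\<bar>k - l\<bar> powr (1 / 2) * cmod (rep u (k - l))) * cmod (rep v l)) \<partial>lborel)\<^sup>2"
      by (subst ennreal_power[symmetric]) (auto intro: power_mono)
  qed
  also have "\<dots> \<le> (mom (1 / 2) u)\<^sup>2 * ennreal ((norm v)\<^sup>2)"
    unfolding mom_def nn_integral_rep[symmetric] by (rule Young_L1_L2) auto
  also have "\<dots> < \<infinity>"
    using mom_finite[of "1 / 2" s u] s u by (simp add: ennreal_mult_less_top power_less_top_ennreal)
  finally show "(\<integral>\<^sup>+k. ennreal ((cmod (conv (rep u) (rep v) k))\<^sup>2) \<partial>lborel) < \<infinity>" .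
qed measurable

lemma herm_conv:
  assumes s: "s > 1" and u: "hsq s u < \<infinity>" and "herm u" "herm v"
  shows "herm (cls (conv (rep u) (rep v)))"
proof -
  have eq: "conv (rep u) (rep v) k = conv (hrep u) (hrep v) k" for k
    by (rule conv_cong[OF hrep_AE[OF assms(3)] hrep_AE[OF assms(4)]]) auto
  have L: "conv (rep u) (rep v) \<in> L2" by (rule conv_L2[OF s u])
  show ?thesis
    unfolding herm_def using rep_cls[OF L] AE_minus[OF rep_cls[OF L]]
    by eventually_elim (simp add: eq conv_reflect[of "hrep u" "hrep v"] hrep_herm)
qed

text \<open>
  The transform of \<open>a\<close> is Hermitian and square integrable, so it belongs to a real function; its
  derivative is the multiplier \<open>ik\<close>.
\<close>

lemma has_L2_deriv_a_form_iff:
  assumes s: "s > 1" and f: "f \<in> L2" and fin: "hsq s (fourier_l2 f) < \<infinity>"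
  shows "has_L2_deriv (a_form f f) v \<longleftrightarrow> v \<in> L2 \<and> fourier_l2 v = - B (fourier_l2 f) (fourier_l2 f)"
proof -
  let ?u = "fourier_l2 f"
  note h = herm_fourier_l2[OF f]
  have cL: "conv (rep ?u) (rep ?u) \<in> L2" by (rule conv_L2[OF s fin])
  obtain g where "g \<in> L2" "fourier_l2 g = cls (conv (rep ?u) (rep ?u))"
    using fourier_l2_surj[OF herm_conv[OF s fin h h]] by blast
  then have "has_fourier_transform g (a_hat f f)" by (simp add: has_fourier_transform_iff a_hat_eq_conv[OF f f] cL)
  then have "has_fourier_transform (a_form f f) (a_hat f f)" unfolding a_form_def by (rule someI[of "\<lambda>u. has_fourier_transform u (a_hat f f)"])
  then have a: "a_form f f \<in> L2" "fourier_l2 (a_form f f) = cls (conv (rep ?u) (rep ?u))"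
    by (auto simp: has_fourier_transform_iff a_hat_eq_conv[OF f f])
  have fa: "AE k in lborel. fourier (a_form f f) k = conv (rep ?u) (rep ?u) k"
    using fourier_L2(3)[OF a(1)] rep_cls[OF cL] unfolding a(2) by eventually_elim simp
  note [measurable] = L2_measurable[OF fourier_L2(1)[OF a(1)]]
  have ae: "AE k in lborel. - bfun (rep ?u) (rep ?u) k = \<i> * complex_of_real k * fourier (a_form f f) k"
    using fa by eventually_elim (simp add: bfun_def)
  have bL: "bfun (rep ?u) (rep ?u) \<in> L2" by (rule bfun_L2[OF s fin fin])
  have dL: "(\<lambda>k. \<i> * complex_of_real k * fourier (a_form f f) k) \<in> L2"
    by (rule L2_cong_AE[OF L2_minus[OF bL] _ ae]) measurable
  have "cls (\<lambda>k. \<i> * complex_of_real k * fourier (a_form f f) k) = - B ?u ?u"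
    by (intro l2_eqI) (use rep_cls[OF dL] ae rep_minus[of "B ?u ?u"] rep_B[OF s fin fin] in \<open>eventually_elim, simp\<close>)
  then show ?thesis unfolding has_L2_deriv_def has_fourier_transform_iff using a(1) dL by auto
qed

lemma continuous_into_Hs_iff:
  "continuous_into_Hs s I \<psi> \<longleftrightarrow> (\<forall>t\<in>I. \<psi> t \<in> L2 \<and> hsq s (fourier_l2 (\<psi> t)) < \<infinity>) \<and>
     (\<forall>t\<in>I. ((\<lambda>r. hsq s (fourier_l2 (\<psi> r) - fourier_l2 (\<psi> t))) \<longlongrightarrow> 0) (at t within I))"
proof -
  have "((\<lambda>r. Hs_norm s (\<lambda>x. \<psi> r x - \<psi> t x)) \<longlongrightarrow> 0) (at t within I) \<longleftrightarrow>
      ((\<lambda>r. hsq s (fourier_l2 (\<psi> r) - fourier_l2 (\<psi> t))) \<longlongrightarrow> 0) (at t within I)"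
    if L: "\<forall>t\<in>I. \<psi> t \<in> L2" and t: "t \<in> I" for t
  proof -
    have "eventually (\<lambda>r. Hs_norm s (\<lambda>x. \<psi> r x - \<psi> t x) = ennpow (hsq s (fourier_l2 (\<psi> r) - fourier_l2 (\<psi> t))) (1 / 2)) (at t within I)"
      using eventually_at_within_mem by eventually_elim (use L t in \<open>simp add: Hs_norm_eq L2_diff fourier_l2_diff\<close>)
    from tendsto_cong[OF this] show ?thesis by (simp add: ennpow_half_tendsto_0_iff)
  qed
  then show ?thesis unfolding continuous_into_Hs_def Hs_iff by blast
qed

lemma has_time_deriv_in_Hs_iff:
  assumes L: "\<forall>t\<in>I. \<psi> t \<in> L2" and t: "t \<in> I"
  shows "has_time_deriv_in_Hs s I \<psi> t w \<longleftrightarrow> w \<in> L2 \<and> hsq s (fourier_l2 w) < \<infinity> \<and>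
     ((\<lambda>r. hsq s ((1 / (r - t)) *\<^sub>R (fourier_l2 (\<psi> r) - fourier_l2 (\<psi> t)) - fourier_l2 w)) \<longlongrightarrow> 0) (at t within I)"
proof -
  have "((\<lambda>r. Hs_norm s (\<lambda>x. (\<psi> r x - \<psi> t x) / (r - t) - w x)) \<longlongrightarrow> 0) (at t within I) \<longleftrightarrow>
      ((\<lambda>r. hsq s ((1 / (r - t)) *\<^sub>R (fourier_l2 (\<psi> r) - fourier_l2 (\<psi> t)) - fourier_l2 w)) \<longlongrightarrow> 0) (at t within I)"
    if w: "w \<in> L2"
  proof -
    have "eventually (\<lambda>r. Hs_norm s (\<lambda>x. (\<psi> r x - \<psi> t x) / (r - t) - w x)
        = ennpow (hsq s ((1 / (r - t)) *\<^sub>R (fourier_l2 (\<psi> r) - fourier_l2 (\<psi> t)) - fourier_l2 w)) (1 / 2)) (at t within I)"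
      using eventually_at_within_mem
    proof eventually_elim
      case (elim r)
      have d: "(\<lambda>x. \<psi> r x - \<psi> t x) \<in> L2" using L elim t by (simp add: L2_diff)
      have q: "(\<lambda>x. (1 / (r - t)) * (\<psi> r x - \<psi> t x)) \<in> L2" using L2_scaleR[OF d, of "1 / (r - t)"] by simp
      show ?case
        using Hs_norm_eq[OF L2_diff[OF q w], of s] L elim t
        unfolding fourier_l2_diff[OF q w] fourier_l2_scaleR[OF d] by (simp add: fourier_l2_diff)
    qed
    from tendsto_cong[OF this] show ?thesis by (simp add: ennpow_half_tendsto_0_iff)
  qed
  then show ?thesis unfolding has_time_deriv_in_Hs_def Hs_iff by blast
qed

lemma has_vector_derivative_iff_quotient:
  fixes f :: "real \<Rightarrow> 'a::real_normed_vector"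
  shows "(f has_vector_derivative d) (at t within S) \<longleftrightarrow>
    ((\<lambda>r. (1 / (r - t)) *\<^sub>R (f r - f t) - d) \<longlongrightarrow> 0) (at t within S)"
proof -
  have "norm ((1 / norm (r - t)) *\<^sub>R (f r - (f t + (r - t) *\<^sub>R d))) = norm ((1 / (r - t)) *\<^sub>R (f r - f t) - d)"
    if "r \<noteq> t" for r
  proof -
    have "(1 / (r - t)) *\<^sub>R (f r - f t) - d = (1 / (r - t)) *\<^sub>R (f r - (f t + (r - t) *\<^sub>R d))"
      using that by (simp add: scaleR_diff_right scaleR_add_right)
    then show ?thesis by simp
  qed
  then have "eventually (\<lambda>r. norm ((1 / norm (r - t)) *\<^sub>R (f r - (f t + (r - t) *\<^sub>R d))) = norm ((1 / (r - t)) *\<^sub>R (f r - f t) - d))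
      (at t within S)" by (simp add: eventually_at_filter)
  from tendsto_cong[OF this, of 0] show ?thesis
    unfolding has_vector_derivative_def has_derivative_within tendsto_norm_zero_iff
    by (simp add: bounded_linear_scaleR_left)
qed

text \<open>
  The equation in Fourier variables: \<open>ik\<close> times the transform of \<open>a(\<psi>,\<psi>)\<close> is \<open>- B\<close>, so a
  solution is the same as a curve \<open>fsol\<close> of transforms. In the direction from \<open>fsol\<close> the
  derivative in \<open>H\<^sup>s\<^sup>-\<^sup>1\<close> is the improved convergence of difference quotients from \<open>fsol_deriv_hsq\<close>.
\<close>

lemma is_solution_iff:
  assumes s: "s > 2"
  shows "is_solution s T \<psi>0 \<psi> \<longleftrightarrow>
    (\<forall>t\<in>{0..<T}. \<psi> t \<in> L2) \<and> (AE x in lborel. \<psi> 0 x = \<psi>0 x) \<and> fsol s {0..<T} (\<lambda>t. fourier_l2 (\<psi> t))"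
proof
  assume sol: "is_solution s T \<psi>0 \<psi>"
  then have L: "\<forall>t\<in>{0..<T}. \<psi> t \<in> L2" and fin: "\<forall>t\<in>{0..<T}. hsq s (fourier_l2 (\<psi> t)) < \<infinity>"
    and c: "\<forall>t\<in>{0..<T}. ((\<lambda>r. hsq s (fourier_l2 (\<psi> r) - fourier_l2 (\<psi> t))) \<longlongrightarrow> 0) (at t within {0..<T})"
    by (auto simp: is_solution_def continuous_into_Hs_iff)
  have "((\<lambda>t. fourier_l2 (\<psi> t)) has_vector_derivative B (fourier_l2 (\<psi> t)) (fourier_l2 (\<psi> t))) (at t within {0..<T})" if t: "t \<in> {0..<T}" for t
  proof -
    obtain w v where w: "has_time_deriv_in_Hs (s - 1) {0..<T} \<psi> t w" and v: "has_L2_deriv (a_form (\<psi> t) (\<psi> t)) v"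
      and wv: "AE x in lborel. w x + v x = 0" using sol t unfolding is_solution_def by blast
    have tL: "\<psi> t \<in> L2" "hsq s (fourier_l2 (\<psi> t)) < \<infinity>" using L fin t by auto
    have vL: "v \<in> L2" and Pv: "fourier_l2 v = - B (fourier_l2 (\<psi> t)) (fourier_l2 (\<psi> t))"
      using v has_L2_deriv_a_form_iff[OF _ tL] s by auto
    have wL: "w \<in> L2" and lim: "((\<lambda>r. hsq (s - 1) ((1 / (r - t)) *\<^sub>R (fourier_l2 (\<psi> r) - fourier_l2 (\<psi> t)) - fourier_l2 w)) \<longlongrightarrow> 0) (at t within {0..<T})"
      using w unfolding has_time_deriv_in_Hs_iff[OF L t] by auto
    have "fourier_l2 w = fourier_l2 (\<lambda>x. - v x)"
      by (rule fourier_l2_cong_AE[OF wL L2_minus[OF vL]]) (use wv in \<open>eventually_elim, simp add: eq_neg_iff_add_eq_0\<close>)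
    then have "fourier_l2 w = B (fourier_l2 (\<psi> t)) (fourier_l2 (\<psi> t))" by (simp add: fourier_l2_minus[OF vL] Pv)
    with hsq_tendsto_0_imp[OF lim] show ?thesis by (simp add: has_vector_derivative_iff_quotient)
  qed
  with L fin c herm_fourier_l2 sol
  show "(\<forall>t\<in>{0..<T}. \<psi> t \<in> L2) \<and> (AE x in lborel. \<psi> 0 x = \<psi>0 x) \<and> fsol s {0..<T} (\<lambda>t. fourier_l2 (\<psi> t))"
    unfolding fsol_def is_solution_def by auto
next
  assume R: "(\<forall>t\<in>{0..<T}. \<psi> t \<in> L2) \<and> (AE x in lborel. \<psi> 0 x = \<psi>0 x) \<and> fsol s {0..<T} (\<lambda>t. fourier_l2 (\<psi> t))"
  then have L: "\<forall>t\<in>{0..<T}. \<psi> t \<in> L2" and sol: "fsol s {0..<T} (\<lambda>t. fourier_l2 (\<psi> t))" by auto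
  have "\<exists>w v. has_time_deriv_in_Hs (s - 1) {0..<T} \<psi> t w \<and> has_L2_deriv (a_form (\<psi> t) (\<psi> t)) v \<and> (AE x in lborel. w x + v x = 0)"
    if t: "t \<in> {0..<T}" for t
  proof -
    let ?u = "fourier_l2 (\<psi> t)"
    have u: "hsq s ?u < \<infinity>" "herm ?u" using sol t unfolding fsol_def by auto
    have s1: "s > 1" using s by simp
    obtain w where w: "w \<in> L2" "fourier_l2 w = B ?u ?u" using fourier_l2_surj[OF B_herm[OF s1 u(1,1) u(2,2)]] by blast
    have "hsq (s - 1) (B ?u ?u) \<le> KB s * hsq s ?u * hsq s ?u" by (rule hsq_B[OF s1 u(1) u(1)])
    also have "\<dots> < \<infinity>" using KB_finite[OF s1] u(1) by (simp add: ennreal_mult_less_top)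
    finally have "hsq (s - 1) (fourier_l2 w) < \<infinity>" by (simp add: w)
    moreover have "((\<lambda>r. hsq (s - 1) ((1 / (r - t)) *\<^sub>R (fourier_l2 (\<psi> r) - ?u) - fourier_l2 w)) \<longlongrightarrow> 0) (at t within {0..<T})"
      using fsol_deriv_hsq[OF sol s t] by (simp add: w)
    ultimately have "has_time_deriv_in_Hs (s - 1) {0..<T} \<psi> t w"
      unfolding has_time_deriv_in_Hs_iff[OF L t] using w by blast
    moreover have "has_L2_deriv (a_form (\<psi> t) (\<psi> t)) (\<lambda>x. - w x)"
      using L t has_L2_deriv_a_form_iff[OF s1 _ u(1)] L2_minus[OF w(1)] by (simp add: fourier_l2_minus[OF w(1)] w(2))
    ultimately show ?thesis by (intro exI[of _ w] exI[of _ "\<lambda>x. - w x"]) auto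
  qed
  with R show "is_solution s T \<psi>0 \<psi>"
    unfolding is_solution_def continuous_into_Hs_iff fsol_def by auto
qed

section \<open>The continuation criterion\<close>

text \<open>
  Interpolation: after the dilation \<open>k \<mapsto> \<mu> k\<close> of the frequency variable, the constant in the
  Cauchy-Schwarz inequality is homogeneous in \<open>\<mu>\<close>; \<open>mom_interpolation\<close> takes \<open>\<mu>\<^bsup>2r\<^esup> Y\<^sup>2 = \<parallel>u\<parallel>\<^sub>r\<^sup>2\<close>,
  which balances both terms and leaves the power \<open>2/r\<close> of the homogeneous norm.
\<close>

lemma mom_dilation_bound:
  assumes la: "\<mu> > 0"
  shows "(mom (3/2) u)\<^sup>2 \<le> ennreal (\<mu> powr (4 - 2 * r)) * kap (3/2) r * (ennreal (\<mu> powr (2 * r) * (norm u)\<^sup>2) + dsq r u)"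
proof -
  let ?w = "\<lambda>k. \<mu> powr (2 * r) + \<bar>k\<bar> powr (2 * r)"
  have w: "?w k > 0" for k using la by (simp add: add_pos_nonneg)
  have "(mom (3/2) u)\<^sup>2 \<le> (\<integral>\<^sup>+k. ennreal (\<bar>k\<bar> powr (2 * (3/2)) / ?w k) \<partial>lborel) * (\<integral>\<^sup>+k. ennreal (?w k * (cmod (rep u k))\<^sup>2) \<partial>lborel)"
    by (rule mom_sq_le_weighted) (use w in auto)
  moreover have "(\<integral>\<^sup>+k. ennreal (\<bar>k\<bar> powr (2 * (3/2)) / ?w k) \<partial>lborel) = ennreal (\<mu> powr (4 - 2 * r)) * kap (3/2) r"
  proof -
    define q where "q k = \<bar>k\<bar> powr (2 * (3/2)) / (1 + \<bar>k\<bar> powr (2 * r))" for k :: real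
    have q0: "q k \<ge> 0" for k by (simp add: q_def)
    have [measurable]: "q \<in> borel_measurable borel" unfolding q_def[abs_def] by measurable
    have "\<bar>0 + \<mu> * k\<bar> powr (2 * (3/2)) / ?w (0 + \<mu> * k) = \<mu> powr (3 - 2 * r) * q k" for k
    proof -
      have "?w (0 + \<mu> * k) = \<mu> powr (2 * r) * (1 + \<bar>k\<bar> powr (2 * r))"
        using la by (simp add: abs_mult powr_mult algebra_simps)
      moreover have "\<mu> powr (3 - 2 * r) = \<mu> powr 3 / \<mu> powr (2 * r)" by (rule powr_diff)
      ultimately show ?thesis using la by (simp add: q_def abs_mult powr_mult)
    qed
    then have e: "ennreal (\<bar>0 + \<mu> * k\<bar> powr (2 * (3/2)) / ?w (0 + \<mu> * k)) = ennreal (\<mu> powr (3 - 2 * r)) * ennreal (q k)" for k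
      by (simp only: ennreal_mult q0 powr_ge_zero)
    have p: "ennreal \<bar>\<mu>\<bar> * ennreal (\<mu> powr (3 - 2 * r)) = ennreal (\<mu> powr (4 - 2 * r))"
    proof -
      have "\<mu> powr (4 - 2 * r) = \<mu> powr (1 + (3 - 2 * r))" by simp
      then have "\<mu> powr (4 - 2 * r) = \<bar>\<mu>\<bar> * \<mu> powr (3 - 2 * r)" using la by (simp only: powr_add) simp
      then show ?thesis by (simp add: ennreal_mult)
    qed
    have "(\<integral>\<^sup>+k. ennreal (\<bar>k\<bar> powr (2 * (3/2)) / ?w k) \<partial>lborel)
       = ennreal \<bar>\<mu>\<bar> * (\<integral>\<^sup>+k. ennreal (\<bar>0 + \<mu> * k\<bar> powr (2 * (3/2)) / ?w (0 + \<mu> * k)) \<partial>lborel)"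
      by (rule nn_integral_real_affine) (use la in auto)
    then have "(\<integral>\<^sup>+k. ennreal (\<bar>k\<bar> powr (2 * (3/2)) / ?w k) \<partial>lborel)
       = ennreal \<bar>\<mu>\<bar> * (ennreal (\<mu> powr (3 - 2 * r)) * (\<integral>\<^sup>+k. ennreal (q k) \<partial>lborel))"
      unfolding e by (subst (asm) nn_integral_cmult) auto
    then show ?thesis unfolding kap_def q_def p[symmetric] by (simp only: mult.assoc)
  qed
  moreover have "(\<integral>\<^sup>+k. ennreal (?w k * (cmod (rep u k))\<^sup>2) \<partial>lborel) = ennreal (\<mu> powr (2 * r) * (norm u)\<^sup>2) + dsq r u"
  proof -
    have "(\<integral>\<^sup>+k. ennreal (?w k * (cmod (rep u k))\<^sup>2) \<partial>lborel)
       = (\<integral>\<^sup>+k. ennreal (\<mu> powr (2 * r)) * ennreal ((cmod (rep u k))\<^sup>2) + ennreal (\<bar>k\<bar> powr (2 * r) * (cmod (rep u k))\<^sup>2) \<partial>lborel)"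
      by (intro nn_integral_cong) (simp add: distrib_right ennreal_mult)
    then show ?thesis by (simp add: nn_integral_add nn_integral_cmult nn_integral_rep dsq_def ennreal_mult)
  qed
  ultimately show ?thesis by simp
qed

lemma mom_interpolation:
  assumes r: "r > 2" and Y: "Y > 0"
  shows "\<exists>c>0. \<forall>u. norm u \<le> Y \<longrightarrow> mom (3/2) u \<le> ennreal c * ennpow (ennpow (dsq r u) (1 / 2)) (2 / r)"
proof -
  \<comment> \<open>The summand makes the constant positive, which is needed where the right-hand side is infinite.\<close>
  define K where "K = enn2real (kap (3/2) r) + 1"
  have "kap (3/2) r < \<infinity>" by (rule kap_finite) (use r in auto)
  then have kap: "kap (3/2) r \<le> ennreal K" by (cases "kap (3/2) r") (auto simp: K_def intro: ennreal_leI)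
  have K: "K > 0" by (simp add: K_def add_nonneg_pos)
  define c where "c = sqrt (2 * K) * Y powr (1 - 2 / r)"
  have c: "c > 0" using K Y by (simp add: c_def)
  have "mom (3/2) u \<le> ennreal c * ennpow (ennpow (dsq r u) (1 / 2)) (2 / r)" if u: "norm u \<le> Y" for u
  proof (cases "dsq r u")
    case (real n)
    have rhs: "ennpow (ennpow (dsq r u) (1 / 2)) (2 / r) = ennreal (n powr (1 / r))"
      using real r by (simp add: ennpow_def powr_powr)
    show ?thesis
    proof (cases "n = 0")
      case True
      then have "AE k in lborel. k = 0 \<or> rep u k = 0"
        using real by (simp add: dsq_def nn_integral_0_iff_AE)
      then have "AE k in lborel. ennreal (\<bar>k\<bar> powr (3/2) * cmod (rep u k)) = 0"
        by eventually_elim auto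
      then have "mom (3/2) u = 0" unfolding mom_def by (simp add: nn_integral_0_iff_AE)
      then show ?thesis by simp
    next
      case False
      then have n: "n > 0" using real by simp
      define la where "la = (n / Y\<^sup>2) powr (1 / (2 * r))"
      have la: "la > 0" using n Y by (simp add: la_def)
      have l1: "la powr (2 * r) = n / Y\<^sup>2" using n Y r by (simp add: la_def powr_powr)
      have l2: "la powr (4 - 2 * r) = (n powr (1 / r))\<^sup>2 * (Y powr (1 - 2 / r))\<^sup>2 / n"
      proof -
        have "la powr (4 - 2 * r) = (n / Y\<^sup>2) powr (2 / r - 1)"
        proof -
          have "1 / (2 * r) * (4 - 2 * r) = 2 / r - 1" using r by (simp add: field_simps)
          then show ?thesis unfolding la_def powr_powr by simp
        qed
        also have "\<dots> = n powr (2 / r - 1) / (Y powr 2) powr (2 / r - 1)"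
          using n Y by (simp add: powr_divide powr_numeral)
        also have "\<dots> = n powr (2 / r) / n / Y powr (2 * (2 / r - 1))"
          using n by (simp add: powr_powr powr_diff)
        also have "Y powr (2 * (2 / r - 1)) = inverse (Y powr (2 * (1 - 2 / r)))"
          by (simp add: powr_minus[symmetric] algebra_simps)
        finally show ?thesis by (simp add: powr_sq field_simps)
      qed
      have "(norm u)\<^sup>2 \<le> Y\<^sup>2" using u by (intro power_mono) auto
      then have "la powr (2 * r) * (norm u)\<^sup>2 \<le> la powr (2 * r) * Y\<^sup>2" by (intro mult_left_mono) auto
      then have nu: "la powr (2 * r) * (norm u)\<^sup>2 \<le> n" using Y by (simp add: l1)
      have "(mom (3/2) u)\<^sup>2 \<le> ennreal (la powr (4 - 2 * r)) * kap (3/2) r * (ennreal (la powr (2 * r) * (norm u)\<^sup>2) + dsq r u)"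
        by (rule mom_dilation_bound[OF la])
      also have "\<dots> \<le> ennreal (la powr (4 - 2 * r)) * ennreal K * (ennreal n + ennreal n)"
        using nu kap real by (intro mult_mono add_mono ennreal_leI) auto
      also have "\<dots> = ennreal (la powr (4 - 2 * r) * K * (n + n))"
        using n K by (simp add: ennreal_mult ennreal_plus[symmetric] del: ennreal_plus)
      also have "la powr (4 - 2 * r) * K * (n + n) = (c * n powr (1 / r))\<^sup>2"
        using n K by (simp add: l2 c_def power_mult_distrib)
      finally have "(mom (3/2) u)\<^sup>2 \<le> (ennreal (c * n powr (1 / r)))\<^sup>2" using c by (simp add: ennreal_power)
      then have "mom (3/2) u \<le> ennreal (c * n powr (1 / r))" by (rule ennreal_le_of_sq) (use c in simp)
      then show ?thesis using c by (simp add: rhs ennreal_mult)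
    qed
  next
    case top
    then show ?thesis using c by (simp add: ennpow_def ennreal_mult_top)
  qed
  with c show ?thesis by blast
qed

text \<open>
  The conservation law of the equation, \<open>inner_B_conserved\<close>.
\<close>

lemma fsol_norm_le:
  assumes sol: "fsol s {0..<T} u" and s: "s > 2" and t: "t \<in> {0..<T}"
  shows "norm (u t) \<le> norm (u 0)"
proof -
  have d: "((\<lambda>r. (norm (u r))\<^sup>2) has_real_derivative 2 * inner (u x) (B (u x) (u x))) (at x within {0..t})"
    if x: "x \<in> {0..t}" for x
  proof (rule has_real_derivative_norm_sq)
    have "(u has_vector_derivative B (u x) (u x)) (at x within {0..<T})" using sol x t unfolding fsol_def by simp
    then show "(u has_vector_derivative B (u x) (u x)) (at x within {0..t})"
      by (rule has_vector_derivative_within_subset) (use t in auto)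
  qed
  have "(norm (u t))\<^sup>2 \<le> (norm (u 0))\<^sup>2"
  proof (rule nonincreasing_of_deriv[OF _ d])
    show "2 * inner (u x) (B (u x) (u x)) \<le> 0" if "x \<in> {0<..<t}" for x
      using inner_B_conserved[of s "u x"] s sol t that by (simp add: fsol_def)
  qed (use t in auto)
  then show ?thesis by (rule power2_le_imp_le) simp
qed

lemma fsol_cong:
  assumes sol: "fsol s I u" and eq: "\<And>t. t \<in> I \<Longrightarrow> v t = u t"
  shows "fsol s I v"
proof -
  have "((\<lambda>r. hsq s (v r - v t)) \<longlongrightarrow> 0) (at t within I)" if t: "t \<in> I" for t
  proof -
    have "eventually (\<lambda>r. hsq s (v r - v t) = hsq s (u r - u t)) (at t within I)"
      using eventually_at_within_mem by eventually_elim (simp add: eq t)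
    from tendsto_cong[OF this] show ?thesis using sol t unfolding fsol_def by blast
  qed
  moreover have "(v has_vector_derivative B (v t) (v t)) (at t within I)" if t: "t \<in> I" for t
    using sol t unfolding fsol_def eq[OF t] by (metis has_vector_derivative_transform[OF t] eq)
  ultimately show ?thesis using sol eq unfolding fsol_def by auto
qed

text \<open>
  The interpolation inequality has one constant along the whole solution because the norm of \<open>L\<^sup>2\<close>
  is conserved.
\<close>

lemma mom_integral_finite:
  assumes L: "\<forall>t\<in>{0..<T}. \<psi> t \<in> L2" and sol: "fsol s {0..<T} (\<lambda>t. fourier_l2 (\<psi> t))" and s: "s > 2" and r: "r > 2"
    and int: "(\<integral>\<^sup>+t\<in>{0..<T}. ennpow (hom_norm r (\<psi> t)) (2 / r) \<partial>lborel) < top"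
  shows "(\<integral>\<^sup>+t\<in>{0..<T}. mom (3/2) (fourier_l2 (\<psi> t)) \<partial>lborel) < \<infinity>"
proof -
  define m where "m t = mom (3/2) (fourier_l2 (\<psi> t)) * indicator {0..<T} t" for t
  obtain c where c: "c > 0" "\<And>u. norm u \<le> norm (fourier_l2 (\<psi> 0)) + 1 \<Longrightarrow> mom (3/2) u \<le> ennreal c * ennpow (ennpow (dsq r u) (1 / 2)) (2 / r)"
    using mom_interpolation[OF r, of "norm (fourier_l2 (\<psi> 0)) + 1"] by (auto simp: add_nonneg_pos)
  have "m \<in> borel_measurable borel"
  proof -
    have "(\<lambda>t. indicator {0..<T} t *\<^sub>R enn2real (mom (3/2) (fourier_l2 (\<psi> t)))) \<in> borel_measurable borel"
      by (rule borel_measurable_continuous_on_indicator) (auto intro: fsol_mom_continuous(1)[OF sol s])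
    moreover have "m = (\<lambda>t. ennreal (indicator {0..<T} t *\<^sub>R enn2real (mom (3/2) (fourier_l2 (\<psi> t)))))"
    proof
      fix t show "m t = ennreal (indicator {0..<T} t *\<^sub>R enn2real (mom (3/2) (fourier_l2 (\<psi> t))))"
        using fsol_mom_continuous(2)[OF sol s, of t] by (auto simp: m_def indicator_def)
    qed
    ultimately show ?thesis by simp
  qed
  note [measurable] = this
  \<comment> \<open>The constant stays next to \<open>m\<close>, which is measurable by continuity; the bound itself only enters
    through monotonicity of the integral.\<close>
  have "m t * ennreal (1 / c) \<le> ennpow (hom_norm r (\<psi> t)) (2 / r) * indicator {0..<T} t" for t
  proof (cases "t \<in> {0..<T}")
    case True
    have "norm (fourier_l2 (\<psi> t)) \<le> norm (fourier_l2 (\<psi> 0)) + 1" using fsol_norm_le[OF sol s True] by simp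
    then have "m t \<le> ennreal c * ennpow (hom_norm r (\<psi> t)) (2 / r)"
      using c(2)[of "fourier_l2 (\<psi> t)"] L True by (simp add: m_def hom_norm_eq)
    then have "m t * ennreal (1 / c) \<le> ennreal c * ennpow (hom_norm r (\<psi> t)) (2 / r) * ennreal (1 / c)"
      by (rule mult_right_mono) simp
    also have "\<dots> = (ennreal c * ennreal (1 / c)) * ennpow (hom_norm r (\<psi> t)) (2 / r)" by (simp only: ac_simps)
    also have "ennreal c * ennreal (1 / c) = 1" using c(1) by (simp add: ennreal_mult[symmetric])
    finally show ?thesis using True by simp
  qed (simp add: m_def)
  then have "(\<integral>\<^sup>+t. m t * ennreal (1 / c) \<partial>lborel) \<le> (\<integral>\<^sup>+t\<in>{0..<T}. ennpow (hom_norm r (\<psi> t)) (2 / r) \<partial>lborel)"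
    by (rule nn_integral_mono)
  then have "(\<integral>\<^sup>+t. m t \<partial>lborel) * ennreal (1 / c) < top" using int by (simp add: nn_integral_multc)
  then show ?thesis using c(1) by (auto simp: m_def[symmetric] ennreal_mult_less_top)
qed

theorem lemma4:
  fixes s s' T :: real
    and \<psi>0 :: "real \<Rightarrow> real"
    and \<psi> :: "real \<Rightarrow> real \<Rightarrow> real"
  assumes "s > 2"
    and "\<psi>0 \<in> Hs s"
    and "0 < T"
    and "is_solution s T \<psi>0 \<psi>"
    and "s' > 2"
    and "(\<integral>\<^sup>+\<tau>\<in>{0..<T}. ennpow (hom_norm s' (\<psi> \<tau>)) (2 / s') \<partial>lborel) < top"
  shows "\<exists>T'>T. \<exists>\<Psi>. is_solution s T' \<psi>0 \<Psi> \<and>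
           (\<forall>\<tau>\<in>{0..<T}. AE \<theta> in lborel. \<Psi> \<tau> \<theta> = \<psi> \<tau> \<theta>)"
proof -
  note s = \<open>s > 2\<close> and T = \<open>0 < T\<close>
  have L: "\<forall>t\<in>{0..<T}. \<psi> t \<in> L2" and init: "AE x in lborel. \<psi> 0 x = \<psi>0 x" and sol: "fsol s {0..<T} (\<lambda>t. fourier_l2 (\<psi> t))"
    using \<open>is_solution s T \<psi>0 \<psi>\<close> unfolding is_solution_iff[OF s] by auto
  obtain uT where uT: "herm uT" "hsq s uT < \<infinity>" "((\<lambda>t. hsq s (fourier_l2 (\<psi> t) - uT)) \<longlongrightarrow> 0) (at T within {0..<T})"
    using fsol_limit[OF sol s T mom_integral_finite[OF L sol s assms(5,6)]] by blast
  obtain \<delta> v where \<delta>: "\<delta> > 0" and v: "v 0 = uT" "fsol s {0..\<delta>} v"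
    using local_existence[OF s uT(1,2)] by blast
  define w where "w t = (if t < T then fourier_l2 (\<psi> t) else v (t - T))" for t
  have w: "fsol s {0..<T + \<delta>} w"
    unfolding w_def using fsol_glue[OF sol s T \<delta> v(2)] uT(3) v(1) by simp
  have "\<exists>f. f \<in> L2 \<and> fourier_l2 f = w t" if "t \<in> {0..<T + \<delta>}" for t
    by (rule fourier_l2_surj) (use w that in \<open>auto simp: fsol_def\<close>)
  then obtain g where g: "\<And>t. t \<in> {0..<T + \<delta>} \<Longrightarrow> g t \<in> L2 \<and> fourier_l2 (g t) = w t" by metis
  define \<Psi> where "\<Psi> t = (if t < T then \<psi> t else g t)" for t
  have \<Psi>: "\<Psi> t \<in> L2 \<and> fourier_l2 (\<Psi> t) = w t" if "t \<in> {0..<T + \<delta>}" for t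
    using that g[OF that] L by (auto simp: \<Psi>_def w_def)
  have "fsol s {0..<T + \<delta>} (\<lambda>t. fourier_l2 (\<Psi> t))"
    by (rule fsol_cong[OF w]) (simp add: \<Psi>)
  then have "is_solution s (T + \<delta>) \<psi>0 \<Psi>"
    unfolding is_solution_iff[OF s] using \<Psi> init T by (auto simp: \<Psi>_def)
  then show ?thesis
    using \<delta> by (intro exI[of _ "T + \<delta>"] exI[of _ \<Psi>]) (auto simp: \<Psi>_def)
qed

end
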